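(* Let $m\in\mathbb{Z}$ with $m\notin\{-8,-5,-3,0\}$ and let $\mathbb{S}_m$ be the simplest sextic field generated over $\mathbb{Q}$ by a root of $$s_m(x)=x^6-2mx^5-(5m+15)x^4-20x^3+5mx^2+(2m+6)x+1.$$ Then $$I(\mathbb{S}_m)=1$$ and $$i(\mathbb{S}_m)=2^{\alpha}3^{\beta},$$ where: (i) $\alpha\in\{3,4\}$ if either ($m\equiv 0$ or $5\pmod 8$ and $3\nmid m$) or ($m\equiv 0$ or $21\pmod{24}$), and $\alpha=0$ otherwise; (ii) $\beta=2$ if $m\equiv 39,120,201\pmod{243}$, and $\beta=0$ otherwise.
   Context: For a number field $\mathbb{K}$ of degree $n$ over $\mathbb{Q}$ with ring of integers $\mathbb{A}$, let $\widehat{\mathbb{A}}$ be the set of $\theta\in\mathbb{A}$ that are primitive over $\mathbb{Q}$, i.e. $\mathbb{K}=\mathbb{Q}(\theta)$. For $\theta\in\widehat{\mathbb{A}}$ let $I(\theta)=[\mathbb{A}:\mathbb{Z}[\theta]]$ and define $I(\mathbb{K})=\gcd_{\theta\in\widehat{\mathbb{A}}} I(\theta)$. For $\theta\in\mathbb{A}$ let $F_\theta(x)\in\mathbb{Z}[x]$ be the (degree $n$) characteristic polynomial of $\theta$ over $\mathbb{Q}$ and set $i(\theta)=\gcd_{x\in\mathbb{Z}}F_\theta(x)$. Define $i(\mathbb{K})=\operatorname{lcm}_{\theta\in\widehat{\mathbb{A}}}\, i(\theta)$.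
   Formalization: The excluded set is {-8,-3,0,5} in place of {-8,-5,-3,0}: for m=5, m²+3m+9=49 is a square, s_5 is reducible, its roots generate a cubic field with i dividing 6, and (i) fails; m=-5 is covered by the theorem proved. *)

theory Defs
  imports
    Complex_Main
    "HOL-Number_Theory.Cong"
    "Jordan_Normal_Form.Char_Poly"
begin

text \<open>Number fields are realised as subfields of \<open>\<complex>\<close>, viewed as \<open>\<rat>\<close>-vector spaces.\<close>

definition complex_subfield :: "complex set \<Rightarrow> bool" where
  "complex_subfield K \<longleftrightarrow>
     0 \<in> K \<and> 1 \<in> K \<and>
     (\<forall>x\<in>K. \<forall>y\<in>K. x + y \<in> K \<and> x * y \<in> K) \<and>
     (\<forall>x\<in>K. - x \<in> K \<and> inverse x \<in> K)"

definition rat_adjoin :: "complex \<Rightarrow> complex set" where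
  "rat_adjoin \<theta> = complex_subfield hull {\<theta>}"

definition int_adjoin :: "complex \<Rightarrow> complex set" where
  "int_adjoin \<theta> = range (\<lambda>p :: int poly. poly (map_poly of_int p) \<theta>)"

definition ring_of_integers :: "complex set \<Rightarrow> complex set" where
  "ring_of_integers K = {x \<in> K. algebraic_int x}"

definition primitive_integers :: "complex set \<Rightarrow> complex set" where
  "primitive_integers K = {\<theta> \<in> ring_of_integers K. rat_adjoin \<theta> = K}"

text \<open>The index is counted as the number of cosets of \<open>\<int>[\<theta>]\<close> in the ring of integers.\<close>

definition element_index :: "complex set \<Rightarrow> complex \<Rightarrow> nat" where
  "element_index K \<theta> = card ((\<lambda>a. (\<lambda>z. a + z) ` int_adjoin \<theta>) ` ring_of_integers K)"

definition field_index :: "complex set \<Rightarrow> nat" where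
  "field_index K = (GCD \<theta>\<in>primitive_integers K. element_index K \<theta>)"

definition rat_scale :: "rat \<Rightarrow> complex \<Rightarrow> complex" where
  "rat_scale q z = of_rat q * z"

global_interpretation rat_vs: vector_space rat_scale
  by unfold_locales (simp_all add: rat_scale_def algebra_simps of_rat_add of_rat_mult)

definition rat_basis :: "complex set \<Rightarrow> complex list \<Rightarrow> bool" where
  "rat_basis K bs \<longleftrightarrow>
     distinct bs \<and> rat_vs.independent (set bs) \<and> rat_vs.span (set bs) = K"

definition mult_matrix :: "complex list \<Rightarrow> complex \<Rightarrow> rat mat \<Rightarrow> bool" where
  "mult_matrix bs \<theta> M \<longleftrightarrow>
     M \<in> carrier_mat (length bs) (length bs) \<and>
     (\<forall>j < length bs. \<theta> * bs ! j = (\<Sum>i < length bs. rat_scale (M $$ (i, j)) (bs ! i)))"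

text \<open>
  The characteristic polynomial of multiplication by \<open>\<theta>\<close> on the \<open>\<rat>\<close>-vector space \<open>K\<close>. It does not
  depend on the basis, and for an algebraic integer \<open>\<theta>\<close> in a number field \<open>K\<close> it has integer
  coefficients, so that the description is then uniquely satisfied.
\<close>

definition field_char_poly :: "complex set \<Rightarrow> complex \<Rightarrow> int poly" where
  "field_char_poly K \<theta> =
     (THE p. \<exists>bs M. rat_basis K bs \<and> mult_matrix bs \<theta> M \<and> map_poly rat_of_int p = char_poly M)"

definition element_value_gcd :: "complex set \<Rightarrow> complex \<Rightarrow> int" where
  "element_value_gcd K \<theta> = (GCD x. poly (field_char_poly K \<theta>) x)"

definition field_value_gcd :: "complex set \<Rightarrow> int" where
  "field_value_gcd K = (LCM \<theta>\<in>primitive_integers K. element_value_gcd K \<theta>)"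

text \<open>
  With \<open>a, b = m \<plusminus> sqrt (m\<^sup>2 + 3 * m + 9)\<close> this polynomial is the product of the simplest cubics
  \<open>x^3 - a * x^2 - (a + 3) * x - 1\<close> and \<open>x^3 - b * x^2 - (b + 3) * x - 1\<close>. The integers \<open>m\<close> for which
  \<open>m\<^sup>2 + 3 * m + 9\<close> is a square are \<open>-8, -3, 0, 5\<close>; precisely for these its roots do not generate
  a field of degree 6.
\<close>

definition simplest_sextic :: "int \<Rightarrow> int poly" where
  "simplest_sextic m = [:1, 2 * m + 6, 5 * m, - 20, - (5 * m + 15), - 2 * m, 1:]"

end

theory Submission
  imports Defs "HOL-Algebra.Sylow" "HOL-Number_Theory.Number_Theory"
begin

text \<open>
  The field is the compositum of the simplest cubic field \<open>\<rat>(\<eta>)\<close> and of \<open>\<rat>(\<delta>)\<close>, where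
  \<open>\<delta>\<^sup>2 = D = m\<^sup>2 + 3 m + 9\<close>; it is cyclic over \<open>\<rat>\<close>, and generators of its completions at \<open>2\<close>, \<open>3\<close> and \<open>5\<close>
  can be written down together with the action of Frobenius.

  The index is \<open>1\<close> because for every prime \<open>p\<close> the integers are generated modulo \<open>p\<close> by a single
  element. For \<open>p \<ge> 5\<close> this element is \<open>\<theta>\<close> if \<open>p\<close> does not divide \<open>D\<close>, as the different of \<open>\<theta>\<close>
  is then prime to \<open>p\<close>, and comes from a Kummer generator if \<open>p\<close> is tamely ramified.

  Sixth differences show that \<open>i(x)\<close> divides \<open>6! = 720\<close>. If \<open>D \<equiv> 1\<close> modulo \<open>8\<close>, then \<open>2\<close> splits in
  \<open>\<rat>(\<delta>)\<close> and the norm of \<open>t - (1 + \<delta>)/2\<close> is the cube of an even number for all integers \<open>t\<close>; if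
  \<open>m \<equiv> 39\<close> modulo \<open>81\<close>, then \<open>3\<close> splits in the cubic subfield and the norm of \<open>t - (\<eta> - 1)/3\<close> is the
  square of a multiple of \<open>3\<close>. In all other cases there are fewer than \<open>p\<close> primes above \<open>p = 2, 3\<close>.
  Each contains \<open>t - x\<close> for at most one class of \<open>t\<close> modulo \<open>p\<close>, so that \<open>t - x\<close> is prime to \<open>p\<close> for
  some \<open>t\<close>. The Frobenius at \<open>5\<close> is never trivial; hence if \<open>5\<close> divided all norms of \<open>t - x\<close>, it would
  divide all products of five conjugates of \<open>t - x\<close> and so all values of the derivative of the characteristic
  polynomial, but a monic sextic that vanishes identically modulo \<open>5\<close> has a simple root.
\<close>

hide_const (open) up_ring.coeff up_ring.monom

section \<open>Sums and products of algebraic integers\<close>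

text \<open>No ideals occur below, and neither \<open>A\<close> nor an integral basis is computed.
  Near a prime p the ring of integers is replaced by an explicit ring R, generated by a few elements
  over the fractions with denominator prime to p. The decisive datum is an element \<rho> such that
  p divides a power of \<rho> and some power of Frobenius fixes every residue modulo \<rho>. Then
  R/\<rho>R has no nilpotents; as \<eta> and \<delta> lie in R, this forces \<open>A\<close> into R,
  and it stands in for \<rho>R being a product of distinct primes. Counting the primes above 2 or 3
  becomes a question about R/\<rho>R: whether the elements t - x are nilpotent there, are killed by
  one of two zero divisors, or have a power congruent to an integer prime to p.

  The exponent of 2 stays in {3, 4} because the two estimates differ: the construction yields 8,
  while the sixth difference allows 16, the 2-part of 720. For 3 both give 9.\<close>

inductive_set int_span :: "complex set \<Rightarrow> complex set" for B where
  int_span_base: "b \<in> B \<Longrightarrow> b \<in> int_span B"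
| int_span_zero: "0 \<in> int_span B"
| int_span_add: "x \<in> int_span B \<Longrightarrow> y \<in> int_span B \<Longrightarrow> x + y \<in> int_span B"
| int_span_uminus: "x \<in> int_span B \<Longrightarrow> - x \<in> int_span B"

lemma int_span_of_nat: "x \<in> int_span B \<Longrightarrow> of_nat n * x \<in> int_span B"
  by (induction n) (auto simp: algebra_simps intro: int_span.intros)

lemma int_span_of_int:
  assumes "x \<in> int_span B"
  shows "of_int n * x \<in> int_span B"
proof (cases "n \<ge> 0")
  case True
  then show ?thesis using int_span_of_nat[OF assms, of "nat n"] by simp
next
  case False
  then have "of_int n * x = - (of_nat (nat (- n)) * x)" by simp
  then show ?thesis using int_span_of_nat[OF assms] int_span_uminus by metis
qed

lemma int_span_sum: "(\<And>i. i \<in> I \<Longrightarrow> f i \<in> int_span B) \<Longrightarrow> sum f I \<in> int_span B"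
  by (induction I rule: infinite_finite_induct) (auto intro: int_span.intros)

text \<open>Turns membership into a row of integer coefficients, from which
  \<open>algebraic_int_if_stable\<close> assembles its matrix.\<close>

lemma int_span_coeffs:
  assumes "x \<in> int_span (b ` {..<n})"
  shows "\<exists>c :: nat \<Rightarrow> int. x = (\<Sum>j<n. of_int (c j) * b j)"
  using assms
proof induction
  case (int_span_base y)
  then obtain i where "i < n" "y = b i" by auto
  then have "y = (\<Sum>j<n. of_int (if j = i then 1 else 0) * b j)"
    by (simp add: if_distrib[of of_int] if_distrib[of "\<lambda>u. u * _"] cong: if_cong)
  then show ?case by (intro exI[of _ "\<lambda>j. if j = i then 1 else 0"])
next
  case int_span_zero
  show ?case by (intro exI[of _ "\<lambda>_. 0"]) simp
next
  case (int_span_add x y)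
  then obtain c d :: "nat \<Rightarrow> int"
    where "x = (\<Sum>j<n. of_int (c j) * b j)" "y = (\<Sum>j<n. of_int (d j) * b j)" by blast
  then have "x + y = (\<Sum>j<n. of_int (c j + d j) * b j)"
    by (simp add: sum.distrib algebra_simps)
  then show ?case by (intro exI[of _ "\<lambda>j. c j + d j"])
next
  case (int_span_uminus x)
  then obtain c :: "nat \<Rightarrow> int" where "x = (\<Sum>j<n. of_int (c j) * b j)" by blast
  then have "- x = (\<Sum>j<n. of_int (- c j) * b j)"
    by (simp add: sum_negf)
  then show ?case by (intro exI[of _ "\<lambda>j. - c j"])
qed

lemma int_span_mult_closed:
  assumes "x \<in> int_span B" and st: "\<And>b. b \<in> B \<Longrightarrow> y * b \<in> int_span B"
  shows "y * x \<in> int_span B"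
  using assms(1)
proof induction
  case (int_span_base b)
  then show ?case by (rule st)
next
  case int_span_zero
  show ?case by (simp add: int_span.int_span_zero)
next
  case (int_span_add x z)
  then have "y * x + y * z \<in> int_span B" by (intro int_span.int_span_add)
  then show ?case by (simp add: distrib_left)
next
  case (int_span_uminus x)
  then show ?case using int_span.int_span_uminus[of "y * x" B] by simp
qed

text \<open>Cayley--Hamilton: \<open>x\<close> is an eigenvalue of an integer matrix.\<close>

lemma algebraic_int_if_stable:
  assumes fin: "finite B" and nz: "\<exists>b\<in>B. b \<noteq> 0" and st: "\<And>b. b \<in> B \<Longrightarrow> x * b \<in> int_span B"
  shows "algebraic_int x"
proof -
  obtain f and n :: nat where B: "B = f ` {..<n}"
    using finite_imp_nat_seg_image_inj_on[OF fin] unfolding lessThan_def by blast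
  have "\<forall>i<n. \<exists>c :: nat \<Rightarrow> int. x * f i = (\<Sum>j<n. of_int (c j) * f j)"
    using st int_span_coeffs[of _ f n] by (auto simp: B)
  then obtain c :: "nat \<Rightarrow> nat \<Rightarrow> int"
    where c: "\<And>i. i < n \<Longrightarrow> x * f i = (\<Sum>j<n. of_int (c i j) * f j)" by metis
  define A :: "int mat" where "A = mat n n (\<lambda>(i,j). c i j)"
  define A' :: "complex mat" where "A' = map_mat of_int A"
  have A: "A \<in> carrier_mat n n" and A': "A' \<in> carrier_mat n n" by (auto simp: A_def A'_def)
  define v where "v = vec n f"
  have "v \<noteq> 0\<^sub>v n"
  proof
    assume "v = 0\<^sub>v n"
    moreover obtain i where "i < n" "f i \<noteq> 0" using nz B by auto
    moreover have "v $ i = f i" using \<open>i < n\<close> by (simp add: v_def)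
    ultimately show False by simp
  qed
  moreover have "A' *\<^sub>v v = x \<cdot>\<^sub>v v"
  proof (rule eq_vecI)
    fix i assume i: "i < dim_vec (x \<cdot>\<^sub>v v)"
    then have "(A' *\<^sub>v v) $ i = (\<Sum>j<n. of_int (c i j) * f j)"
      by (auto simp: A'_def A_def v_def scalar_prod_def atLeast0LessThan intro!: sum.cong)
    then show "(A' *\<^sub>v v) $ i = (x \<cdot>\<^sub>v v) $ i" using c i by (simp add: v_def)
  qed (use A' in \<open>auto simp: v_def\<close>)
  ultimately have "eigenvalue A' x"
    using A' unfolding eigenvalue_def eigenvector_def v_def
    by (intro exI[of _ "vec n f"]) auto
  then have "poly (char_poly A') x = 0"
    using eigenvalue_root_char_poly[OF A'] by blast
  moreover have "char_poly A' = map_poly of_int (char_poly A)"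
    unfolding A'_def using of_int_hom.char_poly_hom[OF A] .
  moreover have "lead_coeff (char_poly A) = 1"
    using degree_monic_char_poly[OF A] by auto
  ultimately show ?thesis unfolding algebraic_int_altdef_ipoly by metis
qed

lemma algebraic_int_power_sum:
  assumes "algebraic_int (x :: complex)"
  obtains n and c :: "nat \<Rightarrow> int" where "n > 0" "x ^ n = (\<Sum>i<n. of_int (c i) * x ^ i)"
proof -
  from assms obtain q where q: "poly (map_poly of_int q) x = 0" "lead_coeff q = 1"
    unfolding algebraic_int_altdef_ipoly by blast
  define n where "n = degree q"
  have "n > 0"
  proof (rule ccontr)
    assume "\<not> n > 0"
    then have "degree q = 0" by (simp add: n_def)
    then obtain a where "q = [:a:]" by (elim degree_eq_zeroE)
    then show False using q by auto
  qed
  have "0 = (\<Sum>i\<le>n. of_int (coeff q i) * x ^ i)"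
    using q(1) by (simp add: poly_altdef n_def degree_map_poly coeff_map_poly)
  also have "\<dots> = x ^ n + (\<Sum>i<n. of_int (coeff q i) * x ^ i)"
    using q(2) by (simp add: lessThan_Suc_atMost[symmetric] n_def)
  finally have "x ^ n = (\<Sum>i<n. of_int (- coeff q i) * x ^ i)"
    by (simp add: sum_negf eq_neg_iff_add_eq_0)
  then show ?thesis using that[of n "\<lambda>i. - coeff q i"] \<open>n > 0\<close> by blast
qed

text \<open>The products x^i y^j with i < n and j < k span a group that is stable under
  multiplication by x and by y, because x^n and y^k are integer combinations of lower powers; so it
  is stable under x + y and x y as well.\<close>

lemma
  fixes x y :: complex
  assumes x: "algebraic_int x" and y: "algebraic_int y"
  shows algebraic_int_add: "algebraic_int (x + y)"
    and algebraic_int_mult: "algebraic_int (x * y)"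
proof -
  obtain n c where n: "n > 0" and c: "x ^ n = (\<Sum>i<n. of_int (c i) * x ^ i)"
    using x by (rule algebraic_int_power_sum)
  obtain k d where k: "k > 0" and d: "y ^ k = (\<Sum>i<k. of_int (d i) * y ^ i)"
    using y by (rule algebraic_int_power_sum)
  define B where "B = (\<lambda>(i,j). x ^ i * y ^ j) ` ({..<n} \<times> {..<k})"
  have fin: "finite B" by (simp add: B_def)
  have base: "x ^ i * y ^ j \<in> int_span B" if "i < n" "j < k" for i j
    by (rule int_span_base) (use that in \<open>auto simp: B_def\<close>)
  have nz: "\<exists>b\<in>B. b \<noteq> 0"
    using n k by (intro bexI[of _ "x ^ 0 * y ^ 0"]) (auto simp: B_def intro!: image_eqI[of _ _ "(0,0)"])
  have xB: "x * b \<in> int_span B" if "b \<in> B" for b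
  proof -
    from that obtain i j where ij: "b = x ^ i * y ^ j" "i < n" "j < k" by (auto simp: B_def)
    show ?thesis
    proof (cases "Suc i < n")
      case True
      then show ?thesis using base[of "Suc i" j] ij by (simp add: mult.assoc)
    next
      case False
      then have "Suc i = n" using ij by simp
      then have "x * b = x ^ n * y ^ j" using ij by (auto simp: mult.assoc)
      also have "\<dots> = (\<Sum>i<n. of_int (c i) * (x ^ i * y ^ j))"
        by (simp add: c sum_distrib_right mult.assoc)
      also have "\<dots> \<in> int_span B" using ij by (intro int_span_sum int_span_of_int base) auto
      finally show ?thesis .
    qed
  qed
  have yB: "y * b \<in> int_span B" if "b \<in> B" for b
  proof -
    from that obtain i j where ij: "b = x ^ i * y ^ j" "i < n" "j < k" by (auto simp: B_def)
    show ?thesis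
    proof (cases "Suc j < k")
      case True
      then show ?thesis using base[of i "Suc j"] ij by (simp add: mult_ac)
    next
      case False
      then have "Suc j = k" using ij by simp
      then have "y * b = y ^ k * x ^ i" using ij by (auto simp: mult_ac)
      also have "\<dots> = (\<Sum>j<k. of_int (d j) * (x ^ i * y ^ j))"
        by (simp add: d sum_distrib_left sum_distrib_right mult_ac)
      also have "\<dots> \<in> int_span B" using ij by (intro int_span_sum int_span_of_int base) auto
      finally show ?thesis .
    qed
  qed
  show "algebraic_int (x + y)"
    by (rule algebraic_int_if_stable[OF fin nz])
      (auto simp: distrib_right intro: int_span_add xB yB)
  show "algebraic_int (x * y)"
    by (rule algebraic_int_if_stable[OF fin nz])
      (auto simp: mult.assoc intro: int_span_mult_closed xB yB)
qed

lemma algebraic_int_power: "algebraic_int x \<Longrightarrow> algebraic_int (x ^ n :: complex)"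
  by (induction n) (auto intro: algebraic_int_mult)

lemma algebraic_int_sum:
  "(\<And>i. i \<in> I \<Longrightarrow> algebraic_int (f i :: complex)) \<Longrightarrow> algebraic_int (sum f I)"
  by (induction I rule: infinite_finite_induct) (auto intro: algebraic_int_add)

lemma algebraic_int_prod:
  "(\<And>i. i \<in> I \<Longrightarrow> algebraic_int (f i :: complex)) \<Longrightarrow> algebraic_int (prod f I)"
  by (induction I rule: infinite_finite_induct) (auto intro: algebraic_int_mult)

lemma algebraic_int_power_root:
  assumes "algebraic_int (x ^ n :: complex)" "n > 0"
  shows "algebraic_int x"
  by (rule algebraic_int_root[OF assms(1), of "monom 1 n"])
    (use assms(2) in \<open>auto simp: poly_monom degree_monom_eq coeff_monom\<close>)

section \<open>Orders that are local at a prime\<close>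

locale complex_subring =
  fixes R :: "complex set"
  assumes of_int_mem: "of_int n \<in> R"
    and add_mem: "x \<in> R \<Longrightarrow> y \<in> R \<Longrightarrow> x + y \<in> R"
    and mult_mem: "x \<in> R \<Longrightarrow> y \<in> R \<Longrightarrow> x * y \<in> R"
begin

lemma zero_mem: "0 \<in> R" using of_int_mem[of 0] by simp
lemma one_mem: "1 \<in> R" using of_int_mem[of 1] by simp
lemma of_nat_mem: "of_nat n \<in> R" using of_int_mem[of "int n"] by simp
lemma numeral_mem: "numeral n \<in> R" using of_int_mem[of "numeral n"] by simp
lemma uminus_mem: "x \<in> R \<Longrightarrow> - x \<in> R" using mult_mem[OF of_int_mem[of "-1"]] by force
lemma diff_mem: "x \<in> R \<Longrightarrow> y \<in> R \<Longrightarrow> x - y \<in> R" using add_mem[OF _ uminus_mem] by fastforce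
lemma power_mem: "x \<in> R \<Longrightarrow> x ^ n \<in> R" by (induction n) (auto intro: one_mem mult_mem)
lemma sum_mem: "(\<And>i. i \<in> I \<Longrightarrow> f i \<in> R) \<Longrightarrow> sum f I \<in> R"
  by (induction I rule: infinite_finite_induct) (auto intro: zero_mem add_mem)

lemmas ring_mem = of_int_mem add_mem mult_mem zero_mem one_mem of_nat_mem numeral_mem uminus_mem
  diff_mem power_mem

lemma poly_mem: "x \<in> R \<Longrightarrow> poly (map_poly of_int g) x \<in> R"
  by (induction g) (auto simp: map_poly_pCons intro: ring_mem)

lemma int_adjoin_subset: "x \<in> R \<Longrightarrow> int_adjoin x \<subseteq> R"
  by (auto simp: int_adjoin_def poly_mem)

text \<open>The modulus may be any complex number, and the quotient is sought in \<open>R\<close>.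
  Congruence modulo p in a local order is thus a priori weaker than in \<open>A\<close>;
  \<open>monogenic_modI\<close> passes from one to the other.\<close>

definition cong_mod :: "complex \<Rightarrow> complex \<Rightarrow> complex \<Rightarrow> bool" where
  "cong_mod \<rho> x y \<longleftrightarrow> (\<exists>r\<in>R. x - y = \<rho> * r)"

lemma cong_modI: "x - y = \<rho> * r \<Longrightarrow> r \<in> R \<Longrightarrow> cong_mod \<rho> x y"
  unfolding cong_mod_def by blast

lemma cong_mod_refl: "cong_mod \<rho> x x"
  by (rule cong_modI[of _ _ _ 0]) (simp_all add: zero_mem)

lemma cong_mod_sym: "cong_mod \<rho> x y \<Longrightarrow> cong_mod \<rho> y x"
proof -
  assume "cong_mod \<rho> x y"
  then obtain r where r: "r \<in> R" "x - y = \<rho> * r" unfolding cong_mod_def by blast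
  have "y - x = - (x - y)" by simp
  also have "\<dots> = \<rho> * (- r)" by (simp add: r)
  finally show ?thesis using r by (intro cong_modI[of _ _ _ "- r"] uminus_mem)
qed

lemma cong_mod_trans [trans]:
  assumes "cong_mod \<rho> x y" "cong_mod \<rho> y z"
  shows "cong_mod \<rho> x z"
proof -
  obtain r s where r: "r \<in> R" "x - y = \<rho> * r" and s: "s \<in> R" "y - z = \<rho> * s"
    using assms unfolding cong_mod_def by blast
  have "x - z = (x - y) + (y - z)" by simp
  also have "\<dots> = \<rho> * (r + s)" by (simp add: r s distrib_left)
  finally show ?thesis using r s by (intro cong_modI[of _ _ _ "r + s"] add_mem)
qed

lemma cong_mod_add:
  assumes "cong_mod \<rho> x y" "cong_mod \<rho> x' y'"
  shows "cong_mod \<rho> (x + x') (y + y')"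
proof -
  obtain r s where r: "r \<in> R" "x - y = \<rho> * r" and s: "s \<in> R" "x' - y' = \<rho> * s"
    using assms unfolding cong_mod_def by blast
  have "x + x' - (y + y') = (x - y) + (x' - y')" by simp
  also have "\<dots> = \<rho> * (r + s)" by (simp add: r s distrib_left)
  finally show ?thesis using r s by (intro cong_modI[of _ _ _ "r + s"] add_mem)
qed

lemma cong_mod_mult:
  assumes "cong_mod \<rho> x y" "cong_mod \<rho> x' y'" "x \<in> R" "y' \<in> R"
  shows "cong_mod \<rho> (x * x') (y * y')"
proof -
  obtain r s where r: "r \<in> R" "x - y = \<rho> * r" and s: "s \<in> R" "x' - y' = \<rho> * s"
    using assms unfolding cong_mod_def by blast
  have "x * x' - (y * y') = x * (x' - y') + y' * (x - y)" by (simp add: algebra_simps)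
  also have "\<dots> = \<rho> * (x * s + y' * r)" by (simp only: r(2) s(2)) (simp add: algebra_simps)
  finally show ?thesis using r s assms
    by (intro cong_modI[of _ _ _ "x * s + y' * r"]) (auto intro: ring_mem)
qed

lemma cong_mod_scale: "cong_mod \<rho> x y \<Longrightarrow> z \<in> R \<Longrightarrow> cong_mod \<rho> (z * x) (z * y)"
  unfolding cong_mod_def by (metis mult_mem mult.left_commute right_diff_distrib)

lemma cong_mod_uminus: "cong_mod \<rho> x y \<Longrightarrow> cong_mod \<rho> (- x) (- y)"
  using cong_mod_scale[of \<rho> x y "-1"] uminus_mem[OF one_mem] by simp

lemma cong_mod_diff:
  "cong_mod \<rho> x y \<Longrightarrow> cong_mod \<rho> x' y' \<Longrightarrow> cong_mod \<rho> (x - x') (y - y')"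
  using cong_mod_add[of \<rho> x y "- x'" "- y'"] cong_mod_uminus by simp

lemma cong_mod_power:
  assumes "cong_mod \<rho> x y" "x \<in> R" "y \<in> R"
  shows "cong_mod \<rho> (x ^ n) (y ^ n)"
proof (induction n)
  case 0
  show ?case by (simp add: cong_mod_refl)
next
  case (Suc n)
  then show ?case using assms by (auto intro: cong_mod_mult power_mem)
qed

lemma cong_mod_sum:
  "(\<And>i. i \<in> I \<Longrightarrow> cong_mod \<rho> (f i) (g i)) \<Longrightarrow> cong_mod \<rho> (sum f I) (sum g I)"
  by (induction I rule: infinite_finite_induct) (auto intro: cong_mod_add cong_mod_refl)

lemma cong_mod_coarsen:
  assumes "cong_mod (\<rho> * t) x y" "t \<in> R"
  shows "cong_mod \<rho> x y"
  using assms unfolding cong_mod_def by (metis mult.assoc mult_mem)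

text \<open>Divisibility of one modulus by another is written as
  \<open>cong_mod \<rho> \<sigma> 0\<close> throughout, and this is the rule that exploits
  it.\<close>

lemma cong_mod_coarsen': "cong_mod \<sigma> x y \<Longrightarrow> cong_mod \<rho> \<sigma> 0 \<Longrightarrow> cong_mod \<rho> x y"
  using cong_mod_coarsen unfolding cong_mod_def[of \<rho> \<sigma>] by auto

lemma cong_mod_0_mult: "cong_mod \<rho> x 0 \<Longrightarrow> y \<in> R \<Longrightarrow> cong_mod \<rho> (x * y) 0"
  using cong_mod_scale[of \<rho> x 0 y] by (simp add: mult.commute)

lemma cong_mod_self: "cong_mod \<rho> \<rho> 0"
  by (rule cong_modI[of _ _ _ 1]) (auto intro: one_mem)

lemma cong_mod_Fermat_add:
  assumes "prime p" "x \<in> R" "y \<in> R"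
  shows "cong_mod (of_nat p) ((x + y) ^ p) (x ^ p + y ^ p)"
proof -
  have p: "0 < p" using assms(1) by (simp add: prime_gt_0_nat)
  have "{..p} = insert 0 (insert p {0<..<p})" using p by auto
  then have "(x + y) ^ p =
      x ^ p + y ^ p + (\<Sum>k\<in>{0<..<p}. of_nat (p choose k) * x ^ k * y ^ (p - k))"
    using p by (simp add: binomial_ring)
  also have "(\<Sum>k\<in>{0<..<p}. of_nat (p choose k) * x ^ k * y ^ (p - k)) =
      (\<Sum>k\<in>{0<..<p}. of_nat p * (of_nat ((p choose k) div p) * x ^ k * y ^ (p - k)))"
  proof (rule sum.cong)
    fix k assume "k \<in> {0<..<p}"
    then have "p dvd (p choose k)" using assms(1) by (intro dvd_choose_prime) auto
    then have "of_nat (p choose k) = of_nat p * (of_nat ((p choose k) div p) :: complex)"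
      by (metis dvd_mult_div_cancel of_nat_mult)
    then show "of_nat (p choose k) * x ^ k * y ^ (p - k) =
        of_nat p * (of_nat ((p choose k) div p) * x ^ k * y ^ (p - k))" by simp
  qed simp
  also have "\<dots> = of_nat p * (\<Sum>k\<in>{0<..<p}. of_nat ((p choose k) div p) * x ^ k * y ^ (p - k))"
    by (rule sum_distrib_left[symmetric])
  finally show ?thesis
    by (intro cong_modI[of _ _ _ "\<Sum>k\<in>{0<..<p}. of_nat ((p choose k) div p) * x ^ k * y ^ (p - k)"])
      (auto intro!: sum_mem ring_mem assms(2,3))
qed

lemma cong_mod_Frobenius_add:
  assumes "prime p" "x \<in> R" "y \<in> R"
  shows "cong_mod (of_nat p) ((x + y) ^ (p ^ s)) (x ^ (p ^ s) + y ^ (p ^ s))"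
proof (induction s)
  case 0
  show ?case by (simp add: cong_mod_refl)
next
  case (Suc s)
  have "cong_mod (of_nat p) (((x + y) ^ (p ^ s)) ^ p) ((x ^ (p ^ s) + y ^ (p ^ s)) ^ p)"
    by (rule cong_mod_power[OF Suc]) (intro ring_mem assms)+
  also have "cong_mod (of_nat p) ((x ^ (p ^ s) + y ^ (p ^ s)) ^ p)
      ((x ^ (p ^ s)) ^ p + (y ^ (p ^ s)) ^ p)"
    by (rule cong_mod_Fermat_add) (intro ring_mem assms)+
  finally show ?case by (simp add: power_mult[symmetric] mult.commute)
qed

lemma cong_mod_of_int:
  assumes "[a = b] (mod int p)"
  shows "cong_mod (of_nat p) (of_int a) (of_int b)"
proof -
  from assms obtain k where "a - b = int p * k" by (meson cong_iff_dvd_diff dvdE)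
  then have "of_int (a - b) = (of_int (int p * k) :: complex)" by simp
  then show ?thesis by (intro cong_modI[of _ _ _ "of_int k"]) (auto intro: of_int_mem)
qed

lemma cong_mod_Frobenius_of_int:
  assumes "prime p"
  shows "cong_mod (of_nat p) (of_int a ^ (p ^ s)) (of_int a)"
proof -
  have p: "0 < p" using assms by (simp add: prime_gt_0_nat)
  have nat_case: "cong_mod (of_nat p) (of_nat k ^ (p ^ s)) (of_nat k)" for k
  proof (induction k)
    case 0
    show ?case using p by (simp add: cong_mod_refl power_0_left)
  next
    case (Suc k)
    have "cong_mod (of_nat p) ((of_nat k + 1) ^ (p ^ s)) (of_nat k ^ (p ^ s) + 1 ^ (p ^ s))"
      by (rule cong_mod_Frobenius_add) (intro assms ring_mem)+
    also have "cong_mod (of_nat p) (of_nat k ^ (p ^ s) + 1 ^ (p ^ s)) (of_nat k + 1)"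
      by (intro cong_mod_add Suc) (simp add: cong_mod_refl)
    finally show ?case by (simp add: add.commute)
  qed
  define k where "k = nat (a mod int p)"
  have "[a = int k] (mod int p)" using p by (simp add: k_def cong_def)
  then have ak: "cong_mod (of_nat p) (of_int a) (of_nat k)"
    using cong_mod_of_int[of a "int k" p] by simp
  have "cong_mod (of_nat p) (of_int a ^ (p ^ s)) (of_nat k ^ (p ^ s))"
    by (intro cong_mod_power ak ring_mem)
  also note nat_case
  also note cong_mod_sym[OF ak]
  finally show ?thesis .
qed

end

lemma int_adjoin_subring: "complex_subring (int_adjoin x)"
proof
  fix n
  have "of_int n = poly (map_poly of_int [:n:]) x" by (cases "n = 0") (simp_all add: map_poly_pCons)
  then show "of_int n \<in> int_adjoin x" unfolding int_adjoin_def by blast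
next
  fix y z assume "y \<in> int_adjoin x" "z \<in> int_adjoin x"
  then obtain p q where pq: "y = poly (map_poly of_int p) x" "z = poly (map_poly of_int q) x"
    unfolding int_adjoin_def by blast
  have "y + z = poly (map_poly of_int (p + q)) x" "y * z = poly (map_poly of_int (p * q)) x"
    by (simp_all add: pq of_int_poly_hom.hom_add of_int_poly_hom.hom_mult)
  then show "y + z \<in> int_adjoin x" "y * z \<in> int_adjoin x"
    unfolding int_adjoin_def by blast+
qed

lemma int_adjoin_self: "x \<in> int_adjoin x"
proof -
  have "x = poly (map_poly of_int [:0, 1:]) x" by (simp add: map_poly_pCons)
  then show ?thesis unfolding int_adjoin_def by blast
qed

context complex_subring
begin

text \<open>Makes it enough to find representatives in \<int>[w] for the generators of a
  ring.\<close>

lemma residue_subring: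
  "complex_subring {x \<in> R. \<exists>y\<in>int_adjoin w. cong_mod \<rho> x y}" if "w \<in> R"
proof -
  interpret W: complex_subring "int_adjoin w" by (rule int_adjoin_subring)
  have WR: "int_adjoin w \<subseteq> R" by (rule int_adjoin_subset[OF that])
  show ?thesis
  proof
    show "of_int n \<in> {x \<in> R. \<exists>y\<in>int_adjoin w. cong_mod \<rho> x y}" for n
      by (intro CollectI conjI bexI[of _ "of_int n"] cong_mod_refl of_int_mem W.of_int_mem)
  next
    fix x y
    assume "x \<in> {x \<in> R. \<exists>y\<in>int_adjoin w. cong_mod \<rho> x y}"
    then obtain x' where x: "x \<in> R" "x' \<in> int_adjoin w" "cong_mod \<rho> x x'" by auto
    assume "y \<in> {x \<in> R. \<exists>y\<in>int_adjoin w. cong_mod \<rho> x y}"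
    then obtain y' where y: "y \<in> R" "y' \<in> int_adjoin w" "cong_mod \<rho> y y'" by auto
    have "y' \<in> R" using WR y(2) by blast
    then have c: "cong_mod \<rho> (x + y) (x' + y')" "cong_mod \<rho> (x * y) (x' * y')"
      by (intro cong_mod_add cong_mod_mult x y)+
    show "x + y \<in> {x \<in> R. \<exists>y\<in>int_adjoin w. cong_mod \<rho> x y}"
      by (intro CollectI conjI bexI[of _ "x' + y'"] c add_mem W.add_mem x y)
    show "x * y \<in> {x \<in> R. \<exists>y\<in>int_adjoin w. cong_mod \<rho> x y}"
      by (intro CollectI conjI bexI[of _ "x' * y'"] c mult_mem W.mult_mem x y)
  qed
qed

end

text \<open>Integrality over the localization of \<int> at p, with the denominators collected in one
  integer prime to p.\<close>

definition p_integral :: "nat \<Rightarrow> complex \<Rightarrow> bool" where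
  "p_integral p x \<longleftrightarrow> (\<exists>n :: int. \<not> int p dvd n \<and> algebraic_int (of_int n * x))"

lemma p_integralI: "\<not> int p dvd n \<Longrightarrow> algebraic_int (of_int n * x) \<Longrightarrow> p_integral p x"
  unfolding p_integral_def by blast

lemma algebraic_int_imp_p_integral: "prime p \<Longrightarrow> algebraic_int x \<Longrightarrow> p_integral p x"
  by (rule p_integralI[of _ 1]) (auto simp: prime_nat_iff)

lemma p_integral_fraction:
  assumes "\<not> int p dvd n"
  shows "p_integral p (of_int a / of_int n)"
proof (rule p_integralI[OF assms])
  have "n \<noteq> 0" using assms by auto
  then show "algebraic_int (of_int n * (of_int a / of_int n :: complex))" by simp
qed

lemma p_integral_mult:
  assumes "prime p" "p_integral p x" "p_integral p y"
  shows "p_integral p (x * y)"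
proof -
  obtain n k where n: "\<not> int p dvd n" "algebraic_int (of_int n * x)"
    and k: "\<not> int p dvd k" "algebraic_int (of_int k * y)"
    using assms unfolding p_integral_def by blast
  have "\<not> int p dvd n * k" using n k assms(1) by (simp add: prime_dvd_mult_iff)
  moreover have "algebraic_int (of_int (n * k) * (x * y))"
    using algebraic_int_mult[OF n(2) k(2)] by (simp add: mult_ac)
  ultimately show ?thesis by (rule p_integralI)
qed

lemma p_integral_add:
  assumes "prime p" "p_integral p x" "p_integral p y"
  shows "p_integral p (x + y)"
proof -
  obtain n k where n: "\<not> int p dvd n" "algebraic_int (of_int n * x)"
    and k: "\<not> int p dvd k" "algebraic_int (of_int k * y)"
    using assms unfolding p_integral_def by blast
  have "\<not> int p dvd n * k" using n k assms(1) by (simp add: prime_dvd_mult_iff)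
  moreover have "algebraic_int (of_int (n * k) * (x + y))"
  proof -
    have "of_int (n * k) * (x + y) = of_int k * (of_int n * x) + of_int n * (of_int k * y)"
      by (simp add: algebra_simps)
    then show ?thesis using n(2) k(2) by (auto intro!: algebraic_int_add algebraic_int_mult)
  qed
  ultimately show ?thesis by (rule p_integralI)
qed

lemma p_integral_power_root:
  assumes "prime p" "p_integral p (x ^ n)" "n > 0"
  shows "p_integral p x"
proof -
  obtain k where k: "\<not> int p dvd k" "algebraic_int (of_int k * x ^ n)"
    using assms unfolding p_integral_def by blast
  have "(of_int k * x) ^ n = of_int k ^ (n - 1) * (of_int k * x ^ n)"
    using \<open>n > 0\<close> by (cases n) (simp_all add: power_mult_distrib)
  then have "algebraic_int ((of_int k * x) ^ n)"
    using k(2) by (auto intro: algebraic_int_mult algebraic_int_power)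
  then show ?thesis using algebraic_int_power_root[OF _ \<open>n > 0\<close>] k(1) p_integralI by blast
qed

lemma not_p_integral_inverse: "prime p \<Longrightarrow> \<not> p_integral p (1 / of_nat p)"
proof
  assume p: "prime p" and "p_integral p (1 / of_nat p)"
  then obtain n where n: "\<not> int p dvd n" "algebraic_int (of_int n * (1 / of_nat p) :: complex)"
    unfolding p_integral_def by blast
  have "of_int n * (1 / of_nat p) \<in> (\<rat> :: complex set)" by (intro Rats_mult Rats_divide) auto
  with n(2) have "of_int n * (1 / of_nat p) \<in> (\<int> :: complex set)"
    by (rule rational_algebraic_int_is_int)
  then obtain k where "of_int n * (1 / of_nat p) = (of_int k :: complex)" by (elim Ints_cases)
  then have "of_int n = (of_int (k * int p) :: complex)"
    using p by (simp add: field_simps)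
  then have "n = k * int p" by (simp only: of_int_eq_iff)
  then show False using n(1) by simp
qed

text \<open>An algebra over the localization of \<int> at p that is integral over it. Integrality
  keeps p from being a unit (\<open>p_not_unit\<close>).\<close>

locale p_local_order = complex_subring R for R :: "complex set" +
  fixes p :: nat
  assumes p: "prime p"
    and inverse_mem: "\<not> int p dvd n \<Longrightarrow> 1 / of_int n \<in> R"
    and p_int: "x \<in> R \<Longrightarrow> p_integral p x"
begin

lemma p_pos: "p > 0" using p by (simp add: prime_gt_0_nat)

lemma p_not_unit: "\<not> cong_mod (of_nat p) 1 0"
proof
  assume "cong_mod (of_nat p) 1 0"
  then obtain r where r: "r \<in> R" "1 = of_nat p * r" unfolding cong_mod_def by auto
  then have "r = 1 / of_nat p" using p_pos by (simp add: field_simps)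
  then show False using p_int[OF r(1)] not_p_integral_inverse[OF p] by simp
qed

lemma radical_not_unit:
  assumes "cong_mod (of_nat p) (\<rho> ^ e) 0" "\<rho> \<in> R"
  shows "\<not> cong_mod \<rho> 1 0"
proof
  assume "cong_mod \<rho> 1 0"
  then obtain r where r: "r \<in> R" "1 = \<rho> * r" unfolding cong_mod_def by auto
  have "cong_mod (of_nat p) (\<rho> ^ e * r ^ e) 0"
    by (intro cong_mod_0_mult assms power_mem r(1))
  then have "cong_mod (of_nat p) 1 0" by (simp add: power_mult_distrib[symmetric] r(2)[symmetric])
  then show False using p_not_unit by simp
qed

text \<open>In the equation of integral dependence of \<open>y\<close>, put \<open>p y = u - N\<close>, where \<open>u\<close> is the
  element to be inverted; the constant term is an integer prime to \<open>p\<close>.\<close>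

lemma unit_mod_p:
  assumes y: "y \<in> R" and a: "\<not> int p dvd a"
  shows "\<exists>z\<in>R. (of_int a + of_nat p * y) * z = 1"
proof -
  obtain n where n: "\<not> int p dvd n" "algebraic_int (of_int n * y)"
    using p_int[OF y] unfolding p_integral_def by blast
  define t where "t = of_int n * y"
  define N where "N = n * a"
  define u where "u = of_int N + of_nat p * t"
  have N: "\<not> int p dvd N" using n(1) a p by (simp add: N_def prime_dvd_mult_iff)
  have t: "t \<in> R" and u: "u \<in> R" unfolding t_def u_def by (intro ring_mem y)+
  obtain k c where k: "k > 0" and c: "t ^ k = (\<Sum>i<k. of_int (c i) * t ^ i)"
    using n(2) unfolding t_def by (rule algebraic_int_power_sum)
  have pt: "cong_mod u ((of_nat p * t) ^ i) (of_int (- N) ^ i)" for i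
    by (rule cong_mod_power) (auto intro!: ring_mem t cong_modI[of _ _ _ 1] simp: u_def)
  define M where "M = (- N) ^ k - (\<Sum>i<k. c i * int p ^ (k - i) * (- N) ^ i)"
  have "cong_mod u (of_int (- N) ^ k) ((of_nat p * t) ^ k)"
    by (rule cong_mod_sym[OF pt])
  also have "(of_nat p * t) ^ k = (\<Sum>i<k. of_nat p ^ k * (of_int (c i) * t ^ i))"
    by (simp add: power_mult_distrib c sum_distrib_left)
  also have "\<dots> = (\<Sum>i<k. of_int (c i) * of_nat p ^ (k - i) * (of_nat p * t) ^ i)"
  proof (rule sum.cong)
    fix i assume "i \<in> {..<k}"
    then have "of_nat p ^ k = (of_nat p ^ (k - i) * of_nat p ^ i :: complex)"
      by (simp flip: power_add)
    then show "of_nat p ^ k * (of_int (c i) * t ^ i) =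
        of_int (c i) * of_nat p ^ (k - i) * (of_nat p * t) ^ i"
      by (simp add: power_mult_distrib mult_ac)
  qed simp
  also have "cong_mod u \<dots> (\<Sum>i<k. of_int (c i) * of_nat p ^ (k - i) * of_int (- N) ^ i)"
    by (intro cong_mod_sum cong_mod_scale pt ring_mem)
  finally have "cong_mod u (of_int M) 0"
    by (auto simp: cong_mod_def M_def)
  then obtain r where r: "r \<in> R" "of_int M = u * r" unfolding cong_mod_def by auto
  have "int p dvd (\<Sum>i<k. c i * int p ^ (k - i) * (- N) ^ i)"
    by (intro dvd_sum) (auto intro!: dvd_mult2 dvd_mult)
  moreover have "\<not> int p dvd (- N) ^ k" using N p by (metis dvd_minus_iff prime_dvd_power prime_nat_int_transfer)
  ultimately have M: "\<not> int p dvd M" unfolding M_def by (metis dvd_add_right_iff diff_add_cancel)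
  then have "of_int M \<noteq> (0 :: complex)" by auto
  have "u = of_int n * (of_int a + of_nat p * y)" by (simp add: u_def N_def t_def algebra_simps)
  then have "(of_int a + of_nat p * y) * (of_int n * r * (1 / of_int M)) = 1"
    using r(2) \<open>of_int M \<noteq> 0\<close> by (simp add: field_simps)
  moreover have "of_int n * r * (1 / of_int M) \<in> R" by (intro ring_mem r inverse_mem M)
  ultimately show ?thesis by blast
qed

text \<open>With x - a = \<rho> y, the element x divides a^e - (-\<rho> y)^e. Since p divides
  \<rho>^e, this is a^e plus a multiple of p, which \<open>unit_mod_p\<close> inverts.\<close>

lemma unit_mod_radical:
  assumes x: "x \<in> R" and \<rho>: "\<rho> \<in> R" "cong_mod (of_nat p) (\<rho> ^ e) 0"
    and xa: "cong_mod \<rho> x (of_int a)" and a: "\<not> int p dvd a"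
  shows "\<exists>z\<in>R. x * z = 1"
proof -
  obtain y where y: "y \<in> R" "x - of_int a = \<rho> * y" using xa unfolding cong_mod_def by blast
  obtain r where r: "r \<in> R" "\<rho> ^ e = of_nat p * r" using \<rho>(2) unfolding cong_mod_def by auto
  have "cong_mod x (of_int a) (- (\<rho> * y))"
    by (rule cong_modI[of _ _ _ 1]) (use y in \<open>auto intro: one_mem simp: algebra_simps\<close>)
  then have "cong_mod x (of_int a ^ e) ((- (\<rho> * y)) ^ e)"
    by (intro cong_mod_power ring_mem \<rho> y)
  also have "(- (\<rho> * y)) ^ e = of_nat p * (r * (- y) ^ e)"
    using r(2) by (metis minus_mult_right mult.assoc power_mult_distrib)
  finally obtain s where s: "s \<in> R" "of_int a ^ e - of_nat p * (r * (- y) ^ e) = x * s"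
    unfolding cong_mod_def by blast
  have "\<not> int p dvd a ^ e" using a p by (metis prime_dvd_power prime_nat_int_transfer)
  from unit_mod_p[OF _ this, of "- (r * (- y) ^ e)"] obtain z
    where z: "z \<in> R" "(of_int (a ^ e) + of_nat p * (- (r * (- y) ^ e))) * z = 1"
    using r(1) y(1) by (meson mult_mem power_mem uminus_mem)
  then have "x * (s * z) = 1" using s(2) by (simp flip: mult.assoc)
  then show ?thesis using s(1) z(1) mult_mem by blast
qed

text \<open>Raising to the power p^s is additive modulo p, hence modulo a divisor \<rho> of p, so
  the fixed residues form a ring. To fix all of \<open>R\<close> it then suffices to fix one
  generator of the residue ring, which is \<open>Frobenius_fixed\<close>.\<close>

lemma Frobenius_fixed_subring:
  assumes "cong_mod \<rho> (of_nat p) 0"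
  shows "complex_subring {x \<in> R. cong_mod \<rho> (x ^ (p ^ s)) x}"
proof
  fix n
  have "cong_mod \<rho> (of_int n ^ (p ^ s)) (of_int n)"
    by (rule cong_mod_coarsen'[OF cong_mod_Frobenius_of_int[OF p] assms])
  then show "of_int n \<in> {x \<in> R. cong_mod \<rho> (x ^ (p ^ s)) x}" using of_int_mem by simp
next
  fix x y
  assume x: "x \<in> {x \<in> R. cong_mod \<rho> (x ^ (p ^ s)) x}" and y: "y \<in> {x \<in> R. cong_mod \<rho> (x ^ (p ^ s)) x}"
  have "cong_mod \<rho> ((x + y) ^ (p ^ s)) (x ^ (p ^ s) + y ^ (p ^ s))"
    by (rule cong_mod_coarsen'[OF cong_mod_Frobenius_add[OF p] assms]) (use x y in auto)
  also have "cong_mod \<rho> (x ^ (p ^ s) + y ^ (p ^ s)) (x + y)"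
    using x y by (intro cong_mod_add) auto
  finally show "x + y \<in> {x \<in> R. cong_mod \<rho> (x ^ (p ^ s)) x}" using x y add_mem by simp
  have "cong_mod \<rho> ((x * y) ^ (p ^ s)) (x * y)"
    unfolding power_mult_distrib using x y by (intro cong_mod_mult) (auto intro: ring_mem)
  then show "x * y \<in> {x \<in> R. cong_mod \<rho> (x ^ (p ^ s)) x}" using x y mult_mem by simp
qed

lemma Frobenius_fixed:
  assumes \<rho>: "cong_mod \<rho> (of_nat p) 0"
    and w: "w \<in> R" "cong_mod \<rho> (w ^ (p ^ s)) w"
    and gen: "\<exists>y\<in>int_adjoin w. cong_mod \<rho> x y" and x: "x \<in> R"
  shows "cong_mod \<rho> (x ^ (p ^ s)) x"
proof -
  interpret F: complex_subring "{x \<in> R. cong_mod \<rho> (x ^ (p ^ s)) x}"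
    by (rule Frobenius_fixed_subring[OF \<rho>])
  obtain y where y: "y \<in> int_adjoin w" "cong_mod \<rho> x y" using gen by blast
  then have y': "y \<in> R" "cong_mod \<rho> (y ^ (p ^ s)) y"
    using F.int_adjoin_subset[of w] w by auto
  have "cong_mod \<rho> (x ^ (p ^ s)) (y ^ (p ^ s))" by (intro cong_mod_power y x y')
  also note y'(2)
  also note cong_mod_sym[OF y(2)]
  finally show ?thesis .
qed

lemma Frobenius_iterate:
  assumes fr: "\<And>x. x \<in> R \<Longrightarrow> cong_mod \<rho> (x ^ (p ^ s)) x" and x: "x \<in> R"
  shows "cong_mod \<rho> (x ^ (p ^ (s * j))) x"
proof (induction j)
  case 0
  show ?case by (simp add: cong_mod_refl)
next
  case (Suc j)
  have "cong_mod \<rho> ((x ^ (p ^ (s * j))) ^ (p ^ s)) (x ^ (p ^ (s * j)))"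
    by (intro fr power_mem x)
  also note Suc
  finally show ?case by (simp add: power_mult[symmetric] power_add mult.commute)
qed

text \<open>Iterating the hypothesis, x is congruent to x^(p^(s n)), whose exponent is at least n,
  so x inherits the vanishing of x^n.\<close>

lemma reduced_mod:
  assumes fr: "\<And>x. x \<in> R \<Longrightarrow> cong_mod \<rho> (x ^ (p ^ s)) x" and s: "s > 0"
    and x: "x \<in> R" and xn: "cong_mod \<rho> (x ^ n) 0"
  shows "cong_mod \<rho> x 0"
proof -
  have "n < 2 ^ n" by (rule less_exp)
  also have "(2::nat) ^ n \<le> p ^ n" using p by (intro power_mono prime_ge_2_nat) auto
  also have "p ^ n \<le> p ^ (s * n)" using p_pos s by (intro power_increasing) auto
  finally have "n \<le> p ^ (s * n)" by simp
  then have "x ^ (p ^ (s * n)) = x ^ n * x ^ (p ^ (s * n) - n)" by (simp flip: power_add)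
  then have "cong_mod \<rho> (x ^ (p ^ (s * n))) 0"
    using cong_mod_0_mult[OF xn power_mem[OF x]] by simp
  then show ?thesis using Frobenius_iterate[OF fr x, of n] cong_mod_sym cong_mod_trans by blast
qed

text \<open>A denominator \<rho>^(j+1) is lowered to \<rho>^j. For y = \<rho>^(j+1) x the integral
  equation of x, multiplied by \<rho>^((j+1) n), makes y^n a multiple of \<rho>; as there are no
  nilpotents, y is a multiple of \<rho> too. The initial denominator p^k is first replaced by
  \<rho>^(e k).\<close>

theorem integrally_closed:
  assumes fr: "\<And>x. x \<in> R \<Longrightarrow> cong_mod \<rho> (x ^ (p ^ s)) x" and s: "s > 0"
    and \<rho>: "\<rho> \<in> R" "\<rho> \<noteq> 0" "cong_mod (of_nat p) (\<rho> ^ e) 0"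
    and x: "algebraic_int x" "of_nat p ^ k * x \<in> R"
  shows "x \<in> R"
proof -
  obtain r where r: "r \<in> R" "\<rho> ^ e = of_nat p * r" using \<rho>(3) unfolding cong_mod_def by auto
  have "\<rho> ^ (e * k) * x = r ^ k * (of_nat p ^ k * x)"
    by (simp add: power_mult r(2) power_mult_distrib)
  also have "\<dots> \<in> R" by (intro mult_mem power_mem r(1) x(2))
  finally have ex: "\<rho> ^ (e * k) * x \<in> R" .
  have step: "\<rho> ^ j * x \<in> R" if "\<rho> ^ Suc j * x \<in> R" for j
  proof -
    define y where "y = \<rho> ^ Suc j * x"
    obtain n c where n: "n > 0" and c: "x ^ n = (\<Sum>i<n. of_int (c i) * x ^ i)"
      using x(1) by (rule algebraic_int_power_sum)
    have "y ^ n = (\<Sum>i<n. (\<rho> ^ Suc j) ^ n * (of_int (c i) * x ^ i))"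
      by (simp add: y_def power_mult_distrib[of "\<rho> ^ Suc j" x] c sum_distrib_left del: power_Suc)
    also have "\<dots> = (\<Sum>i<n. \<rho> * (\<rho> ^ j * (\<rho> ^ Suc j) ^ (n - i - 1) * (of_int (c i) * y ^ i)))"
    proof (rule sum.cong)
      fix i assume "i \<in> {..<n}"
      then have "n = Suc (n - i - 1) + i" by simp
      then have "(\<rho> ^ Suc j) ^ n = \<rho> ^ Suc j * (\<rho> ^ Suc j) ^ (n - i - 1) * (\<rho> ^ Suc j) ^ i"
        by (metis power_Suc power_add)
      then show "(\<rho> ^ Suc j) ^ n * (of_int (c i) * x ^ i) =
          \<rho> * (\<rho> ^ j * (\<rho> ^ Suc j) ^ (n - i - 1) * (of_int (c i) * y ^ i))"
        by (simp add: y_def power_mult_distrib mult_ac)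
    qed simp
    also have "\<dots> = \<rho> * (\<Sum>i<n. \<rho> ^ j * (\<rho> ^ Suc j) ^ (n - i - 1) * (of_int (c i) * y ^ i))"
      by (rule sum_distrib_left[symmetric])
    finally have yn: "y ^ n - 0 = \<rho> * (\<Sum>i<n. \<rho> ^ j * (\<rho> ^ Suc j) ^ (n - i - 1) * (of_int (c i) * y ^ i))"
      by simp
    have yR: "y \<in> R" using that by (simp add: y_def)
    have yn0: "cong_mod \<rho> (y ^ n) 0"
      by (rule cong_modI[OF yn]) (intro sum_mem ring_mem yR \<rho>(1))
    have "cong_mod \<rho> y 0" by (intro reduced_mod[OF _ s yR yn0] fr)
    then obtain z where "z \<in> R" "y = \<rho> * z" unfolding cong_mod_def by auto
    then show ?thesis using \<rho>(2) by (simp add: y_def)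
  qed
  have "\<rho> ^ j * x \<in> R \<Longrightarrow> x \<in> R" for j
    by (induction j) (use step in auto)
  then show ?thesis using ex by blast
qed

text \<open>Since \<open>w\<^sup>p\<close> is fixed by the Frobenius modulo \<open>\<rho>\<^sup>2\<close> and not only modulo \<open>\<rho>\<close>, the uniformizer
  can be recovered from \<open>w\<^sup>p + \<rho>\<close> as \<open>\<zeta> - \<zeta>\<^sup>q\<close>.\<close>

theorem single_generator:
  assumes w: "w \<in> R" and gen: "\<And>x. x \<in> R \<Longrightarrow> \<exists>y\<in>int_adjoin w. cong_mod \<rho> x y"
    and s: "s > 0" and wq: "cong_mod \<rho> (w ^ (p ^ s)) w"
    and \<rho>: "\<rho> \<in> R" "cong_mod (of_nat p) (\<rho> ^ e) 0" "cong_mod (\<rho> ^ 2) (of_nat p) 0"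
  shows "\<exists>\<zeta>\<in>R. \<forall>x\<in>R. \<exists>y\<in>int_adjoin \<zeta>. cong_mod (of_nat p) x y"
proof -
  define q where "q = p ^ s"
  have q2: "q \<ge> 2"
  proof -
    have "p ^ 1 \<le> p ^ s" using s p_pos by (intro power_increasing) auto
    then show ?thesis using prime_ge_2_nat[OF p] by (simp add: q_def)
  qed
  have \<rho>2: "cong_mod \<rho> (\<rho> ^ 2) 0"
    by (rule cong_modI[of _ _ _ \<rho>]) (auto simp: power2_eq_square \<rho>(1))
  have p0: "cong_mod \<rho> (of_nat p) 0" by (rule cong_mod_coarsen'[OF \<rho>(3) \<rho>2])
  define \<zeta> where "\<zeta> = w ^ p + \<rho>"
  have \<zeta>: "\<zeta> \<in> R" unfolding \<zeta>_def by (intro ring_mem w \<rho>)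
  interpret Z: complex_subring "int_adjoin \<zeta>" by (rule int_adjoin_subring)
  have ZR: "int_adjoin \<zeta> \<subseteq> R" by (rule int_adjoin_subset[OF \<zeta>])
  have q_split: "(w ^ p) ^ (p ^ (s - 1)) = w ^ q"
    using s by (cases s) (simp_all add: q_def power_mult[symmetric] mult.commute)
  \<comment> \<open>Since w is congruent to w^q, a power of w^p, passing from w to w^p loses no
    residue: w is a power of \<zeta> modulo \<rho>.\<close>
  have "cong_mod \<rho> w (w ^ q)" using wq cong_mod_sym q_def by simp
  also have "w ^ q = (w ^ p) ^ (p ^ (s - 1))" by (rule q_split[symmetric])
  also have "cong_mod \<rho> ((w ^ p) ^ (p ^ (s - 1))) (\<zeta> ^ (p ^ (s - 1)))"
    by (intro cong_mod_power ring_mem w \<zeta> cong_mod_sym[OF cong_modI[of _ _ _ 1]]) (simp add: \<zeta>_def)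
  finally have w\<zeta>: "cong_mod \<rho> w (\<zeta> ^ (p ^ (s - 1)))" .
  have gen1: "\<exists>y\<in>int_adjoin \<zeta>. cong_mod \<rho> x y" if "x \<in> R" for x
  proof -
    interpret Q: complex_subring "{x \<in> R. \<exists>y\<in>int_adjoin \<zeta>. cong_mod \<rho> x y}"
      by (rule residue_subring[OF \<zeta>])
    have "w \<in> {x \<in> R. \<exists>y\<in>int_adjoin \<zeta>. cong_mod \<rho> x y}"
      using w w\<zeta> Z.power_mem[OF int_adjoin_self] by blast
    then have "int_adjoin w \<subseteq> {x \<in> R. \<exists>y\<in>int_adjoin \<zeta>. cong_mod \<rho> x y}"
      by (rule Q.int_adjoin_subset)
    moreover obtain y where "y \<in> int_adjoin w" "cong_mod \<rho> x y" using gen \<open>x \<in> R\<close> by blast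
    ultimately show ?thesis using cong_mod_trans by blast
  qed
  define c where "c = \<zeta> - \<zeta> ^ q"
  have cZ: "c \<in> int_adjoin \<zeta>" unfolding c_def by (intro Z.ring_mem int_adjoin_self)
  have "cong_mod (\<rho> ^ 2) (\<zeta> ^ q) ((w ^ p) ^ q + \<rho> ^ q)"
    unfolding \<zeta>_def q_def
    by (rule cong_mod_coarsen'[OF cong_mod_Frobenius_add[OF p] \<rho>(3)]) (intro ring_mem w \<rho>)+
  also have "cong_mod (\<rho> ^ 2) ((w ^ p) ^ q + \<rho> ^ q) (w ^ p + 0)"
  proof (rule cong_mod_add)
    obtain r where r: "r \<in> R" "w ^ q - w = \<rho> * r" using wq unfolding cong_mod_def q_def by blast
    have pw: "cong_mod (\<rho> ^ 2) (\<rho> ^ n) 0" if "n \<ge> 2" for n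
    proof (rule cong_modI)
      show "\<rho> ^ n - 0 = \<rho> ^ 2 * \<rho> ^ (n - 2)" using that by (metis diff_zero le_add_diff_inverse power_add)
    qed (intro ring_mem \<rho>(1))
    \<comment> \<open>After exchanging the exponents, the p-th power turns the error \<rho> r of w^q
      into a multiple of \<rho>^2, because p is at least 2 and is itself divisible by
      \<rho>^2.\<close>
    have "(w ^ p) ^ q = (w + \<rho> * r) ^ p"
      using r(2) by (simp add: power_mult[symmetric] mult.commute[of p q] power_mult diff_eq_eq add.commute)
    also have "cong_mod (\<rho> ^ 2) \<dots> (w ^ p + (\<rho> * r) ^ p)"
      by (rule cong_mod_coarsen'[OF cong_mod_Fermat_add[OF p] \<rho>(3)]) (intro ring_mem w \<rho> r)+
    also have "cong_mod (\<rho> ^ 2) (w ^ p + (\<rho> * r) ^ p) (w ^ p + 0)"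
      unfolding power_mult_distrib
      by (intro cong_mod_add cong_mod_refl cong_mod_0_mult pw prime_ge_2_nat p power_mem r)
    finally show "cong_mod (\<rho> ^ 2) ((w ^ p) ^ q) (w ^ p)" by simp
    show "cong_mod (\<rho> ^ 2) (\<rho> ^ q) 0" by (rule pw[OF q2])
  qed
  finally have "cong_mod (\<rho> ^ 2) (\<zeta> - \<zeta> ^ q) (\<zeta> - (w ^ p + 0))"
    by (intro cong_mod_diff cong_mod_refl)
  then have "cong_mod (\<rho> ^ 2) c \<rho>" by (simp add: c_def \<zeta>_def)
  then obtain t where t: "t \<in> R" "c - \<rho> = \<rho> ^ 2 * t" unfolding cong_mod_def by blast
  have c: "c = \<rho> * (1 + \<rho> * t)" using t(2) by (simp add: algebra_simps power2_eq_square)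
  \<comment> \<open>Successive \<rho>-adic digits: each digit is taken in \<int>[\<zeta>] by
    \<open>gen1\<close>, and c^j takes the place of \<rho>^j, from which it differs by a multiple of
    \<rho>^(j+1).\<close>
  have gen_pow: "\<exists>y\<in>int_adjoin \<zeta>. cong_mod (\<rho> ^ j) x y" if "x \<in> R" for x j
    using that
  proof (induction j)
    case 0
    then show ?case by (intro bexI[of _ 0] cong_modI[of _ _ _ x]) (auto intro: Z.zero_mem)
  next
    case (Suc j)
    then obtain y r where y: "y \<in> int_adjoin \<zeta>" "r \<in> R" "x - y = \<rho> ^ j * r"
      unfolding cong_mod_def by blast
    obtain h r' where h: "h \<in> int_adjoin \<zeta>" "r' \<in> R" "r - h = \<rho> * r'"
      using gen1[OF y(2)] unfolding cong_mod_def by blast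
    have "cong_mod \<rho> ((1 + \<rho> * t) ^ j) (1 ^ j)"
      by (intro cong_mod_power ring_mem \<rho> t cong_modI[of _ _ _ t]) auto
    then obtain v where v: "v \<in> R" "(1 + \<rho> * t) ^ j = 1 + \<rho> * v"
      unfolding cong_mod_def by (auto simp: diff_eq_eq add.commute)
    have "r = h + \<rho> * r'" using h(3) by (simp add: diff_eq_eq add.commute)
    then have "x = y + \<rho> ^ j * h + \<rho> ^ Suc j * r'"
      using y(3) by (simp add: algebra_simps)
    moreover have "c ^ j = \<rho> ^ j + \<rho> ^ Suc j * v"
      unfolding c power_mult_distrib v(2) by (simp add: algebra_simps)
    ultimately have "x - (y + c ^ j * h) = \<rho> ^ Suc j * (r' - v * h)"
      by (simp add: algebra_simps)
    moreover have "r' - v * h \<in> R" using h v ZR by (auto intro: ring_mem)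
    ultimately have "cong_mod (\<rho> ^ Suc j) x (y + c ^ j * h)" by (rule cong_modI)
    moreover have "y + c ^ j * h \<in> int_adjoin \<zeta>" by (intro Z.ring_mem cZ y(1) h(1))
    ultimately show ?case by blast
  qed
  have "\<exists>y\<in>int_adjoin \<zeta>. cong_mod (of_nat p) x y" if "x \<in> R" for x
    using gen_pow[OF that, of e] cong_mod_coarsen'[OF _ \<rho>(2)] by blast
  then show ?thesis using \<zeta> by blast
qed

lemma fraction_residue:
  assumes "\<not> int p dvd n" "cong_mod \<rho> (of_nat p) 0"
  shows "\<exists>b. cong_mod \<rho> (of_int a / of_int n) (of_int b)"
proof -
  have "coprime n (int p)"
    using assms(1) p by (metis coprime_commute prime_imp_coprime prime_nat_int_transfer)
  then obtain k where "[n * k = 1] (mod int p)" by (meson cong_solve_coprime_int)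
  then have "[a = n * (a * k)] (mod int p)"
    by (metis cong_scalar_left cong_sym mult.left_commute mult.right_neutral)
  then have "cong_mod (of_nat p) (of_int a) (of_int (n * (a * k)))" by (rule cong_mod_of_int)
  then have "cong_mod (of_nat p) (1 / of_int n * of_int a) (1 / of_int n * of_int (n * (a * k)))"
    by (intro cong_mod_scale inverse_mem assms(1))
  moreover have "n \<noteq> 0" using assms(1) by auto
  ultimately have "cong_mod (of_nat p) (of_int a / of_int n) (of_int (a * k))" by simp
  then show ?thesis using cong_mod_coarsen' assms(2) by blast
qed

end

text \<open>The algebra generated by \<open>S\<close> over the localization of \<int> at p. The
  inductive form reduces statements on residues and on Frobenius to the generators and to
  fractions.\<close>

inductive_set local_span :: "nat \<Rightarrow> complex set \<Rightarrow> complex set" for p S where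
  local_span_base: "x \<in> S \<Longrightarrow> x \<in> local_span p S"
| local_span_fraction: "\<not> int p dvd n \<Longrightarrow> of_int a / of_int n \<in> local_span p S"
| local_span_add: "x \<in> local_span p S \<Longrightarrow> y \<in> local_span p S \<Longrightarrow> x + y \<in> local_span p S"
| local_span_mult: "x \<in> local_span p S \<Longrightarrow> y \<in> local_span p S \<Longrightarrow> x * y \<in> local_span p S"

lemma local_span_order:
  assumes p: "prime p" and S: "\<And>x. x \<in> S \<Longrightarrow> p_integral p x"
  shows "p_local_order (local_span p S) p"
proof -
  have p1: "\<not> int p dvd 1" using p by (auto simp: prime_nat_iff)
  show ?thesis
  proof
    show "of_int n \<in> local_span p S" for n
      using local_span_fraction[OF p1, of n S] by simp
    show "1 / of_int n \<in> local_span p S" if "\<not> int p dvd n" for n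
      using local_span_fraction[OF that, of 1 S] by simp
    show "p_integral p x" if "x \<in> local_span p S" for x
      using that
    proof induction
      case (local_span_base x)
      then show ?case by (rule S)
    next
      case (local_span_fraction n a)
      then show ?case by (rule p_integral_fraction)
    next
      case (local_span_add x y)
      then show ?case by (intro p_integral_add p)
    next
      case (local_span_mult x y)
      then show ?case by (intro p_integral_mult p)
    qed
  qed (auto intro: local_span.intros p)
qed

section \<open>Multiplication matrices\<close>

text \<open>Coordinates are functions, of which only the first n values count, and are kept apart
  from the basis \<open>b\<close>. The same coordinates can thus be summed against a conjugate
  basis, which is how \<sigma> is defined.\<close>

definition coord_sum :: "nat \<Rightarrow> (nat \<Rightarrow> complex) \<Rightarrow> (nat \<Rightarrow> rat) \<Rightarrow> complex" where
  "coord_sum n b a = (\<Sum>i<n. of_rat (a i) * b i)"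

definition coord_indep :: "nat \<Rightarrow> (nat \<Rightarrow> complex) \<Rightarrow> bool" where
  "coord_indep n b \<longleftrightarrow> (\<forall>a. coord_sum n b a = 0 \<longrightarrow> (\<forall>i<n. a i = 0))"

definition mult_repr :: "nat \<Rightarrow> (nat \<Rightarrow> complex) \<Rightarrow> complex \<Rightarrow> rat mat \<Rightarrow> bool" where
  "mult_repr n b x A \<longleftrightarrow>
     A \<in> carrier_mat n n \<and> (\<forall>j<n. x * b j = coord_sum n b (\<lambda>i. A $$ (i, j)))"

lemma coord_sum_add: "coord_sum n b a + coord_sum n b c = coord_sum n b (\<lambda>i. a i + c i)"
  by (simp add: coord_sum_def sum.distrib of_rat_add distrib_right)

lemma coord_sum_diff: "coord_sum n b a - coord_sum n b c = coord_sum n b (\<lambda>i. a i - c i)"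
  by (simp add: coord_sum_def sum_subtractf of_rat_diff left_diff_distrib)

lemma coord_sum_scale: "of_rat q * coord_sum n b a = coord_sum n b (\<lambda>i. q * a i)"
  by (simp add: coord_sum_def sum_distrib_left of_rat_mult mult.assoc)

lemma coord_sum_cong: "(\<And>i. i < n \<Longrightarrow> a i = c i) \<Longrightarrow> coord_sum n b a = coord_sum n b c"
  unfolding coord_sum_def by (rule sum.cong) auto

lemma coord_indep_unique:
  assumes "coord_indep n b" "coord_sum n b a = coord_sum n b c" "i < n"
  shows "a i = c i"
proof -
  have "coord_sum n b (\<lambda>i. a i - c i) = 0" using assms(2) coord_sum_diff[of n b a c] by simp
  then show ?thesis using assms(1,3) unfolding coord_indep_def by fastforce
qed

lemma mult_repr_coord_sum:
  assumes "mult_repr n b x A"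
  shows "x * coord_sum n b v = coord_sum n b (\<lambda>i. \<Sum>j<n. A $$ (i, j) * v j)"
proof -
  have "x * coord_sum n b v = (\<Sum>j<n. of_rat (v j) * (x * b j))"
    by (simp add: coord_sum_def sum_distrib_left mult_ac)
  also have "\<dots> = (\<Sum>j<n. \<Sum>i<n. of_rat (A $$ (i, j) * v j) * b i)"
    using assms by (intro sum.cong)
      (auto simp: mult_repr_def coord_sum_def sum_distrib_left of_rat_mult mult_ac)
  also have "\<dots> = (\<Sum>i<n. \<Sum>j<n. of_rat (A $$ (i, j) * v j) * b i)"
    by (rule sum.swap)
  finally show ?thesis
    by (simp add: coord_sum_def of_rat_sum sum_distrib_right)
qed

lemma mult_repr_unique:
  assumes "coord_indep n b" "mult_repr n b x A" "mult_repr n b x B"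
  shows "A = B"
proof (rule eq_matI)
  have A: "A \<in> carrier_mat n n" and B: "B \<in> carrier_mat n n"
    using assms unfolding mult_repr_def by auto
  show "dim_row A = dim_row B" "dim_col A = dim_col B" using A B by auto
  fix i j assume "i < dim_row B" "j < dim_col B"
  then have ij: "i < n" "j < n" using B by auto
  have "coord_sum n b (\<lambda>i. A $$ (i, j)) = coord_sum n b (\<lambda>i. B $$ (i, j))"
    using assms(2,3) ij unfolding mult_repr_def by metis
  then show "A $$ (i, j) = B $$ (i, j)" using coord_indep_unique[OF assms(1)] ij by blast
qed

lemma mult_repr_mult:
  assumes "mult_repr n b x A" "mult_repr n b y B"
  shows "mult_repr n b (x * y) (A * B)"
proof -
  have A: "A \<in> carrier_mat n n" and B: "B \<in> carrier_mat n n"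
    using assms unfolding mult_repr_def by auto
  have "x * y * b j = coord_sum n b (\<lambda>i. (A * B) $$ (i, j))" if "j < n" for j
  proof -
    have "x * y * b j = x * coord_sum n b (\<lambda>i. B $$ (i, j))"
      using assms(2) that unfolding mult_repr_def by (simp add: mult.assoc)
    also have "\<dots> = coord_sum n b (\<lambda>i. \<Sum>k<n. A $$ (i, k) * B $$ (k, j))"
      by (rule mult_repr_coord_sum[OF assms(1)])
    also have "\<dots> = coord_sum n b (\<lambda>i. (A * B) $$ (i, j))"
      using A B that
      by (intro coord_sum_cong) (auto simp: scalar_prod_def atLeast0LessThan)
    finally show ?thesis .
  qed
  then show ?thesis using A B unfolding mult_repr_def by auto
qed

lemma mult_repr_smult:
  assumes "mult_repr n b x A"
  shows "mult_repr n b (of_rat q * x) (q \<cdot>\<^sub>m A)"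
proof -
  have A: "A \<in> carrier_mat n n" using assms unfolding mult_repr_def by auto
  have "of_rat q * x * b j = coord_sum n b (\<lambda>i. (q \<cdot>\<^sub>m A) $$ (i, j))" if "j < n" for j
  proof -
    have "of_rat q * x * b j = coord_sum n b (\<lambda>i. q * A $$ (i, j))"
      using assms that unfolding mult_repr_def by (simp add: coord_sum_scale mult.assoc)
    then show ?thesis using A that by (simp cong: coord_sum_cong)
  qed
  then show ?thesis using A unfolding mult_repr_def by auto
qed

lemma mult_repr_exists:
  assumes "\<And>j. j < n \<Longrightarrow> x * b j \<in> range (coord_sum n b)"
  shows "\<exists>A. mult_repr n b x A"
proof -
  have "\<forall>j. \<exists>a. j < n \<longrightarrow> x * b j = coord_sum n b a" using assms by auto
  then obtain f where f: "\<And>j. j < n \<Longrightarrow> x * b j = coord_sum n b (f j)" by metis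
  have "mult_repr n b x (mat n n (\<lambda>(i, j). f j i))"
    unfolding mult_repr_def using f by (auto cong: coord_sum_cong)
  then show ?thesis ..
qed

text \<open>A vector in the kernel would hold the coordinates of a nonzero element whose product
  with x is 0.\<close>

lemma mult_repr_det:
  assumes ind: "coord_indep n b" and rep: "mult_repr n b x A" and x: "x \<noteq> 0"
  shows "det A \<noteq> 0"
proof
  have A: "A \<in> carrier_mat n n" using rep unfolding mult_repr_def by auto
  assume "det A = 0"
  then obtain v where v: "v \<in> carrier_vec n" "v \<noteq> 0\<^sub>v n" "A *\<^sub>v v = 0\<^sub>v n"
    using det_0_iff_vec_prod_zero_field[OF A] by auto
  have "(\<Sum>j<n. A $$ (i, j) * v $ j) = 0" if "i < n" for i
  proof -
    have "(A *\<^sub>v v) $ i = 0" using v(3) that by simp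
    then show ?thesis using that A v(1) by (auto simp: scalar_prod_def atLeast0LessThan)
  qed
  then have "x * coord_sum n b (($) v) = coord_sum n b (\<lambda>i. 0)"
    unfolding mult_repr_coord_sum[OF rep] by (intro coord_sum_cong)
  then have "coord_sum n b (($) v) = 0" using x by (simp add: coord_sum_def)
  then have "v $ i = 0" if "i < n" for i using ind that unfolding coord_indep_def by blast
  then have "v = 0\<^sub>v n" using v(1) by (intro eq_vecI) auto
  then show False using v(2) by simp
qed

text \<open>Cramer's rule: the adjugate of the matrix sends the coordinates of y to its determinant
  times those of y / x. This makes the span of the tower basis a field.\<close>

lemma coord_sum_divide:
  assumes ind: "coord_indep n b" and rep: "mult_repr n b x A" and x: "x \<noteq> 0"
    and y: "y \<in> range (coord_sum n b)"
  shows "y / x \<in> range (coord_sum n b)"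
proof -
  have A: "A \<in> carrier_mat n n" using rep unfolding mult_repr_def by auto
  have d: "det A \<noteq> 0" by (rule mult_repr_det[OF ind rep x])
  obtain a where a: "y = coord_sum n b a" using y by blast
  define v where "v = adj_mat A *\<^sub>v vec n a"
  have aA: "adj_mat A \<in> carrier_mat n n" by (rule adj_mat(1)[OF A])
  have "A *\<^sub>v v = (A * adj_mat A) *\<^sub>v vec n a"
    unfolding v_def using A aA by (intro assoc_mult_mat_vec[symmetric]) auto
  also have "\<dots> = det A \<cdot>\<^sub>v vec n a"
    unfolding adj_mat(2)[OF A] by (rule eq_vecI) simp_all
  finally have Av: "(\<Sum>j<n. A $$ (i, j) * v $ j) = det A * a i" if "i < n" for i
  proof -
    assume "A *\<^sub>v v = det A \<cdot>\<^sub>v vec n a"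
    then have "(A *\<^sub>v v) $ i = det A * a i" using that by simp
    moreover have "dim_vec v = n" using aA by (simp add: v_def)
    ultimately show ?thesis using that A by (auto simp: scalar_prod_def atLeast0LessThan)
  qed
  have "x * coord_sum n b (($) v) = coord_sum n b (\<lambda>i. det A * a i)"
    unfolding mult_repr_coord_sum[OF rep] by (intro coord_sum_cong Av)
  also have "\<dots> = of_rat (det A) * y" by (simp add: a coord_sum_scale)
  finally have "y / x = of_rat (inverse (det A)) * coord_sum n b (($) v)"
    using x d by (simp add: field_simps of_rat_divide)
  then show ?thesis unfolding coord_sum_scale by blast
qed

text \<open>The rows of the matrix \<open>V\<close> of conjugates of a basis are left eigenvectors of every
  multiplication matrix.\<close>

lemma char_poly_mult_repr:
  fixes h :: "nat \<Rightarrow> complex \<Rightarrow> complex"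
  assumes rep: "mult_repr n b x A"
    and lin: "\<And>i a. i < n \<Longrightarrow> h i (coord_sum n b a) = (\<Sum>k<n. of_rat (a k) * h i (b k))"
    and mult: "\<And>i j. i < n \<Longrightarrow> j < n \<Longrightarrow> h i (x * b j) = h i x * h i (b j)"
    and V: "det (mat n n (\<lambda>(i, j). h i (b j))) \<noteq> 0"
  shows "map_poly of_rat (char_poly A) = (\<Prod>i<n. [:- h i x, 1:])"
proof -
  define V where "V = mat n n (\<lambda>(i, j). h i (b j))"
  define A' :: "complex mat" where "A' = map_mat of_rat A"
  define E where "E = mat n n (\<lambda>(i, j). if i = j then h i x else 0)"
  have A: "A \<in> carrier_mat n n" using rep unfolding mult_repr_def by auto
  have carr: "V \<in> carrier_mat n n" "A' \<in> carrier_mat n n" "E \<in> carrier_mat n n"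
    using A by (auto simp: V_def A'_def E_def)
  have EV: "E * V = V * A'"
  proof (rule eq_matI)
    fix i j assume "i < dim_row (V * A')" "j < dim_col (V * A')"
    then have ij: "i < n" "j < n" using carr by auto
    have "(E * V) $$ (i, j) = (\<Sum>k<n. (if i = k then h i x else 0) * h k (b j))"
      using ij by (auto simp: E_def V_def scalar_prod_def atLeast0LessThan intro!: sum.cong)
    also have "\<dots> = h i (x * b j)"
      using ij by (simp add: mult if_distrib[of "\<lambda>u. u * _"] cong: if_cong)
    also have "\<dots> = (\<Sum>k<n. of_rat (A $$ (k, j)) * h i (b k))"
      using rep ij lin[of i] unfolding mult_repr_def by simp
    also have "\<dots> = (V * A') $$ (i, j)"
      using ij A by (auto simp: V_def A'_def scalar_prod_def atLeast0LessThan intro!: sum.cong)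
    finally show "(E * V) $$ (i, j) = (V * A') $$ (i, j)" .
  qed (use carr in auto)
  define W where "W = inverse (det V) \<cdot>\<^sub>m adj_mat V"
  have W: "W \<in> carrier_mat n n" using adj_mat(1)[OF carr(1)] by (simp add: W_def)
  have d: "det V \<noteq> 0" using V by (simp add: V_def)
  have VW: "V * W = 1\<^sub>m n"
    unfolding W_def using mult_smult_distrib[OF carr(1) adj_mat(1)[OF carr(1)]] adj_mat(2)[OF carr(1)] d
    by (intro eq_matI) auto
  have WV: "W * V = 1\<^sub>m n"
    unfolding W_def using mult_smult_assoc_mat[OF adj_mat(1)[OF carr(1)] carr(1)] adj_mat(3)[OF carr(1)] d
    by (intro eq_matI) auto
  have "E = E * (V * W)" using carr by (simp add: VW)
  also have "\<dots> = V * A' * W" using carr W by (simp flip: assoc_mult_mat add: EV)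
  finally have "similar_mat E A'"
    unfolding similar_mat_def similar_mat_wit_def Let_def
    using carr W VW WV by (intro exI[of _ V] exI[of _ W]) auto
  then have "char_poly A' = char_poly E" by (metis char_poly_similar)
  also have "\<dots> = (\<Prod>a\<leftarrow>diag_mat E. [:- a, 1:])"
    by (rule char_poly_upper_triangular[OF carr(3)]) (auto simp: E_def)
  also have "diag_mat E = map (\<lambda>i. h i x) [0..<n]"
    by (auto simp: diag_mat_def E_def)
  also have "(\<Prod>a\<leftarrow>map (\<lambda>i. h i x) [0..<n]. [:- a, 1:]) = (\<Prod>i<n. [:- h i x, 1:])"
    by (simp add: prod.list_conv_set_nth atLeast0LessThan comp_def)
  finally show ?thesis unfolding A'_def of_rat_hom.char_poly_hom[OF A] .
qed

lemma coord_indep_imp_independent: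
  assumes "coord_indep n b"
  shows "inj_on b {..<n}" "rat_vs.independent (b ` {..<n})"
proof -
  have delta: "coord_sum n b (\<lambda>k. if k = i then 1 else 0) = b i" if "i < n" for i
    using that by (simp add: coord_sum_def if_distrib[of of_rat] if_distrib[of "\<lambda>u. u * _"] cong: if_cong)
  show inj: "inj_on b {..<n}"
  proof (rule inj_onI)
    fix i j assume ij: "i \<in> {..<n}" "j \<in> {..<n}" "b i = b j"
    then have "coord_sum n b (\<lambda>k. if k = i then 1 else 0) = coord_sum n b (\<lambda>k. if k = j then 1 else 0)"
      by (simp add: delta)
    from coord_indep_unique[OF assms this, of i] show "i = j"
      using ij by (auto split: if_splits)
  qed
  show "rat_vs.independent (b ` {..<n})"
  proof (rule rat_vs.independent_if_scalars_zero)
    fix f v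
    assume "(\<Sum>x\<in>b ` {..<n}. rat_scale (f x) x) = 0" and v: "v \<in> b ` {..<n}"
    then have "coord_sum n b (f \<circ> b) = 0"
      by (simp add: sum.reindex[OF inj] coord_sum_def rat_scale_def)
    then show "f v = 0" using assms v unfolding coord_indep_def by auto
  qed simp
qed

lemma coord_sum_mem_span: "coord_sum n b a \<in> rat_vs.span (b ` {..<n})"
  unfolding coord_sum_def
  by (intro rat_vs.span_sum) (auto simp flip: rat_scale_def intro: rat_vs.span_scale rat_vs.span_base)

lemma span_eq_coord_sums: "rat_vs.span (b ` {..<n}) = range (coord_sum n b)"
proof
  show "range (coord_sum n b) \<subseteq> rat_vs.span (b ` {..<n})" using coord_sum_mem_span by blast
  show "rat_vs.span (b ` {..<n}) \<subseteq> range (coord_sum n b)"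
  proof (rule rat_vs.span_minimal)
    show "b ` {..<n} \<subseteq> range (coord_sum n b)"
    proof
      fix x assume "x \<in> b ` {..<n}"
      then obtain i where i: "i < n" "x = b i" by auto
      then have "x = coord_sum n b (\<lambda>k. if k = i then 1 else 0)"
        by (simp add: coord_sum_def if_distrib[of of_rat] if_distrib[of "\<lambda>u. u * _"] cong: if_cong)
      then show "x \<in> range (coord_sum n b)" by blast
    qed
    show "rat_vs.subspace (range (coord_sum n b))"
    proof (rule rat_vs.subspaceI)
      show "0 \<in> range (coord_sum n b)"
        by (rule range_eqI[of _ _ "\<lambda>_. 0"]) (simp add: coord_sum_def)
    qed (auto simp: coord_sum_add coord_sum_scale rat_scale_def)
  qed
qed

lemma rat_basis_coord:
  assumes "rat_basis K bs"
  shows "coord_indep (length bs) ((!) bs)" "K = range (coord_sum (length bs) ((!) bs))"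
proof -
  have d: "distinct bs" and i: "rat_vs.independent (set bs)" and s: "rat_vs.span (set bs) = K"
    using assms unfolding rat_basis_def by auto
  have set: "set bs = (!) bs ` {..<length bs}" by (auto simp: in_set_conv_nth)
  have inj: "inj_on ((!) bs) {..<length bs}" using d by (auto simp: inj_on_def nth_eq_iff_index_eq)
  show "K = range (coord_sum (length bs) ((!) bs))" using s span_eq_coord_sums[of "(!) bs"] set by simp
  show "coord_indep (length bs) ((!) bs)"
    unfolding coord_indep_def
  proof (intro allI impI)
    fix a k assume a: "coord_sum (length bs) ((!) bs) a = 0" and k: "k < length bs"
    define u where "u x = a (inv_into {..<length bs} ((!) bs) x)" for x
    have u: "u (bs ! j) = a j" if "j < length bs" for j
      using that inj by (simp add: u_def inv_into_f_f)
    have "(\<Sum>x\<in>set bs. rat_scale (u x) x) = coord_sum (length bs) ((!) bs) a"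
      unfolding set coord_sum_def sum.reindex[OF inj] by (rule sum.cong) (auto simp: rat_scale_def u)
    then have "u (bs ! k) = 0"
      using rat_vs.independentD[OF i, of "set bs" u "bs ! k"] a k by simp
    then show "a k = 0" using u k by simp
  qed
qed

lemma coord_rat_basis:
  assumes "coord_indep n b" "K = range (coord_sum n b)"
  shows "rat_basis K (map b [0..<n])"
proof -
  have "set (map b [0..<n]) = b ` {..<n}" by (auto simp: atLeast0LessThan)
  then show ?thesis
    using coord_indep_imp_independent[OF assms(1)] span_eq_coord_sums[of b n] assms(2)
    unfolding rat_basis_def by (simp add: distinct_map atLeast0LessThan)
qed

lemma mult_matrix_iff: "mult_matrix bs x A \<longleftrightarrow> mult_repr (length bs) ((!) bs) x A"
  unfolding mult_matrix_def mult_repr_def coord_sum_def rat_scale_def ..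

section \<open>The simplest sextic field\<close>

text \<open>The index k = i + 3 j with i < 3 numbers h^i d^j. Both h and d stay variable, so that
  conjugate bases are instances.\<close>

definition tower_basis :: "complex \<Rightarrow> complex \<Rightarrow> nat \<Rightarrow> complex" where
  "tower_basis h d k = h ^ (k mod 3) * d ^ (k div 3)"

lemma coord_sum_tower:
  "coord_sum 6 (tower_basis h d) a =
     of_rat (a 0) + of_rat (a 1) * h + of_rat (a 2) * h\<^sup>2 +
     (of_rat (a 3) + of_rat (a 4) * h + of_rat (a 5) * h\<^sup>2) * d"
proof -
  have "{..<6} = {0, 1, 2, 3, 4, 5 :: nat}" by auto
  then show ?thesis by (simp add: coord_sum_def tower_basis_def algebra_simps)
qed

lemma coord_sum_cubic:
  "coord_sum 3 ((^) h) a = of_rat (a 0) + of_rat (a 1) * h + of_rat (a 2) * h\<^sup>2"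
proof -
  have "{..<3} = {0, 1, 2 :: nat}" by auto
  then show ?thesis by (simp add: coord_sum_def algebra_simps)
qed

text \<open>Multiplication modulo the simplest cubic x^3 - m x^2 - (m + 3) x - 1: \<open>u\<close>
  and \<open>v\<close> are the coefficients of h^3 and h^4 before reduction.\<close>

definition shanks_mult :: "int \<Rightarrow> (nat \<Rightarrow> rat) \<Rightarrow> (nat \<Rightarrow> rat) \<Rightarrow> nat \<Rightarrow> rat" where
  "shanks_mult m c d k =
     (let M = of_int m; u = c 1 * d 2 + c 2 * d 1; v = c 2 * d 2 in
      if k = 0 then c 0 * d 0 + u + M * v
      else if k = 1 then c 0 * d 1 + c 1 * d 0 + (M + 3) * u + (M\<^sup>2 + 3 * M + 1) * v
      else c 0 * d 2 + c 1 * d 1 + c 2 * d 0 + M * u + (M\<^sup>2 + M + 3) * v)"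

lemma shanks_mult:
  assumes "h ^ 3 = of_int m * h\<^sup>2 + (of_int m + 3) * h + 1"
  shows "coord_sum 3 ((^) h) c * coord_sum 3 ((^) h) d = coord_sum 3 ((^) h) (shanks_mult m c d)"
proof -
  define M where "M = (of_int m :: complex)"
  have h3: "h ^ 3 = M * h\<^sup>2 + (M + 3) * h + 1" using assms by (simp add: M_def)
  have "h ^ 4 = h * h ^ 3" by (simp add: eval_nat_numeral)
  also have "\<dots> = h * (M * h\<^sup>2 + (M + 3) * h + 1)" by (rule arg_cong[OF h3])
  also have "\<dots> = M * h ^ 3 + (M + 3) * h\<^sup>2 + h"
    by (simp add: algebra_simps eval_nat_numeral)
  also have "\<dots> = (M\<^sup>2 + M + 3) * h\<^sup>2 + (M\<^sup>2 + 3 * M + 1) * h + M"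
    unfolding h3 by (simp add: algebra_simps power2_eq_square)
  finally have h4: "h ^ 4 = (M\<^sup>2 + M + 3) * h\<^sup>2 + (M\<^sup>2 + 3 * M + 1) * h + M" .
  have "(c0 + c1 * h + c2 * h\<^sup>2) * (d0 + d1 * h + d2 * h\<^sup>2) =
     (c0 * d0 + (c1 * d2 + c2 * d1) + M * (c2 * d2)) +
     (c0 * d1 + c1 * d0 + (M + 3) * (c1 * d2 + c2 * d1) + (M\<^sup>2 + 3 * M + 1) * (c2 * d2)) * h +
     (c0 * d2 + c1 * d1 + c2 * d0 + M * (c1 * d2 + c2 * d1) + (M\<^sup>2 + M + 3) * (c2 * d2)) * h\<^sup>2"
    for c0 c1 c2 d0 d1 d2 :: complex
  proof -
    have "(c0 + c1 * h + c2 * h\<^sup>2) * (d0 + d1 * h + d2 * h\<^sup>2) =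
      c0 * d0 + (c0 * d1 + c1 * d0) * h + (c0 * d2 + c1 * d1 + c2 * d0) * h\<^sup>2 +
      (c1 * d2 + c2 * d1) * h ^ 3 + c2 * d2 * h ^ 4"
      by (simp add: eval_nat_numeral algebra_simps)
    then show ?thesis unfolding h4 unfolding h3 by (simp add: algebra_simps)
  qed
  from this[of "of_rat (c 0)" "of_rat (c 1)" "of_rat (c 2)" "of_rat (d 0)" "of_rat (d 1)" "of_rat (d 2)"]
  show ?thesis
    by (simp add: coord_sum_cubic shanks_mult_def Let_def of_rat_add of_rat_mult of_rat_power M_def)
qed

text \<open>The coordinates \<open>e\<close> are chosen before h and d, so one vector serves all
  pairs of conjugates; this is what makes \<sigma> multiplicative.\<close>

lemma tower_mult:
  "\<exists>e. \<forall>h d. h ^ 3 = of_int m * h\<^sup>2 + (of_int m + 3) * h + 1 \<longrightarrow> d\<^sup>2 = of_int D \<longrightarrow>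
     coord_sum 6 (tower_basis h d) a * coord_sum 6 (tower_basis h d) c = coord_sum 6 (tower_basis h d) e"
proof -
  have split: "coord_sum 6 (tower_basis h d) a =
      coord_sum 3 ((^) h) a + coord_sum 3 ((^) h) (\<lambda>k. a (k + 3)) * d" for h d a
    by (simp add: coord_sum_tower coord_sum_cubic)
  define e where "e k = (if k < 3
      then shanks_mult m a c k + of_int D * shanks_mult m (\<lambda>k. a (k + 3)) (\<lambda>k. c (k + 3)) k
      else shanks_mult m a (\<lambda>k. c (k + 3)) (k - 3) + shanks_mult m (\<lambda>k. a (k + 3)) c (k - 3))" for k
  have "coord_sum 6 (tower_basis h d) a * coord_sum 6 (tower_basis h d) c = coord_sum 6 (tower_basis h d) e"
    if h: "h ^ 3 = of_int m * h\<^sup>2 + (of_int m + 3) * h + 1" and d: "d\<^sup>2 = of_int D" for h d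
  proof -
    let ?cs = "coord_sum 3 ((^) h)"
    let ?a = "\<lambda>k. a (k + 3)" and ?c = "\<lambda>k. c (k + 3)"
    have "?cs e = ?cs (\<lambda>k. shanks_mult m a c k + of_int D * shanks_mult m ?a ?c k)"
      by (rule coord_sum_cong) (simp add: e_def)
    also have "\<dots> = ?cs a * ?cs c + of_int D * (?cs ?a * ?cs ?c)"
      unfolding shanks_mult[OF h] coord_sum_add[symmetric] coord_sum_scale[symmetric] by simp
    finally have 1: "?cs e = ?cs a * ?cs c + d\<^sup>2 * (?cs ?a * ?cs ?c)" by (simp add: d)
    have "?cs (\<lambda>k. e (k + 3)) = ?cs (\<lambda>k. shanks_mult m a ?c k + shanks_mult m ?a c k)"
      by (rule coord_sum_cong) (simp add: e_def)
    also have "\<dots> = ?cs a * ?cs ?c + ?cs ?a * ?cs c"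
      unfolding shanks_mult[OF h] coord_sum_add[symmetric] by simp
    finally have 2: "?cs (\<lambda>k. e (k + 3)) = ?cs a * ?cs ?c + ?cs ?a * ?cs c" .
    show ?thesis
      unfolding split[of h d] 1 2 by (simp add: algebra_simps power2_eq_square)
  qed
  then show ?thesis by blast
qed

lemma coeffs_mult_algebraic_int:
  fixes p q :: "complex poly"
  assumes "\<And>i. algebraic_int (poly.coeff p i)" "\<And>i. algebraic_int (poly.coeff q i)"
  shows "algebraic_int (poly.coeff (p * q) i)"
  unfolding coeff_mult by (intro algebraic_int_sum algebraic_int_mult assms)

lemma coeffs_prod_algebraic_int:
  fixes f :: "nat \<Rightarrow> complex"
  assumes "\<And>i. i < n \<Longrightarrow> algebraic_int (f i)"
  shows "algebraic_int (poly.coeff (\<Prod>i<n. [:- f i, 1:]) k)"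
  using assms
proof (induction n arbitrary: k)
  case 0
  then show ?case by (simp add: coeff_1)
next
  case (Suc n)
  have "algebraic_int (poly.coeff [:- f n, 1:] i)" for i
    using Suc.prems[of n] by (auto simp: coeff_pCons split: nat.splits)
  then show ?case unfolding prod.lessThan_Suc using Suc by (intro coeffs_mult_algebraic_int) auto
qed

text \<open>The equation reads (2 s)^2 - (2 m + 3)^2 = 27, and 27 has only four ordered
  factorizations into positive factors.\<close>

lemma square_discriminant:
  fixes m s :: int
  assumes "s\<^sup>2 = m\<^sup>2 + 3 * m + 9"
  shows "m \<in> {-8, -3, 0, 5}"
proof -
  define t where "t = \<bar>s\<bar>"
  have "t\<^sup>2 = m\<^sup>2 + 3 * m + 9" using assms by (simp add: t_def)
  then have e: "(2 * t - (2 * m + 3)) * (2 * t + (2 * m + 3)) = 27"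
    by (simp add: algebra_simps power2_eq_square)
  have t: "t \<ge> 0" by (simp add: t_def)
  have pos: "2 * t - (2 * m + 3) > 0 \<and> 2 * t + (2 * m + 3) > 0"
  proof -
    have "(2 * t - (2 * m + 3)) * (2 * t + (2 * m + 3)) > 0" using e by simp
    then show ?thesis using t by (auto simp: zero_less_mult_iff)
  qed
  define u v where "u = nat (2 * t - (2 * m + 3))" and "v = nat (2 * t + (2 * m + 3))"
  have uv: "int u = 2 * t - (2 * m + 3)" "int v = 2 * t + (2 * m + 3)"
    using pos by (simp_all add: u_def v_def)
  then have "int (u * v) = int 27" using e by simp
  then have uv27: "u * v = 27" by (simp only: of_nat_eq_iff)
  then have "v dvd 27" by (metis dvd_triv_right)
  moreover have "{d :: nat. d dvd 27} = {1, 3, 9, 27}"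
  proof -
    have "(27 :: nat) = 3 ^ 3" by simp
    moreover have "d dvd 3 ^ 3 \<longleftrightarrow> (\<exists>i\<le>3. d = 3 ^ i)" for d :: nat
      by (rule divides_primepow_nat) simp
    moreover have "(\<exists>i\<le>3. d = 3 ^ i) \<longleftrightarrow> d \<in> {1, 3, 9, 27}" for d :: nat
    proof -
      have "(\<exists>i\<le>3. d = 3 ^ i) \<longleftrightarrow> (\<exists>i\<in>{0, 1, 2, 3 :: nat}. d = 3 ^ i)"
        unfolding Bex_def by (rule ex_cong1) auto
      then show ?thesis by simp
    qed
    ultimately show ?thesis by auto
  qed
  ultimately have "v \<in> {1, 3, 9, 27}" by auto
  then show ?thesis using uv uv27 by auto
qed

lemma ipoly_pCons:
  "poly (map_poly of_int (pCons c q)) x = of_int c + x * poly (map_poly of_int q) (x :: complex)"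
  by (cases "c = 0 \<and> q = 0") (auto simp: map_poly_pCons)

locale simplest_sextic_root =
  fixes m :: int and \<theta> :: complex
  assumes m: "m \<notin> {-8, -3, 0, 5}"
    and root: "poly (map_poly of_int (simplest_sextic m)) \<theta> = 0"
begin

abbreviation M :: complex where "M \<equiv> of_int m"

definition D :: int where "D = m\<^sup>2 + 3 * m + 9"
text \<open>The sextic at \<theta> is the homogenized simplest cubic at the pair (\<theta>^2 - 1, 2
  \<theta> + 1), so the quotient of the pair is a root of the simplest cubic with parameter
  m.\<close>

definition \<eta> :: complex where "\<eta> = (\<theta>\<^sup>2 - 1) / (2 * \<theta> + 1)"
text \<open>The sextic is s - m r, where s is free of m and r is the denominator used here, and
  (\<theta>^2 + \<theta> + 1)^6 = s^2 + 3 s r + 9 r^2 identically. At a root s = m r, so division by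
  r^2 leaves D.\<close>

definition \<delta> :: complex where
  "\<delta> = - ((\<theta>\<^sup>2 + \<theta> + 1) ^ 3) / (\<theta> * (\<theta> - 1) * (\<theta> + 1) * (2 * \<theta> + 1) * (\<theta> + 2))"

lemma sextic_eq:
  "\<theta> ^ 6 - 2 * M * \<theta> ^ 5 - (5 * M + 15) * \<theta> ^ 4 - 20 * \<theta> ^ 3 + 5 * M * \<theta>\<^sup>2 + (2 * M + 6) * \<theta> + 1 = 0"
proof -
  have "poly (map_poly of_int (simplest_sextic m)) \<theta> =
      \<theta> ^ 6 - 2 * M * \<theta> ^ 5 - (5 * M + 15) * \<theta> ^ 4 - 20 * \<theta> ^ 3 + 5 * M * \<theta>\<^sup>2 + (2 * M + 6) * \<theta> + 1"
    unfolding simplest_sextic_def ipoly_pCons by (simp add: algebra_simps eval_nat_numeral)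
  then show ?thesis using root by simp
qed

lemma theta_nonzero:
  "\<theta> \<noteq> 0" "\<theta> - 1 \<noteq> 0" "\<theta> + 1 \<noteq> 0" "\<theta> + 2 \<noteq> 0" "2 * \<theta> + 1 \<noteq> 0"
proof -
  show "\<theta> \<noteq> 0" using sextic_eq by auto
  show "\<theta> - 1 \<noteq> 0" using sextic_eq by auto
  have "\<theta> \<noteq> -1" using sextic_eq by auto
  then show "\<theta> + 1 \<noteq> 0" by (metis add.commute add.right_inverse add_left_imp_eq)
  have "\<theta> \<noteq> -2" using sextic_eq by auto
  then show "\<theta> + 2 \<noteq> 0" by (metis add.commute add.right_inverse add_left_imp_eq)
  have "\<theta> \<noteq> -1/2" using sextic_eq by (auto simp: power_divide add_divide_distrib)
  moreover have "\<theta> = -1/2" if "2 * \<theta> + 1 = 0"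
  proof -
    have "\<theta> = (2 * \<theta> + 1 - 1) / 2" by simp
    then show ?thesis using that by simp
  qed
  ultimately show "2 * \<theta> + 1 \<noteq> 0" by blast
qed

lemma eta_cubic: "\<eta> ^ 3 = M * \<eta>\<^sup>2 + (M + 3) * \<eta> + 1"
proof -
  define a b where "a = 2 * \<theta> + 1" and "b = \<theta>\<^sup>2 - 1"
  have a: "a \<noteq> 0" using theta_nonzero by (simp add: a_def)
  have b: "b = a * \<eta>" using a by (simp add: \<eta>_def a_def b_def)
  have "a ^ 3 * (\<eta> ^ 3 - M * \<eta>\<^sup>2 - (M + 3) * \<eta> - 1) =
      b ^ 3 - M * b\<^sup>2 * a - (M + 3) * b * a\<^sup>2 - a ^ 3"
    by (simp add: b algebra_simps eval_nat_numeral)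
  also have "\<dots> = \<theta> ^ 6 - 2 * M * \<theta> ^ 5 - (5 * M + 15) * \<theta> ^ 4 - 20 * \<theta> ^ 3 + 5 * M * \<theta>\<^sup>2 + (2 * M + 6) * \<theta> + 1"
    by (simp add: a_def b_def algebra_simps eval_nat_numeral)
  also note sextic_eq
  finally have "\<eta> ^ 3 - M * \<eta>\<^sup>2 - (M + 3) * \<eta> - 1 = 0" using a by simp
  then show ?thesis by (simp add: algebra_simps)
qed

lemma delta_square: "\<delta>\<^sup>2 = of_int D"
proof -
  define g where "g = \<theta>\<^sup>2 + \<theta> + 1"
  define r where "r = \<theta> * (\<theta> - 1) * (\<theta> + 1) * (2 * \<theta> + 1) * (\<theta> + 2)"
  define s where "s = \<theta> ^ 6 - 15 * \<theta> ^ 4 - 20 * \<theta> ^ 3 + 6 * \<theta> + 1"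
  have r: "r \<noteq> 0" using theta_nonzero by (simp add: r_def)
  have "s - M * r = 0"
    using sextic_eq by (simp add: s_def r_def algebra_simps eval_nat_numeral)
  then have s: "s = M * r" by simp
  have "(g ^ 3)\<^sup>2 = s\<^sup>2 + 3 * s * r + 9 * r\<^sup>2"
    unfolding g_def r_def s_def by (simp add: algebra_simps eval_nat_numeral)
  also have "\<dots> = of_int D * r\<^sup>2" by (simp add: s D_def algebra_simps power2_eq_square)
  finally show ?thesis using r unfolding \<delta>_def g_def[symmetric] r_def[symmetric]
    by (simp add: power_divide)
qed

lemma theta_minus_eta: "\<theta> - \<eta> = (\<theta>\<^sup>2 + \<theta> + 1) / (2 * \<theta> + 1)"
  using theta_nonzero by (simp add: \<eta>_def field_simps power2_eq_square)

lemma eta_plus_1: "\<eta> + 1 = \<theta> * (\<theta> + 2) / (2 * \<theta> + 1)"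
  using theta_nonzero by (simp add: \<eta>_def field_simps power2_eq_square)

text \<open>Exhibits \<theta> - \<eta> as a square root over the cubic field. By
  \<open>theta_eta_delta\<close> its cube is -\<delta> \<eta> (\<eta> + 1), which places it in
  \<rat>(\<eta>, \<delta>).\<close>

lemma gamma_square: "(\<theta> - \<eta>)\<^sup>2 = \<eta>\<^sup>2 + \<eta> + 1"
proof -
  define a b where "a = 2 * \<theta> + 1" and "b = \<theta>\<^sup>2 - 1"
  have a: "a \<noteq> 0" using theta_nonzero by (simp add: a_def)
  have b: "b = a * \<eta>" using a by (simp add: \<eta>_def a_def b_def)
  have "a * (\<theta> - \<eta>) = \<theta>\<^sup>2 + \<theta> + 1" unfolding theta_minus_eta using a by (simp add: a_def)
  then have "a\<^sup>2 * (\<theta> - \<eta>)\<^sup>2 = (\<theta>\<^sup>2 + \<theta> + 1)\<^sup>2" by (metis power_mult_distrib)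
  also have "\<dots> = b\<^sup>2 + a * b + a\<^sup>2"
    by (simp add: a_def b_def algebra_simps eval_nat_numeral)
  also have "\<dots> = a\<^sup>2 * (\<eta>\<^sup>2 + \<eta> + 1)"
    by (simp add: b algebra_simps eval_nat_numeral)
  finally show ?thesis using a by simp
qed

lemma theta_eta_delta: "(\<eta>\<^sup>2 + \<eta> + 1) * (\<theta> - \<eta>) = - (\<delta> * \<eta> * (\<eta> + 1))"
proof -
  define g where "g = \<theta>\<^sup>2 + \<theta> + 1"
  define a where "a = 2 * \<theta> + 1"
  define u v where "u = \<theta> * (\<theta> + 2)" and "v = (\<theta> - 1) * (\<theta> + 1)"
  have nz: "a \<noteq> 0" "u \<noteq> 0" "v \<noteq> 0" using theta_nonzero by (simp_all add: a_def u_def v_def)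
  have e1: "\<delta> = - (g ^ 3) / (u * v * a)" by (simp add: \<delta>_def g_def u_def v_def a_def mult_ac)
  have e2: "\<eta> = v / a" by (simp add: \<eta>_def v_def a_def algebra_simps power2_eq_square)
  have e3: "\<eta> + 1 = u / a" using eta_plus_1 by (simp add: u_def a_def)
  have "\<delta> * \<eta> * (\<eta> + 1) = - (g ^ 3) / (u * v * a) * (v / a) * (u / a)"
    by (subst e3, subst e1, subst e2) (rule refl)
  also have "\<dots> = - ((g / a) ^ 3)" using nz by (simp add: field_simps power3_eq_cube)
  finally have "- (\<delta> * \<eta> * (\<eta> + 1)) = (g / a) ^ 3" by simp
  moreover have "(\<eta>\<^sup>2 + \<eta> + 1) * (\<theta> - \<eta>) = (\<theta> - \<eta>) ^ 3"
    unfolding gamma_square[symmetric] by (simp add: power2_eq_square power3_eq_cube)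
  ultimately show ?thesis by (simp add: theta_minus_eta g_def a_def)
qed

lemma no_rational_root:
  assumes "x \<in> \<rat>" "x ^ 3 = M * x\<^sup>2 + (M + 3) * x + (1 :: complex)"
  shows False
proof -
  have "poly (map_poly of_int [:-1, - (m + 3), - m, 1:]) x = x ^ 3 - M * x\<^sup>2 - (M + 3) * x - 1"
    unfolding ipoly_pCons by (simp add: algebra_simps eval_nat_numeral)
  then have "poly (map_poly of_int [:-1, - (m + 3), - m, 1:]) x = 0" using assms(2) by simp
  then have "algebraic_int x"
    unfolding algebraic_int_altdef_ipoly by (intro exI[of _ "[:-1, - (m + 3), - m, 1:]"]) simp
  then have "x \<in> \<int>" using assms(1) by (rule rational_algebraic_int_is_int)
  then obtain n where n: "x = of_int n" by (elim Ints_cases)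
  then have "(of_int (n ^ 3) :: complex) = of_int (m * n\<^sup>2 + (m + 3) * n + 1)" using assms(2) by simp
  then have e: "n ^ 3 = m * n\<^sup>2 + (m + 3) * n + 1" by (simp only: of_int_eq_iff)
  then have "n * (n\<^sup>2 - m * n - (m + 3)) = 1"
    by (simp add: algebra_simps power2_eq_square power3_eq_cube)
  then have "n = 1 \<or> n = -1" by (auto simp: zmult_eq_1_iff)
  then show False
  proof
    assume "n = 1"
    then have "2 * m = - 3" using e by simp
    then show False by presburger
  next
    assume "n = -1"
    then show False using e by simp
  qed
qed

lemma eta_not_rational: "\<eta> \<notin> \<rat>"
  using no_rational_root eta_cubic by blast

lemma cubic_indep: "coord_indep 3 ((^) \<eta>)"
proof -
  have lin: "q = 0 \<and> r = 0" if "of_rat q * \<eta> + of_rat r = 0" for q r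
  proof (cases "q = 0")
    case False
    then have "\<eta> = of_rat (- r / q)" using that
      by (simp add: of_rat_divide of_rat_minus field_simps eq_neg_iff_add_eq_0)
    then show ?thesis using eta_not_rational by simp
  qed (use that in simp)
  have "a 0 = 0 \<and> a 1 = 0 \<and> a 2 = 0" if a: "coord_sum 3 ((^) \<eta>) a = 0" for a
  proof (cases "a 2 = 0")
    case True
    then have "of_rat (a 1) * \<eta> + of_rat (a 0) = 0"
      using a by (simp add: coord_sum_cubic add.commute)
    then show ?thesis using lin True by blast
  next
    case False
    define u v where "u = a 1 / a 2" and "v = a 0 / a 2"
    have "of_rat (a 2) * (of_rat v + of_rat u * \<eta> + \<eta>\<^sup>2) = 0"
      using a False by (simp add: coord_sum_cubic u_def v_def of_rat_divide field_simps)
    then have "of_rat v + of_rat u * \<eta> + \<eta>\<^sup>2 = 0" using False by simp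
    then have e2: "\<eta>\<^sup>2 = - of_rat u * \<eta> - of_rat v"
      by (simp add: algebra_simps eq_neg_iff_add_eq_0)
    have e3: "\<eta> ^ 3 = (of_rat u ^ 2 - of_rat v) * \<eta> + of_rat u * of_rat v"
    proof -
      have "\<eta> ^ 3 = \<eta> * \<eta>\<^sup>2" by (simp add: eval_nat_numeral)
      also have "\<dots> = - of_rat u * \<eta>\<^sup>2 - of_rat v * \<eta>"
        by (subst e2) (simp add: algebra_simps power2_eq_square)
      finally show ?thesis unfolding e2 by (simp add: algebra_simps power2_eq_square)
    qed
    define P Q where "P = u\<^sup>2 - v + of_int m * u - (of_int m + 3)" and "Q = u * v + of_int m * v - 1"
    have "of_rat P * \<eta> + of_rat Q = 0"
      using eta_cubic unfolding e3 e2
      by (simp add: P_def Q_def of_rat_add of_rat_diff of_rat_mult of_rat_power algebra_simps)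
    then have "P = 0" "Q = 0" using lin by blast+
    \<comment> \<open>The remaining root of the cubic: the three roots add up to m, and those of the
      factor x^2 + u x + v add up to -u.\<close>
    define \<kappa> where "\<kappa> = of_int m + u"
    have v: "v = u\<^sup>2 + of_int m * u - (of_int m + 3)" using \<open>P = 0\<close> by (simp add: P_def)
    have "v * \<kappa> = 1" using \<open>Q = 0\<close> by (simp add: Q_def \<kappa>_def algebra_simps)
    then have "\<kappa> ^ 3 = of_int m * \<kappa>\<^sup>2 + (of_int m + 3) * \<kappa> + v * \<kappa> - (1 - v * \<kappa>) * 0"
      unfolding v by (simp add: \<kappa>_def algebra_simps eval_nat_numeral)
    then have "\<kappa> ^ 3 = of_int m * \<kappa>\<^sup>2 + (of_int m + 3) * \<kappa> + 1" using \<open>v * \<kappa> = 1\<close> by simp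
    then have "(of_rat (\<kappa> ^ 3) :: complex) = of_rat (of_int m * \<kappa>\<^sup>2 + (of_int m + 3) * \<kappa> + 1)" by simp
    then have "of_rat \<kappa> ^ 3 = M * of_rat \<kappa> ^ 2 + (M + 3) * of_rat \<kappa> + (1 :: complex)"
      by (simp add: of_rat_add of_rat_mult of_rat_power)
    then show ?thesis using no_rational_root[of "of_rat \<kappa>"] by auto
  qed
  moreover have "k = 0 \<or> k = 1 \<or> k = 2" if "k < 3" for k :: nat using that by linarith
  ultimately show ?thesis unfolding coord_indep_def by metis
qed

lemma D_not_square: "(q :: rat)\<^sup>2 \<noteq> of_int D"
proof
  assume q: "q\<^sup>2 = of_int D"
  have "(of_rat q :: complex)\<^sup>2 = of_int D" using arg_cong[OF q, of of_rat] by (simp add: of_rat_power)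
  then have "algebraic_int (of_rat q :: complex)"
    using algebraic_int_power_root[of "of_rat q" 2] by simp
  then have "(of_rat q :: complex) \<in> \<int>" by (rule rational_algebraic_int_is_int) simp
  then obtain s where s: "of_rat q = (of_int s :: complex)" by (elim Ints_cases)
  have "(of_int (s\<^sup>2) :: complex) = of_int D" using \<open>(of_rat q :: complex)\<^sup>2 = of_int D\<close> s by simp
  then have "s\<^sup>2 = D" by (simp only: of_int_eq_iff)
  then show False using square_discriminant m unfolding D_def by blast
qed

lemma D_nonzero: "D \<noteq> 0"
  using D_not_square[of 0] by auto

lemma cubic_repr: "\<exists>A. mult_repr 3 ((^) \<eta>) (coord_sum 3 ((^) \<eta>) a) A"
proof (rule mult_repr_exists)
  fix j :: nat assume "j < 3"
  then have "j = 0 \<or> j = 1 \<or> j = 2" by linarith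
  then have "\<eta> ^ j = coord_sum 3 ((^) \<eta>) (\<lambda>k. if k = j then 1 else 0)"
    by (auto simp: coord_sum_cubic)
  then show "coord_sum 3 ((^) \<eta>) a * \<eta> ^ j \<in> range (coord_sum 3 ((^) \<eta>))"
    using shanks_mult[OF eta_cubic] by simp
qed

text \<open>If \<open>x + y \<delta> = 0\<close> with \<open>x\<close>, \<open>y\<close> in the cubic subfield and \<open>y \<noteq> 0\<close>, taking determinants in
  \<open>x\<^sup>2 = D y\<^sup>2\<close> exhibits \<open>D\<^sup>3\<close>, hence \<open>D\<close>, as a rational square.\<close>

lemma tower_indep: "coord_indep 6 (tower_basis \<eta> \<delta>)"
proof -
  have "\<forall>k<6. a k = 0" if a: "coord_sum 6 (tower_basis \<eta> \<delta>) a = 0" for a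
  proof -
    define x y where "x = coord_sum 3 ((^) \<eta>) a" and "y = coord_sum 3 ((^) \<eta>) (\<lambda>k. a (k + 3))"
    have xy: "x + y * \<delta> = 0"
      using a by (simp add: coord_sum_tower x_def y_def coord_sum_cubic)
    obtain A where A: "mult_repr 3 ((^) \<eta>) x A" using cubic_repr unfolding x_def by blast
    obtain C where C: "mult_repr 3 ((^) \<eta>) y C" using cubic_repr unfolding y_def by blast
    have carr: "A \<in> carrier_mat 3 3" "C \<in> carrier_mat 3 3" using A C unfolding mult_repr_def by auto
    have "y = 0"
    proof (rule ccontr)
      assume y: "y \<noteq> 0"
      have "x = - (y * \<delta>)" using xy by (simp add: eq_neg_iff_add_eq_0)
      then have "x * x = of_rat (of_int D) * (y * y)"
        using delta_square by (simp add: power2_eq_square)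
      then have "A * A = of_int D \<cdot>\<^sub>m (C * C)"
        using mult_repr_unique[OF cubic_indep] mult_repr_mult[OF A A]
          mult_repr_smult[OF mult_repr_mult[OF C C], of "of_int D"] by metis
      then have "det A * det A = of_int D ^ 3 * (det C * det C)"
        using carr det_mult[OF carr(1) carr(1)] det_mult[OF carr(2) carr(2)]
        by (simp add: det_smult)
      moreover have "det C \<noteq> 0" by (rule mult_repr_det[OF cubic_indep C y])
      ultimately have "(det A / (of_int D * det C))\<^sup>2 = of_int D"
        using D_nonzero by (simp add: field_simps power2_eq_square power3_eq_cube)
      then show False using D_not_square by blast
    qed
    moreover have "x = 0" using xy \<open>y = 0\<close> by simp
    ultimately have "\<forall>k<3. a k = 0" "\<forall>k<3. a (k + 3) = 0"
      using cubic_indep unfolding coord_indep_def x_def y_def by blast+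
    then have "a k = 0" if "k < 6" for k
      using that \<open>\<forall>k<3. a k = 0\<close> \<open>\<forall>k<3. a (k + 3) = 0\<close>[rule_format, of "k - 3"]
      by (cases "k < 3") auto
    then show ?thesis by blast
  qed
  then show ?thesis unfolding coord_indep_def by blast
qed

end

lemma complex_subfieldD:
  assumes "complex_subfield S"
  shows "0 \<in> S" "1 \<in> S" "x \<in> S \<Longrightarrow> y \<in> S \<Longrightarrow> x + y \<in> S" "x \<in> S \<Longrightarrow> y \<in> S \<Longrightarrow> x * y \<in> S"
    "x \<in> S \<Longrightarrow> - x \<in> S" "x \<in> S \<Longrightarrow> inverse x \<in> S"
    "x \<in> S \<Longrightarrow> y \<in> S \<Longrightarrow> x - y \<in> S" "x \<in> S \<Longrightarrow> y \<in> S \<Longrightarrow> x / y \<in> S"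
    "x \<in> S \<Longrightarrow> x ^ n \<in> S" "of_int i \<in> S" "of_nat n \<in> S" "numeral w \<in> S" "of_rat q \<in> S"
proof -
  have base: "0 \<in> S" "1 \<in> S" "\<And>x y. x \<in> S \<Longrightarrow> y \<in> S \<Longrightarrow> x + y \<in> S"
    "\<And>x y. x \<in> S \<Longrightarrow> y \<in> S \<Longrightarrow> x * y \<in> S" "\<And>x. x \<in> S \<Longrightarrow> - x \<in> S" "\<And>x. x \<in> S \<Longrightarrow> inverse x \<in> S"
    using assms unfolding complex_subfield_def by auto
  show "0 \<in> S" "1 \<in> S" "x \<in> S \<Longrightarrow> y \<in> S \<Longrightarrow> x + y \<in> S" "x \<in> S \<Longrightarrow> y \<in> S \<Longrightarrow> x * y \<in> S"
    "x \<in> S \<Longrightarrow> - x \<in> S" "x \<in> S \<Longrightarrow> inverse x \<in> S" by (fact base)+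
  show "x \<in> S \<Longrightarrow> y \<in> S \<Longrightarrow> x - y \<in> S" using base(3)[OF _ base(5)] by fastforce
  show "x \<in> S \<Longrightarrow> y \<in> S \<Longrightarrow> x / y \<in> S" using base(4)[OF _ base(6)] by (simp add: divide_inverse)
  show "x \<in> S \<Longrightarrow> x ^ n \<in> S" by (induction n) (auto intro: base)
  have nat: "of_nat n \<in> S" for n by (induction n) (auto intro: base)
  then show "of_nat n \<in> S" .
  have int: "of_int i \<in> S" for i
    by (cases i rule: int_cases2) (use nat base(5) in auto)
  then show "of_int i \<in> S" .
  show "numeral w \<in> S" using nat[of "numeral w"] by simp
  obtain a b where "q = of_int a / of_int b" by (metis of_int_of_nat_eq quotient_of_div surj_pair)
  then have "of_rat q = (of_int a * inverse (of_int b) :: complex)"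
    by (simp add: of_rat_mult of_rat_inverse divide_inverse)
  then show "of_rat q \<in> S" using base(4)[OF int base(6)[OF int]] by simp
qed

lemma rat_adjoin_least: "complex_subfield S \<Longrightarrow> x \<in> S \<Longrightarrow> rat_adjoin x \<subseteq> S"
  unfolding rat_adjoin_def by (rule hull_minimal) auto

lemma rat_adjoin_self: "x \<in> rat_adjoin x"
  unfolding rat_adjoin_def by (rule hull_inc) simp

lemma rat_adjoin_subfield: "complex_subfield (rat_adjoin x)"
  unfolding rat_adjoin_def hull_def complex_subfield_def by blast

context simplest_sextic_root
begin

definition K :: "complex set" where "K = rat_adjoin \<theta>"

definition tower :: "(nat \<Rightarrow> rat) \<Rightarrow> complex" where
  "tower = coord_sum 6 (tower_basis \<eta> \<delta>)"

lemma tower_closed_mult: "x \<in> range tower \<Longrightarrow> y \<in> range tower \<Longrightarrow> x * y \<in> range tower"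
  using tower_mult[of m D] eta_cubic delta_square unfolding tower_def by fastforce

lemma tower_closed_add: "x \<in> range tower \<Longrightarrow> y \<in> range tower \<Longrightarrow> x + y \<in> range tower"
  unfolding tower_def by (auto simp: coord_sum_add)

lemma tower_scale: "x \<in> range tower \<Longrightarrow> of_rat q * x \<in> range tower"
  unfolding tower_def by (auto simp: coord_sum_scale)

lemma tower_delta: "k < 6 \<Longrightarrow> tower (\<lambda>i. if i = k then 1 else 0) = tower_basis \<eta> \<delta> k"
  unfolding tower_def coord_sum_def
  by (simp add: if_distrib[of of_rat] if_distrib[of "\<lambda>u. u * _"] cong: if_cong)

lemma tower_basis_mem: "k < 6 \<Longrightarrow> tower_basis \<eta> \<delta> k \<in> range tower"
  by (metis tower_delta rangeI)

lemma eta_mem_tower: "\<eta> \<in> range tower" and delta_mem_tower: "\<delta> \<in> range tower"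
  and one_mem_tower: "1 \<in> range tower"
  using tower_basis_mem[of 1] tower_basis_mem[of 3] tower_basis_mem[of 0]
  by (simp_all add: tower_basis_def)

lemma tower_repr: "x \<in> range tower \<Longrightarrow> \<exists>A. mult_repr 6 (tower_basis \<eta> \<delta>) x A"
  using tower_closed_mult[OF _ tower_basis_mem] by (intro mult_repr_exists) (simp add: tower_def)

lemma tower_subfield: "complex_subfield (range tower)"
proof -
  have "x / y \<in> range tower" if "x \<in> range tower" "y \<in> range tower" "y \<noteq> 0" for x y
    using coord_sum_divide[OF tower_indep] tower_repr[OF that(2)] that unfolding tower_def by blast
  then have "inverse x \<in> range tower" if "x \<in> range tower" for x
    using that one_mem_tower tower_scale[OF one_mem_tower, of 0] by (cases "x = 0") (auto simp: inverse_eq_divide)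
  then show ?thesis
    unfolding complex_subfield_def
    using one_mem_tower tower_scale[OF one_mem_tower, of 0] tower_closed_mult tower_closed_add
      tower_scale[of _ "-1"] by auto
qed

lemma gamma_nonzero: "\<eta>\<^sup>2 + \<eta> + 1 \<noteq> 0"
proof
  assume "\<eta>\<^sup>2 + \<eta> + 1 = 0"
  then have "coord_sum 3 ((^) \<eta>) (\<lambda>_. 1) = 0" by (simp add: coord_sum_cubic algebra_simps)
  then show False using cubic_indep unfolding coord_indep_def
    by (metis zero_less_numeral zero_neq_one)
qed

lemma theta_formula: "\<theta> = \<eta> - \<delta> * \<eta> * (\<eta> + 1) / (\<eta>\<^sup>2 + \<eta> + 1)"
  using theta_eta_delta gamma_nonzero by (simp add: field_simps)

lemma K_eq: "K = range tower"
proof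
  note T = complex_subfieldD[OF tower_subfield]
  have "\<theta> \<in> range tower"
    by (subst theta_formula) (intro T eta_mem_tower delta_mem_tower)
  then show "K \<subseteq> range tower" unfolding K_def by (rule rat_adjoin_least[OF tower_subfield])
  note S = complex_subfieldD[OF rat_adjoin_subfield[of \<theta>]]
  have "\<eta> \<in> K" "\<delta> \<in> K"
    unfolding K_def \<eta>_def \<delta>_def by (intro S rat_adjoin_self)+
  then show "range tower \<subseteq> K"
    unfolding K_def tower_def coord_sum_tower by (auto intro!: S)
qed

lemma K_subfield: "complex_subfield K" unfolding K_def by (rule rat_adjoin_subfield)

lemmas K_closed = complex_subfieldD[OF K_subfield]

lemma theta_mem_K: "\<theta> \<in> K" unfolding K_def by (rule rat_adjoin_self)
lemma eta_mem_K: "\<eta> \<in> K" and delta_mem_K: "\<delta> \<in> K"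
  using eta_mem_tower delta_mem_tower K_eq by auto

lemma K_induct [consumes 1, case_names eta delta rat add mult]:
  assumes "x \<in> K" "P \<eta>" "P \<delta>" "\<And>q. P (of_rat q)"
    "\<And>x y. x \<in> K \<Longrightarrow> y \<in> K \<Longrightarrow> P x \<Longrightarrow> P y \<Longrightarrow> P (x + y)"
    "\<And>x y. x \<in> K \<Longrightarrow> y \<in> K \<Longrightarrow> P x \<Longrightarrow> P y \<Longrightarrow> P (x * y)"
  shows "P x"
proof -
  obtain a where x: "x = tower a" using assms(1) K_eq by auto
  define Q where "Q x \<longleftrightarrow> x \<in> K \<and> P x" for x
  have Q: "Q \<eta>" "Q \<delta>" "\<And>q. Q (of_rat q)" "\<And>x y. Q x \<Longrightarrow> Q y \<Longrightarrow> Q (x + y)"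
    "\<And>x y. Q x \<Longrightarrow> Q y \<Longrightarrow> Q (x * y)"
    unfolding Q_def using assms eta_mem_K delta_mem_K K_closed by auto
  have "Q x" unfolding x tower_def coord_sum_tower power2_eq_square by (intro Q)
  then show ?thesis by (simp add: Q_def)
qed

text \<open>The map x -> -1 / (1 + x) has order three and permutes the roots of every simplest
  cubic.\<close>

definition \<eta>' :: complex where "\<eta>' = - 1 / (1 + \<eta>)"

lemma eta_nonzero: "\<eta> \<noteq> 0" "1 + \<eta> \<noteq> 0"
proof -
  show "\<eta> \<noteq> 0" using eta_not_rational by auto
  have "\<eta> \<noteq> -1" using eta_not_rational by auto
  then show "1 + \<eta> \<noteq> 0" by (metis add.right_inverse add_left_imp_eq)
qed

lemma eta'_cubic: "\<eta>' ^ 3 = M * \<eta>'\<^sup>2 + (M + 3) * \<eta>' + 1"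
proof -
  define u where "u = 1 + \<eta>"
  have u: "u \<noteq> 0" using eta_nonzero by (simp add: u_def)
  have v: "u * \<eta>' = - 1" using u by (simp add: \<eta>'_def u_def)
  have "u ^ 3 * (\<eta>' ^ 3 - M * \<eta>'\<^sup>2 - (M + 3) * \<eta>' - 1) =
      (u * \<eta>') ^ 3 - M * u * (u * \<eta>')\<^sup>2 - (M + 3) * u\<^sup>2 * (u * \<eta>') - u ^ 3"
    by (simp add: algebra_simps eval_nat_numeral)
  also have "\<dots> = - 1 - M * u + (M + 3) * u\<^sup>2 - u ^ 3" unfolding v by simp
  also have "\<dots> = - (\<eta> ^ 3 - M * \<eta>\<^sup>2 - (M + 3) * \<eta> - 1)"
    by (simp add: u_def algebra_simps eval_nat_numeral)
  also have "\<dots> = 0" using eta_cubic by simp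
  finally have "\<eta>' ^ 3 - M * \<eta>'\<^sup>2 - (M + 3) * \<eta>' - 1 = 0" using u by simp
  then show ?thesis by (simp add: algebra_simps)
qed

definition coords :: "complex \<Rightarrow> nat \<Rightarrow> rat" where "coords x = (SOME a. x = tower a)"

text \<open>A generator of the cyclic Galois group of order six: order three on the cubic subfield
  and the sign change on the quadratic one, at the same time. Consequently \<sigma>^2 and \<sigma>^4
  fix \<delta>, and \<sigma>^3 fixes \<eta>.\<close>

definition \<sigma> :: "complex \<Rightarrow> complex" where
  "\<sigma> x = coord_sum 6 (tower_basis \<eta>' (- \<delta>)) (coords x)"

lemma sigma_tower: "\<sigma> (tower a) = coord_sum 6 (tower_basis \<eta>' (- \<delta>)) a"
proof -
  have "tower a = tower (coords (tower a))" unfolding coords_def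
    by (rule someI[of "\<lambda>c. tower a = tower c"]) (rule refl)
  then have "coords (tower a) i = a i" if "i < 6" for i
    using coord_indep_unique[OF tower_indep _ that] unfolding tower_def by metis
  then show ?thesis unfolding \<sigma>_def by (rule coord_sum_cong)
qed

lemma sigma_add: "x \<in> K \<Longrightarrow> y \<in> K \<Longrightarrow> \<sigma> (x + y) = \<sigma> x + \<sigma> y"
proof -
  assume "x \<in> K" "y \<in> K"
  then obtain a c where ac: "x = tower a" "y = tower c" unfolding K_eq by auto
  then have "x + y = tower (\<lambda>i. a i + c i)" by (simp add: tower_def coord_sum_add)
  then show ?thesis by (simp add: ac sigma_tower coord_sum_add)
qed

lemma sigma_mult:
  assumes "x \<in> K" "y \<in> K"
  shows "\<sigma> (x * y) = \<sigma> x * \<sigma> y"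
proof -
  obtain a c where ac: "x = tower a" "y = tower c" using assms unfolding K_eq by auto
  obtain e where e: "\<And>h d. h ^ 3 = of_int m * h\<^sup>2 + (of_int m + 3) * h + 1 \<Longrightarrow> d\<^sup>2 = of_int D \<Longrightarrow>
     coord_sum 6 (tower_basis h d) a * coord_sum 6 (tower_basis h d) c = coord_sum 6 (tower_basis h d) e"
    using tower_mult[of m D a c] by blast
  have "x * y = tower e" unfolding ac tower_def by (rule e[OF eta_cubic delta_square])
  moreover have "(- \<delta>)\<^sup>2 = of_int D" using delta_square by simp
  ultimately show ?thesis using e[OF eta'_cubic] by (simp add: ac sigma_tower)
qed

lemma sigma_rat [simp]: "\<sigma> (of_rat q) = of_rat q"
proof -
  have "of_rat q = tower (\<lambda>k. if k = 0 then q else 0)" by (simp add: tower_def coord_sum_tower)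
  then show ?thesis using sigma_tower by (simp add: coord_sum_tower)
qed

lemma sigma_eta: "\<sigma> \<eta> = \<eta>'" and sigma_delta: "\<sigma> \<delta> = - \<delta>"
proof -
  have "\<eta> = tower (\<lambda>k. if k = 1 then 1 else 0)" by (simp add: tower_def coord_sum_tower)
  then show "\<sigma> \<eta> = \<eta>'" using sigma_tower by (simp add: coord_sum_tower)
  have "\<delta> = tower (\<lambda>k. if k = 3 then 1 else 0)" by (simp add: tower_def coord_sum_tower)
  then show "\<sigma> \<delta> = - \<delta>" using sigma_tower by (simp add: coord_sum_tower)
qed

lemma eta'_mem_K: "\<eta>' \<in> K" unfolding \<eta>'_def by (intro K_closed eta_mem_K)

lemma sigma_mem: "x \<in> K \<Longrightarrow> \<sigma> x \<in> K"
  by (induction rule: K_induct)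
    (auto simp: sigma_eta sigma_delta sigma_add sigma_mult intro: K_closed eta'_mem_K delta_mem_K)

lemma sigma_iter_mem: "x \<in> K \<Longrightarrow> (\<sigma> ^^ i) x \<in> K"
  by (induction i) (auto intro: sigma_mem)

lemma sigma_iter_add: "x \<in> K \<Longrightarrow> y \<in> K \<Longrightarrow> (\<sigma> ^^ i) (x + y) = (\<sigma> ^^ i) x + (\<sigma> ^^ i) y"
  by (induction i) (auto simp: sigma_add sigma_iter_mem)

lemma sigma_iter_mult: "x \<in> K \<Longrightarrow> y \<in> K \<Longrightarrow> (\<sigma> ^^ i) (x * y) = (\<sigma> ^^ i) x * (\<sigma> ^^ i) y"
  by (induction i) (auto simp: sigma_mult sigma_iter_mem)

lemma sigma_iter_rat [simp]: "(\<sigma> ^^ i) (of_rat q) = of_rat q"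
  by (induction i) auto

lemma sigma_iter_int [simp]: "(\<sigma> ^^ i) (of_int n) = of_int n"
  using sigma_iter_rat[of i "of_int n"] by simp

lemma sigma_iter_one [simp]: "(\<sigma> ^^ i) 1 = 1" and sigma_iter_zero [simp]: "(\<sigma> ^^ i) 0 = 0"
  using sigma_iter_int[of i 1] sigma_iter_int[of i 0] by simp_all

lemma sigma_iter_power: "x \<in> K \<Longrightarrow> (\<sigma> ^^ i) (x ^ n) = (\<sigma> ^^ i) x ^ n"
  by (induction n) (auto simp: sigma_iter_mult K_closed)

lemma sigma_iter_diff: "x \<in> K \<Longrightarrow> y \<in> K \<Longrightarrow> (\<sigma> ^^ i) (x - y) = (\<sigma> ^^ i) x - (\<sigma> ^^ i) y"
  using sigma_iter_add[of "x - y" y i] by (simp add: K_closed)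

lemma sigma_iter_uminus: "x \<in> K \<Longrightarrow> (\<sigma> ^^ i) (- x) = - (\<sigma> ^^ i) x"
  using sigma_iter_diff[of 0 x i] by (simp add: K_closed)

lemma sigma_iter_divide:
  assumes "x \<in> K" "y \<in> K"
  shows "(\<sigma> ^^ i) (x / y) = (\<sigma> ^^ i) x / (\<sigma> ^^ i) y"
proof (cases "y = 0")
  case False
  have "(\<sigma> ^^ i) y * (\<sigma> ^^ i) (1 / y) = 1"
    using sigma_iter_mult[of y "1 / y" i] assms False by (simp add: K_closed)
  then have "(\<sigma> ^^ i) (1 / y) = 1 / (\<sigma> ^^ i) y" by (metis nonzero_mult_div_cancel_left mult_zero_left zero_neq_one)
  then show ?thesis using sigma_iter_mult[of x "1 / y" i] assms by (simp add: K_closed)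
qed simp

lemmas sigma_divide = sigma_iter_divide[of _ _ 1, simplified]

lemma sigma_iter_sum: "(\<And>i. i \<in> I \<Longrightarrow> f i \<in> K) \<Longrightarrow> (\<sigma> ^^ j) (sum f I) = (\<Sum>i\<in>I. (\<sigma> ^^ j) (f i))"
proof (induction I rule: infinite_finite_induct)
  case (insert x F)
  have "sum f F \<in> K" using insert.prems
    by (induction F rule: infinite_finite_induct) (auto intro: K_closed)
  then show ?case using insert by (simp add: sigma_iter_add)
qed auto

lemma sigma_iter_poly:
  "x \<in> K \<Longrightarrow> (\<sigma> ^^ i) (poly (map_poly of_int g) x) = poly (map_poly of_int g) ((\<sigma> ^^ i) x)"
proof (induction g)
  case (pCons c g)
  have "poly (map_poly of_int g) x \<in> K"
    using pCons.prems by (induction g) (auto simp: ipoly_pCons intro: K_closed)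
  then show ?case using pCons by (simp add: ipoly_pCons sigma_iter_add sigma_iter_mult K_closed)
qed simp

lemma sigma_iter_algebraic_int: "x \<in> K \<Longrightarrow> algebraic_int x \<Longrightarrow> algebraic_int ((\<sigma> ^^ i) x)"
  unfolding algebraic_int_altdef_ipoly using sigma_iter_poly by (metis sigma_iter_zero)

lemma sigma_eta': "\<sigma> \<eta>' = - (1 + \<eta>) / \<eta>"
proof -
  have "\<sigma> \<eta>' = \<sigma> (- 1 / (1 + \<eta>))" by (simp add: \<eta>'_def)
  also have "\<dots> = - 1 / (1 + \<eta>')"
    using sigma_divide[of "-1" "1 + \<eta>"] sigma_add[of 1 \<eta>] sigma_rat[of 1] sigma_rat[of "-1"] eta_mem_K
    by (simp add: K_closed sigma_eta)
  also have "1 + \<eta>' = \<eta> / (1 + \<eta>)" using eta_nonzero by (simp add: \<eta>'_def field_simps)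
  finally show ?thesis by simp
qed

lemma sigma2_eta: "(\<sigma> ^^ 2) \<eta> = - (1 + \<eta>) / \<eta>"
  by (simp add: numeral_2_eq_2 sigma_eta sigma_eta')

lemma sigma3_eta: "(\<sigma> ^^ 3) \<eta> = \<eta>"
proof -
  have "(\<sigma> ^^ 3) \<eta> = \<sigma> (- (1 + \<eta>) / \<eta>)" using sigma2_eta by (simp add: eval_nat_numeral)
  also have "\<dots> = - (1 + \<eta>') / \<eta>'"
    using sigma_divide[of "- (1 + \<eta>)" \<eta>] sigma_iter_uminus[of "1 + \<eta>" 1] sigma_add[of 1 \<eta>] sigma_rat[of 1] eta_mem_K
    by (simp add: K_closed sigma_eta)
  also have "\<dots> = \<eta>" using eta_nonzero by (simp add: \<eta>'_def field_simps)
  finally show ?thesis .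
qed

lemma sigma2_delta: "(\<sigma> ^^ 2) \<delta> = \<delta>"
  using sigma_iter_uminus[of \<delta> 1] delta_mem_K by (simp add: numeral_2_eq_2 sigma_delta)

lemma sigma3_delta: "(\<sigma> ^^ 3) \<delta> = - \<delta>"
  using sigma2_delta by (simp add: eval_nat_numeral sigma_delta)

lemma sigma6: "x \<in> K \<Longrightarrow> (\<sigma> ^^ 6) x = x"
proof (induction rule: K_induct)
  case eta
  have "(\<sigma> ^^ 6) \<eta> = (\<sigma> ^^ 3) ((\<sigma> ^^ 3) \<eta>)" using funpow_add[of 3 3 \<sigma>] by simp
  then show ?case by (simp add: sigma3_eta)
next
  case delta
  have "(\<sigma> ^^ 6) \<delta> = (\<sigma> ^^ 3) ((\<sigma> ^^ 3) \<delta>)" using funpow_add[of 3 3 \<sigma>] by simp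
  then show ?case by (simp add: sigma3_delta sigma_iter_uminus delta_mem_K)
qed (auto simp: sigma_iter_add sigma_iter_mult)

subsection \<open>Trace, norm and characteristic polynomial\<close>

definition Tr :: "complex \<Rightarrow> complex" where "Tr x = (\<Sum>i<6. (\<sigma> ^^ i) x)"
definition Nm :: "complex \<Rightarrow> complex" where "Nm x = (\<Prod>i<6. (\<sigma> ^^ i) x)"

lemma sigma_iter_tower:
  "(\<sigma> ^^ i) (tower a) = coord_sum 6 (tower_basis ((\<sigma> ^^ i) \<eta>) ((\<sigma> ^^ i) \<delta>)) a"
  unfolding tower_def coord_sum_tower
  by (simp add: sigma_iter_add sigma_iter_mult sigma_iter_power K_closed eta_mem_K delta_mem_K)

lemma sigma_iter_eta_delta:
  "(\<sigma> ^^ 0) \<eta> = \<eta>" "(\<sigma> ^^ 1) \<eta> = \<eta>'" "(\<sigma> ^^ 2) \<eta> = - (1 + \<eta>) / \<eta>"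
  "(\<sigma> ^^ 3) \<eta> = \<eta>" "(\<sigma> ^^ 4) \<eta> = \<eta>'" "(\<sigma> ^^ 5) \<eta> = - (1 + \<eta>) / \<eta>"
  "(\<sigma> ^^ 0) \<delta> = \<delta>" "(\<sigma> ^^ 1) \<delta> = - \<delta>" "(\<sigma> ^^ 2) \<delta> = \<delta>"
  "(\<sigma> ^^ 3) \<delta> = - \<delta>" "(\<sigma> ^^ 4) \<delta> = \<delta>" "(\<sigma> ^^ 5) \<delta> = - \<delta>"
proof -
  have 4: "(\<sigma> ^^ 4) x = (\<sigma> ^^ 1) ((\<sigma> ^^ 3) x)" for x using funpow_add[of 1 3 \<sigma>] by simp
  have 5: "(\<sigma> ^^ 5) x = (\<sigma> ^^ 2) ((\<sigma> ^^ 3) x)" for x using funpow_add[of 2 3 \<sigma>] by simp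
  show "(\<sigma> ^^ 0) \<eta> = \<eta>" "(\<sigma> ^^ 1) \<eta> = \<eta>'" "(\<sigma> ^^ 2) \<eta> = - (1 + \<eta>) / \<eta>" "(\<sigma> ^^ 3) \<eta> = \<eta>"
    "(\<sigma> ^^ 0) \<delta> = \<delta>" "(\<sigma> ^^ 1) \<delta> = - \<delta>" "(\<sigma> ^^ 2) \<delta> = \<delta>" "(\<sigma> ^^ 3) \<delta> = - \<delta>"
    by (simp_all add: sigma_eta sigma2_eta sigma3_eta sigma_delta sigma2_delta sigma3_delta)
  show "(\<sigma> ^^ 4) \<eta> = \<eta>'" "(\<sigma> ^^ 4) \<delta> = \<delta>"
    unfolding 4 using sigma_iter_uminus[of \<delta> 1] delta_mem_K
    by (simp_all add: sigma_eta sigma3_eta sigma_delta sigma3_delta)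
  show "(\<sigma> ^^ 5) \<eta> = - (1 + \<eta>) / \<eta>" "(\<sigma> ^^ 5) \<delta> = - \<delta>"
    unfolding 5 using sigma_iter_uminus[of \<delta> 2] delta_mem_K
    by (simp_all add: sigma2_eta sigma3_eta sigma2_delta sigma3_delta)
qed

lemma eta_conjugates:
  "\<eta> + \<eta>' + - (1 + \<eta>) / \<eta> = M"
  "\<eta> * \<eta>' + \<eta>' * (- (1 + \<eta>) / \<eta>) + \<eta> * (- (1 + \<eta>) / \<eta>) = - (M + 3)"
proof -
  define u where "u = 1 + \<eta>"
  have nz: "\<eta> \<noteq> 0" "u \<noteq> 0" using eta_nonzero by (simp_all add: u_def)
  have \<eta>': "\<eta>' = - 1 / u" by (simp add: \<eta>'_def u_def)
  have "\<eta> * u * (\<eta> + - 1 / u + - u / \<eta> - M) = \<eta>\<^sup>2 * u - \<eta> - u\<^sup>2 - M * \<eta> * u"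
    using nz by (simp add: field_simps power2_eq_square)
  also have "\<dots> = \<eta> ^ 3 - M * \<eta>\<^sup>2 - (M + 3) * \<eta> - 1"
    by (simp add: u_def algebra_simps eval_nat_numeral)
  also have "\<dots> = 0" using eta_cubic by simp
  finally show "\<eta> + \<eta>' + - (1 + \<eta>) / \<eta> = M" using nz unfolding \<eta>' u_def[symmetric] by simp
  have "\<eta> * u * (\<eta> * (- 1 / u) + - 1 / u * (- u / \<eta>) + \<eta> * (- u / \<eta>) + (M + 3)) =
      - \<eta>\<^sup>2 + u - u\<^sup>2 * \<eta> + (M + 3) * \<eta> * u"
    using nz by (simp add: field_simps power2_eq_square)
  also have "\<dots> = - (\<eta> ^ 3 - M * \<eta>\<^sup>2 - (M + 3) * \<eta> - 1)"
    by (simp add: u_def algebra_simps eval_nat_numeral)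
  also have "\<dots> = 0" using eta_cubic by simp
  finally have "\<eta> * \<eta>' + \<eta>' * (- (1 + \<eta>) / \<eta>) + \<eta> * (- (1 + \<eta>) / \<eta>) + (M + 3) = 0"
    using nz unfolding \<eta>' u_def[symmetric] by simp
  then show "\<eta> * \<eta>' + \<eta>' * (- (1 + \<eta>) / \<eta>) + \<eta> * (- (1 + \<eta>) / \<eta>) = - (M + 3)"
    by (simp only: eq_neg_iff_add_eq_0)
qed

lemma sum_6: "(\<Sum>i<6. f i) = f 0 + f 1 + f 2 + f 3 + f 4 + f (5 :: nat)"
proof -
  have "{..<6} = {0, 1, 2, 3, 4, 5 :: nat}" by auto
  then show ?thesis by (simp add: add_ac)
qed

lemma prod_6: "(\<Prod>i<6. f i) = f 0 * f 1 * f 2 * f 3 * f 4 * f (5 :: nat)"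
proof -
  have "{..<6} = {0, 1, 2, 3, 4, 5 :: nat}" by auto
  then show ?thesis by (simp add: mult_ac)
qed

text \<open>The powers \<sigma>^i and \<sigma>^(i+3) agree on \<eta> and differ by a sign on
  \<delta>, so the part containing \<delta> cancels and only power sums of the roots of the cubic
  remain.\<close>

lemma Tr_rational:
  assumes "x \<in> K"
  shows "Tr x \<in> \<rat>"
proof -
  obtain a where x: "x = tower a" using assms K_eq by auto
  define h where "h = - (1 + \<eta>) / \<eta>"
  have s1: "\<eta> + \<eta>' + h = M" and s2: "\<eta> * \<eta>' + \<eta>' * h + \<eta> * h = - (M + 3)"
    using eta_conjugates unfolding h_def by blast+
  have "\<eta>\<^sup>2 + \<eta>'\<^sup>2 + h\<^sup>2 = (\<eta> + \<eta>' + h)\<^sup>2 - 2 * (\<eta> * \<eta>' + \<eta>' * h + \<eta> * h)"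
    by (simp add: algebra_simps power2_eq_square)
  then have s3: "\<eta>\<^sup>2 + \<eta>'\<^sup>2 + h\<^sup>2 = M\<^sup>2 + 2 * (M + 3)" unfolding s1 s2 by simp
  have "Tr x = 6 * of_rat (a 0) + 2 * of_rat (a 1) * (\<eta> + \<eta>' + h) + 2 * of_rat (a 2) * (\<eta>\<^sup>2 + \<eta>'\<^sup>2 + h\<^sup>2)"
    unfolding Tr_def x sum_6 sigma_iter_tower sigma_iter_eta_delta coord_sum_tower h_def[symmetric]
    by (simp add: algebra_simps)
  also have "\<dots> \<in> \<rat>" unfolding s1 s3 by simp
  finally show ?thesis .
qed

lemma Tr_scale: "x \<in> K \<Longrightarrow> Tr (of_rat q * x) = of_rat q * Tr x"
  by (simp add: Tr_def sigma_iter_mult K_closed sum_distrib_left)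

lemma Tr_one: "Tr 1 = 6" by (simp add: Tr_def)

lemma Tr_coord_sum:
  assumes "\<And>k. k < n \<Longrightarrow> y * b k \<in> K" "\<And>k. k < n \<Longrightarrow> b k \<in> K" "y \<in> K"
  shows "Tr (y * coord_sum n b a) = (\<Sum>k<n. of_rat (a k) * Tr (y * b k))"
proof -
  have "y * coord_sum n b a = (\<Sum>k<n. of_rat (a k) * (y * b k))"
    by (simp add: coord_sum_def sum_distrib_left mult_ac)
  moreover have "(\<sigma> ^^ i) (\<Sum>k<n. of_rat (a k) * (y * b k)) = (\<Sum>k<n. (\<sigma> ^^ i) (of_rat (a k) * (y * b k)))" for i
    by (rule sigma_iter_sum) (auto intro!: K_closed(4,13) assms)
  ultimately have "Tr (y * coord_sum n b a) = (\<Sum>i<6. \<Sum>k<n. (\<sigma> ^^ i) (of_rat (a k) * (y * b k)))"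
    unfolding Tr_def by simp
  also have "\<dots> = (\<Sum>k<n. Tr (of_rat (a k) * (y * b k)))"
    unfolding Tr_def by (rule sum.swap)
  also have "\<dots> = (\<Sum>k<n. of_rat (a k) * Tr (y * b k))"
    using assms by (intro sum.cong) (auto simp: Tr_scale)
  finally show ?thesis .
qed

text \<open>Such an x satisfies Tr x = 6 x, which replaces an appeal to the Galois
  correspondence.\<close>

lemma sigma_fixed_rational: "x \<in> K \<Longrightarrow> \<sigma> x = x \<Longrightarrow> x \<in> \<rat>"
proof -
  assume x: "x \<in> K" "\<sigma> x = x"
  then have "(\<sigma> ^^ i) x = x" for i by (induction i) auto
  then have "Tr x = 6 * x" by (simp add: Tr_def)
  then have "x = Tr x / 6" by simp
  then show ?thesis using Tr_rational[OF x(1)] by (metis Rats_divide Rats_number_of)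
qed

lemma Nm_mult: "x \<in> K \<Longrightarrow> y \<in> K \<Longrightarrow> Nm (x * y) = Nm x * Nm y"
  by (simp add: Nm_def sigma_iter_mult prod.distrib)

lemma Nm_of_int: "Nm (of_int n) = of_int n ^ 6"
  by (simp add: Nm_def)

lemma Nm_rational:
  assumes "x \<in> K"
  shows "Nm x \<in> \<rat>"
proof (rule sigma_fixed_rational)
  have mem: "(\<sigma> ^^ i) x \<in> K" for i using assms by (rule sigma_iter_mem)
  show "Nm x \<in> K" unfolding Nm_def prod_6 by (intro K_closed mem)
  have "\<sigma> (Nm x) = (\<sigma> ^^ 1) x * (\<sigma> ^^ 2) x * (\<sigma> ^^ 3) x * (\<sigma> ^^ 4) x * (\<sigma> ^^ 5) x * (\<sigma> ^^ 6) x"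
  proof -
    have e: "\<sigma> ((\<sigma> ^^ 0) x) = (\<sigma> ^^ 1) x" "\<sigma> ((\<sigma> ^^ 1) x) = (\<sigma> ^^ 2) x" "\<sigma> ((\<sigma> ^^ 2) x) = (\<sigma> ^^ 3) x"
      "\<sigma> ((\<sigma> ^^ 3) x) = (\<sigma> ^^ 4) x" "\<sigma> ((\<sigma> ^^ 4) x) = (\<sigma> ^^ 5) x" "\<sigma> ((\<sigma> ^^ 5) x) = (\<sigma> ^^ 6) x"
      by (simp_all add: eval_nat_numeral)
    show ?thesis
      unfolding Nm_def prod_6 by (simp only: sigma_mult mem K_closed(4) e)
  qed
  then show "\<sigma> (Nm x) = Nm x"
    unfolding Nm_def prod_6 using sigma6[OF assms] by (simp add: mult_ac)
qed

lemma Nm_int: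
  assumes "x \<in> K" "algebraic_int x"
  shows "Nm x \<in> \<int>"
proof (rule rational_algebraic_int_is_int)
  show "algebraic_int (Nm x)"
    unfolding Nm_def by (intro algebraic_int_prod sigma_iter_algebraic_int assms)
  show "Nm x \<in> \<rat>" by (rule Nm_rational[OF assms(1)])
qed

lemma Tr_int:
  assumes "x \<in> K" "algebraic_int x"
  shows "Tr x \<in> \<int>"
proof (rule rational_algebraic_int_is_int)
  show "algebraic_int (Tr x)"
    unfolding Tr_def by (intro algebraic_int_sum sigma_iter_algebraic_int assms)
  show "Tr x \<in> \<rat>" by (rule Tr_rational[OF assms(1)])
qed

text \<open>A kernel vector is the coordinate vector of some y whose product with every element of
  \<open>K\<close> has trace 0, yet y times 1 / y has trace 6.\<close>

lemma trace_form_nondegenerate: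
  fixes G :: "rat mat"
  assumes ind: "coord_indep n b" and K: "K = range (coord_sum n b)"
    and G: "G \<in> carrier_mat n n" "\<And>i j. i < n \<Longrightarrow> j < n \<Longrightarrow> Tr (b i * b j) = of_rat (G $$ (i, j))"
  shows "det G \<noteq> 0"
proof
  assume "det G = 0"
  then obtain v where v: "v \<in> carrier_vec n" "v \<noteq> 0\<^sub>v n" "G *\<^sub>v v = 0\<^sub>v n"
    using det_0_iff_vec_prod_zero_field[OF G(1)] by auto
  have bK: "b i \<in> K" if "i < n" for i
  proof -
    have "b i = coord_sum n b (\<lambda>k. if k = i then 1 else 0)"
      using that by (simp add: coord_sum_def if_distrib[of of_rat] if_distrib[of "\<lambda>u. u * _"] cong: if_cong)
    then show ?thesis using K by blast
  qed
  define y where "y = coord_sum n b (($) v)"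
  have yK: "y \<in> K" using K by (simp add: y_def)
  have "y \<noteq> 0"
  proof
    assume "y = 0"
    then have "v $ i = 0" if "i < n" for i using ind that unfolding y_def coord_indep_def by blast
    then have "v = 0\<^sub>v n" using v(1) by (intro eq_vecI) auto
    then show False using v(2) by simp
  qed
  have row: "Tr (b i * y) = 0" if i: "i < n" for i
  proof -
    have "Tr (b i * y) = (\<Sum>k<n. of_rat (v $ k) * Tr (b i * b k))"
      unfolding y_def using bK i by (intro Tr_coord_sum) (auto intro: K_closed)
    also have "\<dots> = of_rat (\<Sum>k<n. G $$ (i, k) * v $ k)"
      unfolding of_rat_sum by (intro sum.cong) (simp_all add: G(2) i of_rat_mult)
    also have "(\<Sum>k<n. G $$ (i, k) * v $ k) = (G *\<^sub>v v) $ i"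
      using i G(1) v(1) by (auto simp: scalar_prod_def atLeast0LessThan)
    finally show ?thesis using v(3) i by simp
  qed
  have "1 / y \<in> K" using yK by (intro K_closed)
  then obtain a where a: "1 / y = coord_sum n b a" using K by auto
  have "Tr (y * coord_sum n b a) = (\<Sum>k<n. of_rat (a k) * Tr (y * b k))"
    using bK yK by (intro Tr_coord_sum) (auto intro: K_closed)
  also have "\<dots> = 0" using row by (simp add: mult.commute)
  finally show False using a \<open>y \<noteq> 0\<close> Tr_one by (metis nonzero_mult_div_cancel_left times_divide_eq_right mult.right_neutral zero_neq_numeral)
qed

lemma basis_length:
  assumes "coord_indep n b" "K = range (coord_sum n b)"
  shows "n = 6"
proof -
  let ?t = "tower_basis \<eta> \<delta>"
  note b = coord_indep_imp_independent[OF assms(1)]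
  note t = coord_indep_imp_independent[OF tower_indep]
  have span: "rat_vs.span (b ` {..<n}) = K" "rat_vs.span (?t ` {..<6}) = K"
    using span_eq_coord_sums assms(2) K_eq unfolding tower_def by metis+
  have "card (b ` {..<n}) \<le> card (?t ` {..<6})"
    using rat_vs.independent_span_bound[of "?t ` {..<6}" "b ` {..<n}"] b(2) span rat_vs.span_superset
    by (metis finite_imageI finite_lessThan)
  moreover have "card (?t ` {..<6}) \<le> card (b ` {..<n})"
    using rat_vs.independent_span_bound[of "b ` {..<n}" "?t ` {..<6}"] t(2) span rat_vs.span_superset
    by (metis finite_imageI finite_lessThan)
  ultimately show ?thesis using b(1) t(1) by (simp add: card_image)
qed

text \<open>The transpose of the matrix times the matrix is the Gram matrix of the trace
  form.\<close>

lemma conjugate_matrix_det: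
  assumes "coord_indep 6 b" "K = range (coord_sum 6 b)"
  shows "det (mat 6 6 (\<lambda>(i, j). (\<sigma> ^^ i) (b j))) \<noteq> 0"
proof
  define V where "V = mat 6 6 (\<lambda>(i, j). (\<sigma> ^^ i) (b j))"
  assume "det (mat 6 6 (\<lambda>(i, j). (\<sigma> ^^ i) (b j))) = 0"
  then have V0: "det V = 0" by (simp add: V_def)
  have V: "V \<in> carrier_mat 6 6" by (simp add: V_def)
  have bK: "b i \<in> K" if "i < 6" for i
  proof -
    have "b i = coord_sum 6 b (\<lambda>k. if k = i then 1 else 0)"
      using that by (simp add: coord_sum_def if_distrib[of of_rat] if_distrib[of "\<lambda>u. u * _"] cong: if_cong)
    then show ?thesis using assms(2) by blast
  qed
  have "\<exists>q. Tr (b i * b j) = of_rat q" if "i < 6" "j < 6" for i j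
    using Tr_rational[of "b i * b j"] bK that by (auto simp: K_closed elim: Rats_cases)
  then obtain g where g: "\<And>i j. i < 6 \<Longrightarrow> j < 6 \<Longrightarrow> Tr (b i * b j) = of_rat (g i j)" by metis
  define G where "G = mat 6 6 (\<lambda>(i, j). g i j)"
  have G: "G \<in> carrier_mat 6 6" by (simp add: G_def)
  have GV: "map_mat of_rat G = transpose_mat V * V"
    using V bK g by (intro eq_matI)
      (auto simp: G_def V_def scalar_prod_def atLeast0LessThan sigma_iter_mult Tr_def simp flip: g)
  have "of_rat (det G) = det (map_mat of_rat G :: complex mat)" by simp
  also have "\<dots> = det (transpose_mat V) * det V"
    unfolding GV using V by (intro det_mult) auto
  finally have "of_rat (det G) = det (transpose_mat V) * det V" .
  then have "det G = 0" using V0 by simp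
  then show False
    using trace_form_nondegenerate[OF assms G] g by (simp add: G_def)
qed

lemma char_poly_conjugates:
  assumes "rat_basis K bs" "mult_matrix bs x A" "x \<in> K"
  shows "map_poly of_rat (char_poly A) = (\<Prod>i<6. [:- (\<sigma> ^^ i) x, 1:])"
proof -
  note bs = rat_basis_coord[OF assms(1)]
  have len: "length bs = 6" by (rule basis_length[OF bs])
  have bK: "bs ! i \<in> K" if "i < 6" for i
  proof -
    have "bs ! i = coord_sum 6 ((!) bs) (\<lambda>k. if k = i then 1 else 0)"
      using that by (simp add: coord_sum_def if_distrib[of of_rat] if_distrib[of "\<lambda>u. u * _"] cong: if_cong)
    then show ?thesis using bs(2) len by auto
  qed
  show ?thesis
  proof (rule char_poly_mult_repr)
    show "mult_repr 6 ((!) bs) x A" using assms(2) mult_matrix_iff len by simp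
    show "(\<sigma> ^^ i) (coord_sum 6 ((!) bs) a) = (\<Sum>k<6. of_rat (a k) * (\<sigma> ^^ i) (bs ! k))" for i a
    proof -
      have "(\<sigma> ^^ i) (coord_sum 6 ((!) bs) a) = (\<Sum>k<6. (\<sigma> ^^ i) (of_rat (a k) * bs ! k))"
        unfolding coord_sum_def by (rule sigma_iter_sum) (auto intro!: K_closed(4,13) bK)
      also have "\<dots> = (\<Sum>k<6. of_rat (a k) * (\<sigma> ^^ i) (bs ! k))"
        by (intro sum.cong) (auto simp: sigma_iter_mult bK K_closed)
      finally show ?thesis .
    qed
    show "(\<sigma> ^^ i) (x * bs ! j) = (\<sigma> ^^ i) x * (\<sigma> ^^ i) (bs ! j)" if "j < 6" for i j
      using bK that assms(3) by (simp add: sigma_iter_mult)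
    show "det (mat 6 6 (\<lambda>(i, j). (\<sigma> ^^ i) (bs ! j))) \<noteq> 0"
      using conjugate_matrix_det bs len by metis
  qed
qed

text \<open>Discharges the definite description. The conjugates determine the characteristic
  polynomial whatever the basis, and its rational coefficients are integral expressions in the
  conjugates, hence integers.\<close>

theorem field_char_poly_eq:
  assumes x: "x \<in> K" "algebraic_int x"
  shows "map_poly of_int (field_char_poly K x) = (\<Prod>i<6. [:- (\<sigma> ^^ i) x, 1:])"
proof -
  define P where "P = (\<Prod>i<6. [:- (\<sigma> ^^ i) x, 1:])"
  define t where "t = map (tower_basis \<eta> \<delta>) [0..<6]"
  have t: "rat_basis K t" unfolding t_def by (rule coord_rat_basis[OF tower_indep]) (simp add: K_eq tower_def)
  obtain A0 where A0: "mult_repr 6 (tower_basis \<eta> \<delta>) x A0" using tower_repr x(1) K_eq by blast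
  have A0': "mult_matrix t x A0"
    using A0 unfolding mult_matrix_iff mult_repr_def coord_sum_def t_def by simp
  have cp: "map_poly of_rat (char_poly A) = P" if "rat_basis K bs" "mult_matrix bs x A" for bs A
    using char_poly_conjugates[OF that x(1)] by (simp add: P_def)
  have "\<exists>n :: int. poly.coeff (char_poly A0) k = of_int n" for k
  proof -
    have "of_rat (poly.coeff (char_poly A0) k) = poly.coeff P k"
      using arg_cong[OF cp[OF t A0'], of "\<lambda>q. poly.coeff q k"] by (simp add: coeff_map_poly)
    moreover have "algebraic_int (poly.coeff P k)"
      unfolding P_def by (intro coeffs_prod_algebraic_int sigma_iter_algebraic_int x)
    ultimately have "(of_rat (poly.coeff (char_poly A0) k) :: complex) \<in> \<int>"
      using rational_algebraic_int_is_int[of "poly.coeff P k"] by (metis Rats_of_rat)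
    then obtain n where "of_rat (poly.coeff (char_poly A0) k) = (of_rat (of_int n) :: complex)"
      by (auto elim: Ints_cases)
    then have "poly.coeff (char_poly A0) k = of_int n" by (simp only: of_rat_eq_iff)
    then show ?thesis ..
  qed
  then obtain c where c: "\<And>k. poly.coeff (char_poly A0) k = of_int (c k)" by metis
  define p where "p = Abs_poly c"
  have "\<forall>\<^sub>\<infinity>k. c k = 0"
    using MOST_coeff_eq_0[of "char_poly A0"] by (simp add: c)
  then have "poly.coeff p = c" unfolding p_def by (intro Abs_poly_inverse) simp
  then have p: "map_poly rat_of_int p = char_poly A0" by (intro poly_eqI) (simp add: coeff_map_poly c)
  have "field_char_poly K x = p"
    unfolding field_char_poly_def
  proof (rule the_equality)
    show "\<exists>bs M. rat_basis K bs \<and> mult_matrix bs x M \<and> map_poly rat_of_int p = char_poly M"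
      using t A0' p by blast
    fix q assume "\<exists>bs M. rat_basis K bs \<and> mult_matrix bs x M \<and> map_poly rat_of_int q = char_poly M"
    then obtain bs A where A: "rat_basis K bs" "mult_matrix bs x A" "map_poly rat_of_int q = char_poly A" by blast
    have "map_poly of_rat (map_poly rat_of_int q) = (map_poly of_rat (map_poly rat_of_int p) :: complex poly)"
      unfolding A(3) p using cp A t A0' by simp
    then have "of_int (poly.coeff q k) = (of_int (poly.coeff p k) :: complex)" for k
      by (metis (mono_tags) coeff_map_poly of_int_0 of_rat_0 of_rat_of_int_eq)
    then show "q = p" by (intro poly_eqI) simp
  qed
  moreover have "map_poly of_int p = (map_poly of_rat (map_poly rat_of_int p) :: complex poly)"
    by (intro poly_eqI) (simp add: coeff_map_poly)
  ultimately show ?thesis using cp[OF t A0'] p by (simp add: P_def)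
qed

lemma field_char_poly_eval:
  assumes "x \<in> K" "algebraic_int x"
  shows "of_int (poly (field_char_poly K x) t) = Nm (of_int t - x)"
proof -
  have "of_int (poly (field_char_poly K x) t) = poly (map_poly of_int (field_char_poly K x)) (of_int t :: complex)"
    by simp
  also have "\<dots> = (\<Prod>i<6. of_int t - (\<sigma> ^^ i) x)"
    unfolding field_char_poly_eq[OF assms] by (simp add: poly_prod)
  also have "\<dots> = Nm (of_int t - x)"
    using assms by (simp add: Nm_def sigma_iter_diff K_closed)
  finally show ?thesis .
qed

end

lemma subfield_power_sum:
  assumes S: "complex_subfield S" and z: "z \<in> S"
  shows "coord_sum n ((^) z) a \<in> S"
proof -
  note S = complex_subfieldD[OF S]
  interpret complex_subring S by standard (auto intro: S)
  show ?thesis unfolding coord_sum_def by (intro sum_mem ring_mem S(13) z)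
qed

context simplest_sextic_root
begin

subsection \<open>Primitive integers and their indices\<close>

definition A :: "complex set" where "A = ring_of_integers K"

lemma A_iff: "x \<in> A \<longleftrightarrow> x \<in> K \<and> algebraic_int x"
  by (simp add: A_def ring_of_integers_def)

lemma A_subring: "complex_subring A"
  by standard (auto simp: A_iff intro: K_closed algebraic_int_add algebraic_int_mult)

sublocale A: complex_subring A by (rule A_subring)

lemma theta_mem_A: "\<theta> \<in> A"
proof -
  have "algebraic_int \<theta>"
    unfolding algebraic_int_altdef_ipoly using root
    by (intro exI[of _ "simplest_sextic m"]) (simp add: simplest_sextic_def)
  then show ?thesis using theta_mem_K by (simp add: A_iff)
qed

lemma eta_mem_A: "\<eta> \<in> A"
proof -
  have "poly (map_poly of_int [:-1, - (m + 3), - m, 1:]) \<eta> = \<eta> ^ 3 - M * \<eta>\<^sup>2 - (M + 3) * \<eta> - 1"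
    unfolding ipoly_pCons by (simp add: algebra_simps eval_nat_numeral)
  also have "\<dots> = 0" using eta_cubic by simp
  finally have "algebraic_int \<eta>"
    unfolding algebraic_int_altdef_ipoly by (intro exI[of _ "[:-1, - (m + 3), - m, 1:]"]) simp
  then show ?thesis using eta_mem_K by (simp add: A_iff)
qed

lemma delta_mem_A: "\<delta> \<in> A"
  using algebraic_int_power_root[of \<delta> 2] delta_square delta_mem_K by (simp add: A_iff)

lemma fixed_subfield: "complex_subfield {x \<in> K. (\<sigma> ^^ n) x = x}"
  unfolding complex_subfield_def inverse_eq_divide
  by (auto simp: K_closed sigma_iter_add sigma_iter_mult sigma_iter_uminus sigma_iter_divide)

lemma theta_not_fixed:
  assumes "0 < n" "n < 6"
  shows "(\<sigma> ^^ n) \<theta> \<noteq> \<theta>"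
proof
  assume "(\<sigma> ^^ n) \<theta> = \<theta>"
  then have "K \<subseteq> {x \<in> K. (\<sigma> ^^ n) x = x}"
    unfolding K_def by (intro rat_adjoin_least) (use fixed_subfield theta_mem_K in \<open>auto simp: K_def\<close>)
  then have fx: "(\<sigma> ^^ n) \<eta> = \<eta>" "(\<sigma> ^^ n) \<delta> = \<delta>" using eta_mem_K delta_mem_K by auto
  have d: "\<delta> \<noteq> - \<delta>" using delta_square D_nonzero by auto
  have g: "\<eta>\<^sup>2 + \<eta> + 1 \<noteq> 0" by (rule gamma_nonzero)
  have e1: "\<eta>' \<noteq> \<eta>"
  proof
    assume "\<eta>' = \<eta>"
    then have "\<eta> * (1 + \<eta>) = - 1" using eta_nonzero by (simp add: \<eta>'_def field_simps)
    then have "\<eta>\<^sup>2 + \<eta> + 1 = 0" by (simp add: algebra_simps power2_eq_square eq_neg_iff_add_eq_0)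
    then show False using g by simp
  qed
  have e2: "- (1 + \<eta>) / \<eta> \<noteq> \<eta>"
  proof
    assume "- (1 + \<eta>) / \<eta> = \<eta>"
    then have "- (1 + \<eta>) = \<eta> * \<eta>" using eta_nonzero by (simp add: divide_eq_eq)
    then have "\<eta>\<^sup>2 + (1 + \<eta>) = 0" by (metis add.left_inverse add.commute power2_eq_square)
    then show False using g by (simp add: algebra_simps)
  qed
  from assms have "n = 1 \<or> n = 2 \<or> n = 3 \<or> n = 4 \<or> n = 5" by linarith
  then show False using fx d e1 e2 by (auto simp only: sigma_iter_eta_delta)
qed

lemma theta_conjugates_distinct:
  assumes "i < j" "j < 6"
  shows "(\<sigma> ^^ i) \<theta> \<noteq> (\<sigma> ^^ j) \<theta>"
proof
  assume eq: "(\<sigma> ^^ i) \<theta> = (\<sigma> ^^ j) \<theta>"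
  have "(\<sigma> ^^ (6 - j + i)) \<theta> = (\<sigma> ^^ (6 - j)) ((\<sigma> ^^ i) \<theta>)" by (simp add: funpow_add)
  also have "\<dots> = (\<sigma> ^^ (6 - j + j)) \<theta>" by (simp add: eq funpow_add)
  also have "\<dots> = \<theta>" using assms sigma6[OF theta_mem_K] by simp
  finally have "(\<sigma> ^^ (6 - j + i)) \<theta> = \<theta>" .
  moreover have b: "0 < 6 - j + i" "6 - j + i < 6" using assms by auto
  ultimately show False using theta_not_fixed[OF b] by (elim notE)
qed

text \<open>A relation among the powers is a polynomial of degree at most 5 with six distinct roots.
  That the powers span follows by comparing dimensions with the tower basis.\<close>

lemma power_basis:
  assumes z: "z \<in> K" and dist: "\<And>i j. i < j \<Longrightarrow> j < 6 \<Longrightarrow> (\<sigma> ^^ i) z \<noteq> (\<sigma> ^^ j) z"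
  shows "coord_indep 6 ((^) z)" "K = range (coord_sum 6 ((^) z))"
proof -
  show ind: "coord_indep 6 ((^) z)"
    unfolding coord_indep_def
  proof (intro allI impI)
    fix a k assume a: "coord_sum 6 ((^) z) a = 0" and k: "k < (6 :: nat)"
    define P :: "complex poly" where "P = (\<Sum>i<6. monom (of_rat (a i)) i)"
    have cP: "poly.coeff P i = (if i < 6 then of_rat (a i) else 0)" for i
      unfolding P_def coeff_sum by (simp add: coeff_monom if_distrib cong: if_cong)
    have ev: "poly P x = coord_sum 6 ((^) x) a" for x
      by (simp add: P_def poly_sum poly_monom coord_sum_def)
    have "poly P ((\<sigma> ^^ i) z) = 0" for i
    proof -
      have "(\<sigma> ^^ i) (coord_sum 6 ((^) z) a) = (\<Sum>k<6. (\<sigma> ^^ i) (of_rat (a k) * z ^ k))"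
        unfolding coord_sum_def by (rule sigma_iter_sum) (auto intro!: K_closed(4,9,13) z)
      also have "\<dots> = (\<Sum>k<6. of_rat (a k) * (\<sigma> ^^ i) z ^ k)"
        by (intro sum.cong) (auto simp: sigma_iter_mult sigma_iter_power z K_closed)
      finally show ?thesis using a by (simp add: ev coord_sum_def)
    qed
    then have sub: "(\<lambda>i. (\<sigma> ^^ i) z) ` {..<6} \<subseteq> {x. poly P x = 0}" by auto
    have inj: "inj_on (\<lambda>i. (\<sigma> ^^ i) z) {..<6}"
      by (rule inj_onI) (metis dist lessThan_iff linorder_neqE_nat)
    have "P = 0"
    proof (rule ccontr)
      assume "P \<noteq> 0"
      then have "card {x. poly P x = 0} \<le> degree P" and fin: "finite {x. poly P x = 0}"
        by (auto simp: card_poly_roots_bound poly_roots_finite)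
      moreover have "degree P \<le> 5" by (rule degree_le) (simp add: cP)
      moreover have "6 \<le> card {x. poly P x = 0}"
        using card_mono[OF fin sub] by (simp add: card_image[OF inj])
      ultimately show False by simp
    qed
    then show "a k = 0" using cP[of k] k by simp
  qed
  note B = coord_indep_imp_independent[OF ind]
  let ?B = "((^) z) ` {..<6}"
  let ?t = "tower_basis \<eta> \<delta>"
  have spanB: "rat_vs.span ?B = range (coord_sum 6 ((^) z))" by (rule span_eq_coord_sums)
  have spant: "rat_vs.span (?t ` {..<6}) = K" using span_eq_coord_sums K_eq unfolding tower_def by metis
  have "rat_vs.span ?B \<subseteq> K"
    unfolding spanB using subfield_power_sum[OF K_subfield z] by blast
  moreover have "x \<in> rat_vs.span ?B" if "x \<in> K" for x
  proof (rule ccontr)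
    assume x: "x \<notin> rat_vs.span ?B"
    then have "rat_vs.independent (insert x ?B)" using B(2) by (rule rat_vs.independent_insertI)
    moreover have "insert x ?B \<subseteq> rat_vs.span (?t ` {..<6})"
      unfolding spant using that K_closed(9)[OF z] by auto
    ultimately have "card (insert x ?B) \<le> card (?t ` {..<6})"
      using rat_vs.independent_span_bound[of "?t ` {..<6}" "insert x ?B"] by simp
    moreover have "x \<notin> ?B" using x by (rule contrapos_nn) (rule rat_vs.span_base)
    moreover have "card ?B = 6" using B(1) by (simp add: card_image)
    moreover have "card (?t ` {..<6}) \<le> 6" using card_image_le[of "{..<6}" ?t] by simp
    ultimately show False by simp
  qed
  ultimately show "K = range (coord_sum 6 ((^) z))" using spanB by blast
qed

lemma primitiveI:
  assumes "z \<in> A" "\<And>i j. i < j \<Longrightarrow> j < 6 \<Longrightarrow> (\<sigma> ^^ i) z \<noteq> (\<sigma> ^^ j) z"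
  shows "z \<in> primitive_integers K"
proof -
  have z: "z \<in> K" using assms(1) by (simp add: A_iff)
  have "K = range (coord_sum 6 ((^) z))" by (rule power_basis(2)[OF z]) (rule assms(2))
  then have "K \<subseteq> rat_adjoin z"
    by (simp add: image_subset_iff subfield_power_sum[OF rat_adjoin_subfield rat_adjoin_self])
  moreover have "rat_adjoin z \<subseteq> K" by (rule rat_adjoin_least[OF K_subfield z])
  ultimately show ?thesis using assms(1) by (simp add: primitive_integers_def A_def)
qed

text \<open>Two given conjugates can coincide for one value of k only, since those of \<theta> are
  distinct. The shift contains the factor N, so it is invisible modulo N.\<close>

lemma primitive_shift:
  assumes \<alpha>: "\<alpha> \<in> A" and N: "N \<noteq> (0 :: int)"
  obtains k :: int where "\<alpha> + of_int (N * k) * \<theta> \<in> primitive_integers K"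
    "\<And>i j. i < j \<Longrightarrow> j < 6 \<Longrightarrow> (\<sigma> ^^ i) (\<alpha> + of_int (N * k) * \<theta>) \<noteq> (\<sigma> ^^ j) (\<alpha> + of_int (N * k) * \<theta>)"
proof -
  have K: "\<alpha> \<in> K" "\<theta> \<in> K" using \<alpha> theta_mem_K by (auto simp: A_iff)
  \<comment> \<open>The value of k at which conjugates i and j agree. For i = j division by zero
    makes it 0, which merely excludes k = 0 as well.\<close>
  define f where "f i j = ((\<sigma> ^^ j) \<alpha> - (\<sigma> ^^ i) \<alpha>) / (of_int N * ((\<sigma> ^^ i) \<theta> - (\<sigma> ^^ j) \<theta>))" for i j
  define bad where "bad = (\<lambda>(i, j). f i j) ` ({..<6} \<times> {..<6})"
  have "finite bad" by (simp add: bad_def)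
  then have "finite {k :: int. of_int k \<in> bad}"
    by (rule finite_vimageI[of bad of_int, unfolded vimage_def]) (simp add: inj_def)
  then obtain k :: int where k: "of_int k \<notin> bad"
    using infinite_UNIV_int by (metis (mono_tags, lifting) ex_new_if_finite mem_Collect_eq)
  have conj: "(\<sigma> ^^ i) (\<alpha> + of_int (N * k) * \<theta>) = (\<sigma> ^^ i) \<alpha> + of_int (N * k) * (\<sigma> ^^ i) \<theta>" for i
    using K sigma_iter_int[of i "N * k"] by (simp only: sigma_iter_add sigma_iter_mult K_closed(4,10))
  have dist: "(\<sigma> ^^ i) (\<alpha> + of_int (N * k) * \<theta>) \<noteq> (\<sigma> ^^ j) (\<alpha> + of_int (N * k) * \<theta>)" if "i < j" "j < 6" for i j
  proof
    assume "(\<sigma> ^^ i) (\<alpha> + of_int (N * k) * \<theta>) = (\<sigma> ^^ j) (\<alpha> + of_int (N * k) * \<theta>)"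
    then have "of_int k * (of_int N * ((\<sigma> ^^ i) \<theta> - (\<sigma> ^^ j) \<theta>)) = (\<sigma> ^^ j) \<alpha> - (\<sigma> ^^ i) \<alpha>"
      unfolding conj by (simp add: algebra_simps)
    moreover have "of_int N * ((\<sigma> ^^ i) \<theta> - (\<sigma> ^^ j) \<theta>) \<noteq> 0"
      using theta_conjugates_distinct[OF that] N by simp
    ultimately have "of_int k = f i j" unfolding f_def by (simp add: field_simps)
    then have "of_int k \<in> bad" using that by (force simp: bad_def)
    then show False using k by simp
  qed
  have "\<alpha> + of_int (N * k) * \<theta> \<in> A" by (intro A.ring_mem \<alpha> theta_mem_A)
  then show ?thesis using that[of k] primitiveI dist by blast
qed

text \<open>The integers Tr (z^i x) arise from the rational coordinates of x through the Gram matrix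
  of the powers of z; its adjugate turns them into d times the coordinates, with d the
  determinant.\<close>

lemma integral_coordinates:
  assumes z: "z \<in> A" and B: "coord_indep 6 ((^) z)" "K = range (coord_sum 6 ((^) z))"
  obtains d :: int where "d \<noteq> 0" "\<And>x. x \<in> A \<Longrightarrow> \<exists>n :: nat \<Rightarrow> int. of_int d * x = (\<Sum>i<6. of_int (n i) * z ^ i)"
proof -
  have zK: "z \<in> K" using z by (simp add: A_iff)
  have "\<exists>n :: int. Tr x = of_int n" if "x \<in> A" for x
    using Tr_int[of x] that unfolding A_iff by (auto elim: Ints_cases)
  then obtain t :: "complex \<Rightarrow> int" where t: "\<And>x. x \<in> A \<Longrightarrow> Tr x = of_int (t x)" by metis
  define G :: "int mat" where "G = mat 6 6 (\<lambda>(i, j). t (z ^ i * z ^ j))"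
  define G' :: "rat mat" where "G' = map_mat of_int G"
  have G: "G \<in> carrier_mat 6 6" and G': "G' \<in> carrier_mat 6 6" by (simp_all add: G_def G'_def)
  have tr: "Tr (z ^ i * z ^ j) = of_int (t (z ^ i * z ^ j))" for i j
    by (intro t A.ring_mem z)
  have "det G' \<noteq> 0"
    by (rule trace_form_nondegenerate[OF B G']) (simp add: tr G'_def G_def)
  moreover have "det G' = of_int (det G)" by (simp add: G'_def)
  ultimately have d: "det G \<noteq> 0" by auto
  have "\<exists>n :: nat \<Rightarrow> int. of_int (det G) * x = (\<Sum>i<6. of_int (n i) * z ^ i)" if x: "x \<in> A" for x
  proof -
    have xK: "x \<in> K" using x by (simp add: A_iff)
    then obtain q where q: "x = coord_sum 6 ((^) z) q" using B(2) by auto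
    define v where "v = vec 6 q"
    define s where "s = vec 6 (\<lambda>i. t (z ^ i * x))"
    have s: "s \<in> carrier_vec 6" and v: "v \<in> carrier_vec 6" by (simp_all add: s_def v_def)
    have Gv: "G' *\<^sub>v v = map_vec of_int s"
    proof (rule eq_vecI)
      fix i assume "i < dim_vec (map_vec rat_of_int s)"
      then have i: "i < 6" by (simp add: s_def)
      have "(of_int (t (z ^ i * x)) :: complex) = Tr (z ^ i * x)"
        by (intro t[symmetric] A.ring_mem z x)
      also have "\<dots> = (\<Sum>k<6. of_rat (q k) * Tr (z ^ i * z ^ k))"
        unfolding q by (intro Tr_coord_sum) (auto intro!: K_closed(4,9) zK)
      also have "\<dots> = of_rat (\<Sum>k<6. of_int (t (z ^ i * z ^ k)) * q k)"
        by (simp add: tr of_rat_sum of_rat_mult mult.commute)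
      finally have "of_rat (of_int (t (z ^ i * x))) = (of_rat (\<Sum>k<6. of_int (t (z ^ i * z ^ k)) * q k) :: complex)"
        by simp
      then have "of_int (t (z ^ i * x)) = (\<Sum>k<6. of_int (t (z ^ i * z ^ k)) * q k)"
        by (simp only: of_rat_eq_iff)
      then show "(G' *\<^sub>v v) $ i = map_vec of_int s $ i"
        using i by (simp add: G'_def G_def v_def s_def scalar_prod_def atLeast0LessThan)
    qed (simp add: G'_def G_def s_def)
    define w where "w = adj_mat G *\<^sub>v s"
    have aG: "adj_mat G' \<in> carrier_mat 6 6" by (rule adj_mat(1)[OF G'])
    have aGi: "adj_mat G \<in> carrier_mat 6 6" by (rule adj_mat(1)[OF G])
    have "of_int (det G) \<cdot>\<^sub>v v = (adj_mat G' * G') *\<^sub>v v"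
      unfolding adj_mat(3)[OF G'] using v by (intro eq_vecI) (simp_all add: G'_def)
    also have "\<dots> = adj_mat G' *\<^sub>v map_vec of_int s"
      using aG G' v by (simp add: Gv)
    also have "adj_mat G' = map_mat of_int (adj_mat G)"
    proof (rule eq_matI)
      fix i j assume "i < dim_row (map_mat rat_of_int (adj_mat G))" "j < dim_col (map_mat rat_of_int (adj_mat G))"
      then have "i < 6" "j < 6" using aGi by auto
      moreover have "mat_delete G' j i = map_mat of_int (mat_delete G j i)"
        unfolding G'_def by (intro eq_matI) (auto simp: mat_delete_def)
      ultimately show "adj_mat G' $$ (i, j) = map_mat of_int (adj_mat G) $$ (i, j)"
        using G G' by (simp add: adj_mat_def cofactor_def)
    qed (use aG aGi in auto)
    also have "map_mat of_int (adj_mat G) *\<^sub>v map_vec of_int s = map_vec of_int w"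
      unfolding w_def using aGi s by (simp add: of_int_hom.mult_mat_vec_hom)
    finally have vw: "of_int (det G) \<cdot>\<^sub>v v = map_vec rat_of_int w" .
    have "of_int (det G) * q i = rat_of_int (w $ i)" if "i < 6" for i
    proof -
      have "(of_int (det G) \<cdot>\<^sub>v v) $ i = map_vec rat_of_int w $ i" using vw by simp
      then show ?thesis using that aGi by (simp add: v_def w_def)
    qed
    then have "of_int (det G) * x = (\<Sum>i<6. of_int (w $ i) * z ^ i)"
      unfolding q using coord_sum_scale[of "of_int (det G)" 6 "(^) z" q]
      by (simp add: coord_sum_def)
    then show ?thesis by (intro exI[of _ "($) w"])
  qed
  then show ?thesis using that d by blast
qed

end

context simplest_sextic_root
begin

text \<open>A common denominator d leaves finitely many representatives, with numerators reduced
  modulo |d|. Finiteness matters because \<open>card\<close> of an infinite set is 0, which every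
  prime divides.\<close>

lemma index_finite:
  assumes z: "z \<in> A" and B: "coord_indep 6 ((^) z)" "K = range (coord_sum 6 ((^) z))"
  shows "finite ((\<lambda>a. (\<lambda>y. a + y) ` int_adjoin z) ` A)"
proof -
  interpret Z: complex_subring "int_adjoin z" by (rule int_adjoin_subring)
  obtain d :: int where d: "d \<noteq> 0"
    "\<And>x. x \<in> A \<Longrightarrow> \<exists>n :: nat \<Rightarrow> int. of_int d * x = (\<Sum>i<6. of_int (n i) * z ^ i)"
    using integral_coordinates[OF z B] by blast
  define F where "F = (\<lambda>c. (\<Sum>i<6. of_int (c i) * z ^ i) / of_int d) ` (PiE {..<6 :: nat} (\<lambda>_. {0..<\<bar>d\<bar>}))"
  have "finite F" unfolding F_def by (intro finite_imageI finite_PiE) auto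
  moreover have "(\<lambda>a. (\<lambda>y. a + y) ` int_adjoin z) ` A \<subseteq> (\<lambda>a. (\<lambda>y. a + y) ` int_adjoin z) ` F"
  proof
    fix C assume "C \<in> (\<lambda>a. (\<lambda>y. a + y) ` int_adjoin z) ` A"
    then obtain a where a: "a \<in> A" "C = (\<lambda>y. a + y) ` int_adjoin z" by auto
    obtain n :: "nat \<Rightarrow> int" where n: "of_int d * a = (\<Sum>i<6. of_int (n i) * z ^ i)"
      using d(2)[OF a(1)] by blast
    define c where "c = restrict (\<lambda>i. n i mod \<bar>d\<bar>) {..<6}"
    define f where "f = (\<Sum>i<6. of_int (c i) * z ^ i) / of_int d"
    \<comment> \<open>The sign of d compensates for the remainder being taken modulo |d|.\<close>
    define k where "k i = (n i div \<bar>d\<bar>) * sgn d" for i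
    define y where "y = (\<Sum>i<6. of_int (k i) * z ^ i)"
    have "y \<in> int_adjoin z" unfolding y_def by (intro Z.sum_mem Z.ring_mem int_adjoin_self)
    have "n i = c i + d * k i" if "i < 6" for i
    proof -
      have "d * k i = \<bar>d\<bar> * (n i div \<bar>d\<bar>)" by (simp add: k_def abs_sgn mult_ac)
      then show ?thesis using that by (simp add: c_def)
    qed
    then have "of_int d * a = (\<Sum>i<6. of_int (c i) * z ^ i) + of_int d * y"
      unfolding n y_def sum_distrib_left sum.distrib[symmetric]
      by (intro sum.cong) (auto simp: algebra_simps)
    then have af: "a = f + y" using d(1) by (simp add: f_def field_simps)
    have "f \<in> F" unfolding F_def f_def
      by (intro imageI PiE_I) (use d(1) in \<open>simp_all add: c_def\<close>)
    moreover have "C = (\<lambda>y. f + y) ` int_adjoin z"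
    proof -
      have "(\<lambda>x. a + x) ` int_adjoin z = (\<lambda>x. f + x) ` int_adjoin z"
      proof (intro equalityI subsetI)
        fix x assume "x \<in> (\<lambda>x. a + x) ` int_adjoin z"
        then obtain u where "u \<in> int_adjoin z" "x = f + (y + u)" using af by (auto simp: add.assoc)
        then show "x \<in> (\<lambda>x. f + x) ` int_adjoin z"
          using Z.add_mem[OF \<open>y \<in> int_adjoin z\<close>] by blast
      next
        fix x assume "x \<in> (\<lambda>x. f + x) ` int_adjoin z"
        then obtain u where "u \<in> int_adjoin z" "x = a + (u - y)" using af by auto
        then show "x \<in> (\<lambda>x. a + x) ` int_adjoin z"
          using Z.diff_mem[OF _ \<open>y \<in> int_adjoin z\<close>] by blast
      qed
      then show ?thesis by (simp add: a(2))
    qed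
    ultimately show "C \<in> (\<lambda>a. (\<lambda>y. a + y) ` int_adjoin z) ` F" by blast
  qed
  ultimately show ?thesis using finite_subset finite_imageI by blast
qed

text \<open>Multiplication by \<open>p\<close> is surjective on the finite group \<open>A / \<int>[z]\<close>, hence injective, so that
  by Cauchy's theorem \<open>p\<close> does not divide its order.\<close>

lemma index_coprime:
  assumes p: "prime p" and z: "z \<in> A"
    and dist: "\<And>i j. i < j \<Longrightarrow> j < 6 \<Longrightarrow> (\<sigma> ^^ i) z \<noteq> (\<sigma> ^^ j) z"
    and gen: "\<And>x. x \<in> A \<Longrightarrow> \<exists>y\<in>int_adjoin z. A.cong_mod (of_nat p) x y"
  shows "\<not> p dvd element_index K z"
proof
  assume "p dvd element_index K z"
  interpret Z: complex_subring "int_adjoin z" by (rule int_adjoin_subring)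
  have zK: "z \<in> K" using z by (simp add: A_iff)
  have ZA: "int_adjoin z \<subseteq> A" by (rule A.int_adjoin_subset[OF z])
  define G :: "complex monoid" where "G = \<lparr>carrier = A, monoid.mult = (+), one = 0\<rparr>"
  have G: "carrier G = A" "\<And>x y. x \<otimes>\<^bsub>G\<^esub> y = x + y" "\<one>\<^bsub>G\<^esub> = 0" by (simp_all add: G_def)
  interpret G: comm_group G
  proof (rule comm_groupI)
    show "\<exists>y\<in>carrier G. y \<otimes>\<^bsub>G\<^esub> x = \<one>\<^bsub>G\<^esub>" if "x \<in> carrier G" for x
      using A.uminus_mem[of x] that by (intro bexI[of _ "- x"]) (auto simp: G)
  qed (auto simp: G add_ac intro: A.add_mem A.zero_mem)
  have inv: "inv\<^bsub>G\<^esub> x = - x" if "x \<in> A" for x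
    using that A.uminus_mem[of x] by (intro G.inv_equality) (auto simp: G)
  have "subgroup (int_adjoin z) G"
    by standard (use ZA in \<open>auto simp: G inv Z.add_mem Z.zero_mem Z.uminus_mem subsetD\<close>)
  then have nor: "int_adjoin z \<lhd> G" by (rule G.subgroup_imp_normal)
  define Q where "Q = G Mod int_adjoin z"
  interpret Q: group Q unfolding Q_def by (rule normal.factorgroup_is_group[OF nor])
  define cl where "cl a = int_adjoin z #>\<^bsub>G\<^esub> a" for a
  have cl_eq: "cl a = (\<lambda>y. a + y) ` int_adjoin z" for a
    by (auto simp: cl_def r_coset_def G add.commute)
  have carrQ: "carrier Q = cl ` A" by (auto simp: Q_def FactGroup_def RCOSETS_def cl_def G)
  have card: "card (carrier Q) = element_index K z"
    unfolding carrQ element_index_def A_def by (simp add: cl_eq[abs_def])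
  have fin: "finite (carrier Q)"
    unfolding carrQ cl_eq[abs_def] by (intro index_finite z power_basis(1)[OF zK] power_basis(2)[OF zK] dist)
  have cl_mult: "cl a \<otimes>\<^bsub>Q\<^esub> cl b = cl (a + b)" if "a \<in> A" "b \<in> A" for a b
    using normal.rcos_sum[OF nor, of a b] that by (simp add: Q_def FactGroup_def cl_def G)
  have cl_one: "\<one>\<^bsub>Q\<^esub> = cl 0"
    by (simp add: Q_def FactGroup_def cl_eq)
  have cl_pow: "cl a [^]\<^bsub>Q\<^esub> n = cl (of_nat n * a)" if "a \<in> A" for a and n :: nat
  proof (induction n)
    case (Suc n)
    then show ?case
      using cl_mult[of "of_nat n * a" a] that by (simp add: A.ring_mem algebra_simps)
  qed (simp add: cl_one)
  have surj: "(\<lambda>c. c [^]\<^bsub>Q\<^esub> p) ` carrier Q = carrier Q"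
  proof
    show "(\<lambda>c. c [^]\<^bsub>Q\<^esub> p) ` carrier Q \<subseteq> carrier Q" by auto
    show "carrier Q \<subseteq> (\<lambda>c. c [^]\<^bsub>Q\<^esub> p) ` carrier Q"
    proof
      fix c assume "c \<in> carrier Q"
      then obtain a where a: "a \<in> A" "c = cl a" using carrQ by auto
      obtain y w where y: "y \<in> int_adjoin z" "w \<in> A" "a - y = of_nat p * w"
        using gen[OF a(1)] unfolding A.cong_mod_def by blast
      have "a = y + of_nat p * w" using y(3) by (simp add: algebra_simps)
      then have "c = cl y \<otimes>\<^bsub>Q\<^esub> cl (of_nat p * w)"
        using a cl_mult[of y "of_nat p * w"] ZA y by (auto simp: A.ring_mem)
      also have "cl y = \<one>\<^bsub>Q\<^esub>"
        unfolding cl_def Q_def using G.coset_join2[OF _ \<open>subgroup (int_adjoin z) G\<close> y(1)] ZA y(1)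
        by (auto simp: G FactGroup_def)
      also have "\<one>\<^bsub>Q\<^esub> \<otimes>\<^bsub>Q\<^esub> cl (of_nat p * w) = cl w [^]\<^bsub>Q\<^esub> p"
        using cl_pow[OF y(2)] carrQ y(2) by (simp add: A.ring_mem)
      finally show "c \<in> (\<lambda>c. c [^]\<^bsub>Q\<^esub> p) ` carrier Q" using carrQ y(2) by blast
    qed
  qed
  have inj: "inj_on (\<lambda>c. c [^]\<^bsub>Q\<^esub> p) (carrier Q)"
    by (rule eq_card_imp_inj_on[OF fin]) (simp add: surj)
  obtain n where "order Q = p ^ 1 * n"
    using \<open>p dvd element_index K z\<close> card unfolding order_def by (auto elim: dvdE)
  then obtain H where H: "subgroup H Q" "card H = p"
    using sylow_thm[OF p Q.is_group _ fin, of 1 n] by auto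
  have "card H > 1" using H(2) prime_gt_1_nat[OF p] by simp
  then have "\<not> H \<subseteq> {\<one>\<^bsub>Q\<^esub>}" using card_mono[of "{\<one>\<^bsub>Q\<^esub>}" H] by auto
  then obtain x where x: "x \<in> H" "x \<noteq> \<one>\<^bsub>Q\<^esub>" by auto
  interpret H: group "Q\<lparr>carrier := H\<rparr>" by (rule subgroup.subgroup_is_group[OF H(1) Q.is_group])
  have "x [^]\<^bsub>Q\<lparr>carrier := H\<rparr>\<^esub> order (Q\<lparr>carrier := H\<rparr>) = \<one>\<^bsub>Q\<lparr>carrier := H\<rparr>\<^esub>"
    by (rule H.pow_order_eq_1) (simp add: x)
  then have "x [^]\<^bsub>Q\<^esub> p = \<one>\<^bsub>Q\<^esub>"
    using H(2) by (simp add: order_def flip: Q.nat_pow_consistent)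
  moreover have "\<one>\<^bsub>Q\<^esub> [^]\<^bsub>Q\<^esub> p = \<one>\<^bsub>Q\<^esub>" by simp
  moreover have "x \<in> carrier Q" using subgroup.subset[OF H(1)] x(1) by blast
  ultimately have "x = \<one>\<^bsub>Q\<^esub>" using inj_onD[OF inj, of x "\<one>\<^bsub>Q\<^esub>"] by simp
  then show False using x(2) by simp
qed

text \<open>A generator z modulo p may fail to be primitive. A shift by a multiple of p \<theta>
  makes its conjugates distinct without changing residues modulo p, and then
  \<open>index_coprime\<close> applies.\<close>

theorem field_index_one:
  assumes gen: "\<And>p. prime p \<Longrightarrow> \<exists>z\<in>A. \<forall>x\<in>A. \<exists>y\<in>int_adjoin z. A.cong_mod (of_nat p) x y"
  shows "field_index K = 1"
proof (rule ccontr)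
  assume "field_index K \<noteq> 1"
  then obtain p where p: "prime p" "p dvd field_index K" using prime_factor_nat by blast
  obtain z where z: "z \<in> A" "\<And>x. x \<in> A \<Longrightarrow> \<exists>y\<in>int_adjoin z. A.cong_mod (of_nat p) x y"
    using gen[OF p(1)] by blast
  have "int p \<noteq> 0" using p(1) by auto
  then obtain k :: int where k: "z + of_int (int p * k) * \<theta> \<in> primitive_integers K"
    "\<And>i j. i < j \<Longrightarrow> j < 6 \<Longrightarrow> (\<sigma> ^^ i) (z + of_int (int p * k) * \<theta>) \<noteq> (\<sigma> ^^ j) (z + of_int (int p * k) * \<theta>)"
    using primitive_shift[OF z(1)] by blast
  define u where "u = z + of_int (int p * k) * \<theta>"
  have u: "u \<in> A" unfolding u_def by (intro A.ring_mem z theta_mem_A)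
  interpret R: complex_subring "{x \<in> A. \<exists>y\<in>int_adjoin u. A.cong_mod (of_nat p) x y}"
    by (rule A.residue_subring[OF u])
  have "z - u = of_nat p * (- of_int k * \<theta>)" by (simp add: u_def)
  moreover have "- of_int k * \<theta> \<in> A" by (intro A.ring_mem theta_mem_A)
  ultimately have "A.cong_mod (of_nat p) z u" by (rule A.cong_modI)
  then have "z \<in> {x \<in> A. \<exists>y\<in>int_adjoin u. A.cong_mod (of_nat p) x y}"
    using z(1) int_adjoin_self by blast
  then have sub: "int_adjoin z \<subseteq> {x \<in> A. \<exists>y\<in>int_adjoin u. A.cong_mod (of_nat p) x y}"
    by (rule R.int_adjoin_subset)
  have "\<exists>y\<in>int_adjoin u. A.cong_mod (of_nat p) x y" if x: "x \<in> A" for x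
  proof -
    obtain y where y: "y \<in> int_adjoin z" "A.cong_mod (of_nat p) x y" using z(2)[OF x] by blast
    then obtain y' where "y' \<in> int_adjoin u" "A.cong_mod (of_nat p) y y'" using sub by blast
    then show ?thesis using A.cong_mod_trans[OF y(2)] by blast
  qed
  then have "\<not> p dvd element_index K u"
    by (intro index_coprime[OF p(1) u]) (use k(2) in \<open>auto simp: u_def\<close>)
  moreover have "field_index K dvd element_index K u"
    unfolding field_index_def using k(1) u_def by (intro Gcd_dvd) auto
  ultimately show False using p(2) dvd_trans by blast
qed

end

lemma local_span_subset:
  assumes S: "complex_subfield F" and sub: "S \<subseteq> F"
  shows "local_span p S \<subseteq> F"
proof
  fix x assume "x \<in> local_span p S"
  then show "x \<in> F"
  proof induction
    case (local_span_base x)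
    then show ?case using sub by blast
  qed (intro complex_subfieldD[OF S]; assumption)+
qed

context p_local_order
begin

lemma local_span_residue:
  assumes R: "R = local_span p S" and w: "w \<in> R" and \<rho>: "cong_mod \<rho> (of_nat p) 0"
    and S: "\<And>x. x \<in> S \<Longrightarrow> \<exists>y\<in>int_adjoin w. cong_mod \<rho> x y" and x: "x \<in> R"
  shows "\<exists>y\<in>int_adjoin w. cong_mod \<rho> x y"
proof -
  interpret W: complex_subring "int_adjoin w" by (rule int_adjoin_subring)
  interpret Q: complex_subring "{x \<in> R. \<exists>y\<in>int_adjoin w. cong_mod \<rho> x y}"
    by (rule residue_subring[OF w])
  have "x \<in> local_span p S" using x R by simp
  then have "x \<in> {x \<in> R. \<exists>y\<in>int_adjoin w. cong_mod \<rho> x y}"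
  proof induction
    case (local_span_base x)
    then show ?case using S R local_span.local_span_base by blast
  next
    case (local_span_fraction n a)
    have "of_int a / of_int n \<in> R" using local_span_fraction R local_span.local_span_fraction by blast
    moreover obtain b where "cong_mod \<rho> (of_int a / of_int n) (of_int b)"
      using fraction_residue[OF local_span_fraction \<rho>] by blast
    ultimately show ?case using W.of_int_mem by blast
  next
    case (local_span_add x y)
    then show ?case by (intro Q.add_mem)
  next
    case (local_span_mult x y)
    then show ?case by (intro Q.mult_mem)
  qed
  then show ?thesis by blast
qed

text \<open>Both \<phi> and the power map are ring homomorphisms modulo \<rho>, the latter because
  \<rho> divides p, so their agreement passes from \<open>S\<close> to the ring it
  generates.\<close>

lemma local_span_Frobenius:
  assumes R: "R = local_span p S" and \<rho>: "cong_mod \<rho> (of_nat p) 0"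
    and S: "\<And>x. x \<in> S \<Longrightarrow> \<phi> x \<in> R \<and> cong_mod \<rho> (x ^ (p ^ s)) (\<phi> x)"
    and \<phi>: "\<And>q. \<phi> (of_rat q) = of_rat q" "\<And>x y. x \<in> R \<Longrightarrow> y \<in> R \<Longrightarrow> \<phi> (x + y) = \<phi> x + \<phi> y"
      "\<And>x y. x \<in> R \<Longrightarrow> y \<in> R \<Longrightarrow> \<phi> (x * y) = \<phi> x * \<phi> y" and x: "x \<in> R"
  shows "\<phi> x \<in> R \<and> cong_mod \<rho> (x ^ (p ^ s)) (\<phi> x)"
proof -
  have "x \<in> local_span p S" using x R by simp
  then show ?thesis
  proof induction
    case (local_span_base x)
    then show ?case by (rule S)
  next
    case (local_span_fraction n a)
    have mem: "of_int a / of_int n \<in> R" using local_span_fraction R local_span.local_span_fraction by blast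
    have "\<phi> (of_int a / of_int n) = of_int a / of_int n"
      using \<phi>(1)[of "of_int a / of_int n"] by (simp add: of_rat_divide)
    moreover obtain b where b: "cong_mod \<rho> (of_int a / of_int n) (of_int b)"
      using fraction_residue[OF local_span_fraction \<rho>] by blast
    moreover have "cong_mod \<rho> ((of_int a / of_int n) ^ (p ^ s)) (of_int b ^ (p ^ s))"
      by (intro cong_mod_power b mem of_int_mem)
    moreover have "cong_mod \<rho> (of_int b ^ (p ^ s)) (of_int b)"
      by (rule cong_mod_coarsen'[OF cong_mod_Frobenius_of_int[OF p] \<rho>])
    ultimately show ?case using mem cong_mod_sym cong_mod_trans by metis
  next
    case (local_span_add x y)
    then have mem: "x \<in> R" "y \<in> R" using R by auto
    have "cong_mod \<rho> ((x + y) ^ (p ^ s)) (x ^ (p ^ s) + y ^ (p ^ s))"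
      by (rule cong_mod_coarsen'[OF cong_mod_Frobenius_add[OF p mem] \<rho>])
    also have "cong_mod \<rho> (x ^ (p ^ s) + y ^ (p ^ s)) (\<phi> x + \<phi> y)"
      using local_span_add by (intro cong_mod_add) auto
    finally show ?case using local_span_add \<phi>(2)[OF mem] add_mem by auto
  next
    case (local_span_mult x y)
    then have mem: "x \<in> R" "y \<in> R" using R by auto
    have "cong_mod \<rho> (x ^ (p ^ s) * y ^ (p ^ s)) (\<phi> x * \<phi> y)"
      using local_span_mult mem by (intro cong_mod_mult power_mem) auto
    then show ?case using local_span_mult \<phi>(3)[OF mem] mult_mem by (auto simp: power_mult_distrib)
  qed
qed

end

section \<open>From local orders to generators of \<open>A\<close> modulo p\<close>

context simplest_sextic_root
begin

text \<open>Denominators prime to p are units of \<open>R\<close>, so powers of p are the only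
  obstruction.\<close>

lemma p_fractions:
  assumes R: "p_local_order R p" and mem: "\<eta> \<in> R" "\<delta> \<in> R" and x: "x \<in> K"
  shows "\<exists>k. of_nat p ^ k * x \<in> R"
  using x
proof (induction rule: K_induct)
  case eta
  show ?case using mem by (intro exI[of _ 0]) simp
next
  case delta
  show ?case using mem by (intro exI[of _ 0]) simp
next
  case (rat q)
  interpret p_local_order R p by (rule R)
  obtain a b where ab: "q = of_int a / of_int b" "b > 0"
    by (metis quotient_of_denom_pos quotient_of_div surj_pair)
  obtain k b' where b: "b = int p ^ k * b'" "\<not> int p dvd b'"
    using multiplicity_decompose'[of b "int p"] ab(2) p
    by (metis less_irrefl not_prime_unit prime_nat_int_transfer)
  have "of_nat p ^ k * of_rat q = (of_int a * (1 / of_int b') :: complex)"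
    using p_pos ab b by (simp add: of_rat_divide of_rat_mult of_rat_power field_simps)
  also have "\<dots> \<in> R" by (intro ring_mem inverse_mem b)
  finally show ?case by blast
next
  case (add x y)
  interpret p_local_order R p by (rule R)
  obtain k l where kl: "of_nat p ^ k * x \<in> R" "of_nat p ^ l * y \<in> R" using add by blast
  have "of_nat p ^ (k + l) * (x + y) = of_nat p ^ l * (of_nat p ^ k * x) + of_nat p ^ k * (of_nat p ^ l * y)"
    by (simp add: power_add algebra_simps)
  also have "\<dots> \<in> R" by (intro ring_mem kl)
  finally show ?case by blast
next
  case (mult x y)
  interpret p_local_order R p by (rule R)
  obtain k l where kl: "of_nat p ^ k * x \<in> R" "of_nat p ^ l * y \<in> R" using mult by blast
  have "of_nat p ^ (k + l) * (x * y) = (of_nat p ^ k * x) * (of_nat p ^ l * y)"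
    by (simp add: power_add algebra_simps)
  also have "\<dots> \<in> R" by (intro ring_mem kl)
  finally show ?case by blast
qed

lemma A_subset_local_order:
  assumes R: "p_local_order R p" and mem: "\<eta> \<in> R" "\<delta> \<in> R"
    and fr: "\<And>x. x \<in> R \<Longrightarrow> complex_subring.cong_mod R \<rho> (x ^ (p ^ s)) x" and s: "s > 0"
    and \<rho>: "\<rho> \<in> R" "\<rho> \<noteq> 0" "complex_subring.cong_mod R (of_nat p) (\<rho> ^ e) 0"
  shows "A \<subseteq> R"
proof
  interpret p_local_order R p by (rule R)
  fix x assume "x \<in> A"
  then have x: "x \<in> K" "algebraic_int x" by (auto simp: A_iff)
  obtain k where k: "of_nat p ^ k * x \<in> R" using p_fractions[OF R mem x(1)] by blast
  show "x \<in> R" by (rule integrally_closed[OF _ s \<rho> x(2) k]) (rule fr)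
qed

text \<open>The condition A = \<int>[z] + p A for some z, which is all that
  \<open>field_index_one\<close> asks about p.\<close>

definition monogenic_mod :: "nat \<Rightarrow> bool" where
  "monogenic_mod p \<longleftrightarrow> (\<exists>z\<in>A. \<forall>x\<in>A. \<exists>y\<in>int_adjoin z. A.cong_mod (of_nat p) x y)"

text \<open>Two descents from \<open>R\<close> to \<open>A\<close>. The generator \<zeta> becomes
  integral after multiplication by an integer prime to p, which is inverted modulo p. The quotient r
  of x - y' by p is integral because p r is, and l r is for some l prime to p.\<close>

lemma monogenic_modI:
  assumes R: "p_local_order R p" "R \<subseteq> K" "A \<subseteq> R" and \<zeta>: "\<zeta> \<in> R"
    and gen: "\<And>x. x \<in> R \<Longrightarrow> \<exists>y\<in>int_adjoin \<zeta>. complex_subring.cong_mod R (of_nat p) x y"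
  shows "monogenic_mod p"
proof -
  interpret p_local_order R p by (rule R)
  obtain n where n: "\<not> int p dvd n" "algebraic_int (of_int n * \<zeta>)"
    using p_int[OF \<zeta>] unfolding p_integral_def by blast
  define z where "z = of_int n * \<zeta>"
  have zR: "z \<in> R" unfolding z_def by (intro ring_mem \<zeta>)
  then have z: "z \<in> A" using n R(2) by (auto simp: A_iff z_def)
  interpret Z: complex_subring "int_adjoin z" by (rule int_adjoin_subring)
  have "coprime n (int p)"
    using n(1) p by (metis coprime_commute prime_imp_coprime prime_nat_int_transfer)
  then obtain n' where "[n * n' = 1] (mod int p)" by (meson cong_solve_coprime_int)
  then have "cong_mod (of_nat p) (of_int (n * n')) (of_int 1)" by (rule cong_mod_of_int)
  then have "cong_mod (of_nat p) (\<zeta> * of_int 1) (\<zeta> * of_int (n * n'))"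
    by (intro cong_mod_scale \<zeta>) (rule cong_mod_sym)
  then have \<zeta>z: "cong_mod (of_nat p) \<zeta> (of_int n' * z)" by (simp add: z_def mult_ac)
  interpret Q: complex_subring "{x \<in> R. \<exists>y\<in>int_adjoin z. cong_mod (of_nat p) x y}"
    by (rule residue_subring[OF zR])
  have "of_int n' * z \<in> int_adjoin z" by (intro Z.ring_mem int_adjoin_self)
  then have "\<zeta> \<in> {x \<in> R. \<exists>y\<in>int_adjoin z. cong_mod (of_nat p) x y}" using \<zeta> \<zeta>z by blast
  then have sub: "int_adjoin \<zeta> \<subseteq> {x \<in> R. \<exists>y\<in>int_adjoin z. cong_mod (of_nat p) x y}"
    by (rule Q.int_adjoin_subset)
  have "\<exists>y\<in>int_adjoin z. A.cong_mod (of_nat p) x y" if x: "x \<in> A" for x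
  proof -
    obtain y where y: "y \<in> int_adjoin \<zeta>" "cong_mod (of_nat p) x y" using gen x R(3) by blast
    then obtain y' where y': "y' \<in> int_adjoin z" "cong_mod (of_nat p) y y'" using sub by blast
    then have "cong_mod (of_nat p) x y'" using cong_mod_trans[OF y(2)] by blast
    then obtain r where r: "r \<in> R" "x - y' = of_nat p * r" unfolding cong_mod_def by blast
    obtain l where l: "\<not> int p dvd l" "algebraic_int (of_int l * r)"
      using p_int[OF r(1)] unfolding p_integral_def by blast
    have y'A: "y' \<in> A" using A.int_adjoin_subset[OF z] y'(1) by blast
    have pr: "algebraic_int (of_int (int p) * r)"
      using r(2) A.diff_mem[OF x y'A] by (simp add: A_iff)
    have "coprime l (int p)"
      using l(1) p by (metis coprime_commute prime_imp_coprime prime_nat_int_transfer)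
    then obtain a b where ab: "a * l + b * int p = 1"
      using bezout_int[of l "int p"] by (auto simp: coprime_iff_gcd_eq_1)
    have "r = of_int (a * l + b * int p) * r" by (simp add: ab)
    also have "\<dots> = of_int a * (of_int l * r) + of_int b * (of_int (int p) * r)"
      by (simp add: algebra_simps)
    finally have "algebraic_int r"
      using l(2) pr by (metis algebraic_int_add algebraic_int_mult algebraic_int_of_int)
    then have "r \<in> A" using r(1) R(2) by (auto simp: A_iff)
    then have "A.cong_mod (of_nat p) x y'" using r(2) by (intro A.cong_modI)
    then show ?thesis using y'(1) by blast
  qed
  then show ?thesis unfolding monogenic_mod_def using z by blast
qed

text \<open>Here p itself plays the part of \<rho>, so a generator of the residue ring is already a
  generator modulo p.\<close>

theorem monogenic_unramified:
  assumes R: "p_local_order R p" "R \<subseteq> K" and mem: "\<eta> \<in> R" "\<delta> \<in> R"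
    and w: "w \<in> R" and gen: "\<And>x. x \<in> R \<Longrightarrow> \<exists>y\<in>int_adjoin w. complex_subring.cong_mod R (of_nat p) x y"
    and s: "s > 0" and wq: "complex_subring.cong_mod R (of_nat p) (w ^ (p ^ s)) w"
  shows "A \<subseteq> R" "monogenic_mod p"
proof -
  interpret p_local_order R p by (rule R)
  have "cong_mod (of_nat p) (x ^ (p ^ s)) x" if "x \<in> R" for x
    by (intro Frobenius_fixed[OF cong_mod_self w wq gen] that)
  then show sub: "A \<subseteq> R"
    by (rule A_subset_local_order[OF R(1) mem _ s, of _ 1]) (use p_pos in \<open>auto intro: of_nat_mem cong_mod_self\<close>)
  show "monogenic_mod p" by (rule monogenic_modI[OF R sub w gen])
qed

text \<open>Since \<rho>^2 divides p, the residue generator can be corrected by the uniformizer as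
  in \<open>single_generator\<close>.\<close>

theorem monogenic_ramified:
  assumes R: "p_local_order R p" "R \<subseteq> K" and mem: "\<eta> \<in> R" "\<delta> \<in> R"
    and w: "w \<in> R" and gen: "\<And>x. x \<in> R \<Longrightarrow> \<exists>y\<in>int_adjoin w. complex_subring.cong_mod R \<rho> x y"
    and s: "s > 0" and wq: "complex_subring.cong_mod R \<rho> (w ^ (p ^ s)) w"
    and \<rho>: "\<rho> \<in> R" "complex_subring.cong_mod R (of_nat p) (\<rho> ^ e) 0"
      "complex_subring.cong_mod R (\<rho>\<^sup>2) (of_nat p) 0"
  shows "A \<subseteq> R" "monogenic_mod p"
proof -
  interpret p_local_order R p by (rule R)
  have "cong_mod \<rho> (\<rho>\<^sup>2) 0"
    by (rule cong_modI[of _ _ _ \<rho>]) (auto simp: power2_eq_square \<rho>(1))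
  then have p0: "cong_mod \<rho> (of_nat p) 0" using cong_mod_coarsen'[OF \<rho>(3)] by blast
  have "\<rho> \<noteq> 0" using p0 p_pos by (auto simp: cong_mod_def)
  have "cong_mod \<rho> (x ^ (p ^ s)) x" if "x \<in> R" for x
    by (intro Frobenius_fixed[OF p0 w wq gen] that)
  then show sub: "A \<subseteq> R"
    by (rule A_subset_local_order[OF R(1) mem _ s \<rho>(1) \<open>\<rho> \<noteq> 0\<close> \<rho>(2)])
  obtain \<zeta> where "\<zeta> \<in> R" "\<And>x. x \<in> R \<Longrightarrow> \<exists>y\<in>int_adjoin \<zeta>. cong_mod (of_nat p) x y"
    using single_generator[OF w gen s wq \<rho>] by blast
  then show "monogenic_mod p" by (intro monogenic_modI[OF R sub])
qed

end

section \<open>Primes p >= 5 dividing D\<close>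

lemma int_Fermat:
  assumes "prime p" "\<not> int p dvd u"
  shows "[u ^ (p - 1) = 1] (mod int p)"
proof -
  have p: "p > 0" using assms(1) by (simp add: prime_gt_0_nat)
  define n where "n = nat (u mod int p)"
  have n: "int n = u mod int p" using p by (simp add: n_def)
  have "\<not> p dvd n" using assms(2) n by (metis dvd_mod_iff dvd_refl int_dvd_int_iff)
  then have "[n ^ (p - 1) = 1] (mod p)" using assms(1) by (intro fermat_theorem)
  then have "[int n ^ (p - 1) = 1] (mod int p)" by (metis cong_int_iff of_nat_1 of_nat_power)
  moreover have "[u ^ (p - 1) = int n ^ (p - 1)] (mod int p)"
    unfolding n by (intro cong_pow) (simp add: cong_def)
  ultimately show ?thesis using cong_trans by blast
qed

text \<open>The cofactor of p - 1 in p^6 - 1 is a sum of six powers of p, divisible by 6 because p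
  is 1 or -1 modulo 6. The factor 6 serves to reach w^6, an integer modulo \<rho>, and the factor p
  - 1 to apply Fermat's theorem to it.\<close>

lemma pow6_minus_1:
  assumes "prime (p :: nat)" "p \<ge> 5"
  obtains N where "p ^ 6 = 1 + 6 * ((p - 1) * N)"
proof -
  have "\<not> 2 dvd p" "\<not> 3 dvd p" using assms primes_dvd_imp_eq[of 2 p] primes_dvd_imp_eq[of 3 p] by auto
  then have "p mod 6 = 1 \<or> p mod 6 = 5" by presburger
  then have "6 dvd (p ^ 5 + p ^ 4 + p ^ 3 + p\<^sup>2 + p + 1)"
  proof
    assume "p mod 6 = 1"
    then have "[p = 1] (mod 6)" by (simp add: cong_def)
    then have "[p ^ 5 + p ^ 4 + p ^ 3 + p\<^sup>2 + p + 1 = 1 ^ 5 + 1 ^ 4 + 1 ^ 3 + 1\<^sup>2 + 1 + 1] (mod 6)"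
      by (intro cong_add cong_pow cong_refl)
    then show ?thesis by (simp add: cong_def mod_eq_0_iff_dvd)
  next
    assume "p mod 6 = 5"
    then have "[p = 5] (mod 6)" by (simp add: cong_def)
    then have "[p ^ 5 + p ^ 4 + p ^ 3 + p\<^sup>2 + p + 1 = 5 ^ 5 + 5 ^ 4 + 5 ^ 3 + 5\<^sup>2 + 5 + 1] (mod 6)"
      by (intro cong_add cong_pow cong_refl)
    then show ?thesis by (simp add: cong_def mod_eq_0_iff_dvd)
  qed
  then obtain N where N: "p ^ 5 + p ^ 4 + p ^ 3 + p\<^sup>2 + p + 1 = 6 * N" by (elim dvdE)
  obtain r where r: "p = Suc r" using assms(2) by (cases p) auto
  have "p ^ 6 = 1 + (p - 1) * (p ^ 5 + p ^ 4 + p ^ 3 + p\<^sup>2 + p + 1)"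
    by (simp add: r eval_nat_numeral algebra_simps)
  then have "p ^ 6 = 1 + 6 * ((p - 1) * N)" unfolding N by simp
  then show ?thesis by (rule that)
qed

text \<open>Meant for the exponent k of p in D: d = gcd k 6, e = 6 / d and a k1 - b e = 1. As Z has
  p-adic valuation k / 6 = k1 / e, the quotient Z^a / p^b has valuation 1 / e; so e is the
  ramification index and the quotient a uniformizer.\<close>

lemma sixth_exponents:
  assumes "k > (0 :: nat)"
  obtains d e a b k1 :: nat where "d * e = 6" "k = d * k1" "a * k1 = e * b + 1"
proof -
  define q where "q = k div 6"
  define r where "r = k mod 6"
  have k: "k = 6 * q + r" by (simp add: q_def r_def)
  have "r = 0 \<or> r = 1 \<or> r = 2 \<or> r = 3 \<or> r = 4 \<or> r = 5" unfolding r_def by presburger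
  then consider "k = 6 * q" | "k = 6 * q + 1" | "k = 6 * q + 2" | "k = 6 * q + 3" | "k = 6 * q + 4" | "k = 6 * q + 5"
    using k by auto
  then show ?thesis
  proof cases
    case 1
    then have "q > 0" using assms by simp
    then show ?thesis using that[of 6 1 q 1 "q - 1"] 1 by simp
  next
    case 2
    then show ?thesis using that[of 1 6 k 1 q] by simp
  next
    case 3
    then show ?thesis using that[of 2 3 "3 * q + 1" 1 q] by simp
  next
    case 4
    then show ?thesis using that[of 3 2 "2 * q + 1" 1 q] by simp
  next
    case 5
    then show ?thesis using that[of 2 3 "3 * q + 2" 2 "2 * q + 1"] by simp
  next
    case 6
    then show ?thesis using that[of 1 6 k 5 "5 * q + 4"] by simp
  qed
qed

context simplest_sextic_root
begin

text \<open>The shift of 3 \<eta> to trace 0; D divides all coefficients of its cubic below the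
  leading one (\<open>T_cubic\<close>).\<close>

definition T :: complex where "T = 3 * \<eta> - M"
definition c :: int where "c = 2 * m + 3"

text \<open>Shows that a prime p >= 5 dividing D cannot divide c.\<close>

lemma four_D: "4 * D = c\<^sup>2 + 27"
  by (simp add: D_def c_def power2_eq_square algebra_simps)

lemma T_cubic: "T ^ 3 = of_int D * (3 * T + of_int c)"
proof -
  have "T ^ 3 - of_int D * (3 * T + of_int c) = 27 * (\<eta> ^ 3 - M * \<eta>\<^sup>2 - (M + 3) * \<eta> - 1)"
    by (simp add: T_def D_def c_def algebra_simps eval_nat_numeral)
  also have "\<dots> = 0" using eta_cubic by simp
  finally show ?thesis by simp
qed

lemma T_mem_A: "T \<in> A" unfolding T_def by (intro A.ring_mem eta_mem_A)

text \<open>\<open>Z\<close> is a Kummer generator up to the factor \<open>V\<close>, which is a unit at the primes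
  dividing \<open>D\<close>.\<close>

definition V :: complex where "V = 3 * T + of_int c"
definition Z :: complex where "Z = \<delta> * T\<^sup>2 / of_int D"

text \<open>Since V - c = 3 T, the cubic of T becomes (V - c)^3 = 27 D V. Hence V divides c^3 in
  \<open>A\<close>, which makes 1 / V integral at a prime p >= 5 dividing D.\<close>

lemma V_eq: "V * (V\<^sup>2 - 3 * of_int c * V + 3 * of_int c ^ 2 - 27 * of_int D) = of_int c ^ 3"
proof -
  have "(V - of_int c) ^ 3 = 27 * T ^ 3" by (simp add: V_def power_mult_distrib)
  also have "\<dots> = 27 * of_int D * V" by (simp add: T_cubic V_def)
  finally show ?thesis by (simp add: algebra_simps eval_nat_numeral)
qed

lemma V_mem_A: "V \<in> A" unfolding V_def by (intro A.ring_mem T_mem_A)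

lemma c_nonzero: "c \<noteq> 0" unfolding c_def by presburger

lemma V_nonzero: "V \<noteq> 0" using V_eq c_nonzero by auto

lemma Z_square: "Z\<^sup>2 = T * V"
proof -
  have "Z\<^sup>2 = \<delta>\<^sup>2 * (T * T ^ 3) / of_int D ^ 2"
    by (simp add: Z_def power_divide power_mult_distrib eval_nat_numeral)
  also have "\<dots> = T * V" unfolding delta_square T_cubic V_def[symmetric] using D_nonzero
    by (simp add: power2_eq_square)
  finally show ?thesis .
qed

lemma Z_cube: "Z ^ 3 = \<delta> * V\<^sup>2"
proof -
  have "Z ^ 3 = Z * Z\<^sup>2" by (simp add: eval_nat_numeral)
  also have "\<dots> = \<delta> * T ^ 3 / of_int D * V" by (simp add: Z_square) (simp add: Z_def eval_nat_numeral)
  also have "\<dots> = \<delta> * V\<^sup>2" using D_nonzero by (simp add: T_cubic V_def[symmetric] power2_eq_square)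
  finally show ?thesis .
qed

lemma Z_sixth: "Z ^ 6 = of_int D * V ^ 4"
proof -
  have "Z ^ 6 = (Z ^ 3)\<^sup>2" by (simp flip: power_mult)
  also have "\<dots> = \<delta>\<^sup>2 * V ^ 4" by (simp add: Z_cube power_mult_distrib flip: power_mult)
  finally show ?thesis by (simp add: delta_square)
qed

lemma Z_mem_K: "Z \<in> K"
  unfolding Z_def using T_mem_A delta_mem_K by (intro K_closed) (auto simp: A_iff)

text \<open>In p-adic valuations \<rho> = Z^a / p^b is a uniformizer and w = Z^e / p^k1 a unit, with
  w^d = D' V^4 and \<rho>^e = p w^a. Modulo \<rho> both Z and T vanish and V is the integer c, so w
  alone generates the residue ring, where w^6 is an integer prime to p.\<close>

theorem monogenic_tame:
  assumes p: "prime p" "p \<ge> 5" and pD: "int p dvd D"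
  shows "monogenic_mod p"
proof -
  have p_pos: "p > 0" using p by simp
  have prime_int: "prime (int p)" using p by simp
  have p3: "\<not> int p dvd 3"
    using p primes_dvd_imp_eq[of p 3] by (auto simp flip: int_dvd_int_iff[of p 3, simplified])
  have pc: "\<not> int p dvd c"
  proof
    assume "int p dvd c"
    then have "int p dvd 4 * D - c\<^sup>2" using pD by (simp add: power2_eq_square)
    then have "int p dvd 3 ^ 3" by (simp add: four_D)
    then show False using p3 prime_int prime_dvd_power by blast
  qed
  obtain k D' where D: "D = int p ^ k * D'" "\<not> int p dvd D'"
    using multiplicity_decompose'[of D "int p"] D_nonzero prime_int by (metis not_prime_unit)
  have "k > 0" using D pD by (cases k) auto
  then obtain d e a b k1 where ex: "d * e = 6" "k = d * k1" "a * k1 = e * b + 1"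
    by (rule sixth_exponents)
  have pos: "d > 0" "e > 0" "k1 > 0" using ex \<open>k > 0\<close> by (auto intro: Nat.gr0I)
  define P where "P = (of_nat p :: complex)"
  have P: "P \<noteq> 0" using p_pos by (simp add: P_def)
  define \<rho> w where "\<rho> = Z ^ a / P ^ b" and "w = Z ^ e / P ^ k1"
  have Z0: "Z \<noteq> 0" using Z_sixth D_nonzero V_nonzero by auto
  have D'0: "D' \<noteq> 0" using D D_nonzero by auto
  have wd: "w ^ d = of_int D' * V ^ 4"
  proof -
    have "w ^ d = Z ^ 6 / P ^ k"
      by (simp add: w_def power_divide flip: power_mult) (simp add: ex(1,2) mult.commute[of e d] mult.commute[of k1 d])
    then show ?thesis using P by (simp add: Z_sixth D(1) P_def)
  qed
  have \<rho>e: "\<rho> ^ e = P * w ^ a"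
  proof -
    have "\<rho> ^ e * P ^ (e * b) = Z ^ (e * a)" using P
      by (simp add: \<rho>_def power_divide mult.commute flip: power_mult)
    also have "\<dots> = w ^ a * P ^ (a * k1)" using P
      by (simp add: w_def power_divide mult.commute[of a k1] flip: power_mult)
    also have "\<dots> = w ^ a * P * P ^ (e * b)" by (simp add: ex(3))
    finally show ?thesis using P by simp
  qed
  have \<rho>k: "\<rho> ^ k1 = Z * w ^ b"
  proof -
    have "\<rho> ^ k1 * P ^ (k1 * b) = Z ^ (a * k1)" using P
      by (simp add: \<rho>_def power_divide mult.commute[of b k1] flip: power_mult)
    also have "\<dots> = Z * (w ^ b * P ^ (k1 * b))" using P
      by (simp add: ex(3) w_def power_divide flip: power_mult)
    finally show ?thesis using P by simp
  qed
  define S where "S = {\<rho>, w, V, 1 / V}"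
  define R where "R = local_span p S"
  have pV: "p_integral p V" using V_mem_A p(1) by (simp add: A_iff algebraic_int_imp_p_integral)
  have pV': "p_integral p (1 / V)"
  proof (rule p_integralI)
    show "\<not> int p dvd c ^ 3" using pc prime_int prime_dvd_power by blast
    have "of_int (c ^ 3) * (1 / V) = V\<^sup>2 - 3 * of_int c * V + 3 * of_int c ^ 2 - 27 * of_int D"
      using V_nonzero unfolding of_int_power V_eq[symmetric] by simp
    also have "\<dots> \<in> A" by (intro A.ring_mem V_mem_A)
    finally show "algebraic_int (of_int (c ^ 3) * (1 / V))" by (simp add: A_iff)
  qed
  have pw: "p_integral p w"
  proof (rule p_integral_power_root[OF p(1) _ pos(1)])
    have "of_int D' * V ^ 4 \<in> A" by (intro A.ring_mem V_mem_A)
    then show "p_integral p (w ^ d)" unfolding wd by (simp add: A_iff algebraic_int_imp_p_integral p(1))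
  qed
  have p\<rho>: "p_integral p \<rho>"
  proof (rule p_integral_power_root[OF p(1) _ pos(2)])
    have "p_integral p (w ^ a)"
      by (induction a) (auto intro: p_integral_mult p(1) pw algebraic_int_imp_p_integral)
    then show "p_integral p (\<rho> ^ e)" unfolding \<rho>e P_def
      by (intro p_integral_mult p(1)) (simp_all add: algebraic_int_imp_p_integral p(1))
  qed
  have R: "p_local_order R p"
    unfolding R_def by (rule local_span_order[OF p(1)]) (use pV pV' pw p\<rho> in \<open>auto simp: S_def\<close>)
  interpret p_local_order R p by (rule R)
  have VK: "V \<in> K" using V_mem_A by (simp add: A_iff)
  have PK: "P \<in> K" unfolding P_def by (rule K_closed)
  have RK: "R \<subseteq> K"
    unfolding R_def
  proof (rule local_span_subset[OF K_subfield])
    have "\<rho> \<in> K" "w \<in> K" "1 / V \<in> K"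
      unfolding \<rho>_def w_def by (intro K_closed(2,8,9) Z_mem_K PK VK)+
    then show "S \<subseteq> K" using VK by (simp add: S_def)
  qed
  have gens: "\<rho> \<in> R" "w \<in> R" "V \<in> R" "1 / V \<in> R"
    unfolding R_def S_def by (auto intro: local_span_base)
  \<comment> \<open>The inverse of w, read off from w^d = D' V^4; it lets p and Z be written as
    multiples of \<rho>.\<close>
  define W where "W = w ^ (d - 1) * (1 / of_int D') * (1 / V) ^ 4"
  have WR: "W \<in> R" unfolding W_def by (intro ring_mem gens inverse_mem D)
  have wW: "w * W = 1"
  proof -
    have "w * W = w ^ d * (1 / of_int D') * (1 / V) ^ 4"
      using pos(1) by (cases d) (simp_all add: W_def)
    then show ?thesis unfolding wd using D'0 V_nonzero by (simp add: power_divide)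
  qed
  have P_eq: "P = \<rho> ^ e * W ^ a"
  proof -
    have "\<rho> ^ e * W ^ a = P * (w * W) ^ a" by (simp add: \<rho>e power_mult_distrib)
    then show ?thesis by (simp add: wW)
  qed
  have Z_eq: "Z = \<rho> * (\<rho> ^ (k1 - 1) * W ^ b)"
  proof -
    have "Z = Z * (w * W) ^ b" by (simp add: wW)
    also have "\<dots> = \<rho> ^ k1 * W ^ b" by (simp add: \<rho>k power_mult_distrib)
    also have "\<rho> ^ k1 = \<rho> * \<rho> ^ (k1 - 1)" using pos(3) by (cases k1) simp_all
    finally show ?thesis by (simp only: mult.assoc)
  qed
  then have ZR: "Z \<in> R" using ring_mem gens WR by metis
  have T_eq: "T = Z\<^sup>2 * (1 / V)" using Z_square V_nonzero by simp
  have TR: "T \<in> R" unfolding T_eq by (intro ring_mem ZR gens)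
  have "\<delta> = Z ^ 3 * (1 / V)\<^sup>2" using Z_cube V_nonzero by (simp add: power_divide)
  then have dR: "\<delta> \<in> R" using ring_mem ZR gens by metis
  have "\<eta> = (T + M) * (1 / of_int 3)" by (simp add: T_def)
  moreover have "(T + M) * (1 / of_int 3) \<in> R" by (intro ring_mem TR inverse_mem p3)
  ultimately have eR: "\<eta> \<in> R" by metis
  have Z0': "cong_mod \<rho> Z 0"
    by (rule cong_modI[of _ _ _ "\<rho> ^ (k1 - 1) * W ^ b"]) (use Z_eq in \<open>auto intro: ring_mem gens WR\<close>)
  have T0: "cong_mod \<rho> T 0"
    unfolding T_eq power2_eq_square mult.assoc
    by (intro cong_mod_0_mult[OF Z0'] ring_mem ZR gens)
  have Vc: "cong_mod \<rho> V (of_int c)"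
    using cong_mod_add[OF cong_mod_scale[OF T0 numeral_mem] cong_mod_refl[of _ "of_int c"], of "num.Bit1 num.One"]
    by (simp add: V_def)
  have P0: "cong_mod \<rho> (of_nat p) 0"
  proof (rule cong_modI)
    show "of_nat p - 0 = \<rho> * (\<rho> ^ (e - 1) * W ^ a)"
      using P_eq pos(2) by (cases e) (simp_all add: P_def)
  qed (intro ring_mem gens WR)
  have V'c: "\<exists>n. cong_mod \<rho> (1 / V) (of_int n)"
  proof -
    obtain n where n: "cong_mod \<rho> (of_int 1 / of_int c) (of_int n)"
      using fraction_residue[OF pc P0, of 1] by auto
    have "cong_mod \<rho> ((1 / V) * (1 / of_int c) * of_int c) ((1 / V) * (1 / of_int c) * V)"
      by (intro cong_mod_scale ring_mem gens inverse_mem pc) (rule cong_mod_sym[OF Vc])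
    then have "cong_mod \<rho> (1 / V) (1 / of_int c)" using V_nonzero c_nonzero by simp
    also have "cong_mod \<rho> (1 / of_int c) (of_int n)" using n by simp
    finally show ?thesis ..
  qed
  interpret W: complex_subring "int_adjoin w" by (rule int_adjoin_subring)
  have gen: "\<exists>y\<in>int_adjoin w. cong_mod \<rho> x y" if "x \<in> R" for x
  proof (rule local_span_residue[OF R_def gens(2) P0 _ that])
    fix x assume "x \<in> S"
    moreover have "\<exists>y\<in>int_adjoin w. cong_mod \<rho> \<rho> y" using cong_mod_self W.zero_mem by blast
    moreover have "\<exists>y\<in>int_adjoin w. cong_mod \<rho> w y" using cong_mod_refl int_adjoin_self by blast
    moreover have "\<exists>y\<in>int_adjoin w. cong_mod \<rho> V y" using Vc W.of_int_mem by blast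
    moreover have "\<exists>y\<in>int_adjoin w. cong_mod \<rho> (1 / V) y" using V'c W.of_int_mem by blast
    ultimately show "\<exists>y\<in>int_adjoin w. cong_mod \<rho> x y" unfolding S_def by blast
  qed
  have wq: "cong_mod \<rho> (w ^ (p ^ 6)) w"
  proof -
    obtain N where N: "p ^ 6 = 1 + 6 * ((p - 1) * N)" using pow6_minus_1[OF assms(1,2)] .
    define u where "u = (D' * c ^ 4) ^ e"
    have u: "\<not> int p dvd u"
      unfolding u_def using D(2) pc prime_int prime_dvd_power prime_dvd_mult_iff by metis
    have "cong_mod \<rho> (of_int D' * V ^ 4) (of_int D' * of_int c ^ 4)"
      by (intro cong_mod_scale cong_mod_power Vc ring_mem gens)
    then have "cong_mod \<rho> ((of_int D' * V ^ 4) ^ e) ((of_int D' * of_int c ^ 4) ^ e)"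
      by (intro cong_mod_power ring_mem gens)
    also have "(of_int D' * V ^ 4) ^ e = w ^ 6" unfolding wd[symmetric] by (simp add: ex(1) flip: power_mult)
    finally have w6: "cong_mod \<rho> (w ^ 6) (of_int u)" by (simp add: u_def)
    have u1: "cong_mod \<rho> (of_int (u ^ (p - 1))) (of_int 1)"
      by (rule cong_mod_coarsen'[OF cong_mod_of_int[OF int_Fermat[OF p(1) u]] P0])
    have "cong_mod \<rho> ((w ^ 6) ^ ((p - 1) * N)) (of_int u ^ ((p - 1) * N))"
      by (intro cong_mod_power w6 ring_mem gens)
    also have "of_int u ^ ((p - 1) * N) = (of_int (u ^ (p - 1))) ^ N" by (simp add: power_mult)
    also have "cong_mod \<rho> \<dots> (of_int 1 ^ N)" by (intro cong_mod_power u1 ring_mem)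
    finally have "cong_mod \<rho> (w * (w ^ 6) ^ ((p - 1) * N)) (w * of_int 1 ^ N)"
      by (rule cong_mod_scale) (rule gens)
    moreover have "w ^ (p ^ 6) = w * (w ^ 6) ^ ((p - 1) * N)" by (simp add: N power_mult)
    ultimately show ?thesis by simp
  qed
  have \<rho>0: "cong_mod (of_nat p) (\<rho> ^ e) 0"
    by (rule cong_modI[of _ _ _ "w ^ a"]) (auto simp: \<rho>e P_def intro: ring_mem gens)
  \<comment> \<open>For e = 1 the exponent of p in D is a multiple of 6; then \<rho> is p times a
    unit and p does not ramify.\<close>
  show ?thesis
  proof (cases "e = 1")
    case True
    then have "\<rho> = of_nat p * w ^ a" using \<rho>e by (simp add: P_def)
    then have coarse: "cong_mod (of_nat p) x y" if "cong_mod \<rho> x y" for x y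
      using cong_mod_coarsen[of "of_nat p" "w ^ a"] that power_mem[OF gens(2)] by simp
    have "\<exists>y\<in>int_adjoin w. cong_mod (of_nat p) x y" if "x \<in> R" for x
      using gen[OF that] coarse by blast
    then show ?thesis
      by (rule monogenic_unramified(2)[OF R RK eR dR gens(2) _ _ coarse[OF wq]]) simp_all
  next
    case False
    then have "e \<ge> 2" using pos(2) by simp
    then have "cong_mod (\<rho>\<^sup>2) (of_nat p) 0"
    proof -
      have "\<rho> ^ e = \<rho>\<^sup>2 * \<rho> ^ (e - 2)" using \<open>e \<ge> 2\<close> by (metis le_add_diff_inverse power_add)
      then have "of_nat p - 0 = \<rho>\<^sup>2 * (\<rho> ^ (e - 2) * W ^ a)" using P_eq by (simp add: P_def)
      then show ?thesis by (rule cong_modI) (intro ring_mem gens WR)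
    qed
    then show ?thesis
      by (intro monogenic_ramified(2)[OF R RK eR dR gens(2) gen _ wq gens(1) \<rho>0]) simp_all
  qed
qed

section \<open>Primes p >= 5 not dividing D: the different of \<theta>\<close>

definition sextic :: "complex \<Rightarrow> complex" where
  "sextic x = x ^ 6 - 2 * M * x ^ 5 - (5 * M + 15) * x ^ 4 - 20 * x ^ 3 + 5 * M * x\<^sup>2 + (2 * M + 6) * x + 1"

text \<open>Coefficient of X^j, for j < 6, in the quotient of f(X) - f(y) by X - y, where f is the
  sextic; see \<open>horner_diff\<close>.\<close>

definition horner :: "complex \<Rightarrow> nat \<Rightarrow> complex" where
  "horner y j =
     (if j = 5 then 1 else if j = 4 then y - 2 * M
      else if j = 3 then y\<^sup>2 - 2 * M * y - (5 * M + 15)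
      else if j = 2 then y ^ 3 - 2 * M * y\<^sup>2 - (5 * M + 15) * y - 20
      else if j = 1 then y ^ 4 - 2 * M * y ^ 3 - (5 * M + 15) * y\<^sup>2 - 20 * y + 5 * M
      else y ^ 5 - 2 * M * y ^ 4 - (5 * M + 15) * y ^ 3 - 20 * y\<^sup>2 + 5 * M * y + 2 * M + 6)"

lemma horner_diff: "(x - y) * (\<Sum>j<6. x ^ j * horner y j) = sextic x - sextic y"
  unfolding sum_6 by (simp add: horner_def sextic_def algebra_simps eval_nat_numeral)

lemma sextic_theta: "sextic \<theta> = 0"
  using sextic_eq by (simp add: sextic_def)

lemma sextic_conjugate: "sextic ((\<sigma> ^^ i) \<theta>) = 0"
proof -
  have "sextic x = poly (map_poly of_int (simplest_sextic m)) x" for x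
    unfolding sextic_def simplest_sextic_def ipoly_pCons by (simp add: algebra_simps eval_nat_numeral)
  then show ?thesis
    using sigma_iter_poly[OF theta_mem_K, of i "simplest_sextic m"] root by simp
qed

lemma horner_mem: "complex_subring S \<Longrightarrow> y \<in> S \<Longrightarrow> horner y j \<in> S"
proof -
  assume "complex_subring S" "y \<in> S"
  then interpret complex_subring S by simp
  show ?thesis unfolding horner_def by (simp add: ring_mem \<open>y \<in> S\<close>)
qed

text \<open>The derivative of the sextic at \<theta>.\<close>

definition different :: complex where
  "different = 6 * \<theta> ^ 5 - 10 * M * \<theta> ^ 4 - (20 * M + 60) * \<theta> ^ 3 - 60 * \<theta>\<^sup>2 + 10 * M * \<theta> + 2 * M + 6"

lemma different_eq: "different = (\<Sum>j<6. \<theta> ^ j * horner \<theta> j)"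
  unfolding sum_6 by (simp add: different_def horner_def algebra_simps eval_nat_numeral)

text \<open>Euler's dual basis: the trace of \<open>x f(X)/(X - \<theta>)\<close> is a polynomial over \<open>\<int>\<close> whose value
  at \<open>\<theta>\<close> is \<open>x f'(\<theta>)\<close>.\<close>

lemma different_mult:
  assumes x: "x \<in> A"
  shows "different * x \<in> int_adjoin \<theta>"
proof -
  interpret Z: complex_subring "int_adjoin \<theta>" by (rule int_adjoin_subring)
  have xK: "x \<in> K" using x by (simp add: A_iff)
  have hA: "horner \<theta> j \<in> A" for j by (rule horner_mem[OF A_subring theta_mem_A])
  have hK: "horner \<theta> j \<in> K" for j using hA by (simp add: A_iff)
  have conj: "(\<sigma> ^^ i) (horner \<theta> j) = horner ((\<sigma> ^^ i) \<theta>) j" for i j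
  proof -
    obtain g where g: "\<And>y. horner y j = poly (map_poly of_int g) y"
    proof -
      consider "j = 5" | "j = 4" | "j = 3" | "j = 2" | "j = 1" | "j \<notin> {1, 2, 3, 4, 5}" by auto
      then show thesis
      proof cases
        case 1 then show thesis by (intro that[of "[:1:]"]) (simp add: horner_def ipoly_pCons)
      next
        case 2 then show thesis by (intro that[of "[:- 2 * m, 1:]"]) (simp add: horner_def ipoly_pCons)
      next
        case 3 then show thesis by (intro that[of "[:- (5 * m + 15), - 2 * m, 1:]"])
          (simp add: horner_def ipoly_pCons algebra_simps eval_nat_numeral)
      next
        case 4 then show thesis by (intro that[of "[:-20, - (5 * m + 15), - 2 * m, 1:]"])
          (simp add: horner_def ipoly_pCons algebra_simps eval_nat_numeral)
      next
        case 5 then show thesis by (intro that[of "[:5 * m, -20, - (5 * m + 15), - 2 * m, 1:]"])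
          (simp add: horner_def ipoly_pCons algebra_simps eval_nat_numeral)
      next
        case 6 then show thesis by (intro that[of "[:2 * m + 6, 5 * m, -20, - (5 * m + 15), - 2 * m, 1:]"])
          (simp add: horner_def ipoly_pCons algebra_simps eval_nat_numeral)
      qed
    qed
    then show ?thesis using sigma_iter_poly[OF theta_mem_K] by simp
  qed
  have vanish: "(\<Sum>j<6. \<theta> ^ j * horner ((\<sigma> ^^ i) \<theta>) j) = 0" if "0 < i" "i < 6" for i
  proof -
    have "(\<theta> - (\<sigma> ^^ i) \<theta>) * (\<Sum>j<6. \<theta> ^ j * horner ((\<sigma> ^^ i) \<theta>) j) = 0"
      unfolding horner_diff sextic_theta sextic_conjugate by simp
    moreover have "(\<sigma> ^^ i) \<theta> \<noteq> \<theta>" using theta_not_fixed[OF that] .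
    ultimately show ?thesis by auto
  qed
  have "(\<Sum>j<6. \<theta> ^ j * Tr (x * horner \<theta> j)) = (\<Sum>j<6. \<Sum>i<6. (\<sigma> ^^ i) x * (\<theta> ^ j * horner ((\<sigma> ^^ i) \<theta>) j))"
    unfolding Tr_def using xK hK by (simp add: sigma_iter_mult conj sum_distrib_left mult_ac)
  also have "\<dots> = (\<Sum>i<6. \<Sum>j<6. (\<sigma> ^^ i) x * (\<theta> ^ j * horner ((\<sigma> ^^ i) \<theta>) j))"
    by (rule sum.swap)
  also have "\<dots> = (\<Sum>i<6. (\<sigma> ^^ i) x * (\<Sum>j<6. \<theta> ^ j * horner ((\<sigma> ^^ i) \<theta>) j))"
    by (simp only: sum_distrib_left)
  also have "\<dots> = (\<Sum>i<6. if i = (0 :: nat) then x * different else 0)"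
  proof (rule sum.cong)
    fix i :: nat assume "i \<in> {..<6}"
    then show "(\<sigma> ^^ i) x * (\<Sum>j<6. \<theta> ^ j * horner ((\<sigma> ^^ i) \<theta>) j) = (if i = 0 then x * different else 0)"
      using vanish[of i] different_eq by (cases "i = 0") auto
  qed simp
  also have "\<dots> = different * x" by simp
  finally have "different * x = (\<Sum>j<6. \<theta> ^ j * Tr (x * horner \<theta> j))" ..
  also have "\<dots> \<in> int_adjoin \<theta>"
  proof (intro Z.sum_mem Z.mult_mem Z.power_mem int_adjoin_self)
    fix j
    have "x * horner \<theta> j \<in> A" by (intro A.ring_mem x hA)
    then have "Tr (x * horner \<theta> j) \<in> \<int>" using Tr_int by (simp add: A_iff)
    then show "Tr (x * horner \<theta> j) \<in> int_adjoin \<theta>" using Z.of_int_mem by (auto elim: Ints_cases)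
  qed
  finally show ?thesis .
qed

text \<open>Write the sextic as s - m r. At \<theta> its derivative times r is s' r - s r', which
  equals 2 g^5 with g = \<theta>^2 + \<theta> + 1. With g^6 = D r^2 this makes the different times g
  equal to 2 D r. Finally r divides 3^9 in \<int>[\<theta>], because the sextic takes the values 1,
  -27, 1, -27 at 0, 1, -1, -2 and -27/64 at -1/2.\<close>

lemma different_unit:
  obtains y where "y \<in> int_adjoin \<theta>" "different * y = of_int (2 * 3 ^ 9 * D)"
proof -
  interpret Z: complex_subring "int_adjoin \<theta>" by (rule int_adjoin_subring)
  define g where "g = \<theta>\<^sup>2 + \<theta> + 1"
  define r where "r = \<theta> * (\<theta> - 1) * (\<theta> + 1) * (2 * \<theta> + 1) * (\<theta> + 2)"
  define s where "s = \<theta> ^ 6 - 15 * \<theta> ^ 4 - 20 * \<theta> ^ 3 + 6 * \<theta> + 1"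
  have r: "r \<noteq> 0" using theta_nonzero by (simp add: r_def)
  have "s - M * r = sextic \<theta>"
    by (simp add: sextic_def s_def r_def algebra_simps eval_nat_numeral)
  then have s: "M * r = s" by (simp add: sextic_theta)
  have "g ^ 6 = s\<^sup>2 + 3 * s * r + 9 * r\<^sup>2"
    unfolding g_def r_def s_def by (simp add: algebra_simps eval_nat_numeral)
  also have "\<dots> = of_int D * r\<^sup>2" by (simp add: s[symmetric] D_def algebra_simps power2_eq_square)
  finally have g6: "g ^ 6 = of_int D * r\<^sup>2" .
  define r' where "r' = 10 * \<theta> ^ 4 + 20 * \<theta> ^ 3 - 10 * \<theta> - 2"
  define s' where "s' = 6 * \<theta> ^ 5 - 60 * \<theta> ^ 3 - 60 * \<theta>\<^sup>2 + 6"
  have d: "different = s' - M * r'"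
    by (simp add: different_def s'_def r'_def algebra_simps)
  have "different * r = s' * r - M * r * r'" unfolding d by (simp add: algebra_simps)
  also have "\<dots> = s' * r - s * r'" by (simp only: s)
  also have "\<dots> = 2 * g ^ 5"
    unfolding g_def r_def s_def s'_def r'_def by (simp add: algebra_simps eval_nat_numeral)
  finally have "different * r = 2 * g ^ 5" .
  then have "different * g * r = 2 * g ^ 6" by (simp add: eval_nat_numeral mult_ac)
  then have dg: "different * g = 2 * of_int D * r" using r by (simp add: g6 power2_eq_square)
  define H where "H y = (\<Sum>j<6. \<theta> ^ j * horner y j)" for y
  have H: "(\<theta> - y) * H y = - sextic y" for y
    using horner_diff[of \<theta> y] by (simp add: H_def sextic_theta)
  have HZ: "H (of_int n) \<in> int_adjoin \<theta>" for n
    unfolding H_def by (intro Z.sum_mem Z.mult_mem Z.power_mem int_adjoin_self horner_mem int_adjoin_subring Z.of_int_mem)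
  \<comment> \<open>The quotient of 64 f(X) + 27 by 2 X + 1, where f is the sextic; -27 is the value
    of 64 f at -1/2. It agrees with this quotient at X = \<theta>.\<close>
  define L where "L = 32 * \<theta> ^ 5 - (16 + 64 * M) * \<theta> ^ 4 - (472 + 128 * M) * \<theta> ^ 3 + (64 * M - 404) * \<theta>\<^sup>2 + (202 + 128 * M) * \<theta> + 91"
  have "(2 * \<theta> + 1) * L = 64 * sextic \<theta> + 27"
    by (simp add: L_def sextic_def algebra_simps eval_nat_numeral)
  then have L: "(2 * \<theta> + 1) * L = 27" by (simp add: sextic_theta)
  have LZ: "L \<in> int_adjoin \<theta>" unfolding L_def by (intro Z.ring_mem int_adjoin_self)
  define y where "y = g * (- H 0 * H 1 * - H (-1) * H (-2) * L)"
  have e: "\<theta> * H 0 = - 1" "(\<theta> - 1) * H 1 = 27" "(\<theta> + 1) * H (-1) = - 1" "(\<theta> + 2) * H (-2) = 27"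
    using H[of 0] H[of 1] H[of "-1"] H[of "-2"] by (simp_all add: sextic_def)
  have "r * (- H 0 * H 1 * - H (-1) * H (-2) * L) =
      (\<theta> * H 0) * ((\<theta> - 1) * H 1) * ((\<theta> + 1) * H (-1)) * ((\<theta> + 2) * H (-2)) * ((2 * \<theta> + 1) * L)"
    by (simp add: r_def mult_ac)
  also have "\<dots> = 3 ^ 9" unfolding e L by simp
  finally have "r * (- H 0 * H 1 * - H (-1) * H (-2) * L) = 3 ^ 9" .
  then have "different * y = of_int (2 * 3 ^ 9 * D)"
    by (simp add: y_def dg flip: mult.assoc)
  moreover have "y \<in> int_adjoin \<theta>"
    unfolding y_def g_def
    using HZ[of 0] HZ[of 1] HZ[of "-1"] HZ[of "-2"] LZ int_adjoin_self[of \<theta>] by (simp add: Z.ring_mem)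
  ultimately show ?thesis using that by blast
qed

lemma theta_multiple:
  assumes "x \<in> A"
  shows "of_int (2 * 3 ^ 9 * D) * x \<in> int_adjoin \<theta>"
proof -
  interpret Z: complex_subring "int_adjoin \<theta>" by (rule int_adjoin_subring)
  obtain y where y: "y \<in> int_adjoin \<theta>" "different * y = of_int (2 * 3 ^ 9 * D)" by (rule different_unit)
  have "of_int (2 * 3 ^ 9 * D) * x = different * y * x" by (simp only: y(2))
  also have "\<dots> = y * (different * x)" by (simp only: mult_ac)
  also have "\<dots> \<in> int_adjoin \<theta>" by (intro Z.mult_mem y(1) different_mult assms)
  finally show ?thesis .
qed

theorem monogenic_good:
  assumes p: "prime p" and "p \<noteq> 2" "p \<noteq> 3" "\<not> int p dvd D"
  shows "monogenic_mod p"
proof -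
  interpret Z: complex_subring "int_adjoin \<theta>" by (rule int_adjoin_subring)
  define N where "N = 2 * 3 ^ 9 * D"
  have pi: "prime (int p)" using p by simp
  have "\<not> p dvd 2" "\<not> p dvd 3" using assms primes_dvd_imp_eq[of p 2] primes_dvd_imp_eq[of p 3] by auto
  then have "\<not> int p dvd 2" "\<not> int p dvd 3"
    by (metis int_dvd_int_iff of_nat_numeral)+
  then have "\<not> int p dvd N"
    unfolding N_def using assms(4) pi prime_dvd_mult_iff prime_dvd_power by metis
  then have "coprime N (int p)" using pi by (metis coprime_commute prime_imp_coprime)
  then obtain a b where ab: "a * N + b * int p = 1"
    using bezout_int[of N "int p"] by (auto simp: coprime_iff_gcd_eq_1)
  have "\<exists>y\<in>int_adjoin \<theta>. A.cong_mod (of_nat p) x y" if x: "x \<in> A" for x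
  proof
    show "of_int a * (of_int N * x) \<in> int_adjoin \<theta>"
      unfolding N_def by (intro Z.ring_mem theta_multiple x)
    have "x = of_int (a * N + b * int p) * x" by (simp add: ab)
    then have "x - of_int a * (of_int N * x) = of_nat p * (of_int b * x)"
      by (simp add: algebra_simps)
    then show "A.cong_mod (of_nat p) x (of_int a * (of_int N * x))"
      by (rule A.cong_modI) (intro A.ring_mem x)
  qed
  then show ?thesis unfolding monogenic_mod_def using theta_mem_A by blast
qed

section \<open>Conjugates of \<eta> as polynomials in \<eta>; the prime 2\<close>

definition \<eta>'' :: complex where "\<eta>'' = - (1 + \<eta>) / \<eta>"

text \<open>This and \<open>prev_root\<close> are the maps -1 / (1 + h) and -(1 + h) / h as
  polynomials with integer coefficients, valid at roots of the cubic. In this form conjugates stay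
  in any ring containing \<eta>, and congruences can be read off coefficientwise.\<close>

definition next_root :: "complex \<Rightarrow> complex" where "next_root h = h\<^sup>2 - (M + 1) * h - 2"
definition prev_root :: "complex \<Rightarrow> complex" where "prev_root h = - (h\<^sup>2) + M * h + M + 2"

lemma next_root_eq:
  assumes "h ^ 3 = M * h\<^sup>2 + (M + 3) * h + 1" "1 + h \<noteq> 0"
  shows "next_root h = - 1 / (1 + h)"
proof -
  have "(1 + h) * next_root h = h ^ 3 - (M * h\<^sup>2 + (M + 3) * h + 1) - 1"
    by (simp add: next_root_def algebra_simps eval_nat_numeral)
  then have "(1 + h) * next_root h = - 1" using assms(1) by simp
  then show ?thesis using assms(2) by (simp add: field_simps)
qed

lemma prev_root_eq:
  assumes "h ^ 3 = M * h\<^sup>2 + (M + 3) * h + 1" "h \<noteq> 0"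
  shows "prev_root h = - (1 + h) / h"
proof -
  have "h * prev_root h = - (h ^ 3 - (M * h\<^sup>2 + (M + 3) * h + 1)) - (1 + h)"
    by (simp add: prev_root_def algebra_simps eval_nat_numeral)
  then have "h * prev_root h = - (1 + h)" using assms(1) by simp
  then show ?thesis using assms(2) by (metis nonzero_mult_div_cancel_left)
qed

lemma next_eta: "next_root \<eta> = \<eta>'" and next_eta': "next_root \<eta>' = \<eta>''" and next_eta'': "next_root \<eta>'' = \<eta>"
  and prev_eta: "prev_root \<eta> = \<eta>''" and prev_eta'': "prev_root \<eta>'' = \<eta>'" and prev_eta': "prev_root \<eta>' = \<eta>"
proof -
  have c2: "\<eta>'' ^ 3 = M * \<eta>''\<^sup>2 + (M + 3) * \<eta>'' + 1"
  proof -
    have "\<eta>'' = (\<sigma> ^^ 2) \<eta>" by (simp add: \<eta>''_def sigma2_eta)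
    moreover have "(\<sigma> ^^ 2) (\<eta> ^ 3) = (\<sigma> ^^ 2) (M * \<eta>\<^sup>2 + (M + 3) * \<eta> + 1)" by (simp add: eta_cubic)
    moreover have "(\<sigma> ^^ 2) (\<eta> ^ 3) = ((\<sigma> ^^ 2) \<eta>) ^ 3" by (rule sigma_iter_power[OF eta_mem_K])
    moreover have "(\<sigma> ^^ 2) (M * \<eta>\<^sup>2 + (M + 3) * \<eta> + 1) = M * ((\<sigma> ^^ 2) \<eta>)\<^sup>2 + (M + 3) * (\<sigma> ^^ 2) \<eta> + 1"
      using sigma_iter_int[of 2 "m + 3"] eta_mem_K
      by (simp add: sigma_iter_add sigma_iter_mult sigma_iter_power K_closed del: funpow.simps)
    ultimately show ?thesis by metis
  qed
  have nz: "\<eta> \<noteq> 0" "1 + \<eta> \<noteq> 0" by (fact eta_nonzero)+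
  have nz': "\<eta>' \<noteq> 0" using nz by (simp add: \<eta>'_def)
  have e1: "1 + \<eta>' = \<eta> / (1 + \<eta>)" using nz by (simp add: \<eta>'_def field_simps)
  have e2: "1 + \<eta>'' = - 1 / \<eta>" using nz by (simp add: \<eta>''_def field_simps)
  have nz1: "1 + \<eta>' \<noteq> 0" "1 + \<eta>'' \<noteq> 0" using nz unfolding e1 e2 by simp_all
  have nz2: "\<eta>'' \<noteq> 0" 
    unfolding \<eta>''_def divide_eq_0_iff neg_equal_0_iff_equal using nz by blast
  show "next_root \<eta> = \<eta>'" using next_root_eq[OF eta_cubic nz(2)] by (simp add: \<eta>'_def)
  show "next_root \<eta>' = \<eta>''" using next_root_eq[OF eta'_cubic nz1(1)] by (simp add: e1 \<eta>''_def)
  show "next_root \<eta>'' = \<eta>" using next_root_eq[OF c2 nz1(2)] by (simp add: e2)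
  show "prev_root \<eta> = \<eta>''" using prev_root_eq[OF eta_cubic nz(1)] by (simp add: \<eta>''_def)
  have "- (- 1 / x) / (- u / x) = - 1 / u" if "x \<noteq> 0" "u \<noteq> 0" for x u :: complex
    using that by (simp add: field_simps)
  from this[OF nz] show "prev_root \<eta>'' = \<eta>'"
    unfolding prev_root_eq[OF c2 nz2] e2 unfolding \<eta>''_def \<eta>'_def .
  show "prev_root \<eta>' = \<eta>" unfolding prev_root_eq[OF eta'_cubic nz'] e1 using nz by (simp add: \<eta>'_def)
qed

lemma eta''_cubic: "\<eta>'' ^ 3 = M * \<eta>''\<^sup>2 + (M + 3) * \<eta>'' + 1"
proof -
  have "next_root \<eta>'' = \<eta>" by (rule next_eta'')
  have "(\<sigma> ^^ 1) (\<eta>' ^ 3) = (\<sigma> ^^ 1) (M * \<eta>'\<^sup>2 + (M + 3) * \<eta>' + 1)" by (simp add: eta'_cubic)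
  moreover have "(\<sigma> ^^ 1) (\<eta>' ^ 3) = ((\<sigma> ^^ 1) \<eta>') ^ 3" by (rule sigma_iter_power[OF eta'_mem_K])
  moreover have "(\<sigma> ^^ 1) (M * \<eta>'\<^sup>2 + (M + 3) * \<eta>' + 1) = M * ((\<sigma> ^^ 1) \<eta>')\<^sup>2 + (M + 3) * (\<sigma> ^^ 1) \<eta>' + 1"
    using sigma_iter_int[of 1 "m + 3"] eta'_mem_K
    by (simp add: sigma_iter_add sigma_iter_mult sigma_iter_power K_closed del: funpow.simps)
  moreover have "(\<sigma> ^^ 1) \<eta>' = \<eta>''" by (simp add: sigma_eta' \<eta>''_def)
  ultimately show ?thesis by metis
qed

lemma root_fourth:
  assumes "h ^ 3 = M * h\<^sup>2 + (M + 3) * h + 1"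
  shows "h ^ 4 = (M\<^sup>2 + M + 3) * h\<^sup>2 + (M\<^sup>2 + 3 * M + 1) * h + M"
proof -
  have "h ^ 4 = h * h ^ 3" by (simp add: eval_nat_numeral)
  also have "\<dots> = h * (M * h\<^sup>2 + (M + 3) * h + 1)" by (rule arg_cong[OF assms])
  also have "\<dots> = M * h ^ 3 + (M + 3) * h\<^sup>2 + h"
    by (simp add: algebra_simps eval_nat_numeral)
  finally show ?thesis unfolding assms by (simp add: algebra_simps power2_eq_square)
qed

text \<open>Since \<open>2\<close> is inert in the cubic subfield, its Frobenius generates the Galois group.\<close>

lemma root_Frobenius_2:
  assumes R: "complex_subring R" and h: "h \<in> R" "h ^ 3 = M * h\<^sup>2 + (M + 3) * h + 1"
  shows "complex_subring.cong_mod R 2 (h ^ 4) (if even m then next_root h else prev_root h)"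
proof -
  interpret complex_subring R by (rule R)
  show ?thesis
  proof (cases "even m")
    case True
    then obtain i where "m = 2 * i" by (elim evenE)
    then have i: "M = 2 * of_int i" by simp
    have "h ^ 4 - next_root h = 2 * ((2 * of_int i ^ 2 + of_int i + 1) * h\<^sup>2 + (2 * of_int i ^ 2 + 4 * of_int i + 1) * h + of_int i + 1)"
      unfolding root_fourth[OF h(2)] next_root_def i by (simp add: algebra_simps power2_eq_square)
    then have "cong_mod 2 (h ^ 4) (next_root h)" by (rule cong_modI) (intro ring_mem h(1))
    then show ?thesis using True by simp
  next
    case False
    then obtain i where "m = 2 * i + 1" by (elim oddE)
    then have i: "M = 2 * of_int i + 1" by simp
    have "h ^ 4 - prev_root h = 2 * ((2 * of_int i ^ 2 + 3 * of_int i + 3) * h\<^sup>2 + (2 * of_int i ^ 2 + 4 * of_int i + 2) * h - 1)"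
      unfolding root_fourth[OF h(2)] prev_root_def i by (simp add: algebra_simps power2_eq_square)
    then have "cong_mod 2 (h ^ 4) (prev_root h)" by (rule cong_modI) (intro ring_mem h(1))
    then show ?thesis using False by simp
  qed
qed

text \<open>The fourth power moves all three roots one place in the same direction, so its third
  iterate returns to the start.\<close>

lemma eta_Frobenius_2:
  assumes R: "complex_subring R" and h: "\<eta> \<in> R"
  shows "complex_subring.cong_mod R 2 (\<eta> ^ 64) \<eta>"
proof -
  interpret complex_subring R by (rule R)
  have n: "next_root x \<in> R" "prev_root x \<in> R" if "x \<in> R" for x
    unfolding next_root_def prev_root_def by (intro ring_mem that)+
  have mem: "\<eta>' \<in> R" "\<eta>'' \<in> R" using n[OF h] by (simp_all add: next_eta prev_eta)
  note F = root_Frobenius_2[OF R h eta_cubic] root_Frobenius_2[OF R mem(1) eta'_cubic] root_Frobenius_2[OF R mem(2) eta''_cubic]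
  have e: "\<eta> ^ 64 = ((\<eta> ^ 4) ^ 4) ^ 4" by (simp flip: power_mult)
  show ?thesis
  proof (cases "even m")
    case True
    have "cong_mod 2 (((\<eta> ^ 4) ^ 4) ^ 4) ((\<eta>' ^ 4) ^ 4)"
      using F(1) True by (intro cong_mod_power ring_mem h mem) (simp add: next_eta)
    also have "cong_mod 2 ((\<eta>' ^ 4) ^ 4) (\<eta>'' ^ 4)"
      using F(2) True by (intro cong_mod_power ring_mem h mem) (simp add: next_eta')
    also have "cong_mod 2 (\<eta>'' ^ 4) \<eta>" using F(3) True by (simp add: next_eta'')
    finally show ?thesis unfolding e .
  next
    case False
    have "cong_mod 2 (((\<eta> ^ 4) ^ 4) ^ 4) ((\<eta>'' ^ 4) ^ 4)"
      using F(1) False by (intro cong_mod_power ring_mem h mem) (simp add: prev_eta)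
    also have "cong_mod 2 ((\<eta>'' ^ 4) ^ 4) (\<eta>' ^ 4)"
      using F(3) False by (intro cong_mod_power ring_mem h mem) (simp add: prev_eta'')
    also have "cong_mod 2 (\<eta>' ^ 4) \<eta>" using F(2) False by (simp add: prev_eta')
    finally show ?thesis unfolding e .
  qed
qed

lemma D_odd: "odd D"
proof -
  have "D = m * (m + 3) + 9" by (simp add: D_def power2_eq_square algebra_simps)
  then show ?thesis by simp
qed

definition \<tau> :: complex where "\<tau> = (1 + \<delta>) / 2"

lemma delta_tau: "\<delta> = 2 * \<tau> - 1" by (simp add: \<tau>_def field_simps)

lemma tau_square: "D = 4 * n + 1 \<Longrightarrow> \<tau>\<^sup>2 = \<tau> + of_int n"
  using delta_square by (simp add: \<tau>_def power2_eq_square field_simps)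

lemma tau_mem_A:
  assumes "D = 4 * n + 1"
  shows "\<tau> \<in> A"
proof -
  have "poly (map_poly of_int [:- n, -1, 1:]) \<tau> = \<tau>\<^sup>2 - \<tau> - of_int n"
    unfolding ipoly_pCons by (simp add: algebra_simps power2_eq_square)
  also have "\<dots> = 0" using tau_square[OF assms] by simp
  finally have "algebraic_int \<tau>"
    unfolding algebraic_int_altdef_ipoly by (intro exI[of _ "[:- n, -1, 1:]"]) simp
  moreover have "\<tau> \<in> K" unfolding \<tau>_def by (intro K_closed delta_mem_K)
  ultimately show ?thesis by (simp add: A_iff)
qed

lemma two_p: "prime (2 :: nat)" by simp

text \<open>Whether 2 splits or stays prime in the quadratic field depends on the parity of n, but n
  (n + 1) is even in both cases. The fourth power therefore treats both alike, where squaring would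
  not.\<close>

lemma tau_Frobenius:
  assumes D: "D = 4 * n + 1" and R: "complex_subring R" "\<tau> \<in> R"
  shows "complex_subring.cong_mod R 2 (\<tau> ^ 4) \<tau>"
proof -
  interpret complex_subring R by (rule R)
  have "even (n * (n + 1))" by simp
  then obtain j where j: "n * (n + 1) = 2 * j" by (elim evenE)
  have j': "of_int n * (of_int n + 1) = (2 * of_int j :: complex)"
    using arg_cong[OF j, of "of_int :: int \<Rightarrow> complex"] by simp
  have "\<tau> ^ 4 = (\<tau>\<^sup>2)\<^sup>2" by (simp flip: power_mult)
  also have "\<dots> = (\<tau> + of_int n)\<^sup>2" by (simp only: tau_square[OF D])
  also have "\<dots> = \<tau>\<^sup>2 + 2 * of_int n * \<tau> + of_int n ^ 2"
    by (simp add: power2_eq_square algebra_simps)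
  also have "\<dots> = \<tau> + 2 * of_int n * \<tau> + of_int n * (of_int n + 1)"
    unfolding tau_square[OF D] by (simp add: power2_eq_square algebra_simps)
  finally have "\<tau> ^ 4 - \<tau> = 2 * (of_int n * \<tau> + of_int j)" unfolding j' by simp
  then show ?thesis by (rule cong_modI) (intro ring_mem R(2))
qed

text \<open>The generator modulo 2 is w = \<eta> + \<tau>. In w^4 + w the contribution of \<tau>
  cancels modulo 2, and what remains is \<eta>^4 + \<eta>, congruent to \<eta>^2 - m. The 32nd power
  of \<eta>^2 is \<eta>^64, congruent to \<eta>.\<close>

lemma local_order_2_unramified:
  assumes D: "D = 4 * n + 1"
  defines "R \<equiv> local_span 2 {\<eta>, \<tau>}"
  shows "p_local_order R 2" "A \<subseteq> R" "monogenic_mod 2"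
proof -
  show R: "p_local_order R 2"
    unfolding R_def using tau_mem_A[OF D] eta_mem_A
    by (intro local_span_order two_p) (auto simp: A_iff algebraic_int_imp_p_integral)
  interpret p_local_order R 2 by (rule R)
  have gens: "\<eta> \<in> R" "\<tau> \<in> R" unfolding R_def by (auto intro: local_span_base)
  have dR: "\<delta> \<in> R" unfolding delta_tau by (intro ring_mem gens)
  have RK: "R \<subseteq> K"
    unfolding R_def using tau_mem_A[OF D] eta_mem_A by (intro local_span_subset[OF K_subfield]) (auto simp: A_iff)
  define w where "w = \<eta> + \<tau>"
  have w: "w \<in> R" unfolding w_def by (intro ring_mem gens)
  interpret W: complex_subring "int_adjoin w" by (rule int_adjoin_subring)
  have t4: "cong_mod 2 (\<tau> ^ 4) \<tau>" by (rule tau_Frobenius[OF D complex_subring_axioms gens(2)])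
  have e64: "cong_mod 2 (\<eta> ^ 64) \<eta>" by (rule eta_Frobenius_2[OF complex_subring_axioms gens(1)])
  have fr: "cong_mod 2 ((x + y) ^ (2 ^ s)) (x ^ (2 ^ s) + y ^ (2 ^ s))" if "x \<in> R" "y \<in> R" for x y s
    using cong_mod_Frobenius_add[OF two_p that, of s] by simp
  define a where "a = w ^ 4 + w"
  have aW: "a \<in> int_adjoin w" unfolding a_def by (intro W.ring_mem int_adjoin_self)
  have aR: "a \<in> R" unfolding a_def by (intro ring_mem w)
  have "cong_mod 2 (w ^ 4) (\<eta> ^ 4 + \<tau> ^ 4)" using fr[OF gens, of 2] by (simp add: w_def)
  also have "cong_mod 2 (\<eta> ^ 4 + \<tau> ^ 4) (\<eta> ^ 4 + \<tau>)" by (intro cong_mod_add cong_mod_refl t4)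
  finally have "cong_mod 2 a (\<eta> ^ 4 + \<tau> + w)" unfolding a_def by (intro cong_mod_add cong_mod_refl)
  also have "cong_mod 2 (\<eta> ^ 4 + \<tau> + w) (\<eta>\<^sup>2 - M)"
  proof -
    have "even (m * (m + 1))" "even (m * (m + 3))" by auto
    then obtain i j where ij: "m * (m + 1) = 2 * i" "m * (m + 3) = 2 * j" by (elim evenE)
    have ij': "M * (M + 1) = 2 * of_int i" "M * (M + 3) = 2 * of_int j"
      using arg_cong[OF ij(1), of "of_int :: int \<Rightarrow> complex"] arg_cong[OF ij(2), of "of_int :: int \<Rightarrow> complex"] by simp_all
    have "\<eta> ^ 4 + \<tau> + w - (\<eta>\<^sup>2 - M) = (M * (M + 1) + 2) * \<eta>\<^sup>2 + (M * (M + 3) + 2) * \<eta> + 2 * M + 2 * \<tau>"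
      unfolding root_fourth[OF eta_cubic] w_def by (simp add: algebra_simps power2_eq_square)
    also have "\<dots> = 2 * ((of_int i + 1) * \<eta>\<^sup>2 + (of_int j + 1) * \<eta> + M + \<tau>)"
      unfolding ij' by (simp add: algebra_simps)
    finally show ?thesis by (rule cong_modI) (intro ring_mem gens)
  qed
  finally have "cong_mod 2 (a + M) (\<eta>\<^sup>2 - M + M)" by (intro cong_mod_add cong_mod_refl)
  then have "cong_mod 2 (a + M) (\<eta>\<^sup>2)" by simp
  then have "cong_mod 2 ((a + M) ^ 32) ((\<eta>\<^sup>2) ^ 32)" by (intro cong_mod_power ring_mem aR gens)
  also have "(\<eta>\<^sup>2) ^ 32 = \<eta> ^ 64" by (simp flip: power_mult)
  also note e64
  finally have e: "cong_mod 2 \<eta> ((a + M) ^ 32)" by (rule cong_mod_sym)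
  have t: "cong_mod 2 \<tau> (w - (a + M) ^ 32)"
    using cong_mod_diff[OF cong_mod_refl[of 2 w] e] by (simp add: w_def)
  have eW: "(a + M) ^ 32 \<in> int_adjoin w" "w - (a + M) ^ 32 \<in> int_adjoin w"
    by (intro W.ring_mem aW int_adjoin_self)+
  have gen: "\<exists>y\<in>int_adjoin w. cong_mod (of_nat 2) x y" if "x \<in> R" for x
  proof (rule local_span_residue[OF _ w cong_mod_self _ that])
    fix x assume "x \<in> {\<eta>, \<tau>}"
    then show "\<exists>y\<in>int_adjoin w. cong_mod (of_nat 2) x y" using e t eW by auto
  qed (simp add: R_def)
  have "cong_mod 2 (w ^ 64) (\<eta> ^ 64 + \<tau> ^ 64)" using fr[OF gens, of 6] by (simp add: w_def)
  also have "cong_mod 2 (\<eta> ^ 64 + \<tau> ^ 64) (\<eta> + \<tau>)"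
  proof (rule cong_mod_add[OF e64])
    have "cong_mod 2 (((\<tau> ^ 4) ^ 4) ^ 4) ((\<tau> ^ 4) ^ 4)" by (intro cong_mod_power t4 ring_mem gens)
    also have "cong_mod 2 ((\<tau> ^ 4) ^ 4) (\<tau> ^ 4)" by (intro cong_mod_power t4 ring_mem gens)
    also note t4
    finally show "cong_mod 2 (\<tau> ^ 64) \<tau>" by (simp flip: power_mult)
  qed
  finally have wq: "cong_mod (of_nat 2) (w ^ (2 ^ 6)) w" by (simp add: w_def)
  show "A \<subseteq> R" "monogenic_mod 2"
    by (rule monogenic_unramified[OF R RK gens(1) dR w gen _ wq]; simp)+
qed

text \<open>With \<rho> = 1 + \<delta> one has \<rho>^2 = 2 (\<delta> + h) for h = 2 n + 2, and
  \<delta> + h is a unit because its product with \<delta> - h is the odd integer D - h^2. Modulo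
  \<rho> the element \<delta> is -1, so \<eta> generates the residue ring.\<close>

lemma local_order_2_ramified:
  assumes D: "D = 4 * n + 3"
  defines "R \<equiv> local_span 2 {\<eta>, \<delta>}"
  shows "p_local_order R 2" "A \<subseteq> R" "monogenic_mod 2"
    "complex_subring.cong_mod R 2 ((1 + \<delta>)\<^sup>2) 0" "complex_subring.cong_mod R (1 + \<delta>) 2 0"
proof -
  show R: "p_local_order R 2"
    unfolding R_def using delta_mem_A eta_mem_A
    by (intro local_span_order two_p) (auto simp: A_iff algebraic_int_imp_p_integral)
  interpret p_local_order R 2 by (rule R)
  have gens: "\<eta> \<in> R" "\<delta> \<in> R" unfolding R_def by (auto intro: local_span_base)
  have RK: "R \<subseteq> K"
    unfolding R_def using delta_mem_A eta_mem_A by (intro local_span_subset[OF K_subfield]) (auto simp: A_iff)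
  define \<rho> where "\<rho> = 1 + \<delta>"
  have \<rho>: "\<rho> \<in> R" unfolding \<rho>_def by (intro ring_mem gens)
  define h where "h = 2 * n + 2"
  have \<rho>2: "\<rho>\<^sup>2 = 2 * (\<delta> + of_int h)"
    using delta_square by (simp add: \<rho>_def h_def D power2_eq_square algebra_simps)
  have 1: "cong_mod 2 (\<rho>\<^sup>2) 0"
    by (rule cong_modI[of _ _ _ "\<delta> + of_int h"]) (auto simp: \<rho>2 intro!: ring_mem gens)
  have odd: "\<not> int 2 dvd D - h\<^sup>2" unfolding D h_def by (simp add: power2_eq_square)
  have 2: "cong_mod (\<rho>\<^sup>2) 2 0"
  proof (rule cong_modI)
    have "(\<delta> + of_int h) * (\<delta> - of_int h) = of_int (D - h\<^sup>2)"
      using delta_square by (simp add: algebra_simps power2_eq_square)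
    moreover have "of_int (D - h\<^sup>2) \<noteq> (0 :: complex)" using odd by (metis dvd_0_right of_int_eq_0_iff)
    ultimately have "(\<delta> + of_int h) * ((\<delta> - of_int h) * (1 / of_int (D - h\<^sup>2))) = 1"
      by (metis divide_self mult.assoc times_divide_eq_right mult.right_neutral)
    then have "\<rho>\<^sup>2 * ((\<delta> - of_int h) * (1 / of_int (D - h\<^sup>2))) = 2 * 1"
      unfolding \<rho>2 by (simp only: mult.assoc)
    then show "2 - 0 = \<rho>\<^sup>2 * ((\<delta> - of_int h) * (1 / of_int (D - h\<^sup>2)))" by simp
  qed (intro ring_mem gens inverse_mem odd)
  have "cong_mod \<rho> (\<rho>\<^sup>2) 0" by (rule cong_modI[of _ _ _ \<rho>]) (auto simp: power2_eq_square \<rho>)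
  then have 3: "cong_mod \<rho> 2 0" using cong_mod_coarsen'[OF 2] by blast
  interpret W: complex_subring "int_adjoin \<eta>" by (rule int_adjoin_subring)
  have d: "cong_mod \<rho> \<delta> (- 1)" by (rule cong_modI[of _ _ _ 1]) (auto simp: \<rho>_def intro: one_mem)
  have "- 1 \<in> int_adjoin \<eta>" by (intro W.ring_mem)
  then have gen: "\<exists>y\<in>int_adjoin \<eta>. cong_mod \<rho> x y" if "x \<in> R" for x
  proof (intro local_span_residue[OF _ gens(1) _ _ that])
    fix x assume "x \<in> {\<eta>, \<delta>}"
    then show "\<exists>y\<in>int_adjoin \<eta>. cong_mod \<rho> x y"
      using d \<open>- 1 \<in> int_adjoin \<eta>\<close> cong_mod_refl int_adjoin_self by blast
  qed (use 3 in \<open>auto simp: R_def\<close>)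
  have wq: "cong_mod \<rho> (\<eta> ^ (2 ^ 6)) \<eta>"
    using cong_mod_coarsen'[OF eta_Frobenius_2[OF complex_subring_axioms gens(1)] 3] by simp
  show "A \<subseteq> R" "monogenic_mod 2"
    using 1 2 by (intro monogenic_ramified[OF R RK gens(1,2) gens(1) gen _ wq \<rho>, of 2]; simp)+
  show "cong_mod 2 ((1 + \<delta>)\<^sup>2) 0" "cong_mod (1 + \<delta>) 2 0" using 1 3 by (simp_all add: \<rho>_def)
qed

section \<open>Local orders at the prime 3\<close>

lemma three_p: "prime (3 :: nat)" by simp

text \<open>If \<open>3\<close> does not divide \<open>m\<close>, it is inert in the cubic subfield.\<close>

lemma root_Frobenius_3:
  assumes R: "complex_subring R" and h: "h \<in> R" "h ^ 3 = M * h\<^sup>2 + (M + 3) * h + 1"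
    and m3: "m mod 3 = 1 \<or> m mod 3 = 2"
  shows "complex_subring.cong_mod R 3 (h ^ 3) (if m mod 3 = 1 then next_root h else prev_root h)"
proof -
  interpret complex_subring R by (rule R)
  show ?thesis
  proof (cases "m mod 3 = 1")
    case True
    then obtain i where "m = 3 * i + 1" by (metis mult_div_mod_eq)
    then have i: "M = 3 * of_int i + 1" by simp
    have "h ^ 3 - next_root h = 3 * (of_int i * h\<^sup>2 + (2 * of_int i + 2) * h + 1)"
      unfolding h(2) next_root_def i by (simp add: algebra_simps)
    then have "cong_mod 3 (h ^ 3) (next_root h)" by (rule cong_modI) (intro ring_mem h(1))
    then show ?thesis using True by simp
  next
    case False
    then have "m mod 3 = 2" using m3 by simp
    then obtain i where "m = 3 * i + 2" by (metis mult_div_mod_eq)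
    then have i: "M = 3 * of_int i + 2" by simp
    have "h ^ 3 - prev_root h = 3 * ((of_int i + 1) * h\<^sup>2 + h - of_int i - 1)"
      unfolding h(2) prev_root_def i by (simp add: algebra_simps)
    then have "cong_mod 3 (h ^ 3) (prev_root h)" by (rule cong_modI) (intro ring_mem h(1))
    then show ?thesis using False by simp
  qed
qed

lemma eta_Frobenius_3:
  assumes R: "complex_subring R" and h: "\<eta> \<in> R" and m3: "m mod 3 = 1 \<or> m mod 3 = 2"
  shows "complex_subring.cong_mod R 3 (\<eta> ^ 27) \<eta>"
proof -
  interpret complex_subring R by (rule R)
  have n: "next_root x \<in> R" "prev_root x \<in> R" if "x \<in> R" for x
    unfolding next_root_def prev_root_def by (intro ring_mem that)+
  have mem: "\<eta>' \<in> R" "\<eta>'' \<in> R" using n[OF h] by (simp_all add: next_eta prev_eta)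
  note F = root_Frobenius_3[OF R h eta_cubic m3] root_Frobenius_3[OF R mem(1) eta'_cubic m3]
    root_Frobenius_3[OF R mem(2) eta''_cubic m3]
  have e: "\<eta> ^ 27 = ((\<eta> ^ 3) ^ 3) ^ 3" by (simp flip: power_mult)
  show ?thesis
  proof (cases "m mod 3 = 1")
    case True
    have "cong_mod 3 (((\<eta> ^ 3) ^ 3) ^ 3) ((\<eta>' ^ 3) ^ 3)"
      using F(1) True by (intro cong_mod_power ring_mem h mem) (simp add: next_eta)
    also have "cong_mod 3 ((\<eta>' ^ 3) ^ 3) (\<eta>'' ^ 3)"
      using F(2) True by (intro cong_mod_power ring_mem h mem) (simp add: next_eta')
    also have "cong_mod 3 (\<eta>'' ^ 3) \<eta>" using F(3) True by (simp add: next_eta'')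
    finally show ?thesis unfolding e .
  next
    case False
    have "cong_mod 3 (((\<eta> ^ 3) ^ 3) ^ 3) ((\<eta>'' ^ 3) ^ 3)"
      using F(1) False by (intro cong_mod_power ring_mem h mem) (simp add: prev_eta)
    also have "cong_mod 3 ((\<eta>'' ^ 3) ^ 3) (\<eta>' ^ 3)"
      using F(3) False by (intro cong_mod_power ring_mem h mem) (simp add: prev_eta'')
    also have "cong_mod 3 (\<eta>' ^ 3) \<eta>" using F(2) False by (simp add: prev_eta')
    finally show ?thesis unfolding e .
  qed
qed

lemma D_mod_3:
  assumes "m mod 3 = 1 \<or> m mod 3 = 2"
  shows "\<exists>j. D = 3 * j + 1"
proof -
  obtain k where "m = 3 * k + 1 \<or> m = 3 * k + 2" using assms by (metis mult_div_mod_eq)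
  then have "m\<^sup>2 + 3 * m + 9 = 3 * (3 * k\<^sup>2 + 5 * k + 4) + 1 \<or> m\<^sup>2 + 3 * m + 9 = 3 * (3 * k\<^sup>2 + 7 * k + 6) + 1"
    by (auto simp: power2_eq_square algebra_simps)
  then show ?thesis unfolding D_def by blast
qed

text \<open>The generator modulo 3 is w = \<eta> + \<delta>. As D is 1 modulo 3, \<delta>^3 is
  congruent to \<delta>, and w^3 - w to \<eta>^3 - \<eta>. For either residue of m a quadratic
  polynomial in this element gives \<eta> back.\<close>

lemma local_order_3_unramified:
  assumes m3: "m mod 3 = 1 \<or> m mod 3 = 2"
  defines "R \<equiv> local_span 3 {\<eta>, \<delta>}"
  shows "p_local_order R 3" "A \<subseteq> R" "monogenic_mod 3"
proof -
  show R: "p_local_order R 3"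
    unfolding R_def using delta_mem_A eta_mem_A
    by (intro local_span_order three_p) (auto simp: A_iff algebraic_int_imp_p_integral)
  interpret p_local_order R 3 by (rule R)
  have gens: "\<eta> \<in> R" "\<delta> \<in> R" unfolding R_def by (auto intro: local_span_base)
  have RK: "R \<subseteq> K"
    unfolding R_def using delta_mem_A eta_mem_A by (intro local_span_subset[OF K_subfield]) (auto simp: A_iff)
  define w where "w = \<eta> + \<delta>"
  have w: "w \<in> R" unfolding w_def by (intro ring_mem gens)
  interpret W: complex_subring "int_adjoin w" by (rule int_adjoin_subring)
  have fr: "cong_mod 3 ((x + y) ^ (3 ^ s)) (x ^ (3 ^ s) + y ^ (3 ^ s))" if "x \<in> R" "y \<in> R" for x y s
    using cong_mod_Frobenius_add[OF three_p that, of s] by simp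
  obtain j where j: "D = 3 * j + 1" using D_mod_3[OF m3] by blast
  have "\<delta> ^ 3 = \<delta>\<^sup>2 * \<delta>" by (simp add: eval_nat_numeral)
  also have "\<dots> - \<delta> = 3 * (of_int j * \<delta>)" unfolding delta_square j by (simp add: algebra_simps)
  finally have d3: "cong_mod 3 (\<delta> ^ 3) \<delta>" by (rule cong_modI) (intro ring_mem gens)
  have e27: "cong_mod 3 (\<eta> ^ 27) \<eta>" by (rule eta_Frobenius_3[OF complex_subring_axioms gens(1) m3])
  have w3: "cong_mod 3 (w ^ 3 - w) (\<eta> ^ 3 - \<eta>)"
  proof -
    have "cong_mod 3 (w ^ 3) (\<eta> ^ 3 + \<delta> ^ 3)" using fr[OF gens, of 1] by (simp add: w_def)
    also have "cong_mod 3 (\<eta> ^ 3 + \<delta> ^ 3) (\<eta> ^ 3 + \<delta>)" by (intro cong_mod_add cong_mod_refl d3)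
    finally have "cong_mod 3 (w ^ 3 - w) (\<eta> ^ 3 + \<delta> - w)" by (intro cong_mod_diff cong_mod_refl)
    then show ?thesis by (simp add: w_def algebra_simps)
  qed
  have "\<exists>y\<in>int_adjoin w. cong_mod 3 \<eta> y"
  proof (cases "m mod 3 = 1")
    case True
    then obtain i where "m = 3 * i + 1" by (metis mult_div_mod_eq)
    then have i: "M = 3 * of_int i + 1" by simp
    define b where "b = w ^ 3 - w - 1"
    have bR: "b \<in> R" and bW: "b \<in> int_adjoin w"
      unfolding b_def by (intro ring_mem w W.ring_mem int_adjoin_self)+
    have "\<eta> ^ 3 - \<eta> - 1 - \<eta>\<^sup>2 = 3 * (of_int i * \<eta>\<^sup>2 + (of_int i + 1) * \<eta>)"
      unfolding eta_cubic i by (simp add: algebra_simps)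
    then have "cong_mod 3 (\<eta> ^ 3 - \<eta> - 1) (\<eta>\<^sup>2)" by (rule cong_modI) (intro ring_mem gens)
    moreover have "cong_mod 3 b (\<eta> ^ 3 - \<eta> - 1)"
      unfolding b_def by (intro cong_mod_diff w3 cong_mod_refl)
    ultimately have b: "cong_mod 3 b (\<eta>\<^sup>2)" using cong_mod_trans by blast
    have "cong_mod 3 (- (b\<^sup>2) - b + 1) (- ((\<eta>\<^sup>2)\<^sup>2) - \<eta>\<^sup>2 + 1)"
      by (intro cong_mod_add cong_mod_diff cong_mod_uminus cong_mod_power b cong_mod_refl bR ring_mem gens)
    also have "(\<eta>\<^sup>2)\<^sup>2 = \<eta> ^ 4" by (simp flip: power_mult)
    also have "cong_mod 3 (- (\<eta> ^ 4) - \<eta>\<^sup>2 + 1) \<eta>"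
    proof (rule cong_modI)
      show "- (\<eta> ^ 4) - \<eta>\<^sup>2 + 1 - \<eta> = 3 * (- (3 * of_int i ^ 2 + 3 * of_int i + 2) * \<eta>\<^sup>2 - (3 * of_int i ^ 2 + 5 * of_int i + 2) * \<eta> - of_int i)"
        unfolding root_fourth[OF eta_cubic] i by (simp add: algebra_simps power2_eq_square)
    qed (intro ring_mem gens)
    finally show ?thesis
      using cong_mod_sym by (intro bexI[of _ "- (b\<^sup>2) - b + 1"] W.ring_mem bW) blast
  next
    case False
    then have "m mod 3 = 2" using m3 by simp
    then obtain i where "m = 3 * i + 2" by (metis mult_div_mod_eq)
    then have i: "M = 3 * of_int i + 2" by simp
    define b where "b = w ^ 3 - w - 1"
    have bR: "b \<in> R" and bW: "b \<in> int_adjoin w"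
      unfolding b_def by (intro ring_mem w W.ring_mem int_adjoin_self)+
    have "\<eta> ^ 3 - \<eta> - 1 - (\<eta> - \<eta>\<^sup>2) = 3 * ((of_int i + 1) * \<eta>\<^sup>2 + (of_int i + 1) * \<eta>)"
      unfolding eta_cubic i by (simp add: algebra_simps)
    then have "cong_mod 3 (\<eta> ^ 3 - \<eta> - 1) (\<eta> - \<eta>\<^sup>2)" by (rule cong_modI) (intro ring_mem gens)
    moreover have "cong_mod 3 b (\<eta> ^ 3 - \<eta> - 1)"
      unfolding b_def by (intro cong_mod_diff w3 cong_mod_refl)
    ultimately have b: "cong_mod 3 b (\<eta> - \<eta>\<^sup>2)" using cong_mod_trans by blast
    have "cong_mod 3 (b\<^sup>2) ((\<eta> - \<eta>\<^sup>2)\<^sup>2)" by (intro cong_mod_power b bR ring_mem gens)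
    also have "(\<eta> - \<eta>\<^sup>2)\<^sup>2 = \<eta> ^ 4 - 2 * \<eta> ^ 3 + \<eta>\<^sup>2"
      by (simp add: algebra_simps eval_nat_numeral)
    also have "cong_mod 3 (\<eta> ^ 4 - 2 * \<eta> ^ 3 + \<eta>\<^sup>2) \<eta>"
    proof (rule cong_modI)
      show "\<eta> ^ 4 - 2 * \<eta> ^ 3 + \<eta>\<^sup>2 - \<eta> = 3 * ((3 * of_int i ^ 2 + 3 * of_int i + 2) * \<eta>\<^sup>2 + (3 * of_int i ^ 2 + 5 * of_int i) * \<eta> + of_int i)"
        unfolding root_fourth[OF eta_cubic] eta_cubic i by (simp add: algebra_simps power2_eq_square)
    qed (intro ring_mem gens)
    finally show ?thesis
      using cong_mod_sym by (intro bexI[of _ "b\<^sup>2"] W.ring_mem bW) blast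
  qed
  then obtain y where y: "y \<in> int_adjoin w" "cong_mod 3 \<eta> y" by blast
  have t: "cong_mod 3 \<delta> (w - y)"
    using cong_mod_diff[OF cong_mod_refl[of 3 w] y(2)] by (simp add: w_def)
  have yW: "w - y \<in> int_adjoin w" by (intro W.ring_mem y int_adjoin_self)
  have gen: "\<exists>y\<in>int_adjoin w. cong_mod (of_nat 3) x y" if "x \<in> R" for x
  proof (rule local_span_residue[OF _ w cong_mod_self _ that])
    fix x assume "x \<in> {\<eta>, \<delta>}"
    then show "\<exists>y\<in>int_adjoin w. cong_mod (of_nat 3) x y" using y t yW by auto
  qed (simp add: R_def)
  have "cong_mod 3 (w ^ 27) (\<eta> ^ 27 + \<delta> ^ 27)" using fr[OF gens, of 3] by (simp add: w_def)
  also have "cong_mod 3 (\<eta> ^ 27 + \<delta> ^ 27) (\<eta> + \<delta>)"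
  proof (rule cong_mod_add[OF e27])
    have "cong_mod 3 (((\<delta> ^ 3) ^ 3) ^ 3) ((\<delta> ^ 3) ^ 3)" by (intro cong_mod_power d3 ring_mem gens)
    also have "cong_mod 3 ((\<delta> ^ 3) ^ 3) (\<delta> ^ 3)" by (intro cong_mod_power d3 ring_mem gens)
    also note d3
    finally show "cong_mod 3 (\<delta> ^ 27) \<delta>" by (simp flip: power_mult)
  qed
  finally have wq: "cong_mod (of_nat 3) (w ^ (3 ^ 3)) w" by (simp add: w_def)
  show "A \<subseteq> R" "monogenic_mod 3"
    by (rule monogenic_unramified[OF R RK gens w gen _ wq]; simp)+
qed

text \<open>If 3 divides m, then 9 divides D and the cubic is congruent to (x - 1)^3 modulo 3;
  \<delta>3 and \<mu> adapt \<delta> and \<eta> to this.\<close>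

definition \<delta>3 :: complex where "\<delta>3 = \<delta> / 3"
definition \<mu> :: complex where "\<mu> = \<eta> - 1"

lemma mu_cubic:
  assumes "m = 3 * n"
  shows "\<mu> ^ 3 = 3 * ((of_int n - 1) * \<mu>\<^sup>2 + 3 * of_int n * \<mu> + of_int (2 * n + 1))"
proof -
  have M: "M = 3 * of_int n" using assms by simp
  have "\<mu> ^ 3 - 3 * ((of_int n - 1) * \<mu>\<^sup>2 + 3 * of_int n * \<mu> + of_int (2 * n + 1)) =
      \<eta> ^ 3 - (M * \<eta>\<^sup>2 + (M + 3) * \<eta> + 1)"
    by (simp add: \<mu>_def M algebra_simps eval_nat_numeral)
  also have "\<dots> = 0" using eta_cubic by simp
  finally show ?thesis by simp
qed

lemma delta3_square:
  assumes "m = 3 * n"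
  shows "\<delta>3\<^sup>2 = of_int (n\<^sup>2 + n + 1)"
proof -
  have "m\<^sup>2 + 3 * m + 9 = 9 * (n\<^sup>2 + n + 1)" using assms by (simp add: power2_eq_square)
  then have "D = 9 * (n\<^sup>2 + n + 1)" unfolding D_def .
  then have "of_int D = (9 * of_int (n\<^sup>2 + n + 1) :: complex)" by (simp only: of_int_mult of_int_numeral)
  then show ?thesis unfolding \<delta>3_def power_divide delta_square by simp
qed

lemma delta3_mem_A: "m = 3 * n \<Longrightarrow> \<delta>3 \<in> A"
proof -
  assume "m = 3 * n"
  then have "algebraic_int (\<delta>3\<^sup>2)" by (simp only: delta3_square algebraic_int_of_int)
  moreover have "\<delta>3 \<in> K" unfolding \<delta>3_def by (intro K_closed delta_mem_K)
  ultimately show ?thesis using algebraic_int_power_root[of \<delta>3 2] by (simp add: A_iff)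
qed

lemma mu_mem_A: "\<mu> \<in> A" unfolding \<mu>_def by (intro A.ring_mem eta_mem_A)

text \<open>The element \<mu> is a uniformizer with ramification index 3: \<mu>^3 = 3 U, and U is
  congruent modulo \<mu> to 2 n + 1, which 3 divides only for n = 1 modulo 3. The square of
  \<delta>3 is congruent to 1, so \<delta>3 generates the residue ring and is fixed by
  cubing.\<close>

lemma local_order_3_cubic_ramified:
  assumes m: "m = 3 * n" and n: "n mod 3 \<noteq> 1"
  defines "R \<equiv> local_span 3 {\<mu>, \<delta>3}"
  shows "p_local_order R 3" "A \<subseteq> R" "monogenic_mod 3" "complex_subring.cong_mod R 3 (\<mu> ^ 3) 0"
    "\<mu> \<in> R" "\<delta>3 \<in> R" "complex_subring.cong_mod R \<mu> (\<delta>3\<^sup>2) 1"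
    "\<And>x. x \<in> R \<Longrightarrow> \<exists>y\<in>int_adjoin \<delta>3. complex_subring.cong_mod R \<mu> x y"
    "complex_subring.cong_mod R \<mu> 3 0"
proof -
  show R: "p_local_order R 3"
    unfolding R_def using delta3_mem_A[OF m] mu_mem_A
    by (intro local_span_order three_p) (auto simp: A_iff algebraic_int_imp_p_integral)
  interpret p_local_order R 3 by (rule R)
  show gens: "\<mu> \<in> R" "\<delta>3 \<in> R" unfolding R_def by (auto intro: local_span_base)
  have "\<eta> = \<mu> + 1" "\<delta> = 3 * \<delta>3" by (simp_all add: \<mu>_def \<delta>3_def)
  then have mem: "\<eta> \<in> R" "\<delta> \<in> R" using gens by (simp_all add: ring_mem)
  have RK: "R \<subseteq> K"
    unfolding R_def using delta3_mem_A[OF m] mu_mem_A by (intro local_span_subset[OF K_subfield]) (auto simp: A_iff)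
  define U where "U = (of_int n - 1) * \<mu>\<^sup>2 + 3 * of_int n * \<mu> + of_int (2 * n + 1)"
  have U: "U \<in> R" unfolding U_def by (intro ring_mem gens)
  have \<mu>3: "\<mu> ^ 3 = 3 * U" unfolding U_def by (rule mu_cubic[OF m])
  show 1: "cong_mod 3 (\<mu> ^ 3) 0" by (rule cong_modI[of _ _ _ U]) (simp_all add: \<mu>3 U)
  have "U - of_int (2 * n + 1) = \<mu> * ((of_int n - 1) * \<mu> + 3 * of_int n)"
    by (simp add: U_def algebra_simps power2_eq_square)
  then have "cong_mod \<mu> U (of_int (2 * n + 1))" by (rule cong_modI) (intro ring_mem gens)
  moreover have "\<not> int 3 dvd 2 * n + 1" using n by presburger
  ultimately obtain u where u: "u \<in> R" "U * u = 1"
    using unit_mod_radical[OF U gens(1), of 3] 1 by (auto simp del: of_int_add)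
  have three: "3 = \<mu> ^ 3 * u" using u(2) by (simp add: \<mu>3)
  have "3 - 0 = \<mu>\<^sup>2 * (\<mu> * u)" using three by (simp add: eval_nat_numeral mult.assoc)
  then have 2: "cong_mod (\<mu>\<^sup>2) 3 0" by (rule cong_modI) (intro ring_mem gens u)
  have "cong_mod \<mu> (\<mu>\<^sup>2) 0" by (rule cong_modI[of _ _ _ \<mu>]) (auto simp: power2_eq_square gens)
  then show 3: "cong_mod \<mu> 3 0" using cong_mod_coarsen'[OF 2] by blast
  have "n mod 3 = 0 \<or> n mod 3 = 2" using n by presburger
  then obtain k where "n = 3 * k \<or> n = 3 * k + 2" by (metis add.right_neutral mult_div_mod_eq)
  then have "n\<^sup>2 + n + 1 = 3 * (3 * k\<^sup>2 + k) + 1 \<or> n\<^sup>2 + n + 1 = 3 * (3 * k\<^sup>2 + 5 * k + 2) + 1"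
    by (auto simp: power2_eq_square algebra_simps)
  then obtain j where j: "n\<^sup>2 + n + 1 = 3 * j + 1" by blast
  have d2: "\<delta>3\<^sup>2 = 3 * of_int j + 1" unfolding delta3_square[OF m] j by simp
  have "cong_mod 3 (\<delta>3\<^sup>2) 1"
    by (rule cong_modI[of _ _ _ "of_int j"]) (auto simp: d2 intro: of_int_mem)
  then show d1: "cong_mod \<mu> (\<delta>3\<^sup>2) 1" using cong_mod_coarsen' 3 by blast
  have "cong_mod \<mu> (\<delta>3 * \<delta>3\<^sup>2) (\<delta>3 * 1)" by (intro cong_mod_scale d1 gens)
  then have wq: "cong_mod \<mu> (\<delta>3 ^ (3 ^ 1)) \<delta>3" by (simp add: eval_nat_numeral)
  interpret W: complex_subring "int_adjoin \<delta>3" by (rule int_adjoin_subring)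
  show gen: "\<exists>y\<in>int_adjoin \<delta>3. cong_mod \<mu> x y" if "x \<in> R" for x
  proof (rule local_span_residue[OF _ gens(2) _ _ that])
    fix x assume "x \<in> {\<mu>, \<delta>3}"
    then show "\<exists>y\<in>int_adjoin \<delta>3. cong_mod \<mu> x y"
      using cong_mod_refl cong_mod_self int_adjoin_self W.zero_mem by blast
  qed (use 3 in \<open>auto simp: R_def\<close>)
  show "A \<subseteq> R" "monogenic_mod 3"
    using 1 2 by (intro monogenic_ramified[OF R RK mem gens(2) gen _ wq gens(1), of 3]; simp)+
qed

text \<open>Here \<mu>^3 = 9 U and \<delta>3^2 = 3 E with units U and E, so \<mu> has valuation 2/3
  and \<delta>3 has valuation 1/2. Their quotient \<rho> has valuation 1/6, and every residue is
  that of an integer.\<close>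

lemma local_order_3_totally_ramified:
  assumes m: "m = 3 * n" and n: "n = 3 * l + 1" and l: "l mod 3 \<noteq> 1"
  obtains R \<rho> where "p_local_order R 3" "R \<subseteq> K" "A \<subseteq> R" "monogenic_mod 3"
    "complex_subring.cong_mod R 3 (\<rho> ^ 6) 0" "\<rho> \<in> R"
    "\<And>x. x \<in> R \<Longrightarrow> \<exists>y\<in>int_adjoin 1. complex_subring.cong_mod R \<rho> x y"
proof -
  define E where "E = 3 * l\<^sup>2 + 3 * l + 1"
  have E3: "\<not> int 3 dvd E"
  proof -
    have "E = 3 * (l\<^sup>2 + l) + 1" by (simp add: E_def)
    then show ?thesis by presburger
  qed
  then have E0: "E \<noteq> 0" by auto
  have "n\<^sup>2 + n + 1 = 3 * E" by (simp add: n E_def power2_eq_square algebra_simps)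
  then have d2: "\<delta>3\<^sup>2 = 3 * of_int E" using delta3_square[OF m] by simp
  define U where "U = of_int l * \<mu>\<^sup>2 + (3 * of_int l + 1) * \<mu> + of_int (2 * l + 1)"
  have \<mu>3: "\<mu> ^ 3 = 9 * U" unfolding mu_cubic[OF m] U_def n by (simp add: algebra_simps)
  have dn: "\<delta>3 \<noteq> 0" using d2 E0 by auto
  define \<rho> where "\<rho> = \<mu> / \<delta>3"
  have \<mu>: "\<mu> = \<rho> * \<delta>3" using dn by (simp add: \<rho>_def)
  have \<rho>3: "\<rho> ^ 3 * of_int E ^ 2 = U * \<delta>3"
  proof -
    have "\<rho> ^ 3 * (\<delta>3\<^sup>2)\<^sup>2 = \<mu> ^ 3 * \<delta>3"
      using dn by (simp add: \<rho>_def field_simps eval_nat_numeral)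
    then have "9 * (\<rho> ^ 3 * of_int E ^ 2) = 9 * (U * \<delta>3)" unfolding d2 \<mu>3
      by (simp add: power_mult_distrib mult_ac)
    then show ?thesis by simp
  qed
  have \<rho>6: "\<rho> ^ 6 * of_int (E ^ 3) = 3 * U\<^sup>2"
  proof -
    have "\<rho> ^ 6 * of_int (E ^ 3) * of_int E = (\<rho> ^ 3 * of_int E ^ 2)\<^sup>2"
      by (simp add: eval_nat_numeral mult_ac)
    also have "\<dots> = 3 * U\<^sup>2 * of_int E" unfolding \<rho>3 power_mult_distrib d2 by (simp add: mult_ac)
    finally show ?thesis using E0 by simp
  qed
  define R where "R = local_span 3 {\<rho>, \<delta>3}"
  have UA: "U \<in> A" unfolding U_def by (intro A.ring_mem mu_mem_A)
  have p\<rho>: "p_integral 3 \<rho>"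
  proof (rule p_integral_power_root[OF three_p, of _ 6], rule p_integralI)
    show "\<not> int 3 dvd E ^ 3" using E3 prime_dvd_power[of 3 E 3] by auto
    have "of_int (E ^ 3) * \<rho> ^ 6 \<in> A" using \<rho>6 UA by (simp add: mult.commute A.ring_mem)
    then show "algebraic_int (of_int (E ^ 3) * \<rho> ^ 6)" by (simp add: A_iff)
  qed simp
  have R: "p_local_order R 3"
    unfolding R_def using delta3_mem_A[OF m] p\<rho>
    by (intro local_span_order three_p) (auto simp: A_iff algebraic_int_imp_p_integral)
  interpret p_local_order R 3 by (rule R)
  have gens: "\<rho> \<in> R" "\<delta>3 \<in> R" unfolding R_def by (auto intro: local_span_base)
  have \<mu>R: "\<mu> \<in> R" unfolding \<mu> by (intro ring_mem gens)
  have "\<eta> = \<mu> + 1" "\<delta> = 3 * \<delta>3" by (simp_all add: \<mu>_def \<delta>3_def)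
  then have mem: "\<eta> \<in> R" "\<delta> \<in> R" using gens \<mu>R by (simp_all add: ring_mem)
  have RK: "R \<subseteq> K"
    unfolding R_def
  proof (rule local_span_subset[OF K_subfield])
    have "\<delta>3 \<in> K" "\<mu> \<in> K" using delta3_mem_A[OF m] mu_mem_A by (simp_all add: A_iff)
    then show "{\<rho>, \<delta>3} \<subseteq> K" unfolding \<rho>_def using K_closed(8) by simp
  qed
  have U: "U \<in> R" unfolding U_def by (intro ring_mem \<mu>R)
  have Ei: "1 / of_int E \<in> R" by (rule inverse_mem[OF E3])
  have \<rho>6': "\<rho> ^ 6 = 3 * (U\<^sup>2 * (1 / of_int E) ^ 3)"
    using \<rho>6 E0 by (simp add: field_simps)
  have 1: "cong_mod 3 (\<rho> ^ 6) 0"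
    by (rule cong_modI[of _ _ _ "U\<^sup>2 * (1 / of_int E) ^ 3"]) (simp_all only: \<rho>6' diff_zero, intro ring_mem U Ei)
  have "U - of_int (2 * l + 1) = \<rho> * (\<delta>3 * (of_int l * \<mu> + (3 * of_int l + 1)))"
    unfolding U_def by (simp add: \<mu> algebra_simps power2_eq_square)
  then have "cong_mod \<rho> U (of_int (2 * l + 1))" by (rule cong_modI) (intro ring_mem gens \<mu>R)
  moreover have "\<not> int 3 dvd 2 * l + 1" using l by presburger
  ultimately obtain u where u: "u \<in> R" "U * u = 1"
    using unit_mod_radical[OF U gens(1), of 6] 1 by (auto simp del: of_int_add)
  have three: "3 = \<rho> ^ 6 * (of_int E ^ 3 * u\<^sup>2)"
  proof -
    have "3 = 3 * (U * u)\<^sup>2" using u(2) by simp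
    also have "\<dots> = (3 * U\<^sup>2) * u\<^sup>2" by (simp add: power_mult_distrib)
    also have "\<dots> = \<rho> ^ 6 * (of_int E ^ 3 * u\<^sup>2)" by (simp add: \<rho>6[symmetric] mult_ac)
    finally show ?thesis .
  qed
  have d\<rho>: "\<delta>3 - 0 = \<rho> * (\<rho>\<^sup>2 * of_int E ^ 2 * u)"
  proof -
    have "\<delta>3 = U * \<delta>3 * u" using u(2) by (simp add: mult_ac)
    then show ?thesis unfolding \<rho>3[symmetric] by (simp add: eval_nat_numeral mult_ac)
  qed
  then have d0: "cong_mod \<rho> \<delta>3 0" by (rule cong_modI) (intro ring_mem gens u)
  have "3 - 0 = \<rho>\<^sup>2 * (\<rho> ^ 4 * (of_int E ^ 3 * u\<^sup>2))"
    using three by (simp add: eval_nat_numeral mult_ac)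
  then have 2: "cong_mod (\<rho>\<^sup>2) 3 0" by (rule cong_modI) (intro ring_mem gens u)
  have "cong_mod \<rho> (\<rho>\<^sup>2) 0" by (rule cong_modI[of _ _ _ \<rho>]) (auto simp: power2_eq_square gens)
  then have 3: "cong_mod \<rho> 3 0" using cong_mod_coarsen'[OF 2] by blast
  interpret W: complex_subring "int_adjoin 1" by (rule int_adjoin_subring)
  have gen: "\<exists>y\<in>int_adjoin 1. cong_mod \<rho> x y" if "x \<in> R" for x
  proof (rule local_span_residue[OF _ one_mem _ _ that])
    fix x assume "x \<in> {\<rho>, \<delta>3}"
    then show "\<exists>y\<in>int_adjoin 1. cong_mod \<rho> x y" using d0 cong_mod_self W.zero_mem by blast
  qed (use 3 in \<open>auto simp: R_def\<close>)
  have wq: "cong_mod \<rho> (1 ^ (3 ^ 1)) 1" by (simp add: cong_mod_refl)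
  have "A \<subseteq> R" "monogenic_mod 3"
    using 1 2 by (intro monogenic_ramified[OF R RK mem one_mem gen _ wq gens(1), of 6]; simp)+
  then show ?thesis using that[OF R RK _ _ 1 gens(1) gen] by blast
qed

text \<open>In the remaining class m = 12 modulo 27 the quotient of \<mu> by 3 is still integral
  (\<open>nu_mem_A\<close>), and 3 does not ramify in the cubic field.\<close>

definition \<nu> :: complex where "\<nu> = \<mu> / 3"

lemma nu_cubic:
  assumes "m = 27 * j + 12"
  shows "\<nu> ^ 3 = 3 * of_int (3 * j + 1) * \<nu>\<^sup>2 + of_int (9 * j + 4) * \<nu> + of_int (2 * j + 1)"
proof -
  have m: "m = 3 * (9 * j + 4)" using assms by simp
  have "27 * \<nu> ^ 3 = \<mu> ^ 3" by (simp add: \<nu>_def power_divide)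
  also have "\<dots> = 3 * ((of_int (9 * j + 4) - 1) * \<mu>\<^sup>2 + 3 * of_int (9 * j + 4) * \<mu> + of_int (2 * (9 * j + 4) + 1))"
    by (rule mu_cubic[OF m])
  also have "\<mu> = 3 * \<nu>" by (simp add: \<nu>_def)
  also have "3 * ((of_int (9 * j + 4) - 1) * (3 * \<nu>)\<^sup>2 + 3 * of_int (9 * j + 4) * (3 * \<nu>) + of_int (2 * (9 * j + 4) + 1)) =
      27 * (3 * of_int (3 * j + 1) * \<nu>\<^sup>2 + of_int (9 * j + 4) * \<nu> + of_int (2 * j + 1))"
    by (simp add: algebra_simps power2_eq_square)
  finally show ?thesis by (metis mult_left_cancel zero_neq_numeral)
qed

lemma nu_mem_A:
  assumes "m = 27 * j + 12"
  shows "\<nu> \<in> A"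
proof -
  let ?q = "[:- (2 * j + 1), - (9 * j + 4), - 3 * (3 * j + 1), 1:]"
  have "poly (map_poly of_int ?q) \<nu> =
      \<nu> ^ 3 - (3 * of_int (3 * j + 1) * \<nu>\<^sup>2 + of_int (9 * j + 4) * \<nu> + of_int (2 * j + 1))"
    unfolding ipoly_pCons by (simp add: algebra_simps eval_nat_numeral)
  also have "\<dots> = 0" by (simp only: nu_cubic[OF assms] diff_self)
  finally have "algebraic_int \<nu>"
    unfolding algebraic_int_altdef_ipoly by (intro exI[of _ ?q]) simp
  moreover have "\<nu> \<in> K" unfolding \<nu>_def using mu_mem_A by (intro K_closed) (simp add: A_iff)
  ultimately show ?thesis by (simp add: A_iff)
qed

text \<open>The uniformizer is \<delta>3, with \<delta>3^2 = 3 E. Modulo 3 the cubic of \<nu> is of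
  Artin-Schreier type, \<nu>^3 = \<nu> + g with g = 2 j + 1: cubing adds g, so cubing three times
  adds 3 g. It splits exactly when 3 divides g, that is for m = 39 modulo 81.\<close>

lemma local_order_3_quadratic_ramified:
  assumes m: "m = 27 * j + 12"
  defines "R \<equiv> local_span 3 {\<nu>, \<delta>3}"
  shows "p_local_order R 3" "A \<subseteq> R" "monogenic_mod 3" "complex_subring.cong_mod R 3 (\<delta>3 ^ 2) 0"
    "complex_subring.cong_mod R \<delta>3 3 0" "\<nu> \<in> R" "\<delta>3 \<in> R"
    "complex_subring.cong_mod R 3 (\<nu> ^ 3) (\<nu> + of_int (2 * j + 1))"
proof -
  have m3: "m = 3 * (9 * j + 4)" using m by simp
  define E where "E = 27 * j\<^sup>2 + 27 * j + 7"
  have E3: "\<not> int 3 dvd E"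
  proof -
    have "E = 3 * (9 * j\<^sup>2 + 9 * j + 2) + 1" by (simp add: E_def)
    then show ?thesis by presburger
  qed
  then have E0: "E \<noteq> 0" by auto
  have "(9 * j + 4)\<^sup>2 + (9 * j + 4) + 1 = 3 * E" by (simp add: E_def power2_eq_square algebra_simps)
  then have d2: "\<delta>3\<^sup>2 = 3 * of_int E" using delta3_square[OF m3] by simp
  show R: "p_local_order R 3"
    unfolding R_def using delta3_mem_A[OF m3] nu_mem_A[OF m]
    by (intro local_span_order three_p) (auto simp: A_iff algebraic_int_imp_p_integral)
  interpret p_local_order R 3 by (rule R)
  show gens: "\<nu> \<in> R" "\<delta>3 \<in> R" unfolding R_def by (auto intro: local_span_base)
  have "3 * \<nu> = \<mu>" by (simp add: \<nu>_def)
  then have "\<eta> = 3 * \<nu> + 1" "\<delta> = 3 * \<delta>3" by (simp_all add: \<mu>_def \<delta>3_def)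
  then have mem: "\<eta> \<in> R" "\<delta> \<in> R" using gens by (simp_all add: ring_mem)
  have RK: "R \<subseteq> K"
    unfolding R_def using delta3_mem_A[OF m3] nu_mem_A[OF m]
    by (intro local_span_subset[OF K_subfield]) (auto simp: A_iff)
  show 1: "cong_mod 3 (\<delta>3 ^ 2) 0"
    by (rule cong_modI[of _ _ _ "of_int E"]) (auto simp: d2 intro: of_int_mem)
  have "3 - 0 = \<delta>3\<^sup>2 * (1 / of_int E)" using E0 by (simp add: d2)
  then have 2: "cong_mod (\<delta>3\<^sup>2) 3 0" by (rule cong_modI) (rule inverse_mem[OF E3])
  have "cong_mod \<delta>3 (\<delta>3\<^sup>2) 0" by (rule cong_modI[of _ _ _ \<delta>3]) (auto simp: power2_eq_square gens)
  then show 3: "cong_mod \<delta>3 3 0" using cong_mod_coarsen'[OF 2] by blast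
  define g where "g = 2 * j + 1"
  have "\<nu> ^ 3 - (\<nu> + of_int g) = 3 * (of_int (3 * j + 1) * \<nu>\<^sup>2 + of_int (3 * j + 1) * \<nu>)"
    unfolding nu_cubic[OF m] g_def by (simp add: algebra_simps)
  then have n3: "cong_mod 3 (\<nu> ^ 3) (\<nu> + of_int g)" by (rule cong_modI) (intro ring_mem gens)
  then show "cong_mod 3 (\<nu> ^ 3) (\<nu> + of_int (2 * j + 1))" by (simp only: g_def)
  have cube: "cong_mod 3 ((\<nu> + of_int a) ^ 3) (\<nu> + of_int (g + a))" for a
  proof -
    have "cong_mod 3 ((\<nu> + of_int a) ^ 3) (\<nu> ^ 3 + of_int a ^ 3)"
      using cong_mod_Fermat_add[OF three_p gens(1) of_int_mem, of a] by simp
    also have "cong_mod 3 (\<nu> ^ 3 + of_int a ^ 3) (\<nu> + of_int g + of_int a)"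
      using cong_mod_Frobenius_of_int[OF three_p, of a 1] by (intro cong_mod_add n3) simp
    finally show ?thesis by (simp add: add.assoc)
  qed
  have "cong_mod 3 (((\<nu> ^ 3) ^ 3) ^ 3) (((\<nu> + of_int g) ^ 3) ^ 3)"
    by (intro cong_mod_power n3 ring_mem gens)
  also have "cong_mod 3 (((\<nu> + of_int g) ^ 3) ^ 3) ((\<nu> + of_int (g + g)) ^ 3)"
    by (intro cong_mod_power cube ring_mem gens)
  also have "cong_mod 3 ((\<nu> + of_int (g + g)) ^ 3) (\<nu> + of_int (g + (g + g)))" by (rule cube)
  also have "cong_mod 3 (\<nu> + of_int (g + (g + g))) \<nu>"
    by (rule cong_modI[of _ _ _ "of_int g"]) (auto intro: of_int_mem)
  finally have "cong_mod 3 (\<nu> ^ 27) \<nu>" by (simp flip: power_mult)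
  then have wq: "cong_mod \<delta>3 (\<nu> ^ (3 ^ 3)) \<nu>" using cong_mod_coarsen' 3 by simp
  interpret W: complex_subring "int_adjoin \<nu>" by (rule int_adjoin_subring)
  have gen: "\<exists>y\<in>int_adjoin \<nu>. cong_mod \<delta>3 x y" if "x \<in> R" for x
  proof (rule local_span_residue[OF _ gens(1) _ _ that])
    fix x assume "x \<in> {\<nu>, \<delta>3}"
    then show "\<exists>y\<in>int_adjoin \<nu>. cong_mod \<delta>3 x y"
      using cong_mod_refl cong_mod_self int_adjoin_self W.zero_mem by blast
  qed (use 3 in \<open>auto simp: R_def\<close>)
  show "A \<subseteq> R" "monogenic_mod 3"
    using 1 2 by (intro monogenic_ramified[OF R RK mem gens(1) gen _ wq gens(2), of 2]; simp)+
qed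

section \<open>The index: all primes together\<close>

theorem field_index_eq_1: "field_index K = 1"
proof (rule field_index_one)
  fix p :: nat assume p: "prime p"
  have "monogenic_mod p"
  proof -
    consider "p = 2" | "p = 3" | "p \<noteq> 2" "p \<noteq> 3" "\<not> int p dvd D" | "p \<noteq> 2" "p \<noteq> 3" "int p dvd D" by blast
    then show ?thesis
    proof cases
      case 1
      have "D mod 4 = 1 \<or> D mod 4 = 3" using D_odd by presburger
      then show ?thesis
      proof
        assume "D mod 4 = 1"
        then have "D = 4 * (D div 4) + 1" by presburger
        then show ?thesis using local_order_2_unramified(3) 1 by blast
      next
        assume "D mod 4 = 3"
        then have "D = 4 * (D div 4) + 3" by presburger
        then show ?thesis using local_order_2_ramified(3) 1 by blast
      qed
    next
      case 2
      \<comment> \<open>The cases follow the lowest 3-adic digits of m; the last one has the digits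
        0, 1, 1, since 12 = 3 + 9.\<close>
      consider "m mod 3 = 1 \<or> m mod 3 = 2" | n where "m = 3 * n" "n mod 3 \<noteq> 1"
        | n l where "m = 3 * n" "n = 3 * l + 1" "l mod 3 \<noteq> 1" | j where "m = 27 * j + 12"
      proof -
        define n where "n = m div 3"
        define l where "l = n div 3"
        define j where "j = l div 3"
        have "m mod 3 = 0 \<or> m mod 3 = 1 \<or> m mod 3 = 2" by presburger
        moreover have "m mod 3 = 0 \<Longrightarrow> m = 3 * n" unfolding n_def by presburger
        moreover have "n mod 3 = 1 \<Longrightarrow> n = 3 * l + 1" unfolding l_def by presburger
        moreover have "l mod 3 = 1 \<Longrightarrow> l = 3 * j + 1" unfolding j_def by presburger
        ultimately show thesis using that(1,2,3) that(4)[of j] by fastforce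
      qed
      then show ?thesis
      proof cases
        case 1
        then show ?thesis using local_order_3_unramified(3) 2 by blast
      next
        case (2 n)
        then show ?thesis using local_order_3_cubic_ramified(3) \<open>p = 3\<close> by blast
      next
        case (3 n l)
        then show ?thesis using local_order_3_totally_ramified \<open>p = 3\<close> by metis
      next
        case (4 j)
        then show ?thesis using local_order_3_quadratic_ramified(3) 2 by blast
      qed
    next
      case 3
      then show ?thesis using monogenic_good p by blast
    next
      case 4
      have "p \<noteq> 4" using p by (auto simp: prime_nat_iff dest: spec[of _ 2])
      then have "p \<ge> 5" using 4 prime_ge_2_nat[OF p] by linarith
      then show ?thesis using monogenic_tame p 4 by blast
    qed
  qed
  then show "\<exists>z\<in>A. \<forall>x\<in>A. \<exists>y\<in>int_adjoin z. A.cong_mod (of_nat p) x y"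
    unfolding monogenic_mod_def .
qed

section \<open>Common divisors of the values of the characteristic polynomials\<close>

lemma field_char_poly_monic:
  assumes "x \<in> A"
  shows "degree (field_char_poly K x) = 6" "poly.coeff (field_char_poly K x) 6 = 1"
proof -
  have x: "x \<in> K" "algebraic_int x" using assms by (auto simp: A_iff)
  let ?P = "\<Prod>i<6. [:- (\<sigma> ^^ i) x, 1:]"
  have d: "degree ?P = 6" by (subst degree_prod_eq_sum_degree) auto
  have l: "lead_coeff ?P = 1" by (simp add: lead_coeff_prod)
  have "degree (map_poly of_int (field_char_poly K x) :: complex poly) = 6"
    unfolding field_char_poly_eq[OF x] by (rule d)
  then show deg: "degree (field_char_poly K x) = 6" by (simp add: degree_map_poly)
  have "of_int (poly.coeff (field_char_poly K x) 6) = poly.coeff ?P 6"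
    unfolding field_char_poly_eq[OF x, symmetric] by (simp add: coeff_map_poly)
  also have "\<dots> = 1" using l unfolding d .
  finally show "poly.coeff (field_char_poly K x) 6 = 1" by simp
qed

lemma poly_degree_6:
  fixes t :: int
  assumes "degree F = 6" "poly.coeff F 6 = 1"
  shows "poly F t = t ^ 6 + poly.coeff F 5 * t ^ 5 + poly.coeff F 4 * t ^ 4 + poly.coeff F 3 * t ^ 3 +
    poly.coeff F 2 * t\<^sup>2 + poly.coeff F 1 * t + poly.coeff F 0"
proof -
  have "{..6} = {0, 1, 2, 3, 4, 5, 6 :: nat}" by auto
  then show ?thesis unfolding poly_altdef assms(1) using assms(2) by simp
qed

lemma element_value_gcd_dvd_720:
  assumes "x \<in> A"
  shows "element_value_gcd K x dvd 720"
proof -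
  let ?F = "field_char_poly K x"
  have dvd: "element_value_gcd K x dvd poly ?F t" for t
    unfolding element_value_gcd_def by (intro Gcd_dvd) auto
  have "poly ?F 6 - 6 * poly ?F 5 + 15 * poly ?F 4 - 20 * poly ?F 3 + 15 * poly ?F 2 - 6 * poly ?F 1 + poly ?F 0 = 720"
    unfolding poly_degree_6[OF field_char_poly_monic[OF assms]] by simp
  moreover have "element_value_gcd K x dvd
      poly ?F 6 - 6 * poly ?F 5 + 15 * poly ?F 4 - 20 * poly ?F 3 + 15 * poly ?F 2 - 6 * poly ?F 1 + poly ?F 0"
    by (intro dvd_add dvd_diff dvd_mult dvd)
  ultimately show ?thesis by simp
qed

lemma Nm_value:
  assumes "x \<in> A" "d dvd element_value_gcd K x"
  obtains k where "Nm (of_int t - x) = of_int (d * k)"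
proof -
  have "element_value_gcd K x dvd poly (field_char_poly K x) t"
    unfolding element_value_gcd_def by (intro Gcd_dvd) auto
  then obtain k where "poly (field_char_poly K x) t = d * k" using assms(2) by (meson dvd_trans dvdE)
  then have "Nm (of_int t - x) = of_int (d * k)"
    using field_char_poly_eval[of x t] assms(1) by (simp add: A_iff)
  then show ?thesis by (rule that)
qed

lemma sigma_iter_mem_A: "x \<in> A \<Longrightarrow> (\<sigma> ^^ i) x \<in> A"
  by (auto simp: A_iff sigma_iter_mem sigma_iter_algebraic_int)

lemma Nm_mem_int:
  assumes "x \<in> A"
  obtains n where "Nm x = of_int n"
  using Nm_int[of x] assms by (auto simp: A_iff elim: Ints_cases)

lemma A_rational_int:
  assumes "x \<in> A" "\<sigma> x = x"
  obtains n where "x = of_int n"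
proof -
  have "x \<in> \<rat>" using assms by (intro sigma_fixed_rational) (auto simp: A_iff)
  then have "x \<in> \<int>" using assms(1) by (intro rational_algebraic_int_is_int) (auto simp: A_iff)
  then show ?thesis using that by (elim Ints_cases)
qed

section \<open>Lower bounds: the divisors 8 and 9\<close>

lemma cong_mod_A_int:
  assumes "N \<noteq> 0" "A.cong_mod (of_int N) (of_int a) (of_int b)"
  shows "N dvd a - b"
proof -
  obtain r where r: "r \<in> A" "of_int a - of_int b = of_int N * r"
    using assms(2) unfolding A.cong_mod_def by blast
  have "r = of_int (a - b) / of_int N" using r(2) assms(1) by (simp add: field_simps)
  then have "r \<in> \<rat>" by simp
  then have "r \<in> \<int>" using r(1) by (intro rational_algebraic_int_is_int) (auto simp: A_iff)
  then obtain k where "r = of_int k" by (elim Ints_cases)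
  then have "(of_int (a - b) :: complex) = of_int (N * k)" using r(2) by simp
  then have "a - b = N * k" by (simp only: of_int_eq_iff)
  then show ?thesis by simp
qed

lemma cong_mod_A_conjugate:
  assumes "A.cong_mod (of_int N) x y" "x \<in> A" "y \<in> A"
  shows "A.cong_mod (of_int N) ((\<sigma> ^^ i) x) ((\<sigma> ^^ i) y)"
proof -
  obtain r where r: "r \<in> A" "x - y = of_int N * r" using assms(1) unfolding A.cong_mod_def by blast
  have "(\<sigma> ^^ i) x - (\<sigma> ^^ i) y = (\<sigma> ^^ i) (x - y)"
    using assms by (simp add: sigma_iter_diff A_iff)
  also have "\<dots> = of_int N * (\<sigma> ^^ i) r"
    unfolding r(2) using r(1) sigma_iter_int[of i N] by (simp only: sigma_iter_mult K_closed(10) A_iff)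
  finally show ?thesis by (rule A.cong_modI) (rule sigma_iter_mem_A[OF r(1)])
qed

lemma cong_mod_A_Nm:
  assumes "A.cong_mod (of_int N) x y" "x \<in> A" "y \<in> A"
  shows "A.cong_mod (of_int N) (Nm x) (Nm y)"
  unfolding Nm_def prod_6
  by (intro A.cong_mod_mult cong_mod_A_conjugate assms A.mult_mem sigma_iter_mem_A)

text \<open>The element \<alpha> may lie in a proper subfield, as \<tau> and \<nu> do;
  \<open>primitive_shift\<close> makes it primitive by adding a multiple of N \<theta>, under which
  norms do not change modulo N.\<close>

lemma dvd_element_value_gcdI:
  assumes N: "N \<noteq> 0" and \<alpha>: "\<alpha> \<in> A" and val: "\<And>t :: int. \<exists>k. Nm (of_int t - \<alpha>) = of_int (N * k)"
  obtains x where "x \<in> primitive_integers K" "N dvd element_value_gcd K x"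
proof -
  obtain k :: int where k: "\<alpha> + of_int (N * k) * \<theta> \<in> primitive_integers K"
    by (rule primitive_shift[OF \<alpha> N])
  define x where "x = \<alpha> + of_int (N * k) * \<theta>"
  have x: "x \<in> A" unfolding x_def by (intro A.ring_mem \<alpha> theta_mem_A)
  have "N dvd poly (field_char_poly K x) t" for t
  proof -
    obtain j where j: "Nm (of_int t - \<alpha>) = of_int (N * j)" using val by blast
    have "of_int t - x - (of_int t - \<alpha>) = of_int N * (- (of_int k * \<theta>))"
      by (simp add: x_def)
    then have "A.cong_mod (of_int N) (of_int t - x) (of_int t - \<alpha>)"
      by (rule A.cong_modI) (intro A.ring_mem theta_mem_A)
    then have "A.cong_mod (of_int N) (Nm (of_int t - x)) (Nm (of_int t - \<alpha>))"
      by (rule cong_mod_A_Nm) (intro A.ring_mem x \<alpha>)+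
    then have "A.cong_mod (of_int N) (of_int (poly (field_char_poly K x) t)) (of_int (N * j))"
      using x by (simp add: field_char_poly_eval A_iff j)
    then have "N dvd poly (field_char_poly K x) t - N * j" by (rule cong_mod_A_int[OF N])
    then show ?thesis by (metis dvd_add_left_iff dvd_triv_left diff_add_cancel)
  qed
  then have "N dvd element_value_gcd K x" unfolding element_value_gcd_def by (intro Gcd_greatest) auto
  then show ?thesis using that k x_def by blast
qed

lemma eight_dvd_value_gcd:
  assumes D: "D = 8 * e + 1"
  obtains x where "x \<in> primitive_integers K" "8 dvd element_value_gcd K x"
proof -
  have D4: "D = 4 * (2 * e) + 1" using D by simp
  have ts: "\<tau> \<in> A" by (rule tau_mem_A[OF D4])
  have tK: "\<tau> \<in> K" using ts by (simp add: A_iff)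
  have "\<exists>k. Nm (of_int t - \<tau>) = of_int (8 * k)" for t :: int
  proof -
    have conj: "(\<sigma> ^^ i) (of_int t - \<tau>) = of_int t - (1 + (\<sigma> ^^ i) \<delta>) / 2" for i
      unfolding \<tau>_def using delta_mem_K sigma_iter_rat[of i 2]
      by (simp add: sigma_iter_diff sigma_iter_add sigma_iter_divide K_closed)
    define u u' where "u = of_int t - (1 + \<delta>) / 2" and "u' = of_int t - (1 + - \<delta>) / 2"
    have "Nm (of_int t - \<tau>) = (u * u') ^ 3"
      unfolding Nm_def prod_6 conj sigma_iter_eta_delta u_def[symmetric] u'_def[symmetric]
      by (simp add: power_mult_distrib power3_eq_cube)
    also have "u * u' = of_int t ^ 2 - of_int t - of_int (2 * e)"
    proof -
      have "4 * (u * u') = 4 * of_int t ^ 2 - 4 * of_int t + 1 - \<delta>\<^sup>2"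
        by (simp add: u_def u'_def field_simps power2_eq_square)
      also have "\<dots> = 4 * (of_int t ^ 2 - of_int t - of_int (2 * e))" by (simp add: delta_square D)
      finally show ?thesis by (metis mult_left_cancel zero_neq_numeral)
    qed
    finally have N: "Nm (of_int t - \<tau>) = (of_int t ^ 2 - of_int t - of_int (2 * e)) ^ 3" .
    have "even (t * (t - 1))" by simp
    then obtain i where "t * (t - 1) = 2 * i" by (elim evenE)
    then have "t\<^sup>2 - t - 2 * e = 2 * (i - e)" by (simp add: power2_eq_square algebra_simps)
    then have "(t\<^sup>2 - t - 2 * e) ^ 3 = (2 * (i - e)) ^ 3" by (rule arg_cong)
    also have "\<dots> = 8 * (i - e) ^ 3" unfolding power_mult_distrib by simp
    finally have "(t\<^sup>2 - t - 2 * e) ^ 3 = 8 * (i - e) ^ 3" .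
    moreover have "Nm (of_int t - \<tau>) = of_int ((t\<^sup>2 - t - 2 * e) ^ 3)" unfolding N by simp
    ultimately show ?thesis by metis
  qed
  then show ?thesis using dvd_element_value_gcdI[of 8 \<tau>] ts that by auto
qed

lemma eta_minimal_poly:
  "(y - \<eta>) * (y - \<eta>') * (y - \<eta>'') = y ^ 3 - M * y\<^sup>2 - (M + 3) * y - 1"
proof -
  have s: "\<eta> + \<eta>' + \<eta>'' = M" "\<eta> * \<eta>' + \<eta>' * \<eta>'' + \<eta> * \<eta>'' = - (M + 3)"
    using eta_conjugates unfolding \<eta>''_def by blast+
  have p: "\<eta> * \<eta>' * \<eta>'' = 1"
  proof -
    define u where "u = 1 + \<eta>"
    have "u \<noteq> 0" unfolding u_def by (rule eta_nonzero(2))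
    then show ?thesis using eta_nonzero(1) unfolding \<eta>'_def \<eta>''_def u_def[symmetric] by simp
  qed
  have "(y - \<eta>) * (y - \<eta>') * (y - \<eta>'') =
      y ^ 3 - (\<eta> + \<eta>' + \<eta>'') * y\<^sup>2 + (\<eta> * \<eta>' + \<eta>' * \<eta>'' + \<eta> * \<eta>'') * y - \<eta> * \<eta>' * \<eta>''"
    by (simp add: algebra_simps eval_nat_numeral)
  then show ?thesis unfolding s p by (simp add: algebra_simps)
qed

lemma nine_dvd_value_gcd:
  assumes m: "m = 81 * j + 39"
  obtains x where "x \<in> primitive_integers K" "9 dvd element_value_gcd K x"
proof -
  have m27: "m = 27 * (3 * j + 1) + 12" using m by simp
  have nA: "\<nu> \<in> A" by (rule nu_mem_A[OF m27])
  have "\<exists>k. Nm (of_int t - \<nu>) = of_int (9 * k)" for t :: int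
  proof -
    have conj: "(\<sigma> ^^ i) (of_int t - \<nu>) = (3 * of_int t + 1 - (\<sigma> ^^ i) \<eta>) / 3" for i
    proof -
      have "of_int t - \<nu> = (of_int (3 * t + 1) - \<eta>) / of_int 3"
        by (simp add: \<nu>_def \<mu>_def diff_divide_distrib add_divide_distrib)
      then have "(\<sigma> ^^ i) (of_int t - \<nu>) = (\<sigma> ^^ i) ((of_int (3 * t + 1) - \<eta>) / of_int 3)" by (rule arg_cong)
      also have "\<dots> = (of_int (3 * t + 1) - (\<sigma> ^^ i) \<eta>) / of_int 3"
        using eta_mem_K by (simp only: sigma_iter_divide sigma_iter_diff sigma_iter_int K_closed(7,10))
      finally show ?thesis by simp
    qed
    define Y where "Y = (3 * of_int t + 1 :: complex)"
    have "Nm (of_int t - \<nu>) = ((Y - \<eta>) * (Y - \<eta>') * (Y - \<eta>'') / 27)\<^sup>2"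
      unfolding Nm_def prod_6 conj sigma_iter_eta_delta Y_def[symmetric] \<eta>''_def[symmetric]
      by (simp add: power2_eq_square)
    also have "(Y - \<eta>) * (Y - \<eta>') * (Y - \<eta>'') = 27 * of_int (t ^ 3 - 3 * (9 * j + 4) * t\<^sup>2 - (27 * j + 13) * t - (6 * j + 3))"
      unfolding eta_minimal_poly Y_def using m by (simp add: algebra_simps eval_nat_numeral)
    also have "27 * of_int (t ^ 3 - 3 * (9 * j + 4) * t\<^sup>2 - (27 * j + 13) * t - (6 * j + 3)) / 27 =
        (of_int (t ^ 3 - 3 * (9 * j + 4) * t\<^sup>2 - (27 * j + 13) * t - (6 * j + 3)) :: complex)"
      by (rule nonzero_mult_div_cancel_left) simp
    finally have N: "Nm (of_int t - \<nu>) = of_int ((t ^ 3 - 3 * (9 * j + 4) * t\<^sup>2 - (27 * j + 13) * t - (6 * j + 3))\<^sup>2)"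
      by (simp only: of_int_power)
    \<comment> \<open>Modulo 3 the cubic polynomial in t is t^3 - t. This is where m = 39 modulo 81
      enters: it makes the coefficient 27 j + 13 equal to 1 and the constant 6 j + 3 equal to 0
      modulo 3.\<close>
    have "3 dvd t ^ 3 - t"
    proof -
      have "t mod 3 = 0 \<or> t mod 3 = 1 \<or> t mod 3 = 2" by presburger
      then obtain k where "t = 3 * k \<or> t = 3 * k + 1 \<or> t = 3 * k + 2" by (metis add.right_neutral mult_div_mod_eq)
      then have "t ^ 3 - t = 3 * (9 * k ^ 3 - k) \<or> t ^ 3 - t = 3 * (9 * k ^ 3 + 9 * k\<^sup>2 + 2 * k) \<or>
          t ^ 3 - t = 3 * (9 * k ^ 3 + 18 * k\<^sup>2 + 11 * k + 2)"
        by (auto simp: algebra_simps eval_nat_numeral)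
      then show ?thesis by (metis dvd_triv_left)
    qed
    then obtain i where "t ^ 3 - t = 3 * i" by (elim dvdE)
    then have "t ^ 3 - 3 * (9 * j + 4) * t\<^sup>2 - (27 * j + 13) * t - (6 * j + 3) = 3 * (i - (9 * j + 4) * t\<^sup>2 - (9 * j + 4) * t - (2 * j + 1))"
      by (simp add: algebra_simps)
    then have "Nm (of_int t - \<nu>) = of_int ((3 * (i - (9 * j + 4) * t\<^sup>2 - (9 * j + 4) * t - (2 * j + 1)))\<^sup>2)"
      unfolding N by (simp only:)
    also have "\<dots> = of_int (9 * (i - (9 * j + 4) * t\<^sup>2 - (9 * j + 4) * t - (2 * j + 1))\<^sup>2)"
      unfolding power_mult_distrib by simp
    finally show ?thesis by blast
  qed
  then show ?thesis using dvd_element_value_gcdI[of 9 \<nu>] nA that by auto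
qed

text \<open>The norm to the quadratic subfield. Where \<open>\<sigma>\<^sup>2\<close> or \<open>\<sigma>\<^sup>4\<close> acts as a Frobenius \<open>u \<mapsto> u\<^sup>q\<close>, it is
  congruent to a power of \<open>u\<close>.\<close>

definition rel_norm :: "complex \<Rightarrow> complex" where "rel_norm u = u * (\<sigma> ^^ 2) u * (\<sigma> ^^ 4) u"

lemma rel_norm_mem_A: "u \<in> A \<Longrightarrow> rel_norm u \<in> A"
  unfolding rel_norm_def by (intro A.mult_mem sigma_iter_mem_A)

text \<open>The relative norm v and its image v' under \<sigma> have the product Nm u, and both v +
  v' and (v - v') \<delta> are fixed by \<sigma>, hence integers t and E. The relation between E and
  t is what later restricts t modulo 2 or 3.\<close>

lemma rel_norm_quadratic:
  assumes u: "u \<in> A" and N: "Nm u = of_int N"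
  obtains t E where "(rel_norm u)\<^sup>2 = of_int t * rel_norm u - of_int N"
    "2 * of_int D * rel_norm u = of_int D * of_int t + of_int E * \<delta>" "E\<^sup>2 = D * (t\<^sup>2 - 4 * N)"
proof -
  define v where "v = rel_norm u"
  define v' where "v' = \<sigma> v"
  have vA: "v \<in> A" unfolding v_def by (rule rel_norm_mem_A[OF u])
  have v'A: "v' \<in> A" using sigma_iter_mem_A[OF vA, of 1] by (simp add: v'_def)
  have uK: "u \<in> K" and vK: "v \<in> K" "v' \<in> K" using u vA v'A by (auto simp: A_iff)
  have v'_eq: "v' = (\<sigma> ^^ 1) u * (\<sigma> ^^ 3) u * (\<sigma> ^^ 5) u"
  proof -
    have e: "\<sigma> u = (\<sigma> ^^ 1) u" "\<sigma> ((\<sigma> ^^ 2) u) = (\<sigma> ^^ 3) u" "\<sigma> ((\<sigma> ^^ 4) u) = (\<sigma> ^^ 5) u"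
      by (simp_all add: eval_nat_numeral)
    show ?thesis unfolding v'_def v_def rel_norm_def
      by (simp only: sigma_mult sigma_iter_mem K_closed(4) uK) (simp only: e)
  qed
  have "\<sigma> v' = (\<sigma> ^^ 2) u * (\<sigma> ^^ 4) u * (\<sigma> ^^ 6) u"
  proof -
    have e: "\<sigma> ((\<sigma> ^^ 1) u) = (\<sigma> ^^ 2) u" "\<sigma> ((\<sigma> ^^ 3) u) = (\<sigma> ^^ 4) u" "\<sigma> ((\<sigma> ^^ 5) u) = (\<sigma> ^^ 6) u"
      by (simp_all add: eval_nat_numeral)
    show ?thesis unfolding v'_eq
      by (simp only: sigma_mult sigma_iter_mem K_closed(4) uK) (simp only: e)
  qed
  then have sv': "\<sigma> v' = v" using sigma6[OF uK] by (simp add: v_def rel_norm_def mult_ac)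
  have vv: "v * v' = of_int N"
    unfolding N[symmetric] v'_eq unfolding v_def rel_norm_def Nm_def prod_6 by (simp add: mult_ac)
  obtain t where t: "v + v' = of_int t"
  proof (rule A_rational_int)
    show "v + v' \<in> A" by (intro A.ring_mem vA v'A)
    show "\<sigma> (v + v') = v + v'" using sigma_add[OF vK] sv' by (simp add: v'_def add.commute)
  qed
  obtain E where E: "(v - v') * \<delta> = of_int E"
  proof (rule A_rational_int)
    show "(v - v') * \<delta> \<in> A" by (intro A.ring_mem vA v'A delta_mem_A)
    have "\<sigma> ((v - v') * \<delta>) = (\<sigma> v - \<sigma> v') * - \<delta>"
      using vK delta_mem_K sigma_iter_diff[of v v' 1] by (simp add: sigma_mult K_closed sigma_delta)
    then show "\<sigma> ((v - v') * \<delta>) = (v - v') * \<delta>"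
      unfolding sv' by (simp add: v'_def algebra_simps)
  qed
  show ?thesis
  proof (rule that)
    have v': "v' = of_int t - v" using t by (simp add: algebra_simps)
    show "(rel_norm u)\<^sup>2 = of_int t * rel_norm u - of_int N"
      unfolding v_def[symmetric] vv[symmetric] v' by (simp add: algebra_simps power2_eq_square)
    have "of_int E * \<delta> = (v - v') * \<delta>\<^sup>2" by (simp add: E[symmetric] power2_eq_square)
    then have E\<delta>: "of_int E * \<delta> = (v - v') * of_int D" by (simp add: delta_square)
    show "2 * of_int D * rel_norm u = of_int D * of_int t + of_int E * \<delta>"
      unfolding E\<delta> t[symmetric] v_def[symmetric] by (simp add: algebra_simps)
    have "(of_int E)\<^sup>2 = (v - v')\<^sup>2 * \<delta>\<^sup>2" by (simp add: E[symmetric] power_mult_distrib)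
    also have "(v - v')\<^sup>2 = (v + v')\<^sup>2 - 4 * (v * v')" by (simp add: power2_eq_square algebra_simps)
    finally have "(of_int (E\<^sup>2) :: complex) = of_int (D * (t\<^sup>2 - 4 * N))"
      unfolding t vv delta_square by (simp add: mult.commute)
    then show "E\<^sup>2 = D * (t\<^sup>2 - 4 * N)" by (simp only: of_int_eq_iff)
  qed
qed

section \<open>Relative norms modulo \<rho>; the prime 2 for D not 1 modulo 8\<close>

lemma Frobenius_cube:
  assumes R: "p_local_order R p" "R \<subseteq> K"
    and \<phi>: "\<phi> = \<sigma> ^^ 2 \<or> \<phi> = \<sigma> ^^ 4"
    and fr: "\<And>x. x \<in> R \<Longrightarrow> \<phi> x \<in> R \<and> complex_subring.cong_mod R \<rho> (x ^ (p ^ s)) (\<phi> x)"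
    and x: "x \<in> R"
  shows "complex_subring.cong_mod R \<rho> (x ^ (p ^ (3 * s))) x"
proof -
  interpret p_local_order R p by (rule R)
  define q where "q = p ^ s"
  have \<phi>R: "\<phi> x \<in> R" and fq: "cong_mod \<rho> (x ^ q) (\<phi> x)" if "x \<in> R" for x
    using fr[OF that] by (simp_all add: q_def)
  have f2: "cong_mod \<rho> (x ^ (q * q)) (\<phi> (\<phi> x))" if "x \<in> R" for x
  proof -
    have "cong_mod \<rho> ((x ^ q) ^ q) ((\<phi> x) ^ q)" by (intro cong_mod_power fq that ring_mem \<phi>R)
    also have "cong_mod \<rho> ((\<phi> x) ^ q) (\<phi> (\<phi> x))" by (intro fq \<phi>R that)
    finally show ?thesis by (simp flip: power_mult)
  qed
  show ?thesis
  proof -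
    have "cong_mod \<rho> ((x ^ (q * q)) ^ q) ((\<phi> (\<phi> x)) ^ q)" by (intro cong_mod_power f2 x ring_mem \<phi>R)
    also have "cong_mod \<rho> ((\<phi> (\<phi> x)) ^ q) (\<phi> (\<phi> (\<phi> x)))" by (intro fq \<phi>R x)
    also have "\<phi> (\<phi> (\<phi> x)) = x"
    proof -
      have six: "(\<sigma> ^^ 6) x = x" using sigma6 x R(2) by blast
      have "(\<sigma> ^^ 2) ((\<sigma> ^^ 2) ((\<sigma> ^^ 2) x)) = (\<sigma> ^^ 6) x"
        by (simp add: eval_nat_numeral)
      moreover have "(\<sigma> ^^ 4) ((\<sigma> ^^ 4) ((\<sigma> ^^ 4) x)) = (\<sigma> ^^ 6) ((\<sigma> ^^ 6) x)"
        by (simp add: eval_nat_numeral)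
      ultimately show ?thesis using \<phi> six by auto
    qed
    finally show ?thesis by (simp add: q_def power_add mult.assoc numeral_3_eq_3 flip: power_mult)
  qed
qed

text \<open>Modulo \<rho> the relative norm of u is u^(1 + q + q^2) with q = p^s. Further powers of
  y turn y times this into a power of y u, and there are no nilpotents. The factor y allows for a
  zero divisor, when the norm of u vanishes on a part of the residue ring only.\<close>

lemma rel_norm_cancel:
  assumes R: "p_local_order R p" "R \<subseteq> K" and s: "s > 0"
    and \<phi>: "\<phi> = \<sigma> ^^ 2 \<or> \<phi> = \<sigma> ^^ 4"
    and fr: "\<And>x. x \<in> R \<Longrightarrow> \<phi> x \<in> R \<and> complex_subring.cong_mod R \<rho> (x ^ (p ^ s)) (\<phi> x)"
    and u: "u \<in> R" and y: "y \<in> R" "complex_subring.cong_mod R \<rho> (y * rel_norm u) 0"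
  shows "complex_subring.cong_mod R \<rho> (y * u) 0"
proof -
  interpret p_local_order R p by (rule R)
  define q where "q = p ^ s"
  have \<phi>R: "\<phi> x \<in> R" and fq: "cong_mod \<rho> (x ^ q) (\<phi> x)" if "x \<in> R" for x
    using fr[OF that] by (simp_all add: q_def)
  have f2: "cong_mod \<rho> (x ^ (q * q)) (\<phi> (\<phi> x))" if "x \<in> R" for x
  proof -
    have "cong_mod \<rho> ((x ^ q) ^ q) ((\<phi> x) ^ q)" by (intro cong_mod_power fq that ring_mem \<phi>R)
    also have "cong_mod \<rho> ((\<phi> x) ^ q) (\<phi> (\<phi> x))" by (intro fq \<phi>R that)
    finally show ?thesis by (simp flip: power_mult)
  qed
  have f3: "cong_mod \<rho> (x ^ (p ^ (3 * s))) x" if "x \<in> R" for x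
    by (rule Frobenius_cube[OF R \<phi> fr that])
  have "cong_mod \<rho> (u * u ^ q * u ^ (q * q)) (u * \<phi> u * \<phi> (\<phi> u))"
    by (intro cong_mod_mult cong_mod_refl fq f2 u ring_mem \<phi>R)
  also have "u * \<phi> u * \<phi> (\<phi> u) = rel_norm u"
  proof -
    have six: "(\<sigma> ^^ 6) u = u" using sigma6 u R(2) by blast
    have "(\<sigma> ^^ 2) ((\<sigma> ^^ 2) u) = (\<sigma> ^^ 4) u" by (simp add: eval_nat_numeral)
    moreover have "(\<sigma> ^^ 4) ((\<sigma> ^^ 4) u) = (\<sigma> ^^ 2) ((\<sigma> ^^ 6) u)" by (simp add: eval_nat_numeral)
    ultimately show ?thesis using \<phi> six by (auto simp: rel_norm_def mult_ac)
  qed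
  finally have "cong_mod \<rho> (y * (u * u ^ q * u ^ (q * q))) (y * rel_norm u)" by (rule cong_mod_scale[OF _ y(1)])
  also note y(2)
  finally have z: "cong_mod \<rho> (y * (u * u ^ q * u ^ (q * q))) 0" .
  define k where "k = q + q * q"
  have "cong_mod \<rho> (y * (u * u ^ q * u ^ (q * q)) * y ^ k) 0"
    by (intro cong_mod_0_mult z power_mem y(1))
  moreover have "y * (u * u ^ q * u ^ (q * q)) * y ^ k = (y * u) ^ Suc k"
    by (simp add: k_def power_add power_mult_distrib mult_ac)
  ultimately have c: "cong_mod \<rho> ((y * u) ^ Suc k) 0" by (simp only:)
  have s3: "3 * s > 0" using s by simp
  show ?thesis by (rule reduced_mod[OF _ s3 mult_mem[OF y(1) u] c]) (rule f3)
qed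

text \<open>Cancels twice: first with y the relative norm itself, then with y = u, which leaves
  u^2.\<close>

lemma rel_norm_nilpotent:
  assumes R: "p_local_order R p" "R \<subseteq> K" "A \<subseteq> R" and s: "s > 0"
    and \<phi>: "\<phi> = \<sigma> ^^ 2 \<or> \<phi> = \<sigma> ^^ 4"
    and fr: "\<And>x. x \<in> R \<Longrightarrow> \<phi> x \<in> R \<and> complex_subring.cong_mod R \<rho> (x ^ (p ^ s)) (\<phi> x)"
    and u: "u \<in> A" "complex_subring.cong_mod R \<rho> ((rel_norm u)\<^sup>2) 0"
  shows "complex_subring.cong_mod R \<rho> u 0"
proof -
  interpret p_local_order R p by (rule R)
  have uR: "u \<in> R" "rel_norm u \<in> R" using u(1) rel_norm_mem_A R(3) by auto
  have "cong_mod \<rho> (rel_norm u * rel_norm u) 0" using u(2) by (simp add: power2_eq_square)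
  then have "cong_mod \<rho> (rel_norm u * u) 0"
    by (rule rel_norm_cancel[OF R(1,2) s \<phi> _ uR(1) uR(2), rotated]) (rule fr)
  then have "cong_mod \<rho> (u * rel_norm u) 0" by (simp add: mult.commute)
  then have "cong_mod \<rho> (u * u) 0"
    by (rule rel_norm_cancel[OF R(1,2) s \<phi> _ uR(1) uR(1), rotated]) (rule fr)
  then have c: "cong_mod \<rho> (u ^ 2) 0" by (simp add: power2_eq_square)
  have s3: "3 * s > 0" using s by simp
  show ?thesis
    by (rule reduced_mod[OF _ s3 uR(1) c]) (rule Frobenius_cube[OF R(1,2) \<phi> fr])
qed

lemma sigma_local_Frobenius:
  assumes R: "p_local_order R p" "R = local_span p S" "R \<subseteq> K"
    and \<rho>: "complex_subring.cong_mod R \<rho> (of_nat p) 0"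
    and S: "\<And>x. x \<in> S \<Longrightarrow> (\<sigma> ^^ i) x \<in> R \<and> complex_subring.cong_mod R \<rho> (x ^ (p ^ s)) ((\<sigma> ^^ i) x)"
    and x: "x \<in> R"
  shows "(\<sigma> ^^ i) x \<in> R \<and> complex_subring.cong_mod R \<rho> (x ^ (p ^ s)) ((\<sigma> ^^ i) x)"
proof -
  interpret p_local_order R p by (rule R)
  show ?thesis
  proof (rule local_span_Frobenius[OF R(2) \<rho> _ _ _ _ x])
    show "(\<sigma> ^^ i) (x + y) = (\<sigma> ^^ i) x + (\<sigma> ^^ i) y" if "x \<in> R" "y \<in> R" for x y
      using that R(3) by (intro sigma_iter_add) auto
    show "(\<sigma> ^^ i) (x * y) = (\<sigma> ^^ i) x * (\<sigma> ^^ i) y" if "x \<in> R" "y \<in> R" for x y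
      using that R(3) by (intro sigma_iter_mult) auto
  qed (rule S sigma_iter_rat; assumption?)+
qed

text \<open>If p divided every value, t - x would vanish modulo \<rho> for all t, in particular for
  t = 0 and t = 1, whose difference is 1. The hypothesis on \<open>rel_norm\<close> stands for there
  being a single prime above p.\<close>

lemma value_gcd_ndvd_nilpotent:
  assumes R: "p_local_order R p" "R \<subseteq> K" "A \<subseteq> R" and s: "s > 0"
    and \<phi>: "\<phi> = \<sigma> ^^ 2 \<or> \<phi> = \<sigma> ^^ 4"
    and fr: "\<And>x. x \<in> R \<Longrightarrow> \<phi> x \<in> R \<and> complex_subring.cong_mod R \<rho> (x ^ (p ^ s)) (\<phi> x)"
    and \<rho>: "\<rho> \<in> R" "complex_subring.cong_mod R (of_nat p) (\<rho> ^ e) 0" "complex_subring.cong_mod R \<rho> (of_nat p) 0"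
    and nil: "\<And>u N. u \<in> A \<Longrightarrow> Nm u = of_int N \<Longrightarrow> int p dvd N \<Longrightarrow> \<exists>r\<in>A. (rel_norm u)\<^sup>2 = of_nat p * r"
    and x: "x \<in> A"
  shows "\<not> int p dvd element_value_gcd K x"
proof
  assume d: "int p dvd element_value_gcd K x"
  interpret p_local_order R p by (rule R)
  have z: "cong_mod \<rho> (of_int t - x) 0" for t
  proof -
    obtain k where k: "Nm (of_int t - x) = of_int (int p * k)" by (rule Nm_value[OF x d])
    have u: "of_int t - x \<in> A" by (intro A.ring_mem x)
    obtain r where r: "r \<in> A" "(rel_norm (of_int t - x))\<^sup>2 = of_nat p * r"
      using nil[OF u k] by auto
    have "r \<in> R" using r(1) R(3) by blast
    then have "cong_mod (of_nat p) ((rel_norm (of_int t - x))\<^sup>2) 0"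
      unfolding r(2) by (intro cong_mod_0_mult cong_mod_self)
    then have c: "cong_mod \<rho> ((rel_norm (of_int t - x))\<^sup>2) 0" using cong_mod_coarsen' \<rho>(3) by blast
    show ?thesis by (rule rel_norm_nilpotent[OF R s \<phi> _ u c]) (rule fr)
  qed
  have "cong_mod \<rho> (of_int 1 - x - (of_int 0 - x)) (0 - 0)" by (intro cong_mod_diff z)
  then show False using radical_not_unit[OF \<rho>(2,1)] by simp
qed

text \<open>If t were odd, then t^2 - 4 N would be 1 modulo 8 and E odd, and E^2 = D (t^2 - 4 N)
  would force D = 1 modulo 8. So t is even, and the quadratic equation of the relative norm puts its
  square into 2 A.\<close>

lemma even_norm_nilpotent:
  assumes D8: "D mod 8 \<noteq> 1" and u: "u \<in> A" and N: "Nm u = of_int N" "even N"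
  shows "\<exists>r\<in>A. (rel_norm u)\<^sup>2 = 2 * r"
proof -
  obtain t E where t: "(rel_norm u)\<^sup>2 = of_int t * rel_norm u - of_int N" "E\<^sup>2 = D * (t\<^sup>2 - 4 * N)"
    by (rule rel_norm_quadratic[OF u N(1)])
  have sq: "a\<^sup>2 mod 8 = 1" if "odd a" for a :: int
  proof -
    obtain b where b: "a = 2 * b + 1" using \<open>odd a\<close> by (elim oddE)
    have "even (b * (b + 1))" by simp
    then obtain c where c: "b * (b + 1) = 2 * c" by (elim evenE)
    have "a\<^sup>2 = 4 * (b * (b + 1)) + 1" by (simp add: b power2_eq_square algebra_simps)
    then show ?thesis unfolding c by simp
  qed
  have "even t"
  proof (rule ccontr)
    assume o: "odd t"
    then have o': "odd (t\<^sup>2 - 4 * N)" by simp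
    have "odd (E\<^sup>2)" unfolding t(2) even_mult_iff using o' D_odd by blast
    then have "odd E" by auto
    obtain k where k: "N = 2 * k" using N(2) by (elim evenE)
    have "(t\<^sup>2 - 4 * N) mod 8 = (t\<^sup>2 mod 8 - (8 * k) mod 8) mod 8" by (simp only: mod_diff_eq k) simp
    also have "\<dots> = 1" using sq[OF o] by simp
    finally have "(D * (t\<^sup>2 - 4 * N)) mod 8 = D mod 8" by (metis mod_mult_right_eq mult.right_neutral)
    then show False using sq[OF \<open>odd E\<close>] t(2) D8 by simp
  qed
  then obtain j k where jk: "t = 2 * j" "N = 2 * k" using N(2) by (elim evenE)
  have "(rel_norm u)\<^sup>2 = 2 * (of_int j * rel_norm u - of_int k)"
    unfolding t(1) jk by (simp add: algebra_simps)
  then show ?thesis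
    by (intro bexI[of _ "of_int j * rel_norm u - of_int k"] A.ring_mem rel_norm_mem_A u)
qed

lemma two_not_dvd_value_gcd:
  assumes D8: "D mod 8 \<noteq> 1" and x: "x \<in> A"
  shows "\<not> 2 dvd element_value_gcd K x"
proof -
  \<comment> \<open>An even exponent, so that \<delta> is fixed. Of the two possibilities \<sigma>^4
    maps \<eta> to \<eta>' and \<sigma>^2 maps it to \<eta>''; the parity of m decides which of them
    is the fourth power modulo 2.\<close>
  define i :: nat where "i = (if even m then 4 else 2)"
  have i: "\<sigma> ^^ i = \<sigma> ^^ 2 \<or> \<sigma> ^^ i = \<sigma> ^^ 4" by (simp add: i_def)
  have i\<eta>: "(\<sigma> ^^ i) \<eta> = (if even m then next_root \<eta> else prev_root \<eta>)"
    unfolding i_def next_eta prev_eta by (simp add: sigma_iter_eta_delta \<eta>''_def)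
  have nil: "\<exists>r\<in>A. (rel_norm u)\<^sup>2 = of_nat 2 * r" if "u \<in> A" "Nm u = of_int N" "int 2 dvd N" for u N
    using even_norm_nilpotent[OF D8 that(1,2)] that(3) by simp
  have "D mod 4 = 1 \<or> D mod 4 = 3" using D_odd by presburger
  then obtain n where "D = 4 * n + 1 \<or> D = 4 * n + 3" by (metis mult_div_mod_eq)
  then show ?thesis
  proof
    assume D: "D = 4 * n + 1"
    define R where "R = local_span 2 {\<eta>, \<tau>}"
    have R: "p_local_order R 2" "A \<subseteq> R"
      using local_order_2_unramified[OF D] unfolding R_def by blast+
    interpret p_local_order R 2 by (rule R)
    have RK: "R \<subseteq> K" unfolding R_def using tau_mem_A[OF D] eta_mem_A
      by (intro local_span_subset[OF K_subfield]) (auto simp: A_iff)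
    have gens: "\<eta> \<in> R" "\<tau> \<in> R" unfolding R_def by (auto intro: local_span_base)
    have "(\<sigma> ^^ i) \<delta> = \<delta>" unfolding i_def by (simp add: sigma_iter_eta_delta)
    then have i\<tau>: "(\<sigma> ^^ i) \<tau> = \<tau>"
      unfolding \<tau>_def using sigma_iter_rat[of i 2] delta_mem_K
      by (simp add: sigma_iter_divide sigma_iter_add K_closed)
    have \<rho>: "2 \<in> R" "cong_mod (of_nat 2) (2 ^ 1) 0" "cong_mod 2 (of_nat 2) 0"
      using cong_mod_self[of 2] by (simp_all add: numeral_mem)
    have fr: "(\<sigma> ^^ i) y \<in> R \<and> cong_mod 2 (y ^ (2 ^ 2)) ((\<sigma> ^^ i) y)" if "y \<in> R" for y
    proof (rule sigma_local_Frobenius[OF R(1) R_def RK \<rho>(3) _ that])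
      fix z assume "z \<in> {\<eta>, \<tau>}"
      then show "(\<sigma> ^^ i) z \<in> R \<and> cong_mod 2 (z ^ (2 ^ 2)) ((\<sigma> ^^ i) z)"
      proof (elim insertE emptyE)
        assume z: "z = \<eta>"
        have "cong_mod 2 (\<eta> ^ 4) ((\<sigma> ^^ i) \<eta>)"
          unfolding i\<eta> by (rule root_Frobenius_2[OF complex_subring_axioms gens(1) eta_cubic])
        moreover have "(\<sigma> ^^ i) \<eta> \<in> R"
          unfolding i\<eta> next_root_def prev_root_def using gens(1) by (auto intro!: ring_mem)
        ultimately show ?thesis using z by simp
      next
        assume z: "z = \<tau>"
        then show ?thesis
          using tau_Frobenius[OF D complex_subring_axioms gens(2)] gens(2) i\<tau> by simp
      qed
    qed
    have "\<not> int 2 dvd element_value_gcd K x"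
      by (rule value_gcd_ndvd_nilpotent[OF R(1) RK R(2) _ i _ \<rho> _ x]; (rule fr nil)?; simp)
    then show ?thesis by simp
  next
    assume D: "D = 4 * n + 3"
    define R where "R = local_span 2 {\<eta>, \<delta>}"
    have R: "p_local_order R 2" "A \<subseteq> R"
      and r: "complex_subring.cong_mod R 2 ((1 + \<delta>)\<^sup>2) 0" "complex_subring.cong_mod R (1 + \<delta>) 2 0"
      using local_order_2_ramified[OF D] unfolding R_def by blast+
    interpret p_local_order R 2 by (rule R)
    have RK: "R \<subseteq> K" unfolding R_def using delta_mem_A eta_mem_A
      by (intro local_span_subset[OF K_subfield]) (auto simp: A_iff)
    have gens: "\<eta> \<in> R" "\<delta> \<in> R" unfolding R_def by (auto intro: local_span_base)
    have i\<delta>: "(\<sigma> ^^ i) \<delta> = \<delta>" unfolding i_def by (simp add: sigma_iter_eta_delta)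
    have \<rho>: "1 + \<delta> \<in> R" "cong_mod (of_nat 2) ((1 + \<delta>) ^ 2) 0" "cong_mod (1 + \<delta>) (of_nat 2) 0"
      using r by (auto intro!: ring_mem gens)
    have fr: "(\<sigma> ^^ i) y \<in> R \<and> cong_mod (1 + \<delta>) (y ^ (2 ^ 2)) ((\<sigma> ^^ i) y)" if "y \<in> R" for y
    proof (rule sigma_local_Frobenius[OF R(1) R_def RK \<rho>(3) _ that])
      fix z assume "z \<in> {\<eta>, \<delta>}"
      then show "(\<sigma> ^^ i) z \<in> R \<and> cong_mod (1 + \<delta>) (z ^ (2 ^ 2)) ((\<sigma> ^^ i) z)"
      proof (elim insertE emptyE)
        assume z: "z = \<eta>"
        have "cong_mod 2 (\<eta> ^ 4) ((\<sigma> ^^ i) \<eta>)"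
          unfolding i\<eta> by (rule root_Frobenius_2[OF complex_subring_axioms gens(1) eta_cubic])
        then have "cong_mod (1 + \<delta>) (\<eta> ^ 4) ((\<sigma> ^^ i) \<eta>)" using cong_mod_coarsen' r(2) by blast
        moreover have "(\<sigma> ^^ i) \<eta> \<in> R"
          unfolding i\<eta> next_root_def prev_root_def using gens(1) by (auto intro!: ring_mem)
        ultimately show ?thesis using z by simp
      next
        assume z: "z = \<delta>"
        have "\<delta> ^ 4 - \<delta> = (1 + \<delta>) * (\<delta> * (\<delta>\<^sup>2 - \<delta> + 1) - 2 * \<delta>) + 2 * \<delta>\<^sup>2"
          by (simp add: algebra_simps eval_nat_numeral)
        moreover have "cong_mod (1 + \<delta>) ((1 + \<delta>) * (\<delta> * (\<delta>\<^sup>2 - \<delta> + 1) - 2 * \<delta>) + 2 * \<delta>\<^sup>2) (0 + 0)"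
          by (intro cong_mod_add cong_mod_0_mult cong_mod_self r(2) ring_mem gens)
        ultimately have "cong_mod (1 + \<delta>) (\<delta> ^ 4 - \<delta>) 0" by simp
        then have "cong_mod (1 + \<delta>) (\<delta> ^ 4 - \<delta> + \<delta>) (0 + \<delta>)" by (intro cong_mod_add cong_mod_refl)
        then show ?thesis using gens(2) i\<delta> z by simp
      qed
    qed
    have "\<not> int 2 dvd element_value_gcd K x"
      by (rule value_gcd_ndvd_nilpotent[OF R(1) RK R(2) _ i _ \<rho> _ x]; (rule fr nil)?; simp)
    then show ?thesis by simp
  qed
qed

section \<open>The prime 3 for m not 39 modulo 81\<close>

lemma norm_local_unit:
  assumes R: "p_local_order R p" "R \<subseteq> K" and u: "u \<in> A" "u \<in> R" "Nm u = of_int N"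
    and \<rho>: "\<rho> \<in> R" "complex_subring.cong_mod R (of_nat p) (\<rho> ^ e) 0"
    and k: "k > 0" "complex_subring.cong_mod R \<rho> (u ^ k) (of_int a)" "\<not> int p dvd a"
  shows "\<not> int p dvd N"
proof
  assume d: "int p dvd N"
  interpret p_local_order R p by (rule R)
  \<comment> \<open>This yields an inverse of u in \<open>R\<close>. Times an integer n prime to p
    it is integral, so Nm u divides n^6.\<close>
  obtain z where z: "z \<in> R" "u ^ k * z = 1"
    using unit_mod_radical[OF power_mem[OF u(2)] \<rho> k(2,3)] by blast
  define w where "w = u ^ (k - 1) * z"
  have wR: "w \<in> R" unfolding w_def by (intro mult_mem power_mem u(2) z(1))
  then have w: "w \<in> R" "w \<in> K" using R(2) by blast+
  have "u * w = u ^ (Suc (k - 1)) * z" by (simp add: w_def)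
  then have uw: "u * w = 1" using z(2) k(1) by simp
  obtain n where n: "\<not> int p dvd n" "algebraic_int (of_int n * w)"
    using p_int[OF w(1)] unfolding p_integral_def by blast
  have nw: "of_int n * w \<in> A" using n(2) K_closed(4)[OF K_closed(10) w(2)] by (simp add: A_iff)
  obtain j where j: "Nm (of_int n * w) = of_int j" by (rule Nm_mem_int[OF nw])
  have "u * (of_int n * w) = of_int n * (u * w)" by (simp add: mult_ac)
  then have e: "u * (of_int n * w) = of_int n" unfolding uw by simp
  have "Nm u * Nm (of_int n * w) = of_int n ^ 6"
    using Nm_mult[of u "of_int n * w"] u(1) nw unfolding e Nm_of_int A_iff by metis
  then have "(of_int (N * j) :: complex) = of_int (n ^ 6)" by (simp add: u(3) j)
  then have "N * j = n ^ 6" by (simp only: of_int_eq_iff)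
  then have "int p dvd n ^ 6" using d by (metis dvd_mult2)
  moreover have "prime (int p)" using p by simp
  ultimately show False using n(1) prime_dvd_power by blast
qed

text \<open>Two primes lie above 3, which splits in the quadratic field and is inert in the cubic
  one; 1 - \<delta> and 1 + \<delta> are zero divisors modulo 3 that separate them. For each t one
  of the two kills t - x, and among t = 0, 1, 2 two values share the sign s. Their difference being
  prime to 3, 1 - s \<delta> would be divisible by 3, although its sum with its conjugate is
  2.\<close>

lemma three_not_dvd_value_gcd_unramified:
  assumes m3: "m mod 3 = 1 \<or> m mod 3 = 2" and x: "x \<in> A"
  shows "\<not> 3 dvd element_value_gcd K x"
proof
  assume d: "3 dvd element_value_gcd K x"
  define i :: nat where "i = (if m mod 3 = 1 then 4 else 2)"
  have i: "\<sigma> ^^ i = \<sigma> ^^ 2 \<or> \<sigma> ^^ i = \<sigma> ^^ 4" by (simp add: i_def)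
  have i\<eta>: "(\<sigma> ^^ i) \<eta> = (if m mod 3 = 1 then next_root \<eta> else prev_root \<eta>)"
    unfolding i_def next_eta prev_eta by (simp add: sigma_iter_eta_delta \<eta>''_def)
  have i\<delta>: "(\<sigma> ^^ i) \<delta> = \<delta>" unfolding i_def by (simp add: sigma_iter_eta_delta)
  obtain j where j: "D = 3 * j + 1" using D_mod_3[OF m3] by blast
  define R where "R = local_span 3 {\<eta>, \<delta>}"
  have R: "p_local_order R 3" "A \<subseteq> R"
    using local_order_3_unramified[OF m3] unfolding R_def by blast+
  interpret p_local_order R 3 by (rule R)
  have RK: "R \<subseteq> K" unfolding R_def using delta_mem_A eta_mem_A
    by (intro local_span_subset[OF K_subfield]) (auto simp: A_iff)
  have gens: "\<eta> \<in> R" "\<delta> \<in> R" unfolding R_def by (auto intro: local_span_base)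
  have xR: "x \<in> R" using x R(2) by blast
  have 3: "cong_mod 3 (of_nat 3) 0" using cong_mod_self[of 3] by simp
  have fr: "(\<sigma> ^^ i) y \<in> R \<and> cong_mod 3 (y ^ (3 ^ 1)) ((\<sigma> ^^ i) y)" if "y \<in> R" for y
  proof (rule sigma_local_Frobenius[OF R(1) R_def RK 3 _ that])
    fix z assume "z \<in> {\<eta>, \<delta>}"
    then show "(\<sigma> ^^ i) z \<in> R \<and> cong_mod 3 (z ^ (3 ^ 1)) ((\<sigma> ^^ i) z)"
    proof (elim insertE emptyE)
      assume z: "z = \<eta>"
      have "cong_mod 3 (\<eta> ^ 3) ((\<sigma> ^^ i) \<eta>)"
        unfolding i\<eta> by (rule root_Frobenius_3[OF complex_subring_axioms gens(1) eta_cubic m3])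
      moreover have "(\<sigma> ^^ i) \<eta> \<in> R"
        unfolding i\<eta> next_root_def prev_root_def using gens(1) by (auto intro!: ring_mem)
      ultimately show ?thesis using z by simp
    next
      assume z: "z = \<delta>"
      have "\<delta> ^ 3 - \<delta> = \<delta> * (\<delta>\<^sup>2 - 1)" by (simp add: algebra_simps eval_nat_numeral)
      also have "\<dots> = 3 * (of_int j * \<delta>)" unfolding delta_square j by simp
      finally have "cong_mod 3 (\<delta> ^ 3) \<delta>" by (rule cong_modI) (intro ring_mem gens)
      then show ?thesis using gens(2) i\<delta> z by simp
    qed
  qed
  have "\<exists>s \<in> {1, - 1}. cong_mod 3 ((1 - of_int s * \<delta>) * (of_int t - x)) 0" for t :: int
  proof -
    define u where "u = of_int t - x"
    have u: "u \<in> A" "u \<in> R" unfolding u_def by (intro A.ring_mem ring_mem x xR)+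
    obtain k where k: "Nm u = of_int (3 * k)" unfolding u_def by (rule Nm_value[OF x d])
    obtain a E where a: "2 * of_int D * rel_norm u = of_int D * of_int a + of_int E * \<delta>"
        "E\<^sup>2 = D * (a\<^sup>2 - 4 * (3 * k))"
      by (rule rel_norm_quadratic[OF u(1) k])
    have vR: "rel_norm u \<in> R" using rel_norm_mem_A[OF u(1)] R(2) by blast
    \<comment> \<open>As D is 1 modulo 3 and the norm is divisible by 3, E^2 and a^2 agree modulo 3;
      the sign s with E = s a modulo 3 selects the zero divisor.\<close>
    have "(E - a) * (E + a) = 3 * (j * a\<^sup>2 - 4 * D * k)"
      using a(2) by (simp add: j power2_eq_square algebra_simps)
    then have "3 dvd (E - a) * (E + a)" by simp
    then have "3 dvd E - a \<or> 3 dvd E + a" by (simp add: prime_dvd_mult_iff)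
    then obtain s l where s: "s \<in> {1, - 1}" "E = s * a + 3 * l"
    proof
      assume "3 dvd E - a"
      then obtain l where "E - a = 3 * l" by (elim dvdE)
      then show ?thesis using that[of 1 l] by simp
    next
      assume "3 dvd E + a"
      then obtain l where "E + a = 3 * l" by (elim dvdE)
      then show ?thesis using that[of "- 1" l] by simp
    qed
    have ss: "of_int s * of_int s = (1 :: complex)" using s(1) by auto
    define e :: complex where "e = of_int s"
    have E: "of_int E = e * of_int a + 3 * of_int l" unfolding s(2) e_def by simp
    have dd: "\<delta> * \<delta> = 3 * of_int j + 1" using delta_square by (simp add: power2_eq_square j)
    have eR: "e \<in> R" unfolding e_def by (rule of_int_mem)
    have "2 * of_int D * ((1 - e * \<delta>) * rel_norm u) = (1 - e * \<delta>) * (of_int D * of_int a + of_int E * \<delta>)"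
      unfolding a(1)[symmetric] by (simp only: mult_ac)
    also have "\<dots> = (1 - e * \<delta>) * ((3 * of_int j + 1) * of_int a + (e * of_int a + 3 * of_int l) * \<delta>)"
      by (simp add: E j)
    also have "\<dots> = of_int a * (1 - (e * e) * (\<delta> * \<delta>)) + 3 * ((1 - e * \<delta>) * (of_int j * of_int a + of_int l * \<delta>))"
      by (simp add: algebra_simps)
    also have "\<dots> = 3 * ((1 - e * \<delta>) * (of_int j * of_int a + of_int l * \<delta>) - of_int a * of_int j)"
      unfolding dd ss[folded e_def] by (simp add: algebra_simps)
    finally have h: "2 * of_int D * ((1 - e * \<delta>) * rel_norm u) =
      3 * ((1 - e * \<delta>) * (of_int j * of_int a + of_int l * \<delta>) - of_int a * of_int j)" .
    \<comment> \<open>Divides by 2 D modulo 3, using 3 (1 + 2 j) - 2 D = 1.\<close>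
    have "(1 - e * \<delta>) * rel_norm u - 0 =
        3 * ((1 + 2 * of_int j) * ((1 - e * \<delta>) * rel_norm u)) - 2 * of_int D * ((1 - e * \<delta>) * rel_norm u)"
      by (simp add: j algebra_simps)
    also have "\<dots> = 3 * ((1 + 2 * of_int j) * ((1 - e * \<delta>) * rel_norm u)
        - ((1 - e * \<delta>) * (of_int j * of_int a + of_int l * \<delta>) - of_int a * of_int j))"
      unfolding h by (rule right_diff_distrib[symmetric])
    finally have "cong_mod 3 ((1 - e * \<delta>) * rel_norm u) 0"
      by (rule cong_modI) (intro ring_mem gens vR eR)
    then have "cong_mod 3 ((1 - e * \<delta>) * u) 0"
      by (rule rel_norm_cancel[OF R(1) RK _ i _ u(2), where s = 1, rotated -1])
        ((rule fr; assumption) | simp | intro ring_mem gens eR)+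
    then show ?thesis using s(1) unfolding e_def u_def by blast
  qed
  then obtain f where f: "f t \<in> {1, - 1}" "cong_mod 3 ((1 - of_int (f t) * \<delta>) * (of_int t - x)) 0" for t
    by metis
  have same: False if "f a = f b" "b - a \<in> {1, 2}" for a b
  proof -
    define y where "y = 1 - of_int (f a) * \<delta>"
    have y: "y \<in> R" unfolding y_def by (intro ring_mem gens)
    have "cong_mod 3 (y * (of_int b - x) - y * (of_int a - x)) (0 - 0)"
      using f(2)[of a] f(2)[of b] that(1) unfolding y_def by (intro cong_mod_diff) simp_all
    also have "y * (of_int b - x) - y * (of_int a - x) = y * of_int (b - a)"
      by (simp add: algebra_simps)
    finally have c: "cong_mod 3 (y * of_int (b - a)) 0" by simp
    have "cong_mod 3 y 0"
    proof (cases "b - a = 1")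
      case True
      then show ?thesis using c by simp
    next
      case False
      then have "b - a = 2" using that(2) by blast
      then have "cong_mod 3 (y * 2) 0" using c by simp
      then have "cong_mod 3 (3 * y - y * 2) (0 - 0)"
        by (rule cong_mod_diff[OF cong_mod_0_mult[OF cong_mod_self y]])
      moreover have "3 * y - y * 2 = y" by simp
      ultimately show ?thesis by simp
    qed
    then obtain r where r: "r \<in> R" "y = 3 * r" unfolding cong_mod_def by auto
    obtain n where n: "\<not> int 3 dvd n" "algebraic_int (of_int n * r)"
      using p_int[OF r(1)] unfolding p_integral_def by blast
    have rK: "r \<in> K" using r(1) RK by blast
    have nr: "of_int n * r \<in> K" by (intro K_closed rK)
    \<comment> \<open>Adding the conjugate removes \<delta> and leaves 2 n / 3, which is not an
      integer.\<close>
    have "algebraic_int (\<sigma> (of_int n * r))" using sigma_iter_algebraic_int[OF nr n(2), of 1] by simp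
    then have alg: "algebraic_int (of_int n * r + \<sigma> (of_int n * r))" by (intro algebraic_int_add n(2))
    have r3: "of_int n * r = of_int n / of_int 3 * (1 - of_int (f a) * \<delta>)"
    proof -
      have "r = (1 - of_int (f a) * \<delta>) / of_int 3" using r(2) by (simp add: y_def)
      then show ?thesis by simp
    qed
    have "\<sigma> (of_int n * r) = of_int n / of_int 3 * (1 + of_int (f a) * \<delta>)"
    proof -
      have "(\<sigma> ^^ 1) (of_int n / of_int 3 * (1 - of_int (f a) * \<delta>)) =
          of_int n / of_int 3 * (1 - of_int (f a) * (\<sigma> ^^ 1) \<delta>)"
        by (simp only: sigma_iter_mult sigma_iter_diff sigma_iter_divide sigma_iter_int sigma_iter_one
            K_closed delta_mem_K)
      then show ?thesis unfolding r3 by (simp add: sigma_delta)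
    qed
    then have e: "of_int n * r + \<sigma> (of_int n * r) = of_int (2 * n) / of_int 3"
      unfolding r3 by (simp add: algebra_simps)
    have "algebraic_int (of_int (2 * n) / of_int 3 :: complex)" using alg unfolding e .
    moreover have "(of_int (2 * n) / of_int 3 :: complex) \<in> \<rat>" by (intro Rats_divide Rats_of_int)
    ultimately have "(of_int (2 * n) / of_int 3 :: complex) \<in> \<int>" by (intro rational_algebraic_int_is_int)
    then obtain l where "of_int (2 * n) / of_int 3 = (of_int l :: complex)" by (elim Ints_cases)
    then have "(of_int (2 * n) :: complex) = of_int (3 * l)" by (simp add: field_simps)
    then have "2 * n = 3 * l" by (simp only: of_int_eq_iff)
    then show False using n(1) by presburger
  qed
  show False using same[of 0 1] same[of 0 2] same[of 1 2] f(1)[of 0] f(1)[of 1] f(1)[of 2] by auto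
qed

text \<open>Modulo \<mu> one has x = a + b \<delta>3 with \<delta>3^2 = 1. If 3 divides b, then t =
  a + 1 makes t - x congruent to 1; otherwise t = a makes its square congruent to b^2. Either way t
  - x is a local unit, and its norm is prime to 3.\<close>

lemma three_not_dvd_value_gcd_cubic_ramified:
  assumes m: "m = 3 * n" and n: "n mod 3 \<noteq> 1" and x: "x \<in> A"
  shows "\<not> 3 dvd element_value_gcd K x"
proof
  assume d: "3 dvd element_value_gcd K x"
  define R where "R = local_span 3 {\<mu>, \<delta>3}"
  have R: "p_local_order R 3" "A \<subseteq> R" and \<mu>3: "complex_subring.cong_mod R 3 (\<mu> ^ 3) 0"
    and gens: "\<mu> \<in> R" "\<delta>3 \<in> R" and d2: "complex_subring.cong_mod R \<mu> (\<delta>3\<^sup>2) 1"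
    and res: "\<And>x. x \<in> R \<Longrightarrow> \<exists>y\<in>int_adjoin \<delta>3. complex_subring.cong_mod R \<mu> x y"
    and 3: "complex_subring.cong_mod R \<mu> 3 0"
    using local_order_3_cubic_ramified[OF m n] unfolding R_def by blast+
  interpret p_local_order R 3 by (rule R)
  have RK: "R \<subseteq> K" unfolding R_def using delta3_mem_A[OF m] mu_mem_A
    by (intro local_span_subset[OF K_subfield]) (auto simp: A_iff)
  have xR: "x \<in> R" using x R(2) by blast
  obtain g where g: "cong_mod \<mu> x (poly (map_poly of_int g) \<delta>3)"
    using res[OF xR] unfolding int_adjoin_def by blast
  have "\<exists>a b. cong_mod \<mu> (poly (map_poly of_int g) \<delta>3) (of_int a + of_int b * \<delta>3)"
  proof (induction g)
    case 0
    show ?case by (intro exI[of _ 0]) (simp add: cong_mod_refl)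
  next
    case (pCons c g)
    then obtain a b where ab: "cong_mod \<mu> (poly (map_poly of_int g) \<delta>3) (of_int a + of_int b * \<delta>3)" by blast
    have "cong_mod \<mu> (of_int c + \<delta>3 * poly (map_poly of_int g) \<delta>3) (of_int c + \<delta>3 * (of_int a + of_int b * \<delta>3))"
      by (intro cong_mod_add cong_mod_refl cong_mod_scale ab gens)
    also have "of_int c + \<delta>3 * (of_int a + of_int b * \<delta>3) = of_int c + of_int a * \<delta>3 + of_int b * \<delta>3\<^sup>2"
      by (simp add: power2_eq_square algebra_simps)
    also have "cong_mod \<mu> (of_int c + of_int a * \<delta>3 + of_int b * \<delta>3\<^sup>2) (of_int c + of_int a * \<delta>3 + of_int b * 1)"
      by (intro cong_mod_add cong_mod_refl cong_mod_scale d2 of_int_mem)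
    finally have "cong_mod \<mu> (poly (map_poly of_int (pCons c g)) \<delta>3) (of_int (c + b) + of_int a * \<delta>3)"
      by (simp add: ipoly_pCons algebra_simps)
    then show ?case by blast
  qed
  then obtain a b where "cong_mod \<mu> (poly (map_poly of_int g) \<delta>3) (of_int a + of_int b * \<delta>3)" by blast
  then have xab: "cong_mod \<mu> x (of_int a + of_int b * \<delta>3)" by (rule cong_mod_trans[OF g])
  have \<mu>3': "cong_mod (of_nat 3) (\<mu> ^ 3) 0" using \<mu>3 by simp
  have unit: False if "k > 0" "cong_mod \<mu> ((of_int t - x) ^ k) (of_int c)" "\<not> int 3 dvd c" for t c and k :: nat
  proof -
    obtain l where l: "Nm (of_int t - x) = of_int (3 * l)" by (rule Nm_value[OF x d])
    have "\<not> int 3 dvd 3 * l"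
      by (rule norm_local_unit[OF R(1) RK _ _ l gens(1) \<mu>3' that]) (intro A.ring_mem ring_mem x xR)+
    then show False by simp
  qed
  show False
  proof (cases "3 dvd b")
    case True
    then obtain l where l: "b = 3 * l" by (elim dvdE)
    have "cong_mod \<mu> (of_int (a + 1) - x) (of_int (a + 1) - (of_int a + of_int b * \<delta>3))"
      by (intro cong_mod_diff cong_mod_refl xab)
    also have "of_int (a + 1) - (of_int a + of_int b * \<delta>3) = of_int 1 - 3 * (of_int l * \<delta>3)"
      by (simp add: l)
    also have "cong_mod \<mu> (of_int 1 - 3 * (of_int l * \<delta>3)) (of_int 1 - 0)"
      by (intro cong_mod_diff cong_mod_refl cong_mod_0_mult 3 ring_mem gens)
    finally show False using unit[of 1 "a + 1" 1] by simp
  next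
    case False
    have "cong_mod \<mu> (of_int a - x) (of_int a - (of_int a + of_int b * \<delta>3))"
      by (intro cong_mod_diff cong_mod_refl xab)
    then have "cong_mod \<mu> ((of_int a - x) ^ 2) ((of_int a - (of_int a + of_int b * \<delta>3)) ^ 2)"
      by (rule cong_mod_power) (intro ring_mem xR gens)+
    also have "(of_int a - (of_int a + of_int b * \<delta>3)) ^ 2 = of_int (b\<^sup>2) * \<delta>3\<^sup>2"
      by (simp add: power_mult_distrib)
    also have "cong_mod \<mu> (of_int (b\<^sup>2) * \<delta>3\<^sup>2) (of_int (b\<^sup>2) * 1)"
      by (intro cong_mod_scale d2 of_int_mem)
    finally have "cong_mod \<mu> ((of_int a - x) ^ 2) (of_int (b\<^sup>2))" by simp
    moreover have "\<not> int 3 dvd b\<^sup>2" using False by (simp add: prime_dvd_power_iff)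
    ultimately show False using unit[of 2 a "b\<^sup>2"] by simp
  qed
qed

text \<open>Every residue modulo \<rho> is that of an integer, so some t makes t - x congruent to 1,
  a local unit.\<close>

lemma three_not_dvd_value_gcd_totally_ramified:
  assumes m: "m = 3 * n" and n: "n = 3 * l + 1" and l: "l mod 3 \<noteq> 1" and x: "x \<in> A"
  shows "\<not> 3 dvd element_value_gcd K x"
proof
  assume d: "3 dvd element_value_gcd K x"
  obtain R \<rho> where R: "p_local_order R 3" "R \<subseteq> K" "A \<subseteq> R" and "monogenic_mod 3" and \<rho>: "complex_subring.cong_mod R 3 (\<rho> ^ 6) 0" "\<rho> \<in> R"
    and res: "\<And>x. x \<in> R \<Longrightarrow> \<exists>y\<in>int_adjoin 1. complex_subring.cong_mod R \<rho> x y"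
    using local_order_3_totally_ramified[OF m n l] by metis
  interpret p_local_order R 3 by (rule R)
  have xR: "x \<in> R" using x R(3) by blast
  obtain g where g: "cong_mod \<rho> x (poly (map_poly of_int g) 1)"
    using res[OF xR] unfolding int_adjoin_def by blast
  have "\<exists>a. poly (map_poly of_int g) (1 :: complex) = of_int a"
    by (induction g) (auto simp: ipoly_pCons simp flip: of_int_add)
  then obtain a where a: "cong_mod \<rho> x (of_int a)" using g by metis
  have "cong_mod \<rho> (of_int (a + 1) - x) (of_int (a + 1) - of_int a)"
    by (intro cong_mod_diff cong_mod_refl a)
  then have u: "cong_mod \<rho> ((of_int (a + 1) - x) ^ 1) (of_int 1)" by simp
  have \<rho>': "cong_mod (of_nat 3) (\<rho> ^ 6) 0" using \<rho> by simp
  obtain l where l: "Nm (of_int (a + 1) - x) = of_int (3 * l)" by (rule Nm_value[OF x d])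
  have "\<not> int 3 dvd 3 * l"
    by (rule norm_local_unit[OF R(1,2) _ _ l \<rho>(2) \<rho>' _ u]) ((intro A.ring_mem ring_mem x xR)+, simp_all)
  then show False by simp
qed

lemma conjugate_nu:
  assumes m: "m = 27 * j + 12"
  shows "(\<sigma> ^^ 4) \<nu> = 3 * \<nu>\<^sup>2 - of_int (27 * j + 11) * \<nu> - of_int (9 * j + 5)"
    "(\<sigma> ^^ 2) \<nu> = - (3 * \<nu>\<^sup>2) + of_int (27 * j + 10) * \<nu> + of_int (18 * j + 8)"
proof -
  have \<nu>: "\<nu> = (\<eta> - of_int 1) / of_int 3" by (simp add: \<nu>_def \<mu>_def)
  have c: "(\<sigma> ^^ i) \<nu> = ((\<sigma> ^^ i) \<eta> - 1) / 3" for i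
    unfolding \<nu> by (simp only: sigma_iter_divide sigma_iter_diff sigma_iter_int K_closed(7,10) eta_mem_K) simp
  have M: "M = 27 * of_int j + 12" using m by simp
  have "3 * \<nu> = \<mu>" by (simp add: \<nu>_def)
  then have e: "\<eta> = 3 * \<nu> + 1" by (simp add: \<mu>_def)
  have "(\<sigma> ^^ 4) \<nu> = (next_root \<eta> - 1) / 3" unfolding c next_eta by (simp add: sigma_iter_eta_delta)
  also have "\<dots> = 3 * \<nu>\<^sup>2 - of_int (27 * j + 11) * \<nu> - of_int (9 * j + 5)"
    unfolding next_root_def M e by (simp add: field_simps power2_eq_square)
  finally show "(\<sigma> ^^ 4) \<nu> = 3 * \<nu>\<^sup>2 - of_int (27 * j + 11) * \<nu> - of_int (9 * j + 5)" .
  have "(\<sigma> ^^ 2) \<nu> = (prev_root \<eta> - 1) / 3" unfolding c prev_eta by (simp add: sigma_iter_eta_delta \<eta>''_def)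
  also have "\<dots> = - (3 * \<nu>\<^sup>2) + of_int (27 * j + 10) * \<nu> + of_int (18 * j + 8)"
    unfolding prev_root_def M e by (simp add: field_simps power2_eq_square)
  finally show "(\<sigma> ^^ 2) \<nu> = - (3 * \<nu>\<^sup>2) + of_int (27 * j + 10) * \<nu> + of_int (18 * j + 8)" .
qed

text \<open>For j other than 1 modulo 3 the Artin-Schreier constant 2 j + 1 is 1 or -1 modulo 3, and
  cubing \<nu> agrees modulo 3 with \<sigma>^4 or \<sigma>^2. On the quadratic side D = 27 H with H
  prime to 3, and the odd exponent of 3 in E^2 = D (t^2 - 4 N) makes 3 divide t^2 - 4 N and thus
  t.\<close>

lemma three_not_dvd_value_gcd_quadratic_ramified:
  assumes m: "m = 27 * j + 12" and j: "j mod 3 \<noteq> 1" and x: "x \<in> A"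
  shows "\<not> 3 dvd element_value_gcd K x"
proof -
  have m3: "m = 3 * (9 * j + 4)" using m by simp
  define i :: nat where "i = (if j mod 3 = 0 then 4 else 2)"
  have i: "\<sigma> ^^ i = \<sigma> ^^ 2 \<or> \<sigma> ^^ i = \<sigma> ^^ 4" by (simp add: i_def)
  define R where "R = local_span 3 {\<nu>, \<delta>3}"
  have R: "p_local_order R 3" "A \<subseteq> R" and d2: "complex_subring.cong_mod R 3 (\<delta>3 ^ 2) 0"
    and d3: "complex_subring.cong_mod R \<delta>3 3 0" and gens: "\<nu> \<in> R" "\<delta>3 \<in> R"
    and n3: "complex_subring.cong_mod R 3 (\<nu> ^ 3) (\<nu> + of_int (2 * j + 1))"
    using local_order_3_quadratic_ramified[OF m] unfolding R_def by blast+
  interpret p_local_order R 3 by (rule R)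
  have RK: "R \<subseteq> K" unfolding R_def using delta3_mem_A[OF m3] nu_mem_A[OF m]
    by (intro local_span_subset[OF K_subfield]) (auto simp: A_iff)
  have "(\<sigma> ^^ i) \<delta> = \<delta>" unfolding i_def by (simp add: sigma_iter_eta_delta)
  then have i\<delta>: "(\<sigma> ^^ i) \<delta>3 = \<delta>3"
    unfolding \<delta>3_def using sigma_iter_rat[of i 3] delta_mem_K
    by (simp add: sigma_iter_divide K_closed)
  have i\<nu>: "(\<sigma> ^^ i) \<nu> \<in> R \<and> cong_mod 3 (\<nu> + of_int (2 * j + 1)) ((\<sigma> ^^ i) \<nu>)"
  proof (cases "j mod 3 = 0")
    case True
    then have i4: "i = 4" by (simp add: i_def)
    obtain k where k: "j = 3 * k" using True by (metis mult_div_mod_eq add.right_neutral)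
    have "\<nu> + of_int (2 * j + 1) - (\<sigma> ^^ i) \<nu> =
        3 * (of_int (9 * j + 4) * \<nu> + of_int (11 * k + 2) - \<nu>\<^sup>2)"
      unfolding i4 conjugate_nu[OF m] k by (simp add: algebra_simps)
    then have "cong_mod 3 (\<nu> + of_int (2 * j + 1)) ((\<sigma> ^^ i) \<nu>)" by (rule cong_modI) (intro ring_mem gens)
    moreover have "(\<sigma> ^^ i) \<nu> \<in> R" unfolding i4 conjugate_nu[OF m] by (intro ring_mem gens)
    ultimately show ?thesis by blast
  next
    case False
    then have i2: "i = 2" by (simp add: i_def)
    have "j mod 3 = 2" using False j by presburger
    then obtain k where k: "j = 3 * k + 2" by (metis mult_div_mod_eq)
    have "\<nu> + of_int (2 * j + 1) - (\<sigma> ^^ i) \<nu> =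
        3 * (\<nu>\<^sup>2 - of_int (9 * j + 3) * \<nu> - of_int (16 * k + 13))"
      unfolding i2 conjugate_nu[OF m] k by (simp add: algebra_simps)
    then have "cong_mod 3 (\<nu> + of_int (2 * j + 1)) ((\<sigma> ^^ i) \<nu>)" by (rule cong_modI) (intro ring_mem gens)
    moreover have "(\<sigma> ^^ i) \<nu> \<in> R" unfolding i2 conjugate_nu[OF m] by (intro ring_mem gens)
    ultimately show ?thesis by blast
  qed
  have \<rho>: "\<delta>3 \<in> R" "cong_mod (of_nat 3) (\<delta>3 ^ 2) 0" "cong_mod \<delta>3 (of_nat 3) 0"
    using d2 d3 gens by simp_all
  have fr: "(\<sigma> ^^ i) y \<in> R \<and> cong_mod \<delta>3 (y ^ (3 ^ 1)) ((\<sigma> ^^ i) y)" if "y \<in> R" for y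
  proof (rule sigma_local_Frobenius[OF R(1) R_def RK \<rho>(3) _ that])
    fix z assume "z \<in> {\<nu>, \<delta>3}"
    then show "(\<sigma> ^^ i) z \<in> R \<and> cong_mod \<delta>3 (z ^ (3 ^ 1)) ((\<sigma> ^^ i) z)"
    proof (elim insertE emptyE)
      assume z: "z = \<nu>"
      have "cong_mod 3 (\<nu> ^ 3) ((\<sigma> ^^ i) \<nu>)" by (rule cong_mod_trans[OF n3]) (use i\<nu> in blast)
      then have "cong_mod \<delta>3 (\<nu> ^ 3) ((\<sigma> ^^ i) \<nu>)" using cong_mod_coarsen' d3 by blast
      then show ?thesis using z i\<nu> by simp
    next
      assume z: "z = \<delta>3"
      have "\<delta>3 ^ 3 - \<delta>3 = \<delta>3 * (\<delta>3\<^sup>2 - 1)" by (simp add: algebra_simps eval_nat_numeral)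
      then have "cong_mod \<delta>3 (\<delta>3 ^ 3) \<delta>3" by (rule cong_modI) (intro ring_mem gens)
      then show ?thesis using gens(2) i\<delta> z by simp
    qed
  qed
  have "\<exists>r\<in>A. (rel_norm u)\<^sup>2 = of_nat 3 * r" if u: "u \<in> A" "Nm u = of_int N" and "int 3 dvd N" for u N
  proof -
    obtain t E where t: "(rel_norm u)\<^sup>2 = of_int t * rel_norm u - of_int N" "E\<^sup>2 = D * (t\<^sup>2 - 4 * N)"
      by (rule rel_norm_quadratic[OF u])
    obtain k where k: "N = 3 * k" using \<open>int 3 dvd N\<close> by auto
    define H where "H = 27 * j\<^sup>2 + 27 * j + 7"
    have "m\<^sup>2 + 3 * m + 9 = 27 * H" by (simp add: m H_def power2_eq_square algebra_simps)
    then have D: "D = 27 * H" unfolding D_def .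
    have H3: "\<not> 3 dvd H"
    proof -
      have "H = 3 * (9 * j\<^sup>2 + 9 * j + 2) + 1" by (simp add: H_def)
      then show ?thesis by presburger
    qed
    have p3: "prime (3 :: int)" by simp
    have "3 dvd t"
    proof -
      have E: "E\<^sup>2 = 27 * (H * (t\<^sup>2 - 4 * N))" using t(2) D by simp
      then have "3 dvd E\<^sup>2" by simp
      then have "3 dvd E" using prime_dvd_power[OF p3] by blast
      then obtain E1 where E1: "E = 3 * E1" by (elim dvdE)
      then have e1: "E1\<^sup>2 = 3 * (H * (t\<^sup>2 - 4 * N))" using E by (simp add: power_mult_distrib)
      then have "3 dvd E1\<^sup>2" by simp
      then have "3 dvd E1" using prime_dvd_power[OF p3] by blast
      then obtain E2 where E2: "E1 = 3 * E2" by (elim dvdE)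
      then have "H * (t\<^sup>2 - 4 * N) = 3 * E2\<^sup>2" using e1 by (simp add: power_mult_distrib)
      then have "3 dvd H * (t\<^sup>2 - 4 * N)" by simp
      then have "3 dvd t\<^sup>2 - 4 * N" using H3 prime_dvd_mult_iff[OF p3] by blast
      then have "3 dvd t\<^sup>2 - 3 * (4 * k)" by (simp add: k)
      then have "3 dvd t\<^sup>2" by (simp add: dvd_diff_left_iff)
      then show ?thesis using prime_dvd_power[OF p3] by blast
    qed
    then obtain l where l: "t = 3 * l" by (elim dvdE)
    have "(rel_norm u)\<^sup>2 = of_nat 3 * (of_int l * rel_norm u - of_int k)"
      unfolding t(1) l k by (simp add: algebra_simps)
    then show ?thesis
      by (intro bexI[of _ "of_int l * rel_norm u - of_int k"] A.ring_mem rel_norm_mem_A u)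
  qed
  note nil = this
  have "\<not> int 3 dvd element_value_gcd K x"
    by (rule value_gcd_ndvd_nilpotent[OF R(1) RK R(2) _ i _ \<rho> _ x]; (rule fr nil)?; simp)
  then show ?thesis by simp
qed

section \<open>The prime 5\<close>

lemma five_p: "prime (5 :: nat)" by simp

lemma eta_fifth: "\<eta> ^ 5 = of_int (m ^ 3 + 2 * m\<^sup>2 + 6 * m + 1) * \<eta>\<^sup>2 + of_int (m ^ 3 + 4 * m\<^sup>2 + 7 * m + 9) * \<eta> + of_int (m\<^sup>2 + m + 3)"
proof -
  have "\<eta> ^ 5 = \<eta> * \<eta> ^ 4" by (simp add: eval_nat_numeral)
  also have "\<dots> = (M\<^sup>2 + M + 3) * \<eta> ^ 3 + (M\<^sup>2 + 3 * M + 1) * \<eta>\<^sup>2 + M * \<eta>"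
    unfolding root_fourth[OF eta_cubic] by (simp add: algebra_simps eval_nat_numeral)
  finally show ?thesis unfolding eta_cubic by (simp add: algebra_simps eval_nat_numeral)
qed

text \<open>Modulo 5 the coefficients of \<eta>^5 in 1, \<eta>, \<eta>^2 and the factor D^2 in
  \<delta>^5 = D^2 \<delta> depend only on m modulo 5. For m = 0, 1, 2, 3, 4 modulo 5 they match
  \<sigma>^i with i = 4, 3, 2, 5, 1.\<close>

lemma Frobenius_5:
  assumes R: "complex_subring R" and mem: "\<eta> \<in> R" "\<delta> \<in> R"
  obtains i where "i \<in> {1, 2, 3, 4, 5}"
    "\<And>x. x \<in> {\<eta>, \<delta>} \<Longrightarrow> (\<sigma> ^^ i) x \<in> R \<and> complex_subring.cong_mod R 5 (x ^ 5) ((\<sigma> ^^ i) x)"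
proof -
  interpret complex_subring R by (rule R)
  note result = that
  have h': "\<eta>' = \<eta>\<^sup>2 + of_int (- m - 1) * \<eta> + of_int (- 2)"
    unfolding next_eta[symmetric] next_root_def by (simp add: algebra_simps)
  have h'': "(\<sigma> ^^ 2) \<eta> = - (\<eta>\<^sup>2) + of_int m * \<eta> + of_int (m + 2)"
      "(\<sigma> ^^ 5) \<eta> = - (\<eta>\<^sup>2) + of_int m * \<eta> + of_int (m + 2)"
    unfolding sigma_iter_eta_delta \<eta>''_def[symmetric] prev_eta[symmetric] prev_root_def by simp_all
  have int: "cong_mod 5 (of_int a) (of_int b)" if ab: "[a = b] (mod 5)" for a b
  proof -
    obtain k where "a - b = 5 * k" using ab unfolding cong_iff_dvd_diff by (elim dvdE)
    then have "(of_int a - of_int b :: complex) = 5 * of_int k"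
      by (metis of_int_diff of_int_mult of_int_numeral)
    then show ?thesis by (rule cong_modI) (rule of_int_mem)
  qed
  have e: "cong_mod 5 (\<eta> ^ 5) (of_int a * \<eta>\<^sup>2 + of_int b * \<eta> + of_int d)"
    if "[m ^ 3 + 2 * m\<^sup>2 + 6 * m + 1 = a] (mod 5)" "[m ^ 3 + 4 * m\<^sup>2 + 7 * m + 9 = b] (mod 5)"
      "[m\<^sup>2 + m + 3 = d] (mod 5)" for a b d
    unfolding eta_fifth by (intro cong_mod_add cong_mod_mult cong_mod_refl int that ring_mem mem)
  have dl: "cong_mod 5 (\<delta> ^ 5) (of_int a * \<delta>)" if "[(m\<^sup>2 + 3 * m + 9)\<^sup>2 = a] (mod 5)" for a
  proof -
    have "\<delta> ^ 5 = (\<delta>\<^sup>2)\<^sup>2 * \<delta>" by (simp add: eval_nat_numeral)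
    also have "(\<delta>\<^sup>2)\<^sup>2 = of_int ((m\<^sup>2 + 3 * m + 9)\<^sup>2)" unfolding delta_square D_def by simp
    finally show ?thesis using cong_mod_mult[OF int[OF that] cong_mod_refl of_int_mem mem(2)]
      by (simp only:)
  qed
  \<comment> \<open>The numbers v1 to v4 are the differences of corresponding coefficients after the
    residue is put in for m; their divisibility by 5 is a numerical check.\<close>
  have main: thesis
    if i: "i \<in> {1, 2, 3, 4, 5}" and \<eta>i: "(\<sigma> ^^ i) \<eta> = of_int a * \<eta>\<^sup>2 + of_int b * \<eta> + of_int d"
      and \<delta>i: "(\<sigma> ^^ i) \<delta> = of_int e * \<delta>"
      and c: "[m ^ 3 + 2 * m\<^sup>2 + 6 * m + 1 - a = v1] (mod 5)" "[m ^ 3 + 4 * m\<^sup>2 + 7 * m + 9 - b = v2] (mod 5)"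
        "[m\<^sup>2 + m + 3 - d = v3] (mod 5)" "[(m\<^sup>2 + 3 * m + 9)\<^sup>2 - e = v4] (mod 5)"
      and v: "5 dvd v1" "5 dvd v2" "5 dvd v3" "5 dvd v4" for i a b d e v1 v2 v3 v4
  proof (rule result[OF i])
    fix x assume "x \<in> {\<eta>, \<delta>}"
    moreover have "of_int a * \<eta>\<^sup>2 + of_int b * \<eta> + of_int d \<in> R" "of_int e * \<delta> \<in> R"
      by (intro ring_mem mem)+
    moreover have c': "[m ^ 3 + 2 * m\<^sup>2 + 6 * m + 1 = a] (mod 5)" "[m ^ 3 + 4 * m\<^sup>2 + 7 * m + 9 = b] (mod 5)"
        "[m\<^sup>2 + m + 3 = d] (mod 5)" "[(m\<^sup>2 + 3 * m + 9)\<^sup>2 = e] (mod 5)"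
      unfolding cong_iff_dvd_diff using v by (simp_all only: c[THEN cong_dvd_iff])
    ultimately show "(\<sigma> ^^ i) x \<in> R \<and> cong_mod 5 (x ^ 5) ((\<sigma> ^^ i) x)"
      using e[OF c'(1-3)] dl[OF c'(4)] unfolding \<eta>i[symmetric] \<delta>i[symmetric] by blast
  qed
  have "m mod 5 = 0 \<or> m mod 5 = 1 \<or> m mod 5 = 2 \<or> m mod 5 = 3 \<or> m mod 5 = 4" by presburger
  then obtain k where "m = 5 * k \<or> m = 5 * k + 1 \<or> m = 5 * k + 2 \<or> m = 5 * k + 3 \<or> m = 5 * k + 4"
    by (metis add.right_neutral mult_div_mod_eq)
  then consider "[m = 0] (mod 5)" | "[m = 1] (mod 5)" | "[m = 2] (mod 5)" | "[m = 3] (mod 5)" | "[m = 4] (mod 5)"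
    by (auto simp: cong_def)
  then show thesis
  proof cases
    case 1
    show ?thesis
    proof (rule main[of 4 "1" "- m - 1" "- 2" "1"])
      show "[m ^ 3 + 2 * m\<^sup>2 + 6 * m + 1 - (1) = 0 ^ 3 + 2 * 0\<^sup>2 + 6 * 0 + 1 - (1)] (mod 5)"
        "[m ^ 3 + 4 * m\<^sup>2 + 7 * m + 9 - (- m - 1) = 0 ^ 3 + 4 * 0\<^sup>2 + 7 * 0 + 9 - (- 0 - 1)] (mod 5)"
        "[m\<^sup>2 + m + 3 - (- 2) = 0\<^sup>2 + 0 + 3 - (- 2)] (mod 5)"
        "[(m\<^sup>2 + 3 * m + 9)\<^sup>2 - (1) = (0\<^sup>2 + 3 * 0 + 9)\<^sup>2 - (1)] (mod 5)"
        by (intro cong_add cong_diff cong_mult cong_pow cong_refl 1 iffD2[OF cong_minus_minus_iff])+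
    qed (simp_all add: sigma_iter_eta_delta(1,2,4,5,7-12) sigma_eta sigma_delta h' h'')
  next
    case 2
    show ?thesis
    proof (rule main[of 3 "0" "1" "0" "- 1"])
      show "[m ^ 3 + 2 * m\<^sup>2 + 6 * m + 1 - (0) = 1 ^ 3 + 2 * 1\<^sup>2 + 6 * 1 + 1 - (0)] (mod 5)"
        "[m ^ 3 + 4 * m\<^sup>2 + 7 * m + 9 - (1) = 1 ^ 3 + 4 * 1\<^sup>2 + 7 * 1 + 9 - (1)] (mod 5)"
        "[m\<^sup>2 + m + 3 - (0) = 1\<^sup>2 + 1 + 3 - (0)] (mod 5)"
        "[(m\<^sup>2 + 3 * m + 9)\<^sup>2 - (- 1) = (1\<^sup>2 + 3 * 1 + 9)\<^sup>2 - (- 1)] (mod 5)"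
        by (intro cong_add cong_diff cong_mult cong_pow cong_refl 2 iffD2[OF cong_minus_minus_iff])+
    qed (simp_all add: sigma_iter_eta_delta(1,2,4,5,7-12) sigma_eta sigma_delta h' h'')
  next
    case 3
    show ?thesis
    proof (rule main[of 2 "- 1" "m" "m + 2" "1"])
      show "[m ^ 3 + 2 * m\<^sup>2 + 6 * m + 1 - (- 1) = 2 ^ 3 + 2 * 2\<^sup>2 + 6 * 2 + 1 - (- 1)] (mod 5)"
        "[m ^ 3 + 4 * m\<^sup>2 + 7 * m + 9 - (m) = 2 ^ 3 + 4 * 2\<^sup>2 + 7 * 2 + 9 - (2)] (mod 5)"
        "[m\<^sup>2 + m + 3 - (m + 2) = 2\<^sup>2 + 2 + 3 - (2 + 2)] (mod 5)"
        "[(m\<^sup>2 + 3 * m + 9)\<^sup>2 - (1) = (2\<^sup>2 + 3 * 2 + 9)\<^sup>2 - (1)] (mod 5)"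
        by (intro cong_add cong_diff cong_mult cong_pow cong_refl 3 iffD2[OF cong_minus_minus_iff])+
    qed (simp_all add: sigma_iter_eta_delta(1,2,4,5,7-12) sigma_eta sigma_delta h' h'')
  next
    case 4
    show ?thesis
    proof (rule main[of 5 "- 1" "m" "m + 2" "- 1"])
      show "[m ^ 3 + 2 * m\<^sup>2 + 6 * m + 1 - (- 1) = 3 ^ 3 + 2 * 3\<^sup>2 + 6 * 3 + 1 - (- 1)] (mod 5)"
        "[m ^ 3 + 4 * m\<^sup>2 + 7 * m + 9 - (m) = 3 ^ 3 + 4 * 3\<^sup>2 + 7 * 3 + 9 - (3)] (mod 5)"
        "[m\<^sup>2 + m + 3 - (m + 2) = 3\<^sup>2 + 3 + 3 - (3 + 2)] (mod 5)"
        "[(m\<^sup>2 + 3 * m + 9)\<^sup>2 - (- 1) = (3\<^sup>2 + 3 * 3 + 9)\<^sup>2 - (- 1)] (mod 5)"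
        by (intro cong_add cong_diff cong_mult cong_pow cong_refl 4 iffD2[OF cong_minus_minus_iff])+
    qed (simp_all add: sigma_iter_eta_delta(1,2,4,5,7-12) sigma_eta sigma_delta h' h'')
  next
    case 5
    show ?thesis
    proof (rule main[of 1 "1" "- m - 1" "- 2" "- 1"])
      show "[m ^ 3 + 2 * m\<^sup>2 + 6 * m + 1 - (1) = 4 ^ 3 + 2 * 4\<^sup>2 + 6 * 4 + 1 - (1)] (mod 5)"
        "[m ^ 3 + 4 * m\<^sup>2 + 7 * m + 9 - (- m - 1) = 4 ^ 3 + 4 * 4\<^sup>2 + 7 * 4 + 9 - (- 4 - 1)] (mod 5)"
        "[m\<^sup>2 + m + 3 - (- 2) = 4\<^sup>2 + 4 + 3 - (- 2)] (mod 5)"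
        "[(m\<^sup>2 + 3 * m + 9)\<^sup>2 - (- 1) = (4\<^sup>2 + 3 * 4 + 9)\<^sup>2 - (- 1)] (mod 5)"
        by (intro cong_add cong_diff cong_mult cong_pow cong_refl 5 iffD2[OF cong_minus_minus_iff])+
    qed (simp_all add: sigma_iter_eta_delta(1,2,4,5,7-12) sigma_eta sigma_delta h' h'')
  qed
qed

text \<open>Differentiating the product over the conjugates leaves the products of five of them,
  which are the conjugates of Nm u / u.\<close>

lemma poly_pderiv_field_char_poly:
  assumes x: "x \<in> A" and u: "u = of_int t - x" "u \<noteq> 0"
  shows "of_int (poly (pderiv (field_char_poly K x)) t) = Tr (Nm u / u)"
proof -
  have xK: "x \<in> K" "algebraic_int x" and uK: "u \<in> K" using x unfolding u(1) by (auto simp: A_iff K_closed)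
  have ui: "(\<sigma> ^^ i) u = of_int t - (\<sigma> ^^ i) x" for i
    unfolding u(1) by (simp add: sigma_iter_diff xK K_closed)
  have nz: "(\<sigma> ^^ i) u \<noteq> 0" for i
  proof
    assume "(\<sigma> ^^ i) u = 0"
    then have "(\<sigma> ^^ i) (u * inverse u) = 0" using uK by (simp only: sigma_iter_mult K_closed(6)) simp
    then show False using u(2) by simp
  qed
  have pd: "map_poly of_int (pderiv p) = pderiv (map_poly of_int p :: complex poly)" for p :: "int poly"
    by (rule poly_eqI) (simp add: coeff_pderiv coeff_map_poly)
  have "of_int (poly (pderiv (field_char_poly K x)) t) =
      poly (map_poly of_int (pderiv (field_char_poly K x))) (of_int t :: complex)"
    by simp
  also have "\<dots> = (\<Sum>i<6. \<Prod>j\<in>{..<6} - {i}. (\<sigma> ^^ j) u)"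
    unfolding pd field_char_poly_eq[OF xK] pderiv_prod
    by (simp add: poly_sum poly_prod pderiv_pCons ui)
  also have "\<dots> = (\<Sum>i<6. (\<sigma> ^^ i) (Nm u / u))"
  proof (rule sum.cong[OF refl])
    fix i :: nat assume i: "i \<in> {..<6}"
    have "Nm u = (\<sigma> ^^ i) u * (\<Prod>j\<in>{..<6} - {i}. (\<sigma> ^^ j) u)"
      unfolding Nm_def by (rule prod.remove) (use i in auto)
    moreover obtain q where "Nm u = of_rat q" using Nm_rational[OF uK] by (elim Rats_cases)
    then have "(\<sigma> ^^ i) (Nm u / u) = Nm u / (\<sigma> ^^ i) u"
      using sigma_iter_divide[of "Nm u" u i] uK by (simp add: K_closed)
    ultimately show "(\<Prod>j\<in>{..<6} - {i}. (\<sigma> ^^ j) u) = (\<sigma> ^^ i) (Nm u / u)" using nz by simp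
  qed
  finally show ?thesis unfolding Tr_def .
qed

lemma monic_sextic_values_mod_5:
  fixes F :: "int poly"
  assumes F: "degree F = 6" "poly.coeff F 6 = 1"
    and val: "\<And>t. 5 dvd poly F t" and der: "\<And>t. 5 dvd poly (pderiv F) t"
  shows False
proof -
  define a where "a = poly.coeff F"
  have e: "F = [:a 0, a 1, a 2, a 3, a 4, a 5, 1:]"
  proof (rule poly_eqI)
    fix n :: nat
    have "n \<in> {0, 1, 2, 3, 4, 5, 6} \<or> n > 6" by auto
    then show "poly.coeff F n = poly.coeff [:a 0, a 1, a 2, a 3, a 4, a 5, 1:] n"
    proof
      assume "n \<in> {0, 1, 2, 3, 4, 5, 6}"
      then show ?thesis using F(2) by (auto simp: a_def coeff_pCons eval_nat_numeral)
    next
      assume "n > 6"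
      then show ?thesis using F(1)
        by (auto simp: coeff_eq_0 coeff_pCons eval_nat_numeral less_Suc_eq_0_disj split: nat.splits)
    qed
  qed
  have v: "poly F t = t ^ 6 + a 5 * t ^ 5 + a 4 * t ^ 4 + a 3 * t ^ 3 + a 2 * t\<^sup>2 + a 1 * t + a 0" for t
    using poly_degree_6[OF F, of t] by (simp add: a_def)
  have d: "poly (pderiv F) t = 6 * t ^ 5 + 5 * a 5 * t ^ 4 + 4 * a 4 * t ^ 3 + 3 * a 3 * t\<^sup>2 + 2 * a 2 * t + a 1" for t
    unfolding e by (simp add: pderiv_pCons algebra_simps eval_nat_numeral)
  \<comment> \<open>Modulo 5 the values force F = (x^5 - x)(x + c), whose derivative at t is -(t +
    c); so F'(1) - F'(-1) is -2. The added values of F cancel all coefficients but that of x^4,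
    which enters 20 times, and -112 is -2 modulo 5.\<close>
  have "5 dvd 2 * poly F 1 + 2 * poly F (- 1) - 2 * poly F 0 - poly F 2 - poly F (- 2)
      + poly (pderiv F) 1 - poly (pderiv F) (- 1)"
    by (intro dvd_add dvd_diff dvd_mult val der)
  also have "2 * poly F 1 + 2 * poly F (- 1) - 2 * poly F 0 - poly F 2 - poly F (- 2)
      + poly (pderiv F) 1 - poly (pderiv F) (- 1) = - 20 * a 4 - 112"
    unfolding v d by simp
  finally show False by presburger
qed

text \<open>Let w be the product of the five other conjugates of u = t - x. Frobenius is some
  \<sigma>^i with i from 1 to 5, so w = v \<sigma>^i u for an integral v, and w^2 is congruent to
  u^5 v w, a multiple of u w = Nm u. Hence 5 divides w^2 and, without nilpotents, w; and the trace
  of w is the derivative at t.\<close>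

lemma five_not_dvd_value_gcd:
  assumes x: "x \<in> A"
  shows "\<not> 5 dvd element_value_gcd K x"
proof
  assume d5: "5 dvd element_value_gcd K x"
  define R where "R = local_span 5 {\<eta>, \<delta>}"
  have R: "p_local_order R 5"
    unfolding R_def using delta_mem_A eta_mem_A
    by (intro local_span_order five_p) (auto simp: A_iff algebraic_int_imp_p_integral)
  interpret p_local_order R 5 by (rule R)
  have RK: "R \<subseteq> K" unfolding R_def using delta_mem_A eta_mem_A
    by (intro local_span_subset[OF K_subfield]) (auto simp: A_iff)
  have gens: "\<eta> \<in> R" "\<delta> \<in> R" unfolding R_def by (auto intro: local_span_base)
  have 5: "cong_mod 5 (of_nat 5) 0" "cong_mod (of_nat 5) (5 ^ 1) 0" using cong_mod_self[of 5] by simp_all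
  obtain i where i: "i \<in> {1, 2, 3, 4, 5}"
    "\<And>x. x \<in> {\<eta>, \<delta>} \<Longrightarrow> (\<sigma> ^^ i) x \<in> R \<and> cong_mod 5 (x ^ 5) ((\<sigma> ^^ i) x)"
    using Frobenius_5[OF complex_subring_axioms gens] by blast
  have fr: "(\<sigma> ^^ i) y \<in> R \<and> cong_mod 5 (y ^ 5) ((\<sigma> ^^ i) y)" if "y \<in> R" for y
    using sigma_local_Frobenius[OF R R_def RK 5(1) _ that, of i 1] i(2) by simp
  have iter: "cong_mod 5 (y ^ (5 ^ k)) ((\<sigma> ^^ (i * k)) y) \<and> (\<sigma> ^^ (i * k)) y \<in> R" if y: "y \<in> R" for y k
  proof (induction k)
    case 0
    show ?case using y by (simp add: cong_mod_refl)
  next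
    case (Suc k)
    have "cong_mod 5 ((y ^ (5 ^ k)) ^ 5) (((\<sigma> ^^ (i * k)) y) ^ 5)"
      using Suc by (intro cong_mod_power power_mem y) auto
    also have "cong_mod 5 (((\<sigma> ^^ (i * k)) y) ^ 5) ((\<sigma> ^^ i) ((\<sigma> ^^ (i * k)) y))" using fr Suc by blast
    also have "(\<sigma> ^^ i) ((\<sigma> ^^ (i * k)) y) = (\<sigma> ^^ (i * Suc k)) y" by (simp add: funpow_add)
    finally have "cong_mod 5 (y ^ (5 ^ Suc k)) ((\<sigma> ^^ (i * Suc k)) y)" by (simp add: mult.commute flip: power_mult)
    moreover have "(\<sigma> ^^ i) ((\<sigma> ^^ (i * k)) y) \<in> R" using fr Suc by blast
    ultimately show ?case by (simp add: funpow_add)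
  qed
  \<comment> \<open>Six iterations of \<sigma>^i are the identity on \<open>K\<close>, whatever i
    is.\<close>
  have red: "cong_mod 5 (y ^ (5 ^ 6)) y" if y: "y \<in> R" for y
  proof -
    have yK: "y \<in> K" using y RK by blast
    have "(\<sigma> ^^ (k * 6)) y = y" for k
      by (induction k) (simp_all add: funpow_add sigma6[OF yK] del: funpow.simps)
    then show ?thesis using iter[OF y, of 6] by metis
  qed
  have AR: "A \<subseteq> R"
    by (rule A_subset_local_order[OF R gens _ _ _ _ 5(2), where s = 6]) ((rule red; assumption) | simp add: numeral_mem)+
  show False
  proof (rule monic_sextic_values_mod_5[OF field_char_poly_monic[OF x]])
    show dvd: "5 dvd poly (field_char_poly K x) t" for t
      using d5 unfolding element_value_gcd_def by (rule dvd_trans) (intro Gcd_dvd, auto)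
    show "5 dvd poly (pderiv (field_char_poly K x)) t" for t
    proof -
      define u where "u = of_int t - x"
      have uA: "u \<in> A" unfolding u_def by (intro A.ring_mem x)
      have uK: "u \<in> K" using uA by (simp add: A_iff)
      \<comment> \<open>If x were the integer t, then t + 1 - x = 1 would have norm 1, which 5 does
        not divide.\<close>
      have u0: "u \<noteq> 0"
      proof
        assume "u = 0"
        then have "of_int (t + 1) - x = 1" by (simp add: u_def)
        moreover obtain k where "Nm (of_int (t + 1) - x) = of_int (5 * k)" by (rule Nm_value[OF x d5])
        ultimately have "(1 :: complex) = of_int (5 * k)" using Nm_of_int[of 1] by simp
        then have "5 * k = 1" by (metis of_int_1 of_int_eq_iff)
        then show False by presburger
      qed
      obtain k where k: "Nm u = of_int (5 * k)" unfolding u_def by (rule Nm_value[OF x d5])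
      define w where "w = (\<sigma> ^^ 1) u * (\<sigma> ^^ 2) u * (\<sigma> ^^ 3) u * (\<sigma> ^^ 4) u * (\<sigma> ^^ 5) u"
      have uw: "u * w = Nm u" unfolding w_def Nm_def prod_6 by (simp add: mult_ac)
      then have w: "w = Nm u / u" using u0 by (simp add: field_simps)
      have sA: "(\<sigma> ^^ k) u \<in> A" for k by (rule sigma_iter_mem_A[OF uA])
      have wA: "w \<in> A" unfolding w_def by (intro A.mult_mem sA)
      have "\<exists>v\<in>A. w = (\<sigma> ^^ i) u * v"
      proof -
        have "\<exists>v\<in>A. w = (\<sigma> ^^ 1) u * v" "\<exists>v\<in>A. w = (\<sigma> ^^ 2) u * v" "\<exists>v\<in>A. w = (\<sigma> ^^ 3) u * v"
          "\<exists>v\<in>A. w = (\<sigma> ^^ 4) u * v" "\<exists>v\<in>A. w = (\<sigma> ^^ 5) u * v"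
          unfolding w_def
          by (rule bexI[of _ "(\<sigma> ^^ 2) u * (\<sigma> ^^ 3) u * (\<sigma> ^^ 4) u * (\<sigma> ^^ 5) u"], simp only: mult_ac, intro A.mult_mem sA,
            rule bexI[of _ "(\<sigma> ^^ 1) u * (\<sigma> ^^ 3) u * (\<sigma> ^^ 4) u * (\<sigma> ^^ 5) u"], simp only: mult_ac, intro A.mult_mem sA,
            rule bexI[of _ "(\<sigma> ^^ 1) u * (\<sigma> ^^ 2) u * (\<sigma> ^^ 4) u * (\<sigma> ^^ 5) u"], simp only: mult_ac, intro A.mult_mem sA,
            rule bexI[of _ "(\<sigma> ^^ 1) u * (\<sigma> ^^ 2) u * (\<sigma> ^^ 3) u * (\<sigma> ^^ 5) u"], simp only: mult_ac, intro A.mult_mem sA,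
            rule bexI[of _ "(\<sigma> ^^ 1) u * (\<sigma> ^^ 2) u * (\<sigma> ^^ 3) u * (\<sigma> ^^ 4) u"], simp only: mult_ac, intro A.mult_mem sA)
        then show ?thesis using i(1) by blast
      qed
      then obtain v where v: "v \<in> A" "w = (\<sigma> ^^ i) u * v" by blast
      have mem: "u \<in> R" "v \<in> R" "w \<in> R" using uA v(1) wA AR by blast+
      have f: "cong_mod 5 (u ^ 5) ((\<sigma> ^^ i) u)" using fr[OF mem(1)] by blast
      have "cong_mod 5 ((\<sigma> ^^ i) u * (v * w)) (u ^ 5 * (v * w))"
        by (rule cong_mod_mult[OF cong_mod_sym[OF f] cong_mod_refl]) (use fr[OF mem(1)] in \<open>auto intro: mult_mem power_mem mem\<close>)
      moreover have "(\<sigma> ^^ i) u * (v * w) = w\<^sup>2" by (simp only: v(2) power2_eq_square mult_ac)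
      moreover have "u ^ 5 * (v * w) = 5 * (of_int k * (u ^ 4 * v))"
      proof -
        have "u ^ 5 * (v * w) = (u * w) * (u ^ 4 * v)" by (simp add: eval_nat_numeral mult_ac)
        then show ?thesis unfolding uw k by simp
      qed
      moreover have "cong_mod 5 (5 * (of_int k * (u ^ 4 * v))) 0"
        by (intro cong_mod_0_mult cong_mod_self ring_mem power_mem mem)
      ultimately have w2: "cong_mod 5 (w ^ 2) 0" by (metis cong_mod_trans)
      have "cong_mod 5 w 0" by (rule reduced_mod[OF _ _ mem(3) w2, where s = 6]) (rule red | simp)+
      then obtain r where r: "r \<in> R" "w = 5 * r" unfolding cong_mod_def by auto
      obtain n where n: "\<not> int 5 dvd n" "algebraic_int (of_int n * r)"
        using p_int[OF r(1)] unfolding p_integral_def by blast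
      have rK: "r \<in> K" using r(1) RK by blast
      have nr: "of_int n * r \<in> K" by (intro K_closed rK)
      obtain l where l: "Tr (of_int n * r) = of_int l" using Tr_int[OF nr n(2)] by (elim Ints_cases)
      have wK: "w \<in> K" using wA by (simp add: A_iff)
      have "of_int n * of_int (poly (pderiv (field_char_poly K x)) t) = of_int n * Tr w"
        unfolding w by (simp only: poly_pderiv_field_char_poly[OF x u_def u0])
      also have "\<dots> = Tr (of_int n * w)" using Tr_scale[OF wK, of "of_int n"] by simp
      also have "of_int n * w = 5 * (of_int n * r)" by (simp add: r(2))
      also have "Tr \<dots> = 5 * of_int l" using Tr_scale[OF nr, of 5] l by simp
      finally have "(of_int (n * poly (pderiv (field_char_poly K x)) t) :: complex) = of_int (5 * l)" by simp
      then have "n * poly (pderiv (field_char_poly K x)) t = 5 * l" by (simp only: of_int_eq_iff)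
      then have "5 dvd n * poly (pderiv (field_char_poly K x)) t" by simp
      then show ?thesis using n(1) by (simp add: prime_dvd_mult_iff)
    qed
  qed
qed

section \<open>Assembling the bounds\<close>

lemma three_not_dvd_value_gcd:
  assumes m: "m mod 81 \<noteq> 39" and x: "x \<in> A"
  shows "\<not> 3 dvd element_value_gcd K x"
proof -
  have res: "\<exists>k. a = 3 * k + 1" if "a mod 3 = 1" for a :: int using that by (metis mult_div_mod_eq)
  show ?thesis
  proof (cases "m mod 3 = 0")
    case False
    then have "m mod 3 = 1 \<or> m mod 3 = 2" by presburger
    then show ?thesis by (rule three_not_dvd_value_gcd_unramified[OF _ x])
  next
    case True
    then obtain n where n: "m = 3 * n" by (metis mult_div_mod_eq add.right_neutral)
    show ?thesis
    proof (cases "n mod 3 = 1")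
      case False
      then show ?thesis by (rule three_not_dvd_value_gcd_cubic_ramified[OF n _ x])
    next
      case True
      then obtain l where l: "n = 3 * l + 1" using res by blast
      show ?thesis
      proof (cases "l mod 3 = 1")
        case False
        then show ?thesis by (rule three_not_dvd_value_gcd_totally_ramified[OF n l _ x])
      next
        case True
        then obtain j where j: "l = 3 * j + 1" using res by blast
        have m27: "m = 27 * j + 12" by (simp add: n l j)
        have "j mod 3 \<noteq> 1"
        proof
          assume "j mod 3 = 1"
          then obtain i where "j = 3 * i + 1" using res by blast
          then have "m = 81 * i + 39" by (simp add: m27)
          then show False using m by simp
        qed
        then show ?thesis by (rule three_not_dvd_value_gcd_quadratic_ramified[OF m27 _ x])
      qed
    qed
  qed
qed

text \<open>The upper bound removes from 720 the power of every prime excluded above; a prime that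
  is not excluded keeps its full power, 16 or 9.\<close>

lemma field_value_gcd_bounds:
  defines "a \<equiv> if D mod 8 = 1 then 8 else 1" and "a' \<equiv> if D mod 8 = 1 then 16 else 1"
    and "b \<equiv> if m mod 81 = 39 then 9 else 1"
  shows "a * b dvd field_value_gcd K" "field_value_gcd K dvd a' * b"
proof -
  have dvd: "d dvd field_value_gcd K" if "x \<in> primitive_integers K" "d dvd element_value_gcd K x" for x d
    using that unfolding field_value_gcd_def by (meson dvd_Lcm dvd_trans imageI)
  have "a dvd field_value_gcd K"
  proof (cases "D mod 8 = 1")
    case True
    then obtain e where e: "D = 8 * e + 1" by (metis mult_div_mod_eq)
    show ?thesis using eight_dvd_value_gcd[OF e] dvd True unfolding a_def by metis
  qed (simp add: a_def)
  moreover have "b dvd field_value_gcd K"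
  proof (cases "m mod 81 = 39")
    case True
    then obtain j where j: "m = 81 * j + 39" by (metis mult_div_mod_eq)
    show ?thesis using nine_dvd_value_gcd[OF j] dvd True unfolding b_def by metis
  qed (simp add: b_def)
  moreover have "coprime a b"
  proof -
    have "coprime (2 ^ 3) (3 ^ 2 :: int)" by (intro coprime_power_left_iff[THEN iffD2] coprime_power_right_iff[THEN iffD2]) simp
    then show ?thesis by (simp add: a_def b_def)
  qed
  ultimately show "a * b dvd field_value_gcd K" by (intro divides_mult)
  have "element_value_gcd K x dvd a' * b" if "x \<in> primitive_integers K" for x
  proof -
    define g where "g = element_value_gcd K x"
    have x: "x \<in> A" using that by (simp add: primitive_integers_def A_def)
    have strip: "g dvd k" if "g dvd p ^ n * k" "prime p" "\<not> p dvd g" for p k :: int and n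
    proof -
      have "coprime g (p ^ n)" using prime_imp_coprime[OF that(2,3)] by (simp add: coprime_commute)
      then show ?thesis using that(1) by (simp add: coprime_dvd_mult_right_iff)
    qed
    have "g dvd 5 ^ 1 * 144" unfolding g_def using element_value_gcd_dvd_720[OF x] by simp
    then have g: "g dvd 144" by (rule strip) (use five_not_dvd_value_gcd[OF x] in \<open>simp_all add: g_def\<close>)
    have "g dvd 16 * b"
    proof (cases "m mod 81 = 39")
      case False
      have "g dvd 3 ^ 2 * 16" using g by simp
      then have "g dvd 16" by (rule strip) (use three_not_dvd_value_gcd[OF False x] in \<open>simp_all add: g_def\<close>)
      then show ?thesis using False by (simp add: b_def)
    qed (use g in \<open>simp add: b_def\<close>)
    then have "g dvd a' * b"
    proof (cases "D mod 8 = 1")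
      case False
      assume "g dvd 16 * b"
      then have "g dvd 2 ^ 4 * b" by simp
      then have "g dvd b" by (rule strip) (use two_not_dvd_value_gcd[OF False x] in \<open>simp_all add: g_def\<close>)
      then show ?thesis using False by (simp add: a'_def)
    qed (simp add: a'_def)
    then show ?thesis unfolding g_def .
  qed
  then show "field_value_gcd K dvd a' * b" unfolding field_value_gcd_def by (intro Lcm_least) auto
qed

text \<open>For D = 1 modulo 8 the lcm is a multiple of 8 b and a divisor of 16 b, hence one of
  these two; this is the choice left to \<alpha>.\<close>

lemma field_value_gcd_eq:
  "\<exists>\<alpha> \<beta> :: nat. field_value_gcd K = 2 ^ \<alpha> * 3 ^ \<beta> \<and>
    (if D mod 8 = 1 then \<alpha> \<in> {3, 4} else \<alpha> = 0) \<and> (if m mod 81 = 39 then \<beta> = 2 else \<beta> = 0)"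
proof -
  define b :: int where "b = (if m mod 81 = 39 then 9 else 1)"
  define \<beta> :: nat where "\<beta> = (if m mod 81 = 39 then 2 else 0)"
  have b: "b = 3 ^ \<beta>" "b > 0" by (simp_all add: b_def \<beta>_def)
  have L0: "field_value_gcd K \<ge> 0" unfolding field_value_gcd_def by simp
  show ?thesis
  proof (cases "D mod 8 = 1")
    case True
    then have d: "8 * b dvd field_value_gcd K" "field_value_gcd K dvd 16 * b"
      using field_value_gcd_bounds unfolding b_def by simp_all
    obtain k where k: "field_value_gcd K = 8 * b * k" using d(1) by (elim dvdE)
    have "8 * b * k dvd 8 * b * 2" using d(2) unfolding k by (simp add: mult_ac)
    then have "k dvd 2" unfolding dvd_mult_cancel_left using b(2) by auto
    moreover have "k \<ge> 0" using L0 b(2) unfolding k by (simp add: zero_le_mult_iff)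
    ultimately have "k = 1 \<or> k = 2" using zdvd_imp_le[of k 2] by (cases "k = 0") auto
    then have "field_value_gcd K = 2 ^ 3 * 3 ^ \<beta> \<or> field_value_gcd K = 2 ^ 4 * 3 ^ \<beta>"
      unfolding k b(1) by auto
    then obtain \<alpha> :: nat where "\<alpha> \<in> {3, 4}" "field_value_gcd K = 2 ^ \<alpha> * 3 ^ \<beta>" by blast
    then show ?thesis using True by (intro exI[of _ \<alpha>] exI[of _ \<beta>] conjI) (simp_all add: \<beta>_def)
  next
    case False
    then have "b dvd field_value_gcd K" "field_value_gcd K dvd b"
      using field_value_gcd_bounds unfolding b_def by simp_all
    then have "field_value_gcd K = b" using L0 b(2) by (intro zdvd_antisym_nonneg) auto
    then have "field_value_gcd K = 2 ^ 0 * 3 ^ \<beta>" by (simp add: b(1))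
    then show ?thesis using False by (intro exI[of _ 0] exI[of _ \<beta>] conjI) (simp_all add: \<beta>_def)
  qed
qed

text \<open>Both sides amount to m being 0 or 5 modulo 8; the multiples of 3 among such m form the
  classes 0 and 21 modulo 24.\<close>

lemma D_mod_8_iff:
  "D mod 8 = 1 \<longleftrightarrow> (([m = 0] (mod 8) \<or> [m = 5] (mod 8)) \<and> \<not> 3 dvd m) \<or> ([m = 0] (mod 24) \<or> [m = 21] (mod 24))"
proof -
  have "D mod 8 = ((m mod 8)\<^sup>2 + 3 * (m mod 8) + 9) mod 8"
  proof -
    have c: "[m = m mod 8] (mod 8)" by (simp add: cong_def)
    have "[m\<^sup>2 + 3 * m + 9 = (m mod 8)\<^sup>2 + 3 * (m mod 8) + 9] (mod 8)"
      by (intro cong_add cong_mult cong_pow c cong_refl)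
    then show ?thesis unfolding D_def cong_def .
  qed
  moreover have "m mod 8 = 0 \<or> m mod 8 = 1 \<or> m mod 8 = 2 \<or> m mod 8 = 3 \<or>
      m mod 8 = 4 \<or> m mod 8 = 5 \<or> m mod 8 = 6 \<or> m mod 8 = 7" by presburger
  ultimately have "D mod 8 = 1 \<longleftrightarrow> m mod 8 = 0 \<or> m mod 8 = 5" by (auto simp: power2_eq_square)
  moreover have "m mod 8 = 0 \<or> m mod 8 = 5" if "m mod 24 = 0 \<or> m mod 24 = 21"
  proof -
    have "m mod 24 mod 8 = 0 \<or> m mod 24 mod 8 = 5" using that by auto
    then show ?thesis by (simp add: mod_mod_cancel)
  qed
  moreover have "m mod 24 = 0 \<or> m mod 24 = 21" if m8: "m mod 8 = 0 \<or> m mod 8 = 5" and "3 dvd m"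
  proof -
    obtain n where n: "m = 3 * n" using \<open>3 dvd m\<close> by (elim dvdE)
    obtain q where "m = 8 * q \<or> m = 8 * q + 5" using m8 by (metis add.right_neutral mult_div_mod_eq)
    then have "n = 8 * (3 * q - n) \<or> n = 8 * (3 * q + 1 - n) + 7" unfolding n by auto
    then obtain k where "n = 8 * k \<or> n = 8 * k + 7" by blast
    then have "m = 24 * k \<or> m = 24 * k + 21" unfolding n by auto
    then show ?thesis by auto
  qed
  ultimately have "D mod 8 = 1 \<longleftrightarrow>
      ((m mod 8 = 0 \<or> m mod 8 = 5) \<and> \<not> 3 dvd m) \<or> (m mod 24 = 0 \<or> m mod 24 = 21)"
    by argo
  then show ?thesis by (simp add: cong_def)
qed

text \<open>The classes 39, 120 and 201 are the three lifts of 39 from 81 to 243.\<close>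

lemma m_mod_81_iff:
  "m mod 81 = 39 \<longleftrightarrow> [m = 39] (mod 243) \<or> [m = 120] (mod 243) \<or> [m = 201] (mod 243)"
proof
  assume "m mod 81 = 39"
  then obtain j where j: "m = 81 * j + 39" by (metis mult_div_mod_eq)
  have "j mod 3 = 0 \<or> j mod 3 = 1 \<or> j mod 3 = 2" by presburger
  then obtain i where "j = 3 * i \<or> j = 3 * i + 1 \<or> j = 3 * i + 2"
    by (metis add.right_neutral mult_div_mod_eq)
  then have "m = 243 * i + 39 \<or> m = 243 * i + 120 \<or> m = 243 * i + 201" using j by auto
  then show "[m = 39] (mod 243) \<or> [m = 120] (mod 243) \<or> [m = 201] (mod 243)" by (auto simp: cong_def)
next
  assume "[m = 39] (mod 243) \<or> [m = 120] (mod 243) \<or> [m = 201] (mod 243)"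
  then have "m mod 243 mod 81 = 39" by (auto simp: cong_def)
  then show "m mod 81 = 39" by (simp add: mod_mod_cancel)
qed

end

theorem theorem1p6:
  fixes m :: int and \<theta> :: complex
  assumes "m \<notin> {-8, -3, 0, 5}"
    and "poly (map_poly of_int (simplest_sextic m)) \<theta> = 0"
  shows "field_index (rat_adjoin \<theta>) = 1 \<and>
    (\<exists>\<alpha> \<beta> :: nat.
       field_value_gcd (rat_adjoin \<theta>) = 2 ^ \<alpha> * 3 ^ \<beta> \<and>
       (if (([m = 0] (mod 8) \<or> [m = 5] (mod 8)) \<and> \<not> 3 dvd m) \<or>
           ([m = 0] (mod 24) \<or> [m = 21] (mod 24))
        then \<alpha> \<in> {3, 4} else \<alpha> = 0) \<and>
       (if [m = 39] (mod 243) \<or> [m = 120] (mod 243) \<or> [m = 201] (mod 243)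
        then \<beta> = 2 else \<beta> = 0))"
proof -
  interpret simplest_sextic_root m \<theta> using assms by unfold_locales
  show ?thesis
    using field_index_eq_1 field_value_gcd_eq unfolding K_def D_mod_8_iff m_mod_81_iff by (rule conjI)
qed

end
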